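(* Let $r\ge 1$, let $W=W(r)$ be the web superalgebra, let $\mathscr H=\mathscr H_c(r)$ be the Sergeev superalgebra, and let $M^\lambda$ ($\lambda\in\Lambda'(r)$) be its permutation supermodules (all defined in the context). There exists a locally unital isomorphism of superalgebras $$\psi\colon W\xrightarrow{\ \sim\ }\operatorname{End}_{\mathscr H}\Big(\bigoplus_{\lambda\in\Lambda'(r)}M^\lambda\Big)$$ given on generators as follows. For $\mathsf a=(\mathsf a_1,\dots,\mathsf a_m)\in\mathsf A(r)$, $m\ge 1$, $1\le i\le m-1$, $1\le j\le m$, and $\mathsf b=(\mathsf a_1,\dots,\mathsf a_{i-1},\mathsf a_i+\mathsf a_{i+1},\mathsf a_{i+2},\dots,\mathsf a_m)$: (1) $\psi(\mathsf a)=1_{\widehat{\mathsf a}}$; (2) the merge of the $i$-th and $(i+1)$-st strands, $1_{(\mathsf a_1,\dots,\mathsf a_{i-1})}\otimes m_{\mathsf a_i,\mathsf a_{i+1}}\otimes 1_{(\mathsf a_{i+2},\dots,\mathsf a_m)}\colon\mathsf a\to\mathsf b$, is sent to $e_{r-1}^{(\widehat{\mathsf a}_r)}e_{r-2}^{(\widehat{\mathsf a}_{r-1})}\cdots e_i^{(\widehat{\mathsf a}_{i+1})}1_{\widehat{\mathsf a}}$; (3) the split $1_{(\mathsf a_1,\dots,\mathsf a_{i-1})}\otimes s_{\mathsf a_i,\mathsf a_{i+1}}\otimes 1_{(\mathsf a_{i+2},\dots,\mathsf a_m)}\colon\mathsf b\to\mathsf a$ is sent to $f_i^{(\widehat{\mathsf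 a}_{i+1})}f_{i+1}^{(\widehat{\mathsf a}_{i+2})}\cdots f_{r-1}^{(\widehat{\mathsf a}_r)}1_{\widehat{\mathsf b}}$; (4) the dot on the $j$-th strand, $1_{(\mathsf a_1,\dots,\mathsf a_{j-1})}\otimes d_{\mathsf a_j}\otimes 1_{(\mathsf a_{j+1},\dots,\mathsf a_m)}\colon\mathsf a\to\mathsf a$, is sent to $h_{\bar j}1_{\widehat{\mathsf a}}$. In particular, $\psi$ restricts to superspace isomorphisms $\psi_{\mathsf a,\mathsf b}\colon \mathsf b W\mathsf a\xrightarrow{\sim}\operatorname{Hom}_{\mathscr H}(M^{\widehat{\mathsf a}},M^{\widehat{\mathsf b}})$ for all $\mathsf a,\mathsf b\in\mathsf A(r)$.
   Context: All vector spaces are over $\mathbb C$. A superspace is a $\mathbb Z/2$-graded vector space; $|v|$ denotes parity; homomorphisms of superalgebras are parity-preserving. Fix $r\ge1$. **Web superalgebra.** $\mathsf A(r)$ is the set of tuples $\mathsf a=(\mathsf a_1,\dots,\mathsf a_m)$, $m\ge1$, of positive integers with sum $r$. Local symbols, for $k,l>0$: merges $m_{k,l}\colon(k,l)\to(k+l)$ and splits $s_{k,l}\colon(k+l)\to(k,l)$, which are even, and dots $d_k\colon(k)\to(k)$, which are odd. For (possibly empty) tuples $x,y$ of positive integers and a symbol $g\colon u\to v$, $1_x\otimes g\otimes 1_y\colon(x,u,y)\to(x,v,y)$ denotes $g$ with identity strands $x$ to its left and $y$ to its right (tuples are concatenated). If $f$ is a linear combination of composites of such, $1_x\otimes f\otimes1_y$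 means adding these strands to every factor. A product $fg$ means "$f$ on top of (after) $g$". For $f\colon u\to v$, $g\colon u'\to v'$, $f\otimes g:=(f\otimes1_{v'})(1_u\otimes g)$. Parity is the number of dots mod 2. $W=W(r)$ is the associative superalgebra generated by the even elements $\mathsf a\in\mathsf A(r)$ (identities, also written $1_{\mathsf a}$) and all $1_x\otimes g\otimes1_y$ ($g$ a symbol) whose source and target lie in $\mathsf A(r)$, subject to: the $\mathsf a$ are pairwise orthogonal idempotents; a generator $w$ with source $\mathsf a$ and target $\mathsf b$ satisfies $w=\mathsf b w\mathsf a$ (so non-composable products vanish); the superinterchange law $(1_x\otimes1_v\otimes1_y\otimes g\otimes1_z)(1_x\otimes f\otimes1_y\otimes1_{u'}\otimes1_z)=(-1)^{|f||g|}(1_x\otimes f\otimes1_y\otimes1_{v'}\otimes1_z)(1_x\otimes1_u\otimes1_y\otimes g\otimes1_z)$ for symbols $f\colon u\to v$, $g\colon u'\to v'$; and the local relations below. A local relation is understood to hold after applying $1_x\otimes(-)\otimes1_y$ for all $x,y$ for which the source lies in $\mathsf A(r)$. Conventions: strands labelled $0$ are erased, so $m_{0,k}=m_{k,0}=s_{0,k}=s_{k,0}=1_k$; $d_0=0$; any expression containing a strand with negative label is $0$. Ladders: $E^{(j)}_{k,l}=(m_{k,j}\otimes1_{l-j})(1_k\otimes s_{j,l-j})\colon(k,l)\to(k+j,l-j)$ and $F^{(j)}_{k,l}=(1_{k-j}\otimes m_{j,l})(s_{k-j,j}\otimes1_l)\colon(k,l)\to(k-j,l+j)$; $E=E^{(1)}$,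 $F=F^{(1)}$; with a dot on the rung, $\bar E_{k,l}=(m_{k,1}\otimes1_{l-1})(1_k\otimes d_1\otimes1_{l-1})(1_k\otimes s_{1,l-1})$ and $\bar F_{k,l}=(1_{k-1}\otimes m_{1,l})(1_{k-1}\otimes d_1\otimes1_l)(s_{k-1,1}\otimes1_l)$. Subscripts $k,l$ are suppressed when determined by the source. On three strands $(h,k,l)$, $G_1$ (resp. $G_2$) is the ladder $G$ applied to the first two (resp. last two) strands. Local relations ($h,k,l>0$): - $m_{h+k,l}(m_{h,k}\otimes1_l)=m_{h,k+l}(1_h\otimes m_{k,l})$ and $(1_h\otimes s_{k,l})s_{h,k+l}=(s_{h,k}\otimes1_l)s_{h+k,l}$; - $m_{k,l}s_{k,l}=\binom{k+l}{l}1_{k+l}$; - $d_kd_k=k\,1_k$; - $d_{1+k}m_{1,k}=m_{1,k}(d_1\otimes1_k)+m_{1,k}(1_1\otimes d_k)$, $s_{1,k}d_{1+k}=(d_1\otimes1_k)s_{1,k}+(1_1\otimes d_k)s_{1,k}$, and their mirror images $d_{k+1}m_{k,1}=m_{k,1}(d_k\otimes1_1)+m_{k,1}(1_k\otimes d_1)$, $s_{k,1}d_{k+1}=(d_k\otimes1_1)s_{k,1}+(1_k\otimes d_1)s_{k,1}$; - $s_{1,1}m_{1,1}-(d_1\otimes d_1)s_{1,1}m_{1,1}(d_1\otimes d_1)=2\cdot1_{(1,1)}$; - on $(k,l)$: $EF-FE=(k-l)1_{(k,l)}$; - on $(k,l)$: $\bar EF-F\bar E=d_k\otimes1_l-1_k\otimes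 d_l=E\bar F-\bar FE$; - on $(h,k,l)$: $E_1E_2-E_2E_1=\bar E_1\bar E_2+\bar E_2\bar E_1$ and $F_2F_1-F_1F_2=\bar F_2\bar F_1+\bar F_1\bar F_2$; - on $(h,k,l)$: $E_1\bar E_2-\bar E_2E_1=\bar E_1E_2-E_2\bar E_1$ and $F_1\bar F_2-\bar F_2F_1=\bar F_1F_2-F_2\bar F_1$. Thus $W=\bigoplus_{\mathsf a,\mathsf b\in\mathsf A(r)}\mathsf bW\mathsf a$. **Sergeev superalgebra.** $\mathscr H=\mathscr H_c(r)$ is the associative unital superalgebra generated by even $s_1,\dots,s_{r-1}$ and odd $c_1,\dots,c_r$ subject to $c_i^2=1$, $c_ic_j=-c_jc_i$ ($i\ne j$), $s_i^2=1$, $s_is_{i+1}s_i=s_{i+1}s_is_{i+1}$, $s_is_j=s_js_i$ ($|i-j|>1$), $c_is_i=s_ic_{i+1}$, $c_{i+1}s_i=s_ic_i$, and $c_j$ commutes with $s_i$ for $j\neq i,i+1$. **Permutation supermodules and operators.** $\Lambda(r)$ is the set of $\lambda=(\lambda_1,\dots,\lambda_r)$ of nonnegative integers with sum $r$; $\Lambda'(r)\subset\Lambda(r)$ is the subset of those whose only zeros are trailing. For $\mathsf a\in\mathsf A(r)$ of length $m$, $\widehat{\mathsf a}\in\Lambda'(r)$ is $\mathsf a$ followed by $r-m$ zeros. $V=\mathbb C^{r|r}$ has homogeneous basis $v_1,\dots,v_r$ (even), $v_{\bar1},\dots,v_{\bar r}$ (odd); bars cancel in pairs; $|i|$ is the parity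 of $v_i$; $\underline i$ is the unbarred version of $i$. $M^\lambda\subseteq V^{\otimes r}$ is the span of the monomials $v_{i_1}\otimes\cdots\otimes v_{i_r}$ having exactly $\lambda_k$ tensor factors with $\underline{i_j}=k$ for each $k$. With the odd map $P(v_i)=(-1)^{|i|}\sqrt{-1}\,v_{\bar i}$, $\mathscr H$ acts on $V^{\otimes r}$ and on each $M^\lambda$ by $s_i.(u_1\otimes\cdots\otimes u_r)=(-1)^{|u_i||u_{i+1}|}u_1\otimes\cdots\otimes u_{i+1}\otimes u_i\otimes\cdots\otimes u_r$ and $c_j.(u_1\otimes\cdots\otimes u_r)=(-1)^{|u_1|+\cdots+|u_{j-1}|}u_1\otimes\cdots\otimes P(u_j)\otimes\cdots\otimes u_r$. Operators on $V^{\otimes r}$: $1_\lambda$ is the projection onto $M^\lambda$; $e_i,f_i$ (even, $1\le i\le r-1$) and $h_{\bar j}$ (odd, $1\le j\le r$) are given on $V$ for $k\in\{1,\dots,r,\bar1,\dots,\bar r\}$ by: $e_i$ sends $v_k$ to $0$ unless $\underline k=i+1$, in which case it lowers the index by one keeping the bar (or lack of bar); $f_i$ sends $v_k$ to $0$ unless $\underline k=i$, in which case it raises the index by one keeping the bar (or lack of bar); $h_{\bar j}v_k=\delta_{j,\underline k}v_{\bar k}$. They act on $V^{\otimes r}$ by $x(v_{i_1}\otimes\cdots\otimes v_{i_r})=\sum_{t}(-1)^{|x|(|i_1|+\cdots+|i_{t-1}|)}v_{i_1}\otimes\cdots\otimes x v_{i_t}\otimes\cdots\otimes v_{i_r}$.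 Divided powers: $e_i^{(p)}=e_i^p/p!$, $f_i^{(p)}=f_i^p/p!$. These operators supercommute with $\mathscr H$. $\operatorname{Hom}_{\mathscr H}$ consists of sums of homogeneous maps $f$ with $f(hv)=(-1)^{|f||h|}hf(v)$. The products of operators in the claim map $M^\lambda\to M^\mu$ for some $\lambda,\mu\in\Lambda'(r)$ and are viewed as elements of the endomorphism superalgebra. "Locally unital" means that distinguished idempotents (the $\mathsf a\in\mathsf A(r)$ in $W$; the projections $1_\lambda$, $\lambda\in\Lambda'(r)$, in the endomorphism superalgebra) are sent to distinguished idempotents. *)

theory Defs
  imports
    Complex_Main
    "HOL-Algebra.QuotRing"
    "HOL-Algebra.Module"
    "HOL-Library.Poly_Mapping"
    "HOL-Library.Z2"
begin

section \<open>Superspaces, superalgebras and presentations\<close>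

text \<open>Superspaces and superalgebras over the complex numbers are module records of HOL-Algebra
  together with the homogeneous components. As usual for that record type, \<^const>\<open>mult\<close> and
  \<^const>\<open>one\<close> are meaningless for mere superspaces.\<close>

record 'a superalgebra = "(complex, 'a) module" +
  grade :: "bit \<Rightarrow> 'a set"

definition superspace_iso ::
  "('a, 'x) superalgebra_scheme \<Rightarrow> ('b, 'y) superalgebra_scheme \<Rightarrow> ('a \<Rightarrow> 'b) \<Rightarrow> bool" where
  "superspace_iso A B \<phi> \<longleftrightarrow>
     bij_betw \<phi> (carrier A) (carrier B) \<and>
     (\<forall>x\<in>carrier A. \<forall>y\<in>carrier A. \<phi> (x \<oplus>\<^bsub>A\<^esub> y) = \<phi> x \<oplus>\<^bsub>B\<^esub> \<phi> y) \<and>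
     (\<forall>c. \<forall>x\<in>carrier A. \<phi> (c \<odot>\<^bsub>A\<^esub> x) = c \<odot>\<^bsub>B\<^esub> \<phi> x) \<and>
     (\<forall>p. \<phi> ` grade A p \<subseteq> grade B p)"

definition superalgebra_iso ::
  "('a, 'x) superalgebra_scheme \<Rightarrow> ('b, 'y) superalgebra_scheme \<Rightarrow> ('a \<Rightarrow> 'b) \<Rightarrow> bool" where
  "superalgebra_iso A B \<phi> \<longleftrightarrow> \<phi> \<in> ring_iso A B \<and> superspace_iso A B \<phi>"

definition corner :: "('a, 'x) superalgebra_scheme \<Rightarrow> 'a \<Rightarrow> 'a \<Rightarrow> ('a, 'x) superalgebra_scheme" where
  "corner A e f = A\<lparr>carrier := (\<lambda>x. e \<otimes>\<^bsub>A\<^esub> x \<otimes>\<^bsub>A\<^esub> f) ` carrier A,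
                    grade := \<lambda>p. (\<lambda>x. e \<otimes>\<^bsub>A\<^esub> x \<otimes>\<^bsub>A\<^esub> f) ` carrier A \<inter> grade A p\<rparr>"

definition super_quotient :: "('a, 'x) superalgebra_scheme \<Rightarrow> 'a set \<Rightarrow> 'a set superalgebra" where
  "super_quotient A I =
     \<lparr>carrier = carrier (A Quot I), mult = mult (A Quot I), one = one (A Quot I),
      zero = zero (A Quot I), add = add (A Quot I),
      smult = (\<lambda>c X. \<Union>x\<in>X. I +>\<^bsub>A\<^esub> (c \<odot>\<^bsub>A\<^esub> x)),
      grade = (\<lambda>p. (\<lambda>x. I +>\<^bsub>A\<^esub> x) ` grade A p)\<rparr>"

text \<open>With concatenation as the addition of words, \<^typ>\<open>'g list \<Rightarrow>\<^sub>0 complex\<close> with its product from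
  Poly_Mapping is the free associative unital algebra on \<^typ>\<open>'g\<close>, equivalently the tensor algebra of
  the vector space with basis \<^typ>\<open>'g\<close>.\<close>

instantiation list :: (type) monoid_add
begin
definition zero_list :: "'a list" where "zero_list = []"
definition plus_list :: "'a list \<Rightarrow> 'a list \<Rightarrow> 'a list" where "plus_list = (@)"
instance by standard (simp_all add: zero_list_def plus_list_def)
end

abbreviation bas :: "'g \<Rightarrow> 'g \<Rightarrow>\<^sub>0 complex" where
  "bas w \<equiv> Poly_Mapping.single w 1"

definition scl :: "complex \<Rightarrow> ('g \<Rightarrow>\<^sub>0 complex) \<Rightarrow> ('g \<Rightarrow>\<^sub>0 complex)" where
  "scl c = Poly_Mapping.map ((*) c)"

definition lin_ext :: "('g \<Rightarrow> 'h \<Rightarrow>\<^sub>0 complex) \<Rightarrow> ('g \<Rightarrow>\<^sub>0 complex) \<Rightarrow> ('h \<Rightarrow>\<^sub>0 complex)" where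
  "lin_ext f x = (\<Sum>w\<in>Poly_Mapping.keys x. scl (Poly_Mapping.lookup x w) (f w))"

definition word_parity :: "('g \<Rightarrow> bit) \<Rightarrow> 'g list \<Rightarrow> bit" where
  "word_parity par w = (\<Sum>g\<leftarrow>w. par g)"

definition homogeneous :: "('g \<Rightarrow> bit) \<Rightarrow> bit \<Rightarrow> ('g list \<Rightarrow>\<^sub>0 complex) set" where
  "homogeneous par p = {x. \<forall>w\<in>Poly_Mapping.keys x. word_parity par w = p}"

definition free_superalgebra :: "'g set \<Rightarrow> ('g \<Rightarrow> bit) \<Rightarrow> ('g list \<Rightarrow>\<^sub>0 complex) superalgebra" where
  "free_superalgebra G par =
     \<lparr>carrier = {x. Poly_Mapping.keys x \<subseteq> lists G}, mult = (*), one = 1, zero = 0, add = (+),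
      smult = scl,
      grade = (\<lambda>p. {x. Poly_Mapping.keys x \<subseteq> lists G} \<inter> homogeneous par p)\<rparr>"

definition relation_ideal ::
  "'g set \<Rightarrow> ('g \<Rightarrow> bit) \<Rightarrow> ('g list \<Rightarrow>\<^sub>0 complex) set \<Rightarrow> ('g list \<Rightarrow>\<^sub>0 complex) set" where
  "relation_ideal G par R = Idl\<^bsub>free_superalgebra G par\<^esub> R"

text \<open>The associative unital superalgebra with generators \<open>G\<close> of parity \<open>par\<close>, subject to
  \<open>x = 0\<close> for \<open>x \<in> R\<close>.\<close>

definition presented ::
  "'g set \<Rightarrow> ('g \<Rightarrow> bit) \<Rightarrow> ('g list \<Rightarrow>\<^sub>0 complex) set \<Rightarrow> ('g list \<Rightarrow>\<^sub>0 complex) set superalgebra" where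
  "presented G par R = super_quotient (free_superalgebra G par) (relation_ideal G par R)"

definition koszul :: "bit \<Rightarrow> complex" where
  "koszul p = (if p = 0 then 1 else - 1)"


section \<open>The web superalgebra\<close>

definition compositions :: "nat \<Rightarrow> nat list set" where
  "compositions r = {a. a \<noteq> [] \<and> (\<forall>k\<in>set a. 0 < k) \<and> sum_list a = r}"

datatype web_symbol = Merge nat nat | Split nat nat | Dot nat

fun src :: "web_symbol \<Rightarrow> nat list" where
  "src (Merge k l) = [k, l]"
| "src (Split k l) = [k + l]"
| "src (Dot k) = [k]"

fun tgt :: "web_symbol \<Rightarrow> nat list" where
  "tgt (Merge k l) = [k + l]"
| "tgt (Split k l) = [k, l]"
| "tgt (Dot k) = [k]"

fun sym_parity :: "web_symbol \<Rightarrow> bit" where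
  "sym_parity (Dot k) = 1"
| "sym_parity _ = 0"

text \<open>\<open>Layer x g y\<close> is \<open>1\<^sub>x \<otimes> g \<otimes> 1\<^sub>y\<close>.\<close>

datatype web_gen = Idm "nat list" | Layer "nat list" web_symbol "nat list"

fun gen_src :: "web_gen \<Rightarrow> nat list" where
  "gen_src (Idm a) = a"
| "gen_src (Layer x g y) = x @ src g @ y"

fun gen_tgt :: "web_gen \<Rightarrow> nat list" where
  "gen_tgt (Idm a) = a"
| "gen_tgt (Layer x g y) = x @ tgt g @ y"

fun gen_parity :: "web_gen \<Rightarrow> bit" where
  "gen_parity (Idm a) = 0"
| "gen_parity (Layer x g y) = sym_parity g"

definition web_gens :: "nat \<Rightarrow> web_gen set" where
  "web_gens r = {w. gen_src w \<in> compositions r \<and> gen_tgt w \<in> compositions r}"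

type_synonym web = "web_gen list \<Rightarrow>\<^sub>0 complex"

text \<open>Local webs are linear combinations of words of generators of arbitrary total label, the
  leftmost letter being on top. Strands labelled \<open>0\<close> are erased, and \<open>pad x y f\<close> is
  \<open>1\<^sub>x \<otimes> f \<otimes> 1\<^sub>y\<close>.\<close>

abbreviation erase :: "nat list \<Rightarrow> nat list" where
  "erase a \<equiv> filter (\<lambda>k. 0 < k) a"

fun pad_gen :: "nat list \<Rightarrow> nat list \<Rightarrow> web_gen \<Rightarrow> web_gen" where
  "pad_gen x y (Idm a) = Idm (erase x @ a @ erase y)"
| "pad_gen x y (Layer u g v) = Layer (erase x @ u) g (v @ erase y)"

definition pad :: "nat list \<Rightarrow> nat list \<Rightarrow> web \<Rightarrow> web" where
  "pad x y = lin_ext (\<lambda>w. bas (map (pad_gen x y) w))"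

definition ident :: "nat list \<Rightarrow> web" where
  "ident a = bas [Idm (erase a)]"

definition merge :: "nat \<Rightarrow> nat \<Rightarrow> web" where
  "merge k l = (if k = 0 \<or> l = 0 then ident [k + l] else bas [Layer [] (Merge k l) []])"

definition split :: "nat \<Rightarrow> nat \<Rightarrow> web" where
  "split k l = (if k = 0 \<or> l = 0 then ident [k + l] else bas [Layer [] (Split k l) []])"

definition dot :: "nat \<Rightarrow> web" where
  "dot k = (if k = 0 then 0 else bas [Layer [] (Dot k) []])"

text \<open>The ladders are \<open>0\<close> when one of their labels would be negative.\<close>

definition ladder_E :: "nat \<Rightarrow> nat \<Rightarrow> nat \<Rightarrow> web" where
  "ladder_E j k l = (if l < j then 0 else pad [] [l - j] (merge k j) * pad [k] [] (split j (l - j)))"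

definition ladder_F :: "nat \<Rightarrow> nat \<Rightarrow> nat \<Rightarrow> web" where
  "ladder_F j k l = (if k < j then 0 else pad [k - j] [] (merge j l) * pad [] [l] (split (k - j) j))"

abbreviation EE :: "nat \<Rightarrow> nat \<Rightarrow> web" where "EE \<equiv> ladder_E 1"

abbreviation FF :: "nat \<Rightarrow> nat \<Rightarrow> web" where "FF \<equiv> ladder_F 1"

definition EE_bar :: "nat \<Rightarrow> nat \<Rightarrow> web" where
  "EE_bar k l = (if l < 1 then 0 else
     pad [] [l - 1] (merge k 1) * pad [k] [l - 1] (dot 1) * pad [k] [] (split 1 (l - 1)))"

definition FF_bar :: "nat \<Rightarrow> nat \<Rightarrow> web" where
  "FF_bar k l = (if k < 1 then 0 else
     pad [k - 1] [] (merge 1 l) * pad [k - 1] [l] (dot 1) * pad [] [l] (split (k - 1) 1))"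

text \<open>\<open>on12 G h k l\<close> is \<open>G\<^sub>1\<close> and \<open>on23 G h k l\<close> is \<open>G\<^sub>2\<close> on three strands \<open>(h, k, l)\<close>.\<close>

abbreviation on12 :: "(nat \<Rightarrow> nat \<Rightarrow> web) \<Rightarrow> nat \<Rightarrow> nat \<Rightarrow> nat \<Rightarrow> web" where
  "on12 G h k l \<equiv> pad [] [l] (G h k)"

abbreviation on23 :: "(nat \<Rightarrow> nat \<Rightarrow> web) \<Rightarrow> nat \<Rightarrow> nat \<Rightarrow> nat \<Rightarrow> web" where
  "on23 G h k l \<equiv> pad [h] [] (G k l)"

text \<open>\<open>local_relation s f g\<close>: the relation \<open>f = g\<close> between local webs with source \<open>s\<close>.\<close>

inductive local_relation :: "nat list \<Rightarrow> web \<Rightarrow> web \<Rightarrow> bool" where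
  merge_assoc: "\<lbrakk>0 < h; 0 < k; 0 < l\<rbrakk> \<Longrightarrow> local_relation [h, k, l]
     (merge (h + k) l * pad [] [l] (merge h k)) (merge h (k + l) * pad [h] [] (merge k l))"
| split_assoc: "\<lbrakk>0 < h; 0 < k; 0 < l\<rbrakk> \<Longrightarrow> local_relation [h + k + l]
     (pad [h] [] (split k l) * split h (k + l)) (pad [] [l] (split h k) * split (h + k) l)"
| merge_split: "\<lbrakk>0 < k; 0 < l\<rbrakk> \<Longrightarrow> local_relation [k + l]
     (merge k l * split k l) (scl (of_nat ((k + l) choose l)) (ident [k + l]))"
| dot_dot: "0 < k \<Longrightarrow> local_relation [k] (dot k * dot k) (scl (of_nat k) (ident [k]))"
| dot_merge_left: "0 < k \<Longrightarrow> local_relation [1, k]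
     (dot (1 + k) * merge 1 k) (merge 1 k * pad [] [k] (dot 1) + merge 1 k * pad [1] [] (dot k))"
| dot_split_left: "0 < k \<Longrightarrow> local_relation [1 + k]
     (split 1 k * dot (1 + k)) (pad [] [k] (dot 1) * split 1 k + pad [1] [] (dot k) * split 1 k)"
| dot_merge_right: "0 < k \<Longrightarrow> local_relation [k, 1]
     (dot (k + 1) * merge k 1) (merge k 1 * pad [] [1] (dot k) + merge k 1 * pad [k] [] (dot 1))"
| dot_split_right: "0 < k \<Longrightarrow> local_relation [k + 1]
     (split k 1 * dot (k + 1)) (pad [] [1] (dot k) * split k 1 + pad [k] [] (dot 1) * split k 1)"
| dots_crossing: "local_relation [1, 1]
     (split 1 1 * merge 1 1
        - (pad [] [1] (dot 1) * pad [1] [] (dot 1)) * split 1 1 * merge 1 1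
            * (pad [] [1] (dot 1) * pad [1] [] (dot 1)))
     (scl 2 (ident [1, 1]))"
| EF: "\<lbrakk>0 < k; 0 < l\<rbrakk> \<Longrightarrow> local_relation [k, l]
     (EE (k - 1) (l + 1) * FF k l - FF (k + 1) (l - 1) * EE k l)
     (scl (of_nat k - of_nat l) (ident [k, l]))"
| E_bar_F: "\<lbrakk>0 < k; 0 < l\<rbrakk> \<Longrightarrow> local_relation [k, l]
     (EE_bar (k - 1) (l + 1) * FF k l - FF (k + 1) (l - 1) * EE_bar k l)
     (pad [] [l] (dot k) - pad [k] [] (dot l))"
| E_F_bar: "\<lbrakk>0 < k; 0 < l\<rbrakk> \<Longrightarrow> local_relation [k, l]
     (EE (k - 1) (l + 1) * FF_bar k l - FF_bar (k + 1) (l - 1) * EE k l)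
     (pad [] [l] (dot k) - pad [k] [] (dot l))"
| E1_E2: "\<lbrakk>0 < h; 0 < k; 0 < l\<rbrakk> \<Longrightarrow> local_relation [h, k, l]
     (on12 EE h (k + 1) (l - 1) * on23 EE h k l - on23 EE (h + 1) (k - 1) l * on12 EE h k l)
     (on12 EE_bar h (k + 1) (l - 1) * on23 EE_bar h k l
        + on23 EE_bar (h + 1) (k - 1) l * on12 EE_bar h k l)"
| F2_F1: "\<lbrakk>0 < h; 0 < k; 0 < l\<rbrakk> \<Longrightarrow> local_relation [h, k, l]
     (on23 FF (h - 1) (k + 1) l * on12 FF h k l - on12 FF h (k - 1) (l + 1) * on23 FF h k l)
     (on23 FF_bar (h - 1) (k + 1) l * on12 FF_bar h k l
        + on12 FF_bar h (k - 1) (l + 1) * on23 FF_bar h k l)"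
| E1_E2_bar: "\<lbrakk>0 < h; 0 < k; 0 < l\<rbrakk> \<Longrightarrow> local_relation [h, k, l]
     (on12 EE h (k + 1) (l - 1) * on23 EE_bar h k l
        - on23 EE_bar (h + 1) (k - 1) l * on12 EE h k l)
     (on12 EE_bar h (k + 1) (l - 1) * on23 EE h k l
        - on23 EE (h + 1) (k - 1) l * on12 EE_bar h k l)"
| F1_F2_bar: "\<lbrakk>0 < h; 0 < k; 0 < l\<rbrakk> \<Longrightarrow> local_relation [h, k, l]
     (on12 FF h (k - 1) (l + 1) * on23 FF_bar h k l
        - on23 FF_bar (h - 1) (k + 1) l * on12 FF h k l)
     (on12 FF_bar h (k - 1) (l + 1) * on23 FF h k l
        - on23 FF (h - 1) (k + 1) l * on12 FF_bar h k l)"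

text \<open>\<open>W\<close> is generated by its idempotents and layers without adjoining a further unit, and is locally
  unital: \<open>W = \<Oplus> bWa\<close>. As there are finitely many idempotents, in terms of the unital algebra
  \<^const>\<open>presented\<close> this means that they sum up to \<open>1\<close>, which is \<open>web_unit\<close>.\<close>

inductive_set web_relations :: "nat \<Rightarrow> web set" for r :: nat where
  web_unit: "(\<Sum>a\<in>compositions r. bas [Idm a]) - 1 \<in> web_relations r"
| idem_idem: "\<lbrakk>a \<in> compositions r; b \<in> compositions r\<rbrakk> \<Longrightarrow>
     bas [Idm a] * bas [Idm b] - (if a = b then bas [Idm a] else 0) \<in> web_relations r"
| idem_gen: "w \<in> web_gens r \<Longrightarrow>
     bas [w] - bas [Idm (gen_tgt w)] * bas [w] * bas [Idm (gen_src w)] \<in> web_relations r"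
| superinterchange: "\<lbrakk>x @ src f @ y @ src g @ z \<in> compositions r;
      x @ tgt f @ y @ tgt g @ z \<in> compositions r\<rbrakk> \<Longrightarrow>
     bas [Layer (x @ tgt f @ y) g z] * bas [Layer x f (y @ src g @ z)]
       - scl (koszul (sym_parity f * sym_parity g))
           (bas [Layer x f (y @ tgt g @ z)] * bas [Layer (x @ src f @ y) g z]) \<in> web_relations r"
| local: "\<lbrakk>local_relation s f g; x @ s @ y \<in> compositions r\<rbrakk> \<Longrightarrow>
     pad x y f - pad x y g \<in> web_relations r"

definition web_algebra :: "nat \<Rightarrow> web set superalgebra" where
  "web_algebra r = presented (web_gens r) gen_parity (web_relations r)"

definition web_class :: "nat \<Rightarrow> web_gen \<Rightarrow> web set" where
  "web_class r w =
     relation_ideal (web_gens r) gen_parity (web_relations r)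
       +>\<^bsub>free_superalgebra (web_gens r) gen_parity\<^esub> bas [w]"


section \<open>The Sergeev superalgebra\<close>

datatype sergeev_gen = SS nat | CC nat

fun sergeev_parity :: "sergeev_gen \<Rightarrow> bit" where
  "sergeev_parity (SS i) = 0"
| "sergeev_parity (CC j) = 1"

definition sergeev_gens :: "nat \<Rightarrow> sergeev_gen set" where
  "sergeev_gens r = SS ` {1..<r} \<union> CC ` {1..r}"

abbreviation ss :: "nat \<Rightarrow> sergeev_gen list \<Rightarrow>\<^sub>0 complex" where "ss i \<equiv> bas [SS i]"

abbreviation cc :: "nat \<Rightarrow> sergeev_gen list \<Rightarrow>\<^sub>0 complex" where "cc j \<equiv> bas [CC j]"

inductive_set sergeev_relations :: "nat \<Rightarrow> (sergeev_gen list \<Rightarrow>\<^sub>0 complex) set" for r :: nat where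
  cc_square: "i \<in> {1..r} \<Longrightarrow> cc i * cc i - 1 \<in> sergeev_relations r"
| cc_anticommute: "\<lbrakk>i \<in> {1..r}; j \<in> {1..r}; i \<noteq> j\<rbrakk> \<Longrightarrow>
     cc i * cc j + cc j * cc i \<in> sergeev_relations r"
| ss_square: "i \<in> {1..<r} \<Longrightarrow> ss i * ss i - 1 \<in> sergeev_relations r"
| braid: "\<lbrakk>i \<in> {1..<r}; i + 1 \<in> {1..<r}\<rbrakk> \<Longrightarrow>
     ss i * ss (i + 1) * ss i - ss (i + 1) * ss i * ss (i + 1) \<in> sergeev_relations r"
| ss_commute: "\<lbrakk>i \<in> {1..<r}; j \<in> {1..<r}; i + 1 < j \<or> j + 1 < i\<rbrakk> \<Longrightarrow>
     ss i * ss j - ss j * ss i \<in> sergeev_relations r"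
| cc_ss: "i \<in> {1..<r} \<Longrightarrow> cc i * ss i - ss i * cc (i + 1) \<in> sergeev_relations r"
| cc_Suc_ss: "i \<in> {1..<r} \<Longrightarrow> cc (i + 1) * ss i - ss i * cc i \<in> sergeev_relations r"
| cc_ss_commute: "\<lbrakk>i \<in> {1..<r}; j \<in> {1..r}; j \<noteq> i; j \<noteq> i + 1\<rbrakk> \<Longrightarrow>
     cc j * ss i - ss i * cc j \<in> sergeev_relations r"

definition sergeev :: "nat \<Rightarrow> (sergeev_gen list \<Rightarrow>\<^sub>0 complex) set superalgebra" where
  "sergeev r = presented (sergeev_gens r) sergeev_parity (sergeev_relations r)"


section \<open>Tensor space and permutation supermodules\<close>

text \<open>\<open>(k, p)\<close> is the index of the basis vector \<open>v\<^sub>k\<close> if \<open>p = 0\<close> and of its barred version if \<open>p = 1\<close>.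
  The tensor powers of \<open>V\<close> sit inside the tensor algebra \<open>tens\<close>, whose product \<open>*\<close> is the tensor
  product.\<close>

type_synonym idx = "nat \<times> bit"
type_synonym tens = "idx list \<Rightarrow>\<^sub>0 complex"

fun bar :: "idx \<Rightarrow> idx" where
  "bar (k, p) = (k, p + 1)"

abbreviation idx_parity :: "idx list \<Rightarrow> bit" where
  "idx_parity \<equiv> word_parity snd"

definition idx_words :: "nat \<Rightarrow> idx list set" where
  "idx_words r = {w. length w = r \<and> (\<forall>i\<in>set w. fst i \<in> {1..r})}"

definition tensor_space :: "nat \<Rightarrow> tens set" where
  "tensor_space r = {x. Poly_Mapping.keys x \<subseteq> idx_words r}"

definition weights :: "nat \<Rightarrow> (nat \<Rightarrow> nat) set" where
  "weights r = {\<mu>. (\<forall>k. k \<notin> {1..r} \<longrightarrow> \<mu> k = 0) \<and> (\<Sum>k=1..r. \<mu> k) = r}"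

definition weights' :: "nat \<Rightarrow> (nat \<Rightarrow> nat) set" where
  "weights' r = {\<mu>\<in>weights r. \<forall>k\<in>{1..r}. \<mu> k = 0 \<longrightarrow> (\<forall>l\<in>{k..r}. \<mu> l = 0)}"

definition hat :: "nat list \<Rightarrow> nat \<Rightarrow> nat" where
  "hat a k = (if k \<in> {1..length a} then a ! (k - 1) else 0)"

definition weight_words :: "nat \<Rightarrow> (nat \<Rightarrow> nat) \<Rightarrow> idx list set" where
  "weight_words r \<mu> = {w\<in>idx_words r. \<forall>k. length (filter (\<lambda>i. fst i = k) w) = \<mu> k}"

definition perm_module :: "nat \<Rightarrow> (nat \<Rightarrow> nat) \<Rightarrow> tens set" where
  "perm_module r \<mu> = {x. Poly_Mapping.keys x \<subseteq> weight_words r \<mu>}"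

definition perm_module_sum :: "nat \<Rightarrow> tens set" where
  "perm_module_sum r = {\<Sum>\<mu>\<in>weights' r. x \<mu> | x. \<forall>\<mu>\<in>weights' r. x \<mu> \<in> perm_module r \<mu>}"

definition proj :: "nat \<Rightarrow> (nat \<Rightarrow> nat) \<Rightarrow> tens \<Rightarrow> tens" where
  "proj r \<mu> = lin_ext (\<lambda>w. if w \<in> weight_words r \<mu> then bas w else 0)"

definition PP :: "idx \<Rightarrow> tens" where
  "PP i = scl (koszul (snd i) * \<i>) (bas [bar i])"

text \<open>Positions in a word are numbered from \<open>0\<close>, tensor factors from \<open>1\<close>.\<close>

fun sergeev_gen_act :: "sergeev_gen \<Rightarrow> tens \<Rightarrow> tens" where
  "sergeev_gen_act (SS i) = lin_ext (\<lambda>w.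
     scl (koszul (snd (w ! (i - 1)) * snd (w ! i))) (bas (w[i - 1 := w ! i, i := w ! (i - 1)])))"
| "sergeev_gen_act (CC j) = lin_ext (\<lambda>w.
     scl (koszul (idx_parity (take (j - 1) w)))
       (bas (take (j - 1) w) * PP (w ! (j - 1)) * bas (drop j w)))"

definition sergeev_free_act :: "(sergeev_gen list \<Rightarrow>\<^sub>0 complex) \<Rightarrow> tens \<Rightarrow> tens" where
  "sergeev_free_act x v = lin_ext (\<lambda>w. foldr sergeev_gen_act w v) x"

text \<open>On \<^const>\<open>tensor_space\<close> this is independent of the chosen representative; see
  \<open>sergeev_act_eq\<close> below.\<close>

definition sergeev_act :: "(sergeev_gen list \<Rightarrow>\<^sub>0 complex) set \<Rightarrow> tens \<Rightarrow> tens" where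
  "sergeev_act h v = sergeev_free_act (SOME x. x \<in> h) v"

text \<open>For \<open>x :: idx \<Rightarrow> tens\<close> an operator on \<open>V\<close> of parity \<open>p\<close>, given on the basis.\<close>

definition superderivation :: "bit \<Rightarrow> (idx \<Rightarrow> tens) \<Rightarrow> tens \<Rightarrow> tens" where
  "superderivation p x = lin_ext (\<lambda>w. \<Sum>t<length w.
     scl (koszul (p * idx_parity (take t w))) (bas (take t w) * x (w ! t) * bas (drop (Suc t) w)))"

definition e_op :: "nat \<Rightarrow> tens \<Rightarrow> tens" where
  "e_op i = superderivation 0 (\<lambda>k. if fst k = i + 1 then bas [(i, snd k)] else 0)"

definition f_op :: "nat \<Rightarrow> tens \<Rightarrow> tens" where
  "f_op i = superderivation 0 (\<lambda>k. if fst k = i then bas [(i + 1, snd k)] else 0)"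

definition h_bar_op :: "nat \<Rightarrow> tens \<Rightarrow> tens" where
  "h_bar_op j = superderivation 1 (\<lambda>k. if fst k = j then bas [bar k] else 0)"

definition divided_power :: "(tens \<Rightarrow> tens) \<Rightarrow> nat \<Rightarrow> tens \<Rightarrow> tens" where
  "divided_power f n x = scl (1 / fact n) ((f ^^ n) x)"

definition op_prod :: "(tens \<Rightarrow> tens) list \<Rightarrow> tens \<Rightarrow> tens" where
  "op_prod fs = foldr (\<circ>) fs id"


section \<open>Homomorphisms of modules over the Sergeev superalgebra\<close>

text \<open>Maps with domain \<open>M\<close> are \<^const>\<open>extensional\<close>, so that they are determined by their values
  on \<open>M\<close>.\<close>

definition linear_maps :: "tens set \<Rightarrow> tens set \<Rightarrow> (tens \<Rightarrow> tens) set" where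
  "linear_maps M N = {f \<in> M \<rightarrow>\<^sub>E N.
     (\<forall>u\<in>M. \<forall>v\<in>M. f (u + v) = f u + f v) \<and> (\<forall>c. \<forall>v\<in>M. f (scl c v) = scl c (f v))}"

definition sergeev_hom_grade :: "nat \<Rightarrow> tens set \<Rightarrow> tens set \<Rightarrow> bit \<Rightarrow> (tens \<Rightarrow> tens) set" where
  "sergeev_hom_grade r M N p = {f \<in> linear_maps M N.
     (\<forall>q. f ` (M \<inter> homogeneous snd q) \<subseteq> homogeneous snd (p + q)) \<and>
     (\<forall>q. \<forall>h\<in>grade (sergeev r) q. \<forall>v\<in>M.
        f (sergeev_act h v) = scl (koszul (p * q)) (sergeev_act h (f v)))}"

text \<open>\<^const>\<open>mult\<close> and \<^const>\<open>one\<close> are meaningful for \<open>M = N\<close>, where this is the superalgebra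
  of endomorphisms.\<close>

definition sergeev_hom :: "nat \<Rightarrow> tens set \<Rightarrow> tens set \<Rightarrow> (tens \<Rightarrow> tens) superalgebra" where
  "sergeev_hom r M N =
     \<lparr>carrier = {\<lambda>v\<in>M. f v + g v | f g. f \<in> sergeev_hom_grade r M N 0 \<and> g \<in> sergeev_hom_grade r M N 1},
      mult = compose M, one = (\<lambda>v\<in>M. v), zero = (\<lambda>v\<in>M. 0), add = (\<lambda>f g. \<lambda>v\<in>M. f v + g v),
      smult = (\<lambda>c f. \<lambda>v\<in>M. scl c (f v)),
      grade = sergeev_hom_grade r M N\<rparr>"

definition perm_end :: "nat \<Rightarrow> (tens \<Rightarrow> tens) superalgebra" where
  "perm_end r = sergeev_hom r (perm_module_sum r) (perm_module_sum r)"

text \<open>An operator on the tensor space, viewed as a map on the sum of the permutation modules.\<close>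

definition on_sum :: "nat \<Rightarrow> (tens \<Rightarrow> tens) \<Rightarrow> tens \<Rightarrow> tens" where
  "on_sum r f = restrict f (perm_module_sum r)"


section \<open>Well-definedness\<close>

lemma lookup_scl: "Poly_Mapping.lookup (scl c x) w = c * Poly_Mapping.lookup x w"
  by (simp add: scl_def Poly_Mapping.map.rep_eq when_def)

lemma keys_scl: "Poly_Mapping.keys (scl c x) \<subseteq> Poly_Mapping.keys x"
  by (auto simp: in_keys_iff lookup_scl)

lemma scl_add: "scl c (x + y) = scl c x + scl c y"
  by (rule poly_mapping_eqI) (simp add: lookup_scl lookup_add algebra_simps)

lemma scl_add_left: "scl (c + d) x = scl c x + scl d x"
  by (rule poly_mapping_eqI) (simp add: lookup_scl lookup_add algebra_simps)

lemma scl_scl [simp]: "scl c (scl d x) = scl (c * d) x"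
  by (rule poly_mapping_eqI) (simp add: lookup_scl algebra_simps)

lemma scl_simps [simp]: "scl c 0 = 0" "scl 0 x = 0" "scl 1 x = x" "scl (- c) x = - scl c x"
  by (rule poly_mapping_eqI, simp add: lookup_scl)+

lemma scl_sum: "scl c (\<Sum>i\<in>A. f i) = (\<Sum>i\<in>A. scl c (f i))"
  by (induction A rule: infinite_finite_induct) (simp_all add: scl_add)

lemma scl_single: "scl c (Poly_Mapping.single w d) = Poly_Mapping.single w (c * d)"
  by (rule poly_mapping_eqI) (simp add: lookup_scl lookup_single when_def)

lemma single_conv_scl: "Poly_Mapping.single w c = scl c (bas w)"
  by (rule poly_mapping_eqI) (simp add: lookup_scl lookup_single when_def)

lemma lin_ext_bas_self: "lin_ext bas x = x"
proof (rule poly_mapping_eqI)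
  fix w
  have "Poly_Mapping.lookup (lin_ext bas x) w =
    (\<Sum>v\<in>Poly_Mapping.keys x. if v = w then Poly_Mapping.lookup x v else 0)"
    by (simp add: lin_ext_def lookup_sum lookup_scl lookup_single when_def if_distrib cong: if_cong)
  then show "Poly_Mapping.lookup (lin_ext bas x) w = Poly_Mapping.lookup x w"
    by (simp add: in_keys_iff)
qed

lemma linear_induct [case_names zero step]:
  assumes "P 0" "\<And>c w y. P y \<Longrightarrow> w \<in> Poly_Mapping.keys x \<Longrightarrow> P (scl c (bas w) + y)"
  shows "P x"
proof -
  have "P (\<Sum>w\<in>S. scl (Poly_Mapping.lookup x w) (bas w))"
    if "finite S" "S \<subseteq> Poly_Mapping.keys x" for S
    using that by (induction S rule: finite_induct) (auto intro: assms)
  from this[of "Poly_Mapping.keys x"] show ?thesis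
    using lin_ext_bas_self[of x] by (simp add: lin_ext_def)
qed

lemma scl_mult:
  fixes x y :: "'g list \<Rightarrow>\<^sub>0 complex"
  shows "scl c x * y = scl c (x * y)" "x * scl c y = scl c (x * y)"
proof -
  have *: "scl c x * y = scl c (x * y)" for c and x y :: "'g list \<Rightarrow>\<^sub>0 complex"
    by (simp add: scl_def mult_map_scale_conv_mult mult.assoc)
  then show "scl c x * y = scl c (x * y)" .
  have single: "x * Poly_Mapping.single 0 c = scl c x"
  proof (induction x rule: linear_induct)
    case (step d w y)
    then show ?case
      by (simp add: algebra_simps scl_add *) (simp add: mult_single scl_single mult.commute[of c d])
  qed simp
  show "x * scl c y = scl c (x * y)"
    using * single by (simp add: scl_def[of c] mult_map_scale_conv_mult mult.assoc[symmetric])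
qed

lemma bas_mult: "bas v * bas w = bas (v @ w)"
  by (simp add: mult_single plus_list_def)

lemma bas_mult_left: "bas v * (bas w * x) = bas (v @ w) * x"
  by (simp add: mult.assoc[symmetric] bas_mult)

lemma bas_Nil: "bas [] = 1"
  by (metis single_one zero_list_def)

lemma lin_ext_superset:
  assumes "finite S" "Poly_Mapping.keys x \<subseteq> S"
  shows "lin_ext f x = (\<Sum>w\<in>S. scl (Poly_Mapping.lookup x w) (f w))"
  unfolding lin_ext_def
  by (rule sum.mono_neutral_left[OF assms]) (auto simp: in_keys_iff)

lemma lin_ext_add: "lin_ext f (x + y) = lin_ext f x + lin_ext f y"
  by (simp add: lin_ext_superset[of "Poly_Mapping.keys x \<union> Poly_Mapping.keys y"] keys_add
      lookup_add scl_add_left sum.distrib)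

lemma lin_ext_scl: "lin_ext f (scl c x) = scl c (lin_ext f x)"
  using lin_ext_superset[OF _ keys_scl, of x f c]
  by (simp add: lin_ext_def lookup_scl scl_sum)

lemma lin_ext_zero [simp]: "lin_ext f 0 = 0"
  by (simp add: lin_ext_def)

lemma lin_ext_uminus: "lin_ext f (- x) = - lin_ext f x"
  using lin_ext_scl[of f "-1" x] by simp

lemma lin_ext_diff: "lin_ext f (x - y) = lin_ext f x - lin_ext f y"
  using lin_ext_add[of f x "- y"] by (simp add: lin_ext_uminus)

lemma lin_ext_mon [simp]: "lin_ext f (bas w) = f w"
  by (simp add: lin_ext_def)

lemma lin_ext_sum: "lin_ext f (\<Sum>i\<in>A. g i) = (\<Sum>i\<in>A. lin_ext f (g i))"
  by (induction A rule: infinite_finite_induct) (simp_all add: lin_ext_add)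

lemma keys_lin_ext:
  assumes "\<And>w. w \<in> Poly_Mapping.keys x \<Longrightarrow> Poly_Mapping.keys (f w) \<subseteq> S"
  shows "Poly_Mapping.keys (lin_ext f x) \<subseteq> S"
  unfolding lin_ext_def
  by (rule order.trans[OF keys_sum], rule UN_least, rule order.trans[OF keys_scl], rule assms)

lemma keys_one_word: "Poly_Mapping.keys (1 :: 'g list \<Rightarrow>\<^sub>0 complex) = {[]}"
  by (simp add: bas_Nil[symmetric] del: single_one)

lemma keys_mult_lists:
  assumes "Poly_Mapping.keys x \<subseteq> lists G" "Poly_Mapping.keys y \<subseteq> lists G"
  shows "Poly_Mapping.keys (x * y) \<subseteq> lists G"
proof
  fix w assume "w \<in> Poly_Mapping.keys (x * y)"
  then obtain u v where "w = u @ v" "u \<in> Poly_Mapping.keys x" "v \<in> Poly_Mapping.keys y"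
    using keys_mult[of x y] by (auto simp: plus_list_def)
  moreover from this have "u \<in> lists G" "v \<in> lists G"
    using assms by blast+
  ultimately show "w \<in> lists G" by simp
qed

lemma free_superalgebra_simps [simp]:
  "carrier (free_superalgebra G par) = {x. Poly_Mapping.keys x \<subseteq> lists G}"
  "mult (free_superalgebra G par) = (*)"
  "one (free_superalgebra G par) = 1"
  "zero (free_superalgebra G par) = 0"
  "add (free_superalgebra G par) = (+)"
  "smult (free_superalgebra G par) = scl"
  by (simp_all add: free_superalgebra_def)

lemma ring_free_superalgebra: "ring (free_superalgebra G par)"
proof (rule ringI)
  show "abelian_group (free_superalgebra G par)"
  proof (rule abelian_groupI)
    fix x assume "x \<in> carrier (free_superalgebra G par)"
    then show "\<exists>y\<in>carrier (free_superalgebra G par).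
        y \<oplus>\<^bsub>free_superalgebra G par\<^esub> x = \<zero>\<^bsub>free_superalgebra G par\<^esub>"
      by (intro bexI[of _ "- x"]) auto
  next
    fix x y assume "x \<in> carrier (free_superalgebra G par)" "y \<in> carrier (free_superalgebra G par)"
    then show "x \<oplus>\<^bsub>free_superalgebra G par\<^esub> y \<in> carrier (free_superalgebra G par)"
      using keys_add[of x y] by auto
  qed (simp_all add: add.assoc add.commute)
  show "Group.monoid (free_superalgebra G par)"
    by (rule monoidI) (simp_all add: mult.assoc keys_mult_lists zero_list_def)
qed (auto simp: algebra_simps)

lemma web_gens_keys:
  "Poly_Mapping.keys (x :: web) \<subseteq> lists (web_gens n) \<Longrightarrow> Poly_Mapping.keys (y :: web) \<subseteq> lists (web_gens n)
    \<Longrightarrow> Poly_Mapping.keys (x - y) \<subseteq> lists (web_gens n)"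
  "Poly_Mapping.keys (x :: web) \<subseteq> lists (web_gens n) \<Longrightarrow> Poly_Mapping.keys (y :: web) \<subseteq> lists (web_gens n)
    \<Longrightarrow> Poly_Mapping.keys (x + y) \<subseteq> lists (web_gens n)"
  "Poly_Mapping.keys (x :: web) \<subseteq> lists (web_gens n) \<Longrightarrow> Poly_Mapping.keys (scl c x) \<subseteq> lists (web_gens n)"
  using keys_add[of x y] keys_diff[of x y] keys_scl[of c x] by blast+

definition local_web :: "nat \<Rightarrow> web \<Rightarrow> bool" where
  "local_web n f \<longleftrightarrow> Poly_Mapping.keys f \<subseteq> lists (web_gens n)"

lemma local_web_closed:
  "local_web n 0"
  "local_web n f \<Longrightarrow> local_web n g \<Longrightarrow> local_web n (f + g)"
  "local_web n f \<Longrightarrow> local_web n g \<Longrightarrow> local_web n (f - g)"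
  "local_web n f \<Longrightarrow> local_web n (scl c f)"
  "local_web n f \<Longrightarrow> local_web n g \<Longrightarrow> local_web n (f * g)"
  by (simp_all add: local_web_def web_gens_keys keys_mult_lists)

lemma sum_list_erase: "sum_list (erase x) = sum_list x"
  by (induction x) auto

lemma local_web_pad:
  "sum_list x + sum_list y \<le> m \<Longrightarrow> local_web (m - sum_list x - sum_list y) f \<Longrightarrow> local_web m (pad x y f)"
  unfolding local_web_def pad_def
proof (rule keys_lin_ext)
  define n where "n = m - sum_list x - sum_list y"
  fix w assume "Poly_Mapping.keys f \<subseteq> lists (web_gens (m - sum_list x - sum_list y))"
    and w: "w \<in> Poly_Mapping.keys f" and "sum_list x + sum_list y \<le> m"
  then have f: "Poly_Mapping.keys f \<subseteq> lists (web_gens n)" "w \<in> Poly_Mapping.keys f"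
    and m: "m = sum_list x + n + sum_list y"
    by (simp_all add: n_def)
  have "pad_gen x y g \<in> web_gens m" if "g \<in> web_gens n" for g
    using that m
    by (cases g) (auto simp: web_gens_def compositions_def sum_list_erase)
  then show "Poly_Mapping.keys (bas (map (pad_gen x y) w)) \<subseteq> lists (web_gens m)"
    using f by (auto simp: lists_eq_set)
qed

lemma sum_list_pos_iff: "0 < sum_list a \<longleftrightarrow> (\<exists>x\<in>set a. 0 < x)" for a :: "nat list"
  by (induction a) auto

lemma local_web_local:
  "0 < k + l \<Longrightarrow> n = k + l \<Longrightarrow> local_web n (merge k l)"
  "0 < k + l \<Longrightarrow> n = k + l \<Longrightarrow> local_web n (split k l)"
  "0 < k \<Longrightarrow> n = k \<Longrightarrow> local_web n (dot k)"
  "0 < sum_list a \<Longrightarrow> n = sum_list a \<Longrightarrow> local_web n (ident a)"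
  by (auto simp: local_web_def merge_def split_def dot_def ident_def web_gens_def compositions_def
      sum_list_erase filter_empty_conv sum_list_pos_iff[symmetric])

lemma local_web_ladder:
  "n = k + l \<Longrightarrow> local_web n (EE k l)"
  "n = k + l \<Longrightarrow> local_web n (FF k l)"
  "n = k + l \<Longrightarrow> local_web n (EE_bar k l)"
  "n = k + l \<Longrightarrow> local_web n (FF_bar k l)"
  unfolding ladder_E_def ladder_F_def EE_bar_def FF_bar_def
  by (cases "l < 1"; cases "k < 1"; simp only: if_True if_False;
      (intro local_web_closed local_web_pad local_web_local; simp))+

lemma local_web_local_relation: "local_relation s f g \<Longrightarrow> local_web (sum_list s) f \<and> local_web (sum_list s) g"
  by (induction rule: local_relation.induct)
     (intro conjI local_web_closed local_web_local local_web_ladder local_web_pad; simp)+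

lemma local_web_bas: "set w \<subseteq> web_gens n \<Longrightarrow> local_web n (bas w)"
  by (auto simp: local_web_def)

lemma web_relations_subset:
  "web_relations r \<subseteq> carrier (free_superalgebra (web_gens r) gen_parity)"
proof
  fix x assume "x \<in> web_relations r"
  then have "local_web r x"
  proof cases
    case web_unit
    show ?thesis unfolding web_unit local_web_def
      by (intro web_gens_keys order.trans[OF keys_sum])
         (auto simp: web_gens_def bas_Nil[symmetric] simp del: single_one)
  next
    case (local s f g x y)
    then show ?thesis
      using local_web_local_relation[of s f g]
      by (auto intro!: local_web_closed(3) local_web_pad simp: compositions_def)
  next
    case (idem_idem a b)
    then have "Idm a \<in> web_gens r" "Idm b \<in> web_gens r"
      by (auto simp: web_gens_def)
    with idem_idem show ?thesis by (auto simp: bas_mult intro!: local_web_closed local_web_bas)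
  next
    case (idem_gen w)
    then have "Idm (gen_src w) \<in> web_gens r" "Idm (gen_tgt w) \<in> web_gens r"
      by (auto simp: web_gens_def)
    with idem_gen show ?thesis by (auto simp: bas_mult intro!: local_web_closed local_web_bas)
  next
    case (superinterchange x f y g z)
    have sum: "sum_list (src h) = sum_list (tgt h)" for h by (cases h) simp_all
    have ne: "src h \<noteq> []" "tgt h \<noteq> []" for h by (cases h; simp)+
    have "Layer (x @ tgt f @ y) g z \<in> web_gens r" "Layer x f (y @ src g @ z) \<in> web_gens r"
         "Layer x f (y @ tgt g @ z) \<in> web_gens r" "Layer (x @ src f @ y) g z \<in> web_gens r"
      using superinterchange(2,3)
      by (simp_all only: web_gens_def compositions_def mem_Collect_eq gen_src.simps gen_tgt.simps
            set_append ball_Un sum_list_append sum ne append_assoc append_is_Nil_conv simp_thms) simp_all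
    then show ?thesis unfolding superinterchange(1) bas_mult
      by (intro local_web_closed local_web_bas) simp_all
  qed
  then show "x \<in> carrier (free_superalgebra (web_gens r) gen_parity)"
    by (simp add: local_web_def)
qed

lemma sergeev_relations_subset:
  "sergeev_relations r \<subseteq> carrier (free_superalgebra (sergeev_gens r) sergeev_parity)"
proof -
  have gens: "SS i \<in> sergeev_gens r" if "i \<in> {1..<r}" for i
    using that by (auto simp: sergeev_gens_def)
  have gens': "CC i \<in> sergeev_gens r" if "i \<in> {1..r}" for i
    using that by (auto simp: sergeev_gens_def)
  have closed: "Poly_Mapping.keys (x + y) \<subseteq> lists G" "Poly_Mapping.keys (x - y) \<subseteq> lists G"
    if "Poly_Mapping.keys x \<subseteq> lists G" "Poly_Mapping.keys y \<subseteq> lists G"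
    for x y :: "'g list \<Rightarrow>\<^sub>0 complex" and G
    using that keys_add[of x y] keys_diff[of x y] by blast+
  show ?thesis
  proof
    fix x assume "x \<in> sergeev_relations r"
    then show "x \<in> carrier (free_superalgebra (sergeev_gens r) sergeev_parity)"
      unfolding free_superalgebra_simps mem_Collect_eq
      by cases (simp_all only: bas_mult, (rule closed; simp add: gens gens' zero_list_def)+)
  qed
qed

lemma gen_act_linear:
  "sergeev_gen_act g (x + y) = sergeev_gen_act g x + sergeev_gen_act g y"
  "sergeev_gen_act g (scl c x) = scl c (sergeev_gen_act g x)"
  "sergeev_gen_act g 0 = 0"
  by (cases g; simp add: lin_ext_add lin_ext_scl)+

lemma word_act_linear:
  "foldr sergeev_gen_act w (x + y) = foldr sergeev_gen_act w x + foldr sergeev_gen_act w y"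
  "foldr sergeev_gen_act w (scl c x) = scl c (foldr sergeev_gen_act w x)"
  "foldr sergeev_gen_act w 0 = 0"
  by (induction w) (simp_all add: gen_act_linear)

lemma free_act_linear_right:
  "sergeev_free_act x (u + v) = sergeev_free_act x u + sergeev_free_act x v"
  "sergeev_free_act x (scl c v) = scl c (sergeev_free_act x v)"
  "sergeev_free_act x 0 = 0"
  by (simp_all add: sergeev_free_act_def lin_ext_def word_act_linear scl_add scl_sum
      sum.distrib mult.commute)

lemma free_act_linear_left:
  "sergeev_free_act (x + y) v = sergeev_free_act x v + sergeev_free_act y v"
  "sergeev_free_act (x - y) v = sergeev_free_act x v - sergeev_free_act y v"
  "sergeev_free_act (scl c x) v = scl c (sergeev_free_act x v)"
  "sergeev_free_act 0 v = 0"
  by (simp_all add: sergeev_free_act_def lin_ext_add lin_ext_diff lin_ext_scl)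

lemma free_act_bas: "sergeev_free_act (bas w) v = foldr sergeev_gen_act w v"
  by (simp add: sergeev_free_act_def)

lemma free_act_one: "sergeev_free_act 1 v = v"
  by (simp add: free_act_bas bas_Nil[symmetric] del: single_one)

lemma free_act_mult: "sergeev_free_act (x * y) v = sergeev_free_act x (sergeev_free_act y v)"
proof (induction x rule: linear_induct)
  case (step c w x)
  have "sergeev_free_act (bas w * y) v = sergeev_free_act (bas w) (sergeev_free_act y v)"
    by (induction y rule: linear_induct)
       (simp_all add: algebra_simps scl_mult bas_mult free_act_linear_left free_act_linear_right free_act_bas)
  then show ?case
    by (simp add: algebra_simps scl_mult free_act_linear_left step.IH)
qed (simp add: free_act_linear_left)

lemma word_parity_take_Suc:
  "n < length w \<Longrightarrow> word_parity par (take (Suc n) w) = word_parity par (take n w) + par (w ! n)"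
  by (simp add: word_parity_def take_Suc_conv_app_nth)

lemma CC_act_bas:
  assumes "n < length w"
  shows "sergeev_gen_act (CC (Suc n)) (bas w) =
     scl (koszul (idx_parity (take (Suc n) w)) * \<i>) (bas (w[n := bar (w ! n)]))"
proof -
  have "koszul (p + q) = koszul p * koszul q" for p q
    by (cases p; cases q) (simp_all add: koszul_def)
  then show ?thesis
    using assms
    by (simp add: PP_def scl_mult bas_mult word_parity_take_Suc upd_conv_take_nth_drop mult.assoc)
qed

lemma SS_act_bas:
  "sergeev_gen_act (SS (Suc n)) (bas w) =
     scl (koszul (snd (w ! n) * snd (w ! Suc n))) (bas (w[n := w ! Suc n, Suc n := w ! n]))"
  by simp

lemma take_parity_bar:
  assumes "j < length w"
  shows "idx_parity (take n (w[j := bar (w ! j)])) = idx_parity (take n w) + (if j < n then 1 else 0)"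
  using assms
proof (induction n)
  case (Suc n)
  show ?case
  proof (cases "n < length w")
    case True
    have "snd (bar i) = snd i + 1" for i by (cases i) simp
    with True Suc show ?thesis
      by (auto simp: word_parity_take_Suc nth_list_update algebra_simps)
  next
    case False
    with Suc show ?thesis by simp
  qed
qed (simp add: word_parity_def)

lemma take_parity_swap:
  assumes "Suc j < length w"
  shows "idx_parity (take n (w[j := w ! Suc j, Suc j := w ! j])) =
     idx_parity (take n w) + (if n = Suc j then snd (w ! j) + snd (w ! Suc j) else 0)"
  using assms
proof (induction n)
  case (Suc n)
  show ?case
  proof (cases "n < length w")
    case True
    with Suc show ?thesis
      by (auto simp: word_parity_take_Suc nth_list_update algebra_simps)
  next
    case False
    with Suc show ?thesis by simp
  qed
qed (simp add: word_parity_def)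

lemma gen_act_tensor_space:
  assumes "g \<in> sergeev_gens r" "v \<in> tensor_space r"
  shows "sergeev_gen_act g v \<in> tensor_space r"
proof -
  have *: "Poly_Mapping.keys (sergeev_gen_act g (bas w)) \<subseteq> idx_words r" if w: "w \<in> idx_words r" for w
  proof (cases g)
    case (SS i)
    then obtain n where "i = Suc n" "Suc n < r" using assms(1) by (cases i) (auto simp: sergeev_gens_def)
    moreover have "w[n := w ! Suc n, Suc n := w ! n] \<in> idx_words r"
      using w \<open>Suc n < r\<close> by (auto simp: idx_words_def dest!: set_update_subset_insert[THEN subsetD])
    ultimately show ?thesis
      using keys_scl SS by (force simp del: sergeev_gen_act.simps simp add: SS_act_bas)
  next
    case (CC i)
    then obtain n where n: "i = Suc n" "n < r" using assms(1) by (cases i) (auto simp: sergeev_gens_def)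
    have "fst (bar i) = fst i" for i by (cases i) simp
    then have "w[n := bar (w ! n)] \<in> idx_words r"
      using w \<open>n < r\<close> by (auto simp: idx_words_def all_set_conv_all_nth nth_list_update)
    then show ?thesis
      using keys_scl CC n w by (force simp del: sergeev_gen_act.simps simp add: CC_act_bas idx_words_def)
  qed
  have "Poly_Mapping.keys v \<subseteq> idx_words r"
    using assms by (simp add: tensor_space_def)
  moreover have "sergeev_gen_act g v = lin_ext (\<lambda>w. sergeev_gen_act g (bas w)) v"
    by (cases g) simp_all
  ultimately have "Poly_Mapping.keys (sergeev_gen_act g v) \<subseteq> idx_words r"
    using * by (simp only:) (rule keys_lin_ext, metis subsetD)
  then show ?thesis by (simp add: tensor_space_def)
qed

lemma free_act_tensor_space:
  assumes "Poly_Mapping.keys x \<subseteq> lists (sergeev_gens r)" "v \<in> tensor_space r"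
  shows "sergeev_free_act x v \<in> tensor_space r"
proof -
  have "foldr sergeev_gen_act w v \<in> tensor_space r" if "w \<in> lists (sergeev_gens r)" for w
    using that by (induction w) (auto simp: assms(2) gen_act_tensor_space simp del: sergeev_gen_act.simps)
  then have "Poly_Mapping.keys (sergeev_free_act x v) \<subseteq> idx_words r"
    using assms(1) unfolding sergeev_free_act_def tensor_space_def mem_Collect_eq
    by (intro keys_lin_ext) blast
  then show ?thesis by (simp add: tensor_space_def)
qed

lemma koszul_add: "koszul (p + q) = koszul p * koszul q"
  by (cases p; cases q) (simp_all add: koszul_def)

lemma bar_bar: "bar (bar i) = i"
  by (cases i) simp

lemma koszul_square: "koszul p * koszul p = 1"
  by (simp add: koszul_def)

lemma scl_bas_cong: "c = d \<Longrightarrow> u = v \<Longrightarrow> scl c (bas u) = scl d (bas v)"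
  by simp

lemma nth_swap:
  assumes "Suc n < length w" "m < length w"
  shows "w[n := w ! Suc n, Suc n := w ! n] ! m = w ! (if m = n then Suc n else if m = Suc n then n else m)"
  using assms by (auto simp: nth_list_update)

lemma snd_bar: "snd (bar i) = snd i + 1"
  by (cases i) simp

lemma bit_add_self: "p + p = 0" "p + (p + q) = q" for p q :: bit
  by (cases p; cases q; simp)+

lemma koszul_one: "koszul 0 = 1" "koszul 1 = - 1"
  by (simp_all add: koszul_def)

lemma relation_act_bas:
  assumes "x \<in> sergeev_relations r" and w: "w \<in> idx_words r"
  shows "sergeev_free_act x (bas w) = 0"
proof -
  define K where "K p q = koszul (p * q)" for p q
  have K_square: "K p q * K p q = 1" and K_commute: "K p q = K q p"
    and K_one: "K (p + 1) q = K p q * koszul q" "K p (q + 1) = K p q * koszul p" for p q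
    by (cases p; cases q; simp add: K_def koszul_def)+
  have SS_act: "sergeev_gen_act (SS (Suc n)) (bas w) =
     scl (K (snd (w ! n)) (snd (w ! Suc n))) (bas (w[n := w ! Suc n, Suc n := w ! n]))" for n w
    by (simp add: K_def)
  note act = free_act_linear_left bas_mult free_act_bas free_act_one CC_act_bas SS_act gen_act_linear
    append_Cons append_Nil foldr.simps o_apply id_apply length_list_update scl_scl
  note parity = take_parity_bar take_parity_swap snd_bar koszul_add koszul_one
  have len: "length w = r" using w by (simp add: idx_words_def)
  note [simp del] = sergeev_gen_act.simps
  from assms(1) show ?thesis
  proof cases
    case (cc_square i)
    then obtain n where "i = Suc n" "n < length w" by (cases i) (auto simp: len)
    then show ?thesis unfolding cc_square(1)
      by (simp add: act parity bar_bar koszul_square mult.assoc mult.left_commute)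
  next
    case (cc_anticommute i j)
    then obtain n m where nm: "i = Suc n" "j = Suc m" "n < length w" "m < length w" "n \<noteq> m"
      by (cases i; cases j) (auto simp: len)
    then have "n < m \<or> m < n" by linarith
    with nm show ?thesis unfolding cc_anticommute(1)
      by (auto simp: act parity list_update_swap[of n m] mult_ac)
  next
    case (ss_square i)
    then obtain n where "i = Suc n" "Suc n < length w" by (cases i) (auto simp: len)
    then show ?thesis unfolding ss_square(1)
      by (simp add: act parity K_commute[of "snd (w ! Suc n)"] K_square list_update_swap)
  next
    case (braid i)
    then obtain n where n: "i = Suc n" "Suc (Suc n) < length w" by (cases i) (auto simp: len)
    have "w[n := w ! Suc n, Suc n := w ! Suc (Suc n), Suc (Suc n) := w ! n, n := w ! Suc (Suc n), Suc n := w ! Suc n] =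
      w[Suc n := w ! Suc (Suc n), Suc (Suc n) := w ! Suc n, n := w ! Suc (Suc n), Suc n := w ! Suc n, Suc (Suc n) := w ! n]"
      using n by (intro nth_equalityI) (simp_all add: nth_list_update)
    with n show ?thesis unfolding braid(1) by (simp add: act mult_ac)
  next
    case (ss_commute i j)
    then obtain n m where nm: "i = Suc n" "j = Suc m" "Suc n < length w" "Suc m < length w"
        "Suc n < m \<or> Suc m < n"
      by (cases i; cases j) (auto simp: len)
    have "w[m := w ! Suc m, Suc m := w ! m, n := w ! Suc n, Suc n := w ! n] =
      w[n := w ! Suc n, Suc n := w ! n, m := w ! Suc m, Suc m := w ! m]"
      using nm by (intro nth_equalityI) (auto simp: nth_list_update)
    with nm show ?thesis unfolding ss_commute(1) by (auto simp: act mult_ac)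
  next
    case (cc_ss i)
    then obtain n where n: "i = Suc n" "Suc n < length w" by (cases i) (auto simp: len)
    have "w[n := w ! Suc n, Suc n := w ! n, n := bar (w ! Suc n)] =
      w[Suc n := bar (w ! Suc n), n := bar (w ! Suc n), Suc n := w ! n]"
      using n by (intro nth_equalityI) (simp_all add: nth_list_update)
    with n show ?thesis unfolding cc_ss(1)
      by (simp add: act parity word_parity_take_Suc K_def koszul_def)
  next
    case (cc_Suc_ss i)
    then obtain n where n: "i = Suc n" "Suc n < length w" by (cases i) (auto simp: len)
    have "w[n := w ! Suc n, Suc n := bar (w ! n)] =
      w[n := bar (w ! n), n := w ! Suc n, Suc n := bar (w ! n)]"
      using n by (intro nth_equalityI) (simp_all add: nth_list_update)
    with n show ?thesis unfolding cc_Suc_ss(1)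
      by (simp add: act parity word_parity_take_Suc K_def koszul_def)
  next
    case (cc_ss_commute i j)
    then obtain n m where nm: "i = Suc n" "j = Suc m" "Suc n < length w" "m < length w" "m \<noteq> n" "m \<noteq> Suc n"
      by (cases i; cases j) (auto simp: len)
    have "w[n := w ! Suc n, Suc n := w ! n, m := bar (w ! m)] =
      w[m := bar (w ! m), n := w ! Suc n, Suc n := w ! n]"
      using nm by (intro nth_equalityI) (auto simp: nth_list_update)
    with nm show ?thesis unfolding cc_ss_commute(1)
      by (simp add: act parity mult_ac)
  qed
qed

lemma relation_act:
  assumes "x \<in> sergeev_relations r" "v \<in> tensor_space r"
  shows "sergeev_free_act x v = 0"
proof -
  show ?thesis
    by (rule linear_induct[where x = v])
       (use assms in \<open>auto simp: free_act_linear_right tensor_space_def relation_act_bas subsetD\<close>)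
qed

lemma ideal_act:
  assumes "x \<in> relation_ideal (sergeev_gens r) sergeev_parity (sergeev_relations r)"
    and v: "v \<in> tensor_space r"
  shows "sergeev_free_act x v = 0"
proof -
  define A where "A = free_superalgebra (sergeev_gens r) sergeev_parity"
  interpret A: ring A unfolding A_def by (rule ring_free_superalgebra)
  note carr = free_superalgebra_simps[of "sergeev_gens r" sergeev_parity, folded A_def]
  let ?J = "{x \<in> carrier A. \<forall>v\<in>tensor_space r. sergeev_free_act x v = 0}"
  have "ideal ?J A"
  proof (rule idealI)
    show "ring A" by (rule A.ring_axioms)
    show "subgroup ?J (add_monoid A)"
    proof (rule A.add.subgroupI)
      fix x assume x: "x \<in> ?J"
      have "\<ominus>\<^bsub>A\<^esub> x = - x"
        by (rule A.minus_equality) (use x in \<open>auto simp: carr\<close>)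
      moreover have "sergeev_free_act (- x) v = 0" if "v \<in> tensor_space r" for v
        using free_act_linear_left(3)[of "-1" x v] x that by simp
      ultimately show "\<ominus>\<^bsub>A\<^esub> x \<in> ?J" using x by (auto simp: carr)
    next
      fix x y assume "x \<in> ?J" "y \<in> ?J"
      then show "x \<oplus>\<^bsub>A\<^esub> y \<in> ?J"
        using A.a_closed[of x y] by (auto simp: carr free_act_linear_left)
    next
      have "\<zero>\<^bsub>A\<^esub> \<in> ?J" by (auto simp: carr free_act_linear_left)
      then show "?J \<noteq> {}" by blast
    qed auto
  next
    fix a x assume *: "a \<in> ?J" "x \<in> carrier A"
    then show "x \<otimes>\<^bsub>A\<^esub> a \<in> ?J"
      using A.m_closed[of x a] by (auto simp: carr free_act_mult free_act_linear_right)
    have "sergeev_free_act x v \<in> tensor_space r" if "v \<in> tensor_space r" for v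
      using * that by (auto simp: carr intro!: free_act_tensor_space)
    with * show "a \<otimes>\<^bsub>A\<^esub> x \<in> ?J"
      using A.m_closed[of a x] by (auto simp: carr free_act_mult)
  qed
  moreover have "sergeev_relations r \<subseteq> ?J"
    using sergeev_relations_subset[of r] relation_act[of _ r] by (auto simp: A_def)
  ultimately have "Idl\<^bsub>A\<^esub> (sergeev_relations r) \<subseteq> ?J"
    by (rule A.genideal_minimal)
  then show ?thesis
    using assms by (auto simp: relation_ideal_def A_def)
qed

lemma sergeev_act_eq:
  assumes "h \<in> carrier (sergeev r)" "x \<in> h" "v \<in> tensor_space r"
  shows "sergeev_act h v = sergeev_free_act x v"
proof -
  define A where "A = free_superalgebra (sergeev_gens r) sergeev_parity"
  define I where "I = relation_ideal (sergeev_gens r) sergeev_parity (sergeev_relations r)"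
  note carr = free_superalgebra_simps[of "sergeev_gens r" sergeev_parity, folded A_def]
  obtain z where "h = I +>\<^bsub>A\<^esub> z"
    using assms(1) by (auto simp: sergeev_def presented_def super_quotient_def FactRing_def
        A_RCOSETS_def' A_def I_def)
  then have "sergeev_free_act y v = sergeev_free_act z v" if "y \<in> h" for y
    using that assms(3) ideal_act[of _ r v]
    by (auto simp: a_r_coset_def' carr I_def free_act_linear_left)
  moreover have "(SOME x. x \<in> h) \<in> h" using assms(2) by (rule someI)
  ultimately show ?thesis using assms(2) by (simp add: sergeev_act_def)
qed

lemma finite_compositions: "finite (compositions r)"
proof (rule finite_subset)
  have "length a \<le> sum_list a" if "\<forall>k\<in>set a. 0 < k" for a :: "nat list"
    using that by (induction a) auto
  then show "compositions r \<subseteq> {a. set a \<subseteq> {..r} \<and> length a \<le> r}"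
    by (auto simp: compositions_def member_le_sum_list)
qed (rule finite_lists_length_le, simp)

lemma finite_weights': "finite (weights' r)"
proof (rule finite_subset)
  have "\<mu> k \<le> (\<Sum>k=1..r. \<mu> k)" if "k \<in> {1..r}" for \<mu> :: "nat \<Rightarrow> nat" and k
    using that by (intro member_le_sum) auto
  note le = this
  show "weights' r \<subseteq> {\<mu>. \<forall>k. (k \<in> {1..r} \<longrightarrow> \<mu> k \<in> {..r}) \<and> (k \<notin> {1..r} \<longrightarrow> \<mu> k = 0)}"
  proof
    fix \<mu> assume "\<mu> \<in> weights' r"
    then have *: "\<forall>k. k \<notin> {1..r} \<longrightarrow> \<mu> k = 0" "(\<Sum>k=1..r. \<mu> k) = r"
      by (auto simp: weights'_def weights_def)
    have "\<mu> k \<le> r" if "k \<in> {1..r}" for k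
      using le[OF that, of \<mu>] *(2) by (simp only:)
    with *(1) show "\<mu> \<in> {\<mu>. \<forall>k. (k \<in> {1..r} \<longrightarrow> \<mu> k \<in> {..r}) \<and> (k \<notin> {1..r} \<longrightarrow> \<mu> k = 0)}"
      by blast
  qed
qed (rule finite_set_of_finite_funs; simp)

lemma ring_presented:
  assumes "R \<subseteq> carrier (free_superalgebra G par)"
  shows "ring (presented G par R)"
proof -
  interpret A: ring "free_superalgebra G par" by (rule ring_free_superalgebra)
  have "ideal (relation_ideal G par R) (free_superalgebra G par)"
    unfolding relation_ideal_def using assms by (rule A.genideal_ideal)
  then have "ring (free_superalgebra G par Quot relation_ideal G par R)"
    by (rule ideal.quotient_is_ring)
  then interpret Q: ring "free_superalgebra G par Quot relation_ideal G par R" .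
  let ?W = "presented G par R"
  have eq: "carrier ?W = carrier (free_superalgebra G par Quot relation_ideal G par R)"
    "mult ?W = mult (free_superalgebra G par Quot relation_ideal G par R)"
    "one ?W = one (free_superalgebra G par Quot relation_ideal G par R)"
    "zero ?W = zero (free_superalgebra G par Quot relation_ideal G par R)"
    "add ?W = add (free_superalgebra G par Quot relation_ideal G par R)"
    by (simp_all add: presented_def super_quotient_def)
  show ?thesis
  proof (rule ringI)
    show "abelian_group ?W"
    proof (rule abelian_groupI)
      fix x assume "x \<in> carrier ?W"
      then show "\<exists>y\<in>carrier ?W. y \<oplus>\<^bsub>?W\<^esub> x = \<zero>\<^bsub>?W\<^esub>"
        unfolding eq using Q.l_neg Q.a_inv_closed by blast
    qed (unfold eq, simp_all add: Q.a_ac)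
    show "Group.monoid ?W"
      by (rule monoidI) (unfold eq, simp_all add: Q.m_assoc)
  qed (unfold eq, simp_all add: Q.l_distr Q.r_distr)
qed

corollary ring_web_algebra: "ring (web_algebra r)" and ring_sergeev: "ring (sergeev r)"
  unfolding web_algebra_def sergeev_def
  by (rule ring_presented, rule web_relations_subset, rule ring_presented, rule sergeev_relations_subset)

end

(* Label the strands of a composition by offsets, the partial sums of its parts, and realise a web as
   an operator on words with these labels: a merge relabels letters, a split sums over the ways of
   relabelling some of them, a dot is an odd derivation. The web relations become identities between
   such operators, ladders being single rungs that move one letter.

   Everything reduces to the composition (1,...,1). For every composition a, the identity of a is the
   total merge m from (1,...,1) to a times an even web. By the relations, a web following m equals some
   total merge m' following a combination of dots and crossings of thin strands, where
   crossing = split merge - 1, and dots and crossings satisfy the Sergeev relations. On words with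
   distinct letters, their products take a fixed word to every other word in essentially one way, which
   gives faithfulness. For fullness, an operator on these words that supercommutes with the Sergeev
   superalgebra is determined by its value at the fixed word, and dots and crossings realise every
   such value. *)

theory Submission imports Defs "HOL-Library.Multiset" begin

text \<open>No basis of the web algebra is constructed. Faithfulness rests on a map
  \<open>PHI\<close> in the opposite direction, from words with distinct letters back to thin webs:
  it takes the fixed word to the identity web and the action of dots and crossings to left
  multiplication. So a combination of them that kills the fixed word is zero as a web.
  \<open>PHI\<close> exists only because crossings satisfy the braid relation and single dots slide
  through them, and neither is a defining relation. The braid relation comes from expanding a split
  after a merge for (1,2) and for (2,1) strands. Sliding is extracted from two relations symmetric
  in the dots and costs a division by 2. Dividing by integers also makes total merges right
  invertible and reduces every split to splits of one thin strand. Two labellings are needed. With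
  offsets, a merge or split with an empty strand is an identity without further care. With strand
  numbers, the number of strands stays fixed along a ladder, so that the ladder relations become
  supercommutators. \<open>CC_op\<close> translates between the two.\<close>

declare add_bit_eq_xor [simp del] mult_bit_eq_and [simp del] bit_add_self [simp]

section \<open>Linear operators on spans of words\<close>

abbreviation "keys \<equiv> Poly_Mapping.keys"
abbreviation "lookup \<equiv> Poly_Mapping.lookup"

text \<open>Operators are total and linear on all combinations of words, even where they have no
  meaning for webs. An identity between two of them on a span then has to be checked on single words
  only.\<close>

definition linear_op :: "(('a \<Rightarrow>\<^sub>0 complex) \<Rightarrow> ('b \<Rightarrow>\<^sub>0 complex)) \<Rightarrow> bool" where
  "linear_op f \<longleftrightarrow> (\<forall>x y. f (x + y) = f x + f y) \<and> (\<forall>c x. f (scl c x) = scl c (f x))"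

definition spn :: "'a set \<Rightarrow> ('a \<Rightarrow>\<^sub>0 complex) set" where
  "spn S = {x. keys x \<subseteq> S}"

lemma linear_opD:
  assumes "linear_op f"
  shows "f (x + y) = f x + f y" "f (scl c x) = scl c (f x)" "f 0 = 0" "f (- x) = - f x"
    "f (x - y) = f x - f y" "f (\<Sum>i\<in>A. g i) = (\<Sum>i\<in>A. f (g i))"
proof -
  show *: "f (x + y) = f x + f y" "f (scl c x) = scl c (f x)" for x y c
    using assms by (simp_all add: linear_op_def)
  show 0: "f 0 = 0" using *(2)[of 0 0] by simp
  show m: "f (- x) = - f x" for x using *(2)[of "-1" x] by simp
  show "f (x - y) = f x - f y" using *(1)[of x "- y"] by (simp add: m)
  show "f (\<Sum>i\<in>A. g i) = (\<Sum>i\<in>A. f (g i))"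
    by (induction A rule: infinite_finite_induct) (simp_all add: * 0)
qed

lemma linear_op_lin_ext [simp]: "linear_op (lin_ext f)"
  by (simp add: linear_op_def lin_ext_add lin_ext_scl)

lemma linear_op_id [simp]: "linear_op id" "linear_op (\<lambda>x. x)"
  by (simp_all add: linear_op_def)

lemma linear_op_comp: "linear_op f \<Longrightarrow> linear_op g \<Longrightarrow> linear_op (\<lambda>x. f (g x))"
  by (simp add: linear_op_def)

lemma linear_op_add: "linear_op f \<Longrightarrow> linear_op g \<Longrightarrow> linear_op (\<lambda>x. f x + g x)"
  by (simp add: linear_op_def scl_add algebra_simps)

lemma linear_op_scl: "linear_op f \<Longrightarrow> linear_op (\<lambda>x. scl c (f x))"
  by (simp add: linear_op_def scl_add mult.commute)

lemma linear_op_diff: "linear_op f \<Longrightarrow> linear_op g \<Longrightarrow> linear_op (\<lambda>x. f x - g x)"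
  using linear_op_add[of f "\<lambda>x. scl (-1) (g x)"] linear_op_scl[of g "-1"] by simp

lemma linear_op_zero [simp]: "linear_op (\<lambda>x. 0)"
  by (simp add: linear_op_def)

lemmas linear_intros = linear_op_lin_ext linear_op_id linear_op_add linear_op_scl linear_op_diff linear_op_zero

lemma linear_op_eqI:
  assumes "linear_op f" "linear_op g" "\<And>w. w \<in> keys v \<Longrightarrow> f (bas w) = g (bas w)"
  shows "f v = g v"
  by (rule linear_induct[where x = v]) (simp_all add: linear_opD[OF assms(1)] linear_opD[OF assms(2)] assms(3))

lemma linear_op_conv_lin_ext: "linear_op f \<Longrightarrow> f x = lin_ext (\<lambda>w. f (bas w)) x"
  by (rule linear_op_eqI) simp_all

lemma spn_closed [intro, simp]:
  "0 \<in> spn S" "x \<in> spn S \<Longrightarrow> y \<in> spn S \<Longrightarrow> x + y \<in> spn S" "x \<in> spn S \<Longrightarrow> scl c x \<in> spn S"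
  "x \<in> spn S \<Longrightarrow> - x \<in> spn S"
  "x \<in> spn S \<Longrightarrow> y \<in> spn S \<Longrightarrow> x - y \<in> spn S"
  using keys_add[of x y] keys_diff[of x y] keys_scl[of c x] by (auto simp: spn_def)

lemma spn_sum [intro]: "(\<And>i. i \<in> A \<Longrightarrow> f i \<in> spn S) \<Longrightarrow> (\<Sum>i\<in>A. f i) \<in> spn S"
  by (induction A rule: infinite_finite_induct) auto

lemma bas_spn [simp]: "bas w \<in> spn S \<longleftrightarrow> w \<in> S"
  by (simp add: spn_def)

lemma spn_keys: "v \<in> spn S \<Longrightarrow> w \<in> keys v \<Longrightarrow> w \<in> S"
  by (auto simp: spn_def)

lemma spn_mono: "S \<subseteq> T \<Longrightarrow> v \<in> spn S \<Longrightarrow> v \<in> spn T"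
  by (auto simp: spn_def)

lemma linear_op_spn:
  assumes "linear_op f" "\<And>w. w \<in> S \<Longrightarrow> f (bas w) \<in> spn T" "v \<in> spn S"
  shows "f v \<in> spn T"
proof -
  have "f v = lin_ext (\<lambda>w. f (bas w)) v" using assms(1) by (rule linear_op_conv_lin_ext)
  moreover have "lin_ext (\<lambda>w. f (bas w)) v \<in> spn T"
    unfolding spn_def mem_Collect_eq using assms(2,3) by (intro keys_lin_ext) (auto simp: spn_def)
  ultimately show ?thesis by simp
qed

lemma linear_op_spn_eqI:
  assumes "v \<in> spn S" "linear_op f" "linear_op g" "\<And>w. w \<in> S \<Longrightarrow> f (bas w) = g (bas w)"
  shows "f v = g v"
  by (rule linear_op_eqI[OF assms(2,3)]) (rule assms(4), rule spn_keys[OF assms(1)])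

section \<open>Rungs\<close>

definition pos :: "nat \<Rightarrow> idx list \<Rightarrow> nat set" where
  "pos a w = {t. t < length w \<and> fst (w ! t) = a}"

lemma pos_less: "t \<in> pos a w \<Longrightarrow> t < length w"
  and pos_fst: "t \<in> pos a w \<Longrightarrow> fst (w ! t) = a"
  by (simp_all add: pos_def)

lemma finite_pos [simp]: "finite (pos a w)"
  by (simp add: pos_def)

definition shift_at :: "nat \<Rightarrow> nat \<Rightarrow> bit \<Rightarrow> idx list \<Rightarrow> idx list" where
  "shift_at t b \<beta> w = w[t := (b, snd (w ! t) + \<beta>)]"

definition ksgn :: "bit \<Rightarrow> bit \<Rightarrow> complex" where
  "ksgn p q = koszul (p * q)"

lemma ksgn_simps [simp]:
  "ksgn 0 q = 1" "ksgn p 0 = 1" "ksgn p q * ksgn p q = 1" "ksgn p q * (ksgn p q * z) = z"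
  by (cases p; cases q; simp add: ksgn_def koszul_def)+

lemma ksgn_one: "ksgn 1 1 = - 1"
  by (simp add: ksgn_def koszul_def)

lemma ksgn_add: "ksgn p (q + q') = ksgn p q * ksgn p q'" "ksgn (p + p') q = ksgn p q * ksgn p' q"
  by (simp_all only: ksgn_def distrib_left distrib_right koszul_add)

lemma ksgn_commute: "ksgn p q = ksgn q p"
  by (simp only: ksgn_def mult.commute)

text \<open>A matrix unit of the queer Lie superalgebra, acting as a superderivation; for
  \<open>\<beta> = 1\<close> it also flips the bar. With \<open>a = b\<close> it counts letters if
  \<open>\<beta> = 0\<close> and is the dot if \<open>\<beta> = 1\<close>.\<close>

definition rung :: "nat \<Rightarrow> nat \<Rightarrow> bit \<Rightarrow> tens \<Rightarrow> tens" where
  "rung a b \<beta> = lin_ext (\<lambda>w. \<Sum>t\<in>pos a w.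
     scl (ksgn \<beta> (idx_parity (take t w))) (bas (shift_at t b \<beta> w)))"

lemma linear_rung [simp]: "linear_op (rung a b \<beta>)"
  by (simp add: rung_def)

text \<open>Brings the operators \<open>e_op\<close>, \<open>f_op\<close> and
  \<open>h_bar_op\<close> of the statement into the same form as the ladders.\<close>

lemma superderivation_rung:
  "superderivation \<beta> (\<lambda>k. if fst k = a then bas [(b, snd k + \<beta>)] else 0) = rung a b \<beta>"
proof -
  have "(\<Sum>t<length w. scl (koszul (\<beta> * idx_parity (take t w)))
      (bas (take t w) * (if fst (w ! t) = a then bas [(b, snd (w ! t) + \<beta>)] else 0) * bas (drop (Suc t) w))) =
    (\<Sum>t\<in>pos a w. scl (ksgn \<beta> (idx_parity (take t w))) (bas (shift_at t b \<beta> w)))" for w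
    unfolding ksgn_def[symmetric]
    by (intro sum.mono_neutral_cong_right)
      (auto simp: pos_def bas_mult shift_at_def upd_conv_take_nth_drop)
  then show ?thesis by (simp only: superderivation_def rung_def)
qed

lemma e_op_rung: "e_op i = rung (i + 1) i 0"
  using superderivation_rung[of 0 "i + 1" i] by (simp add: e_op_def cong: if_cong)

lemma f_op_rung: "f_op i = rung i (i + 1) 0"
  using superderivation_rung[of 0 i "i + 1"] by (simp add: f_op_def cong: if_cong)

lemma h_bar_op_rung: "h_bar_op j = rung j j 1"
proof -
  have "(if fst k = j then bas [bar k] else 0) = (if fst k = j then bas [(j, snd k + 1)] else 0)" for k
    by (cases k) simp
  then show ?thesis using superderivation_rung[of 1 j j] by (simp add: h_bar_op_def)
qed

lemma take_parity_update:
  assumes "j < length w"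
  shows "idx_parity (take n (w[j := v])) = idx_parity (take n w) + (if j < n then snd (w ! j) + snd v else 0)"
  using assms
proof (induction n)
  case (Suc n)
  show ?case
  proof (cases "n < length w")
    case True
    with Suc show ?thesis
      by (auto simp: word_parity_take_Suc nth_list_update algebra_simps less_Suc_eq)
  next
    case False
    with Suc show ?thesis by simp
  qed
qed (simp add: word_parity_def)

lemma take_parity_shift_at:
  assumes "t < length w"
  shows "idx_parity (take n (shift_at t b \<beta> w)) = idx_parity (take n w) + (if t < n then \<beta> else 0)"
  using assms by (simp add: shift_at_def take_parity_update bit_add_self)

lemma length_shift_at [simp]: "length (shift_at t b \<beta> w) = length w"
  by (simp add: shift_at_def)

lemma pos_shift_at:
  "t < length w \<Longrightarrow> pos c (shift_at t b \<beta> w) = (pos c w - {t}) \<union> (if b = c then {t} else {})"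
  by (auto simp: pos_def shift_at_def nth_list_update)

lemma shift_at_same: "t < length w \<Longrightarrow> shift_at t d \<gamma> (shift_at t b \<beta> w) = shift_at t d (\<beta> + \<gamma>) w"
  by (simp add: shift_at_def add.assoc)

lemma shift_at_swap: "t \<noteq> t' \<Longrightarrow> shift_at t d \<gamma> (shift_at t' b \<beta> w) = shift_at t' b \<beta> (shift_at t d \<gamma> w)"
  by (simp add: shift_at_def list_update_swap)

text \<open>The part of a composite of two rungs in which they hit different letters. The summand
  \<open>\<beta>\<close> in the second sign is the change of parity that the first rung has already
  made to the left of \<open>t'\<close>.\<close>

definition off_diagonal :: "nat \<Rightarrow> nat \<Rightarrow> bit \<Rightarrow> nat \<Rightarrow> nat \<Rightarrow> bit \<Rightarrow> idx list \<Rightarrow> tens" where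
  "off_diagonal a b \<beta> c d \<gamma> w = (\<Sum>(t, t') \<in> {(t, t'). t \<in> pos a w \<and> t' \<in> pos c w \<and> t' \<noteq> t}.
     scl (ksgn \<beta> (idx_parity (take t w)) * ksgn \<gamma> (idx_parity (take t' w) + (if t < t' then \<beta> else 0)))
       (bas (shift_at t' d \<gamma> (shift_at t b \<beta> w))))"

text \<open>Both rungs can hit the same letter only if the second starts where the first ends; then
  they fuse into one rung whose parity is the sum.\<close>

lemma rung_rung:
  "rung c d \<gamma> (rung a b \<beta> (bas w)) =
     off_diagonal a b \<beta> c d \<gamma> w + (if b = c then rung a d (\<beta> + \<gamma>) (bas w) else 0)"
proof -
  let ?X = "\<lambda>t t'. scl (ksgn \<beta> (idx_parity (take t w)) * ksgn \<gamma> (idx_parity (take t' w) + (if t < t' then \<beta> else 0)))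
       (bas (shift_at t' d \<gamma> (shift_at t b \<beta> w)))"
  have "rung c d \<gamma> (rung a b \<beta> (bas w)) = (\<Sum>t\<in>pos a w. \<Sum>t'\<in>pos c (shift_at t b \<beta> w). ?X t t')"
    unfolding rung_def lin_ext_mon lin_ext_sum lin_ext_scl scl_sum scl_scl
    by (intro sum.cong refl) (simp only: take_parity_shift_at pos_less)
  also have "\<dots> = (\<Sum>t\<in>pos a w. (\<Sum>t'\<in>pos c w - {t}. ?X t t') + (if b = c then ?X t t else 0))"
  proof (intro sum.cong refl)
    fix t assume "t \<in> pos a w"
    then have "pos c (shift_at t b \<beta> w) = (pos c w - {t}) \<union> (if b = c then {t} else {})"
      by (simp only: pos_less pos_shift_at)
    then show "(\<Sum>t'\<in>pos c (shift_at t b \<beta> w). ?X t t') =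
      (\<Sum>t'\<in>pos c w - {t}. ?X t t') + (if b = c then ?X t t else 0)"
      by (cases "b = c") (simp_all only: if_True if_False, subst sum.union_disjoint, simp_all)
  qed
  also have "\<dots> = (\<Sum>t\<in>pos a w. \<Sum>t'\<in>pos c w - {t}. ?X t t') + (if b = c then rung a d (\<beta> + \<gamma>) (bas w) else 0)"
  proof (cases "b = c")
    case True
    have "(\<Sum>t\<in>pos a w. ?X t t) = rung a d (\<beta> + \<gamma>) (bas w)"
      unfolding rung_def lin_ext_mon
      by (intro sum.cong refl) (simp only: shift_at_same pos_less ksgn_add less_irrefl if_False ksgn_simps mult_1_right)
    with True show ?thesis by (simp only: sum.distrib if_True simp_thms)
  qed (simp only: if_False add_0_right)
  also have "(\<Sum>t\<in>pos a w. \<Sum>t'\<in>pos c w - {t}. ?X t t') = off_diagonal a b \<beta> c d \<gamma> w"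
    unfolding off_diagonal_def
    by (subst sum.Sigma) (auto intro!: sum.cong)
  finally show ?thesis .
qed

text \<open>The order in which two different letters are hit matters only for the right one of them:
  it sees the other letter before or after the change of parity. This costs the factor
  \<open>ksgn \<beta> \<gamma>\<close> whichever letter is on the right.\<close>

lemma off_diagonal_swap:
  "off_diagonal c d \<gamma> a b \<beta> w = scl (ksgn \<beta> \<gamma>) (off_diagonal a b \<beta> c d \<gamma> w)"
  unfolding off_diagonal_def scl_sum
proof (rule sum.reindex_bij_witness[where i = prod.swap and j = prod.swap], goal_cases)
  case (5 x)
  obtain t' t where x: "x = (t', t)" by (cases x)
  have assoc: "ksgn \<beta> \<gamma> * (u * (v * ksgn \<beta> \<gamma>)) = u * v" for u v
    using ksgn_simps(3)[of \<beta> \<gamma>] by (simp add: mult_ac)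
  from 5 x have "t < t' \<or> t' < t" "t \<noteq> t'" by auto
  then have swap: "shift_at t' d \<gamma> (shift_at t b \<beta> w) = shift_at t b \<beta> (shift_at t' d \<gamma> w)"
    by (simp add: shift_at_swap)
  from \<open>t < t' \<or> t' < t\<close> show ?case
    by (auto simp only: x prod.swap_def fst_conv snd_conv case_prod_conv if_True if_False ksgn_add
        swap scl_scl mult.assoc ksgn_commute[of \<gamma> \<beta>] assoc not_less_iff_gr_or_eq
        ksgn_simps mult_1_right)
       (simp_all add: mult_ac)
qed auto

text \<open>All ladder relations are instances of this one supercommutator formula.\<close>

lemma rung_commutator:
  "rung c d \<gamma> (rung a b \<beta> v) - scl (ksgn \<beta> \<gamma>) (rung a b \<beta> (rung c d \<gamma> v)) =
     (if b = c then rung a d (\<beta> + \<gamma>) v else 0) -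
     scl (ksgn \<beta> \<gamma>) (if d = a then rung c b (\<beta> + \<gamma>) v else 0)" (is "?f v = ?g v")
proof (rule linear_op_eqI[of ?f ?g])
  fix w
  show "?f (bas w) = ?g (bas w)"
    unfolding rung_rung off_diagonal_swap[of c d] scl_add scl_scl ksgn_simps scl_simps add.commute[of \<gamma> \<beta>]
    by simp
next
  show "linear_op ?f"
    by (intro linear_op_diff linear_op_scl linear_op_comp[OF linear_rung] linear_rung)
  show "linear_op ?g"
    by (cases "b = c"; cases "d = a"; simp only: if_True if_False simp_thms;
       intro linear_op_diff linear_op_scl linear_rung linear_op_zero)
qed

lemma rung_diagonal:
  assumes "v \<in> spn {w. card (pos a w) = k}"
  shows "rung a a 0 v = scl (of_nat k) v"
proof (rule linear_op_spn_eqI[OF assms])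
  fix w assume "w \<in> {w. card (pos a w) = k}"
  moreover have "rung a a 0 (bas w) = (\<Sum>t\<in>pos a w. bas w)"
    unfolding rung_def lin_ext_mon
  proof (intro sum.cong refl)
    fix t assume "t \<in> pos a w"
    then have "(a, snd (w ! t)) = w ! t" using pos_fst[of t a w] by auto
    then show "scl (ksgn 0 (idx_parity (take t w))) (bas (shift_at t a 0 w)) = bas w"
      by (simp only: shift_at_def ksgn_simps scl_simps add_0_right list_update_id)
  qed
  moreover have "(\<Sum>t\<in>S. bas w) = scl (of_nat (card S)) (bas w)" if "finite S" for S :: "nat set"
    using that by (induction S) (auto simp: scl_add_left simp del: sum_constant)
  note this[OF finite_pos, of a w]
  ultimately show "rung a a 0 (bas w) = scl (of_nat k) (bas w)" by (simp only: mem_Collect_eq)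
next
  show "linear_op (rung a a 0)" by (rule linear_rung)
  show "linear_op (scl (of_nat k))" by (rule linear_op_scl[OF linear_op_id(2)])
qed

section \<open>Words labelled by offsets\<close>

fun base :: "nat \<Rightarrow> nat list \<Rightarrow> nat list" where
  "base p [] = []"
| "base p (k # a) = replicate k p @ base (p + k) a"

text \<open>Only the multiset of labels is prescribed, so these words are closed under permuting
  letters and changing bars. Their span is a model of the permutation supermodule of
  \<open>a\<close>.\<close>

definition NW :: "nat list \<Rightarrow> idx list set" where
  "NW a = {w. mset (map fst w) = mset (base 0 a)}"

lemma base_append: "base p (a @ b) = base p a @ base (p + sum_list a) b"
  by (induction a arbitrary: p) (simp_all add: add.assoc)

lemma base_erase [simp]: "base p (erase a) = base p a"
  by (induction a arbitrary: p) simp_all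

lemma base_bounds: "z \<in> set (base p a) \<Longrightarrow> p \<le> z \<and> z < p + sum_list a"
proof (induction a arbitrary: p)
  case (Cons k a)
  then show ?case by (fastforce simp: in_set_replicate)
qed simp

lemma NW_cong: "base 0 a = base 0 b \<Longrightarrow> NW a = NW b"
  by (simp add: NW_def)

lemma NW_erase [simp]: "NW (erase x @ b) = NW (x @ b)" "NW (b @ erase x) = NW (b @ x)"
    "NW (b @ k # erase x) = NW (b @ k # x)" "NW (b @ k # l # erase x) = NW (b @ k # l # x)"
    "NW (b @ c @ erase x) = NW (b @ c @ x)" "NW (b @ 0 # x) = NW (b @ x)" "NW (b @ k # 0 # x) = NW (b @ k # x)"
  by (rule NW_cong; simp add: base_append sum_list_erase)+

lemma count_pos: "count (mset (map fst w)) z = card (pos z w)"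
proof -
  have "count (mset (map fst w)) z = length (filter (\<lambda>i. fst i = z) w)"
    by (induction w) auto
  then show ?thesis by (simp add: pos_def length_filter_conv_card)
qed

lemma NW_count: "w \<in> NW a \<longleftrightarrow> (\<forall>z. card (pos z w) = count (mset (base 0 a)) z)"
  by (simp add: NW_def multiset_eq_iff flip: count_pos)

text \<open>A strand of thickness \<open>n\<close> reserves the labels strictly inside its range.
  They are free for the labels that a split creates.\<close>

lemma NW_letters:
  assumes "w \<in> NW (x @ n # y)" "t < length w"
  shows "fst (w ! t) \<le> sum_list x \<or> sum_list x + n \<le> fst (w ! t)"
proof -
  have "set (map fst w) = set (base 0 (x @ n # y))"
    using assms(1) mset_eq_setD[of "map fst w" "base 0 (x @ n # y)"] by (simp only: NW_def mem_Collect_eq)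
  then have "fst (w ! t) \<in> set (base 0 (x @ n # y))" using assms(2) by force
  then show ?thesis by (fastforce simp: base_append dest: base_bounds)
qed

lemma count_base_out: "z < p \<or> p + sum_list a \<le> z \<Longrightarrow> count (mset (base p a)) z = 0"
  using base_bounds[of z p a] by (metis count_eq_zero_iff not_le set_mset_mset)

lemma NW_card_pos:
  assumes "w \<in> NW (x @ n # y)" "0 < n"
  shows "card (pos (sum_list x) w) = n"
proof -
  have "card (pos (sum_list x) w) = count (mset (base 0 (x @ n # y))) (sum_list x)"
    using assms(1) by (simp add: NW_count)
  also have "\<dots> = n" using assms(2)
    by (simp add: base_append count_base_out)
  finally show ?thesis .
qed

lemma NW_pos_empty:
  assumes "w \<in> NW (x @ n # y)" "0 < k" "k < n"
  shows "pos (sum_list x + k) w = {}"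
  using NW_letters[OF assms(1)] assms(2,3) by (fastforce simp: pos_def)

definition relabel :: "(nat \<Rightarrow> nat) \<Rightarrow> idx list \<Rightarrow> idx list" where
  "relabel \<phi> w = map (apfst \<phi>) w"

definition set_at :: "nat set \<Rightarrow> nat \<Rightarrow> idx list \<Rightarrow> idx list" where
  "set_at T b w = map (\<lambda>s. if s \<in> T then (b, snd (w ! s)) else w ! s) [0..<length w]"

lemma length_relabel [simp]: "length (relabel \<phi> w) = length w"
  and length_set_at [simp]: "length (set_at T b w) = length w"
  by (simp_all add: relabel_def set_at_def)

lemma nth_relabel [simp]: "t < length w \<Longrightarrow> relabel \<phi> w ! t = (\<phi> (fst (w ! t)), snd (w ! t))"
  by (simp add: relabel_def apfst_def map_prod_def split: prod.split)

lemma nth_set_at [simp]: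
  "t < length w \<Longrightarrow> set_at T b w ! t = (if t \<in> T then (b, snd (w ! t)) else w ! t)"
  by (simp add: set_at_def)

lemma nth_shift_at: "t < length w \<Longrightarrow> s < length w \<Longrightarrow>
    shift_at t b \<beta> w ! s = (if s = t then (b, snd (w ! t) + \<beta>) else w ! s)"
  by (simp add: shift_at_def nth_list_update)

lemma pos_set_at: "T \<subseteq> {..<length w} \<Longrightarrow> pos z (set_at T b w) = (pos z w - T) \<union> (if z = b then T else {})"
  by (auto simp: pos_def)

lemma parity_take_cong:
  assumes "length v = length w" "\<And>s. s < length w \<Longrightarrow> snd (v ! s) = snd (w ! s)"
  shows "idx_parity (take t v) = idx_parity (take t w)"
proof -
  have "map snd v = map snd w" using assms by (intro nth_equalityI) auto
  then show ?thesis unfolding word_parity_def by (metis take_map)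
qed

lemma parity_take_relabel [simp]: "idx_parity (take t (relabel \<phi> w)) = idx_parity (take t w)"
  by (rule parity_take_cong) auto

lemma parity_take_set_at [simp]: "idx_parity (take t (set_at T b w)) = idx_parity (take t w)"
  by (rule parity_take_cong) auto

lemma pos_subset: "pos a w \<subseteq> {..<length w}"
  by (auto simp: pos_def)

text \<open>The whole range is collapsed rather than the two labels in it, so that a composite of
  nested merges is again of this form.\<close>

definition collapse :: "nat \<Rightarrow> nat \<Rightarrow> nat \<Rightarrow> nat" where
  "collapse p n z = (if p \<le> z \<and> z < p + n then p else z)"

definition relabel_op :: "(nat \<Rightarrow> nat) \<Rightarrow> tens \<Rightarrow> tens" where
  "relabel_op \<phi> = lin_ext (\<lambda>w. bas (relabel \<phi> w))"

text \<open>The letters of the strand at \<open>p\<close> are distributed over two strands in all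
  possible ways; \<open>T\<close> consists of those that go to the right one.\<close>

definition split_op :: "nat \<Rightarrow> nat \<Rightarrow> nat \<Rightarrow> tens \<Rightarrow> tens" where
  "split_op p b l = lin_ext (\<lambda>w. \<Sum>T | T \<subseteq> pos p w \<and> card T = l. bas (set_at T b w))"

text \<open>The strands of a composition are labelled by their offsets, the partial sums of the parts, so that
  erased strands need no relabelling.\<close>

fun sym_op :: "nat \<Rightarrow> web_symbol \<Rightarrow> tens \<Rightarrow> tens" where
  "sym_op p (Merge k l) = relabel_op (collapse p (k + l))"
| "sym_op p (Split k l) = split_op p (p + k) l"
| "sym_op p (Dot k) = rung p p 1"

lemma linear_relabel_op [simp]: "linear_op (relabel_op \<phi>)"
  and linear_split_op [simp]: "linear_op (split_op p b l)"
  by (simp_all add: relabel_op_def split_op_def)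

lemma linear_sym_op [simp]: "linear_op (sym_op p g)"
  by (cases g) simp_all

definition prj :: "nat list \<Rightarrow> tens \<Rightarrow> tens" where
  "prj a = lin_ext (\<lambda>w. if w \<in> NW a then bas w else 0)"

lemma linear_prj [simp]: "linear_op (prj a)"
  by (simp add: prj_def)

lemma prj_spn [simp]: "prj a v \<in> spn (NW a)"
  unfolding prj_def spn_def mem_Collect_eq by (rule keys_lin_ext) simp

lemma prj_id: "v \<in> spn (NW a) \<Longrightarrow> prj a v = v"
  by (rule linear_op_spn_eqI[where g = "\<lambda>v. v"]) (assumption | simp only: prj_def lin_ext_mon if_True linear_intros)+

text \<open>The projection to the source in front of a layer makes the operator total and lets
  products of layers that cannot be composed vanish.\<close>

fun theta_gen :: "web_gen \<Rightarrow> tens \<Rightarrow> tens" where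
  "theta_gen (Idm a) v = prj a v"
| "theta_gen (Layer x g y) v = sym_op (sum_list x) g (prj (x @ src g @ y) v)"

lemma linear_theta_gen [simp]: "linear_op (theta_gen g)"
proof (cases g)
  case (Idm a)
  then have "theta_gen g = prj a" by auto
  then show ?thesis by simp
next
  case (Layer x h y)
  then have "theta_gen g = (\<lambda>v. sym_op (sum_list x) h (prj (x @ src h @ y) v))" by auto
  then show ?thesis by (simp add: linear_op_comp)
qed

definition theta :: "web \<Rightarrow> tens \<Rightarrow> tens" where
  "theta x v = lin_ext (\<lambda>ws. foldr theta_gen ws v) x"

lemma linear_theta_word [simp]: "linear_op (\<lambda>v. foldr theta_gen ws v)"
  by (induction ws) (simp_all add: linear_op_comp)

lemma linear_theta [simp]: "linear_op (theta x)"
  by (simp add: linear_op_def theta_def lin_ext_def linear_opD[OF linear_theta_word] scl_add scl_sum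
      sum.distrib mult.commute)

lemma theta_simps:
  "theta (x + y) v = theta x v + theta y v"
  "theta (x - y) v = theta x v - theta y v"
  "theta (scl c x) v = scl c (theta x v)"
  "theta 0 v = 0"
  "theta (bas ws) v = foldr theta_gen ws v"
  "theta (\<Sum>i\<in>A. f i) v = (\<Sum>i\<in>A. theta (f i) v)"
  by (simp_all add: theta_def lin_ext_add lin_ext_diff lin_ext_scl lin_ext_sum)

lemma theta_one [simp]: "theta 1 v = v"
  by (simp add: theta_simps bas_Nil[symmetric] del: single_one)

lemma theta_mult: "theta (x * y) v = theta x (theta y v)"
proof (induction x rule: linear_induct)
  case (step c w x)
  have "theta (bas w * y) v = theta (bas w) (theta y v)"
    by (induction y rule: linear_induct)
       (simp_all add: algebra_simps scl_mult bas_mult theta_simps linear_opD[OF linear_theta_word])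
  then show ?case
    by (simp add: algebra_simps scl_mult theta_simps step.IH)
qed (simp add: theta_simps)

lemma map_collapse_base:
  "sum_list a \<le> p \<or> p + n \<le> q \<Longrightarrow> map (collapse p n) (base q a) = base q a" if "q = 0 \<or> p + n \<le> q"
  using that base_bounds[of _ q a] by (intro map_idI) (fastforce simp: collapse_def)

lemma sym_op_typed:
  assumes "v \<in> spn (NW (x @ src g @ y))"
  shows "sym_op (sum_list x) g v \<in> spn (NW (x @ tgt g @ y))"
proof (rule linear_op_spn[OF linear_sym_op _ assms])
  fix w assume w: "w \<in> NW (x @ src g @ y)"
  show "sym_op (sum_list x) g (bas w) \<in> spn (NW (x @ tgt g @ y))"
  proof (cases g)
    case (Merge k l)
    have "mset (map fst (relabel (collapse (sum_list x) (k + l)) w)) =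
      image_mset (collapse (sum_list x) (k + l)) (mset (map fst w))"
      by (simp add: relabel_def image_mset.compositionality o_def multiset.map_comp)
    also have "\<dots> = mset (map (collapse (sum_list x) (k + l)) (base 0 (x @ k # l # y)))"
      using w by (simp add: NW_def Merge)
    also have "map (collapse (sum_list x) (k + l)) (base 0 (x @ k # l # y)) = base 0 (x @ (k + l) # y)"
      by (simp add: base_append map_collapse_base add.assoc)
         (simp add: collapse_def replicate_add)
    finally show ?thesis by (simp add: Merge relabel_op_def NW_def)
  next
    case (Split k l)
    have "set_at T (sum_list x + k) w \<in> NW (x @ k # l # y)"
      if T: "T \<subseteq> pos (sum_list x) w" "card T = l" for T
    proof -
      have fin: "finite T" using T(1) finite_pos finite_subset by blast
      have "card (pos z (set_at T (sum_list x + k) w)) = count (mset (base 0 (x @ k # l # y))) z" for z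
      proof -
        have 1: "card (pos z w) = count (mset (base 0 (x @ (k + l) # y))) z"
          using w by (simp add: NW_count Split)
        have 2: "pos z (set_at T (sum_list x + k) w) = (pos z w - T) \<union> (if z = sum_list x + k then T else {})"
          using T pos_subset by (intro pos_set_at) blast
        have 3: "pos z w - T = (if z = sum_list x then pos z w - T else pos z w)"
          using T by (auto simp: pos_def)
        have 4: "card (pos (sum_list x) w - T) = card (pos (sum_list x) w) - l"
          using T fin by (simp add: card_Diff_subset)
        have 5: "l \<le> card (pos (sum_list x) w)" using T card_mono by (metis finite_pos)
        have 6: "pos z w \<inter> T = {}" if "z \<noteq> sum_list x"
          using T that by (auto simp: pos_def)
        have eq: "pos (sum_list x) w - T \<union> T = pos (sum_list x) w" using T by blast
        show ?thesis
        proof (cases "z = sum_list x")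
          case True
          with 1 2 3 4 5 show ?thesis
            by (cases "k = 0") (simp_all add: base_append eq Un_absorb2 T(1) add.assoc)
        next
          case False
          then have "card (pos z (set_at T (sum_list x + k) w)) = card (pos z w) + (if z = sum_list x + k then l else 0)"
            unfolding 2 using 3 6 fin T(2) by (auto simp: card_Un_disjoint)
          then show ?thesis using False 1 by (simp add: base_append add.assoc)
        qed
      qed
      then show ?thesis by (simp add: NW_count)
    qed
    then show ?thesis by (auto simp: Split split_op_def)
  next
    case (Dot k)
    have "shift_at t (sum_list x) 1 w \<in> NW (x @ k # y)" if "t \<in> pos (sum_list x) w" for t
    proof -
      have "pos z (shift_at t (sum_list x) 1 w) = pos z w" for z
        using that by (auto simp: pos_def nth_shift_at)
      with w show ?thesis by (simp add: NW_count Dot)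
    qed
    then show ?thesis by (auto simp: Dot rung_def)
  qed
qed

lemma theta_gen_typed: "theta_gen g v \<in> spn (NW (gen_tgt g))"
proof (cases g)
  case (Layer x h y)
  have "sym_op (sum_list x) h (prj (x @ src h @ y) v) \<in> spn (NW (x @ tgt h @ y))"
    by (rule sym_op_typed[OF prj_spn])
  then show ?thesis by (simp add: Layer)
qed simp

lemma theta_layer:
  "v \<in> spn (NW (x @ src g @ y)) \<Longrightarrow> theta (bas [Layer x g y]) v = sym_op (sum_list x) g v"
  by (simp add: theta_simps prj_id)

section \<open>Padding\<close>

lemma linear_pad: "linear_op (pad x y)"
  by (simp add: pad_def)

lemmas pad_linear = linear_opD[OF linear_pad]

lemma pad_bas: "pad x y (bas w) = bas (map (pad_gen x y) w)"
  by (simp add: pad_def)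

lemma pad_mult: "pad x y (f * g) = pad x y f * pad x y g"
proof (induction f rule: linear_induct)
  case (step c w f)
  have "pad x y (bas w * g) = pad x y (bas w) * pad x y g"
    by (induction g rule: linear_induct)
       (simp_all add: algebra_simps scl_mult bas_mult pad_linear pad_bas)
  then show ?case
    by (simp add: algebra_simps scl_mult pad_linear step.IH)
qed (simp add: pad_linear)

lemma pad_gen_pad_gen: "pad_gen x y (pad_gen u v g) = pad_gen (x @ u) (v @ y) g"
  by (cases g) simp_all

lemma pad_pad: "pad x y (pad u v f) = pad (x @ u) (v @ y) f"
proof (induction f rule: linear_induct)
  case (step c w f)
  then show ?case by (simp add: pad_linear pad_bas pad_gen_pad_gen o_def)
qed (simp add: pad_linear)

lemmas pad_simps = pad_mult pad_pad pad_linear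

lemma theta_pad_ident:
  assumes "v \<in> spn (NW (x @ a @ y))"
  shows "theta (pad x y (ident a)) v = v"
proof -
  have "NW (erase x @ erase a @ erase y) = NW (x @ a @ y)"
    by (rule NW_cong) (simp add: base_append sum_list_erase)
  then show ?thesis
    using assms by (simp add: ident_def pad_bas theta_simps prj_id)
qed

lemma NW_erase_both [simp]: "NW (erase x @ k # erase y) = NW (x @ k # y)" "NW (erase x @ k # l # erase y) = NW (x @ k # l # y)"
  by (rule NW_cong; simp add: base_append sum_list_erase)+

text \<open>This is the case of a merge with an empty strand: a single strand already carries the
  only label that occurs in its range.\<close>

lemma collapse_NW:
  assumes "w \<in> NW (x @ n # y)"
  shows "relabel (collapse (sum_list x) n) w = w"
  using NW_letters[OF assms] by (intro nth_equalityI) (fastforce simp: collapse_def prod_eq_iff)+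

text \<open>If one of the strands is empty, the web is an identity and \<open>collapse\<close> fixes
  every letter that occurs. So the formula holds for erased strands as well.\<close>

lemma theta_pad_merge:
  assumes "v \<in> spn (NW (x @ k # l # y))"
  shows "theta (pad x y (merge k l)) v = relabel_op (collapse (sum_list x) (k + l)) v"
proof (cases "k = 0 \<or> l = 0")
  case True
  then have NW: "NW (x @ k # l # y) = NW (x @ (k + l) # y)" by auto
  then have "relabel_op (collapse (sum_list x) (k + l)) v = v"
    by (intro linear_op_spn_eqI[OF assms, where g = "\<lambda>v. v"]) (auto simp: relabel_op_def collapse_NW linear_op_id)
  moreover have "theta (pad x y (ident [k + l])) v = v"
    by (rule theta_pad_ident) (use assms NW in simp)
  ultimately show ?thesis using True by (simp add: merge_def)
next
  case False
  then show ?thesis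
    using assms by (simp add: merge_def pad_bas theta_simps prj_id sum_list_erase)
qed

lemma split_op_empty: "split_op p b 0 v = v"
proof -
  have "{T. T \<subseteq> pos p w \<and> card T = 0} = {{}}" for w
    using rev_finite_subset[OF finite_pos] by (auto simp: card_eq_0_iff)
  moreover have "set_at {} b w = w" for w by (simp add: set_at_def map_nth)
  ultimately have "split_op p b 0 (bas w) = bas w" for w
    by (simp only: split_op_def lin_ext_mon) simp
  then show ?thesis
    by (rule linear_op_eqI[OF linear_split_op linear_op_id(2)])
qed

text \<open>For \<open>l = 0\<close> only the empty set can be chosen; for \<open>k = 0\<close> all
  letters are chosen, but the new label equals the old one. Both times the operator is the identity,
  as it should be for an erased strand.\<close>

lemma theta_pad_split:
  assumes "v \<in> spn (NW (x @ (k + l) # y))"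
  shows "theta (pad x y (split k l)) v = split_op (sum_list x) (sum_list x + k) l v"
proof (cases "k = 0 \<or> l = 0")
  case True
  have "split_op (sum_list x) (sum_list x + k) l v = v"
  proof (cases "l = 0")
    case False
    with True have "k = 0" by simp
    show ?thesis
    proof (rule linear_op_spn_eqI[OF assms, where g = "\<lambda>v. v"])
      fix w assume "w \<in> NW (x @ (k + l) # y)"
      then have "card (pos (sum_list x) w) = l"
        using False by (simp add: \<open>k = 0\<close> NW_card_pos)
      then have "{T. T \<subseteq> pos (sum_list x) w \<and> card T = l} = {pos (sum_list x) w}"
        using card_subset_eq[OF finite_pos] by auto
      moreover have "set_at (pos (sum_list x) w) (sum_list x) w = w"
        by (intro nth_equalityI) (auto simp: pos_def prod_eq_iff)
      ultimately show "split_op (sum_list x) (sum_list x + k) l (bas w) = bas w"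
        by (simp add: split_op_def \<open>k = 0\<close>)
    qed (simp_all add: linear_op_id)
  qed (simp add: split_op_empty)
  moreover have "theta (pad x y (ident [k + l])) v = v"
    by (rule theta_pad_ident) (use assms in simp)
  ultimately show ?thesis using True by (simp add: split_def)
next
  case False
  then show ?thesis
    using assms by (simp add: split_def pad_bas theta_simps prj_id sum_list_erase)
qed

lemma theta_pad_dot:
  assumes "v \<in> spn (NW (x @ k # y))" "0 < k"
  shows "theta (pad x y (dot k)) v = rung (sum_list x) (sum_list x) 1 v"
  using assms by (simp add: dot_def pad_bas theta_simps prj_id sum_list_erase)

lemma merge_typed: "v \<in> spn (NW (x @ k # l # y)) \<Longrightarrow> relabel_op (collapse (sum_list x) (k + l)) v \<in> spn (NW (x @ (k + l) # y))"
  using sym_op_typed[of v x "Merge k l" y] by simp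

lemma split_typed: "v \<in> spn (NW (x @ (k + l) # y)) \<Longrightarrow> split_op (sum_list x) (sum_list x + k) l v \<in> spn (NW (x @ k # l # y))"
  using sym_op_typed[of v x "Split k l" y] by simp

lemma dot_typed: "v \<in> spn (NW (x @ k # y)) \<Longrightarrow> rung (sum_list x) (sum_list x) 1 v \<in> spn (NW (x @ k # y))"
  using sym_op_typed[of v x "Dot k" y] by simp

section \<open>Interchange of local operators\<close>

lemma relabel_op_comp: "relabel_op \<phi> (relabel_op \<chi> v) = relabel_op (\<phi> \<circ> \<chi>) v" (is "?f v = ?g v")
proof (rule linear_op_eqI[of ?f ?g])
  show "linear_op ?f" by (intro linear_op_comp[OF linear_relabel_op] linear_relabel_op)
  show "?f (bas w) = ?g (bas w)" for w
    by (simp add: relabel_op_def relabel_def apfst_compose comp_def)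
qed simp

lemma relabel_shift_at: "\<phi> b = d \<Longrightarrow> t < length w \<Longrightarrow> relabel \<phi> (shift_at t b \<beta> w) = shift_at t d \<beta> (relabel \<phi> w)"
  by (intro nth_equalityI) (auto simp: nth_shift_at)

lemma relabel_set_at: "\<phi> b = d \<Longrightarrow> relabel \<phi> (set_at T b w) = set_at T d (relabel \<phi> w)"
  by (intro nth_equalityI) auto

lemma pos_relabel_eq:
  assumes "\<And>z. \<phi> z = c \<longleftrightarrow> z = a"
  shows "pos c (relabel \<phi> w) = pos a w"
proof -
  have "fst (relabel \<phi> w ! t) = c \<longleftrightarrow> fst (w ! t) = a" if "t < length w" for t
    using that by (simp only: nth_relabel fst_conv assms)
  then show ?thesis unfolding pos_def length_relabel by blast
qed

text \<open>The first hypothesis makes the letters \<open>a\<close> before relabelling exactly the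
  letters \<open>c\<close> after it, so that both sides sum over the same positions.\<close>

lemma relabel_rung:
  assumes "\<And>z. \<phi> z = c \<longleftrightarrow> z = a" "\<phi> b = d"
  shows "relabel_op \<phi> (rung a b \<beta> v) = rung c d \<beta> (relabel_op \<phi> v)" (is "?f v = ?g v")
proof (rule linear_op_eqI[of ?f ?g])
  show "linear_op ?f" by (intro linear_op_comp[OF linear_relabel_op] linear_rung)
  show "linear_op ?g" by (intro linear_op_comp[OF linear_rung] linear_relabel_op)
  show "?f (bas w) = ?g (bas w)" for w
    unfolding relabel_op_def rung_def lin_ext_mon lin_ext_sum lin_ext_scl pos_relabel_eq[OF assms(1)]
    by (intro sum.cong refl) (simp only: relabel_shift_at assms(2) pos_less parity_take_relabel)
qed

lemma relabel_split:
  assumes "\<And>z. \<phi> z = c \<longleftrightarrow> z = a" "\<phi> b = d"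
  shows "relabel_op \<phi> (split_op a b l v) = split_op c d l (relabel_op \<phi> v)" (is "?f v = ?g v")
proof (rule linear_op_eqI[of ?f ?g])
  show "linear_op ?f" by (intro linear_op_comp[OF linear_relabel_op] linear_split_op)
  show "linear_op ?g" by (intro linear_op_comp[OF linear_split_op] linear_relabel_op)
  show "?f (bas w) = ?g (bas w)" for w
    unfolding relabel_op_def split_op_def lin_ext_mon lin_ext_sum pos_relabel_eq[OF assms(1)]
    by (intro sum.cong refl) (simp only: relabel_set_at assms(2))
qed

lemma finite_subsets_card: "finite S \<Longrightarrow> finite {T. T \<subseteq> S \<and> card T = l}"
  by (rule finite_subset[of _ "Pow S"]) auto

lemma finite_subs [simp]: "finite {T. T \<subseteq> pos p w \<and> card T = l}"
  by (simp add: finite_subsets_card)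

lemma split_rung_bas:
  assumes "a \<noteq> p" "a \<noteq> b"
  shows "split_op p b l (rung a a \<beta> (bas w)) = rung a a \<beta> (split_op p b l (bas w))"
proof -
  let ?S = "{T. T \<subseteq> pos p w \<and> card T = l}"
  have "split_op p b l (rung a a \<beta> (bas w)) = (\<Sum>t\<in>pos a w. \<Sum>T\<in>?S.
      scl (ksgn \<beta> (idx_parity (take t w))) (bas (set_at T b (shift_at t a \<beta> w))))"
    unfolding rung_def split_op_def lin_ext_mon lin_ext_sum lin_ext_scl scl_sum
  proof (intro sum.cong refl)
    fix t assume "t \<in> pos a w"
    then have "pos p (shift_at t a \<beta> w) = pos p w"
      using assms by (auto simp: pos_shift_at pos_less dest: pos_fst)
    then show "{T. T \<subseteq> pos p (shift_at t a \<beta> w) \<and> card T = l} = ?S" by simp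
  qed
  also have "\<dots> = (\<Sum>T\<in>?S. \<Sum>t\<in>pos a w.
      scl (ksgn \<beta> (idx_parity (take t w))) (bas (set_at T b (shift_at t a \<beta> w))))"
    by (rule sum.swap)
  also have "\<dots> = rung a a \<beta> (split_op p b l (bas w))"
    unfolding rung_def split_op_def lin_ext_mon lin_ext_sum
  proof (intro sum.cong refl)
    fix T assume "T \<in> ?S"
    then have T: "T \<subseteq> pos p w" by simp
    then show "pos a w = pos a (set_at T b w)"
      using assms by (subst pos_set_at) (auto simp: pos_def)
    fix t assume "t \<in> pos a (set_at T b w)"
    then have "t < length w" "t \<notin> T"
      using assms T by (auto simp: pos_def split: if_splits)
    then have "set_at T b (shift_at t a \<beta> w) = shift_at t a \<beta> (set_at T b w)"
      by (intro nth_equalityI) (auto simp: nth_shift_at)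
    then show "scl (ksgn \<beta> (idx_parity (take t w))) (bas (set_at T b (shift_at t a \<beta> w))) =
      scl (ksgn \<beta> (idx_parity (take t (set_at T b w)))) (bas (shift_at t a \<beta> (set_at T b w)))"
      by simp
  qed
  finally show ?thesis .
qed

lemma split_rung:
  assumes "a \<noteq> p" "a \<noteq> b"
  shows "split_op p b l (rung a a \<beta> v) = rung a a \<beta> (split_op p b l v)" (is "?f v = ?g v")
proof (rule linear_op_eqI[of ?f ?g])
  show "linear_op ?f" by (intro linear_op_comp[OF linear_split_op] linear_rung)
  show "linear_op ?g" by (intro linear_op_comp[OF linear_rung] linear_split_op)
qed (rule split_rung_bas[OF assms])

lemma split_split_bas:
  assumes "p \<noteq> p'" "b \<noteq> p'" "b' \<noteq> p"
  shows "split_op p' b' l' (split_op p b l (bas w)) = split_op p b l (split_op p' b' l' (bas w))"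
proof -
  have eq: "split_op p' b' l' (split_op p b l (bas w)) = (\<Sum>T\<in>{T. T \<subseteq> pos p w \<and> card T = l}.
      \<Sum>T'\<in>{T'. T' \<subseteq> pos p' w \<and> card T' = l'}. bas (set_at T' b' (set_at T b w)))"
    if "p \<noteq> p'" "b \<noteq> p'" for p b l p' b' l'
    unfolding split_op_def lin_ext_mon lin_ext_sum
  proof (intro sum.cong refl)
    fix T assume "T \<in> {T. T \<subseteq> pos p w \<and> card T = l}"
    then have "pos p' (set_at T b w) = pos p' w"
      using that by (subst pos_set_at) (auto simp: pos_def)
    then show "{T'. T' \<subseteq> pos p' (set_at T b w) \<and> card T' = l'} = {T'. T' \<subseteq> pos p' w \<and> card T' = l'}"
      by simp
  qed
  have swap: "set_at T' b' (set_at T b w) = set_at T b (set_at T' b' w)"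
    if "T \<subseteq> pos p w" "T' \<subseteq> pos p' w" for T T'
    using that assms(1) by (intro nth_equalityI) (auto simp: pos_def)
  show ?thesis
    unfolding eq[OF assms(1,2)] eq[OF assms(1)[symmetric] assms(3)]
    by (subst sum.swap, intro sum.cong refl) (simp add: swap)
qed

lemma split_split:
  assumes "p \<noteq> p'" "b \<noteq> p'" "b' \<noteq> p"
  shows "split_op p' b' l' (split_op p b l v) = split_op p b l (split_op p' b' l' v)" (is "?f v = ?g v")
proof (rule linear_op_eqI[of ?f ?g])
  show "linear_op ?f" by (intro linear_op_comp[OF linear_split_op] linear_split_op)
  show "linear_op ?g" by (intro linear_op_comp[OF linear_split_op] linear_split_op)
qed (rule split_split_bas[OF assms])

lemma rung_anticommute: "a \<noteq> c \<Longrightarrow> rung c c 1 (rung a a 1 v) = - rung a a 1 (rung c c 1 v)"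
  using rung_commutator[of c c 1 a a 1 v] by (simp add: ksgn_one add_eq_0_iff2)

text \<open>An odd element squares to half its supercommutator with itself.\<close>

lemma rung_square: "rung a a 1 (rung a a 1 v) = rung a a 0 v"
proof -
  have "rung a a 1 (rung a a 1 v) + rung a a 1 (rung a a 1 v) = rung a a 0 v + rung a a 0 v"
    using rung_commutator[of a a 1 a a 1 v] by (simp add: ksgn_one)
  then have "scl 2 (rung a a 1 (rung a a 1 v)) = scl 2 (rung a a 0 v)"
    using scl_add_left[of 1 1 "rung a a 1 (rung a a 1 v)"] scl_add_left[of 1 1 "rung a a 0 v"] by simp
  then have "scl (1/2) (scl 2 (rung a a 1 (rung a a 1 v))) = scl (1/2) (scl 2 (rung a a 0 v))" by simp
  then show ?thesis by simp
qed

fun sym_pos :: "web_symbol \<Rightarrow> bool" where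
  "sym_pos (Merge k l) \<longleftrightarrow> 0 < k \<and> 0 < l"
| "sym_pos (Split k l) \<longleftrightarrow> 0 < k \<and> 0 < l"
| "sym_pos (Dot k) \<longleftrightarrow> 0 < k"

text \<open>The labels that \<open>f\<close> reads or writes lie below those of \<open>g\<close>, so
  the two operators concern different letters. Only a pair of dots produces a sign.\<close>

lemma sym_op_interchange:
  assumes "sym_pos f" "sym_pos g" "p + sum_list (src f) \<le> p'"
  shows "sym_op p' g (sym_op p f v) = scl (koszul (sym_parity f * sym_parity g)) (sym_op p f (sym_op p' g v))"
proof -
  have out: "collapse q n z = c \<longleftrightarrow> z = c" if "c < q \<or> q + n \<le> c" "0 < n" for q n z c
    using that by (auto simp: collapse_def)
  have fix': "collapse q n c = c" if "c < q \<or> q + n \<le> c" for q n c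
    using that by (auto simp: collapse_def)
  have comm: "collapse p' n' \<circ> collapse p n = collapse p n \<circ> collapse p' n'" if "p + n \<le> p'" "0 < n" for n n'
    using that by (auto simp: collapse_def fun_eq_iff)
  consider (mm) k l k' l' where "f = Merge k l" "g = Merge k' l'" | (ms) k l k' l' where "f = Merge k l" "g = Split k' l'"
    | (md) k l k' where "f = Merge k l" "g = Dot k'" | (sm) k l k' l' where "f = Split k l" "g = Merge k' l'"
    | (ss) k l k' l' where "f = Split k l" "g = Split k' l'" | (sd) k l k' where "f = Split k l" "g = Dot k'"
    | (dm) k k' l' where "f = Dot k" "g = Merge k' l'" | (ds) k k' l' where "f = Dot k" "g = Split k' l'"
    | (dd) k k' where "f = Dot k" "g = Dot k'"
    by (cases f; cases g) auto
  then show ?thesis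
  proof cases
    case mm
    with assms comm[of "k + l" "k' + l'"] show ?thesis by (simp add: koszul_one relabel_op_comp)
  next
    case ms
    have "relabel_op (collapse p (k + l)) (split_op p' (p' + k') l' v) =
        split_op p' (p' + k') l' (relabel_op (collapse p (k + l)) v)"
      by (rule relabel_split) (use ms assms in \<open>auto simp: out fix'\<close>)
    with ms show ?thesis by (simp add: koszul_one)
  next
    case md
    have "relabel_op (collapse p (k + l)) (rung p' p' 1 v) = rung p' p' 1 (relabel_op (collapse p (k + l)) v)"
      by (rule relabel_rung) (use md assms in \<open>auto simp: out fix'\<close>)
    with md show ?thesis by (simp add: koszul_one)
  next
    case sm
    have "relabel_op (collapse p' (k' + l')) (split_op p (p + k) l v) =
        split_op p (p + k) l (relabel_op (collapse p' (k' + l')) v)"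
      by (rule relabel_split) (use sm assms in \<open>auto simp: out fix'\<close>)
    with sm show ?thesis by (simp add: koszul_one)
  next
    case ss
    with assms split_split[of p p' "p + k" "p' + k'" l' l v] show ?thesis by (simp add: koszul_one)
  next
    case sd
    with assms split_rung[of p' p "p + k" l 1 v] show ?thesis by (simp add: koszul_one)
  next
    case dm
    have "relabel_op (collapse p' (k' + l')) (rung p p 1 v) = rung p p 1 (relabel_op (collapse p' (k' + l')) v)"
      by (rule relabel_rung) (use dm assms in \<open>auto simp: out fix'\<close>)
    with dm show ?thesis by (simp add: koszul_one)
  next
    case ds
    with assms split_rung[of p p' "p' + k'" l' 1 v] show ?thesis by (simp add: koszul_one)
  next
    case dd
    with assms have "p \<noteq> p'" by auto
    with dd rung_anticommute[of p p' v] show ?thesis by (simp add: koszul_one)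
  qed
qed

lemma theta_interchange:
  assumes "sym_pos f" "sym_pos g"
  shows "theta (bas [Layer (x @ tgt f @ y) g z] * bas [Layer x f (y @ src g @ z)]) v =
     theta (scl (koszul (sym_parity f * sym_parity g)) (bas [Layer x f (y @ tgt g @ z)] * bas [Layer (x @ src f @ y) g z])) v"
proof -
  define u where "u = prj (x @ src f @ y @ src g @ z) v"
  have sum: "sum_list (src h) = sum_list (tgt h)" for h by (cases h) simp_all
  have "u \<in> spn (NW (x @ src f @ (y @ src g @ z)))" by (simp add: u_def)
  then have "sym_op (sum_list x) f u \<in> spn (NW ((x @ tgt f @ y) @ src g @ z))"
    using sym_op_typed by fastforce
  then have 1: "theta (bas [Layer (x @ tgt f @ y) g z] * bas [Layer x f (y @ src g @ z)]) v =
      sym_op (sum_list (x @ tgt f @ y)) g (sym_op (sum_list x) f u)"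
    by (simp add: theta_mult theta_layer) (simp add: theta_simps prj_id u_def)
  have "u \<in> spn (NW ((x @ src f @ y) @ src g @ z))" by (simp add: u_def)
  then have "sym_op (sum_list (x @ src f @ y)) g u \<in> spn (NW (x @ src f @ (y @ tgt g @ z)))"
    using sym_op_typed by fastforce
  then have 2: "theta (bas [Layer x f (y @ tgt g @ z)] * bas [Layer (x @ src f @ y) g z]) v =
      sym_op (sum_list x) f (sym_op (sum_list (x @ src f @ y)) g u)"
    by (simp add: theta_mult theta_layer) (simp add: theta_simps prj_id u_def)
  show ?thesis unfolding theta_simps(3) 1 2
    using sym_op_interchange[OF assms, of "sum_list x" "sum_list (x @ src f @ y)" u] by (simp add: sum)
qed

section \<open>Relations without ladders\<close>

text \<open>Both sides choose disjoint sets of \<open>m - l\<close> and \<open>l\<close> letters for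
  the middle and the right strand. On the left, \<open>m\<close> letters leave the first strand and
  \<open>l\<close> of them go on; on the right, those \<open>l\<close> letters are chosen
  first.\<close>

lemma split_assoc_op:
  assumes "w \<in> NW (x @ n # y)" "0 < h" "0 < k" "h + k < n" "l \<le> m"
  defines "p \<equiv> sum_list x"
  shows "split_op (p + h) (p + (h + k)) l (split_op p (p + h) m (bas w)) =
         split_op p (p + h) (m - l) (split_op p (p + (h + k)) l (bas w))"
proof -
  have empty: "pos (p + h) w = {}" "pos (p + (h + k)) w = {}"
    unfolding p_def using assms by (intro NW_pos_empty[OF assms(1)]; simp)+
  let ?A = "Sigma {S. S \<subseteq> pos p w \<and> card S = m} (\<lambda>S. {T. T \<subseteq> S \<and> card T = l})"
  let ?B = "Sigma {T. T \<subseteq> pos p w \<and> card T = l} (\<lambda>T. {S. S \<subseteq> pos p w - T \<and> card S = m - l})"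
  have fin: "finite S" if "S \<subseteq> pos p w" for S using that finite_pos finite_subset by blast
  have len: "S \<subseteq> {..<length w}" if "S \<subseteq> pos p w" for S using that pos_subset by blast
  have "split_op (p + h) (p + (h + k)) l (split_op p (p + h) m (bas w)) =
    (\<Sum>S | S \<subseteq> pos p w \<and> card S = m. \<Sum>T | T \<subseteq> S \<and> card T = l. bas (set_at T (p + (h + k)) (set_at S (p + h) w)))"
    unfolding split_op_def lin_ext_mon lin_ext_sum
  proof (intro sum.cong refl)
    fix S assume "S \<in> {S. S \<subseteq> pos p w \<and> card S = m}"
    then have "pos (p + h) (set_at S (p + h) w) = S"
      using empty len[of S] by (subst pos_set_at) auto
    then show "{T. T \<subseteq> pos (p + h) (set_at S (p + h) w) \<and> card T = l} = {T. T \<subseteq> S \<and> card T = l}" by simp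
  qed
  also have "\<dots> = (\<Sum>(S, T)\<in>?A. bas (set_at T (p + (h + k)) (set_at S (p + h) w)))"
    by (rule sum.Sigma) (simp_all add: finite_subsets_card fin)
  also have "\<dots> = (\<Sum>(T, S)\<in>?B. bas (set_at S (p + h) (set_at T (p + (h + k)) w)))"
  proof (rule sum.reindex_bij_witness[where i = "\<lambda>(T, S). (S \<union> T, T)" and j = "\<lambda>(S, T). (T, S - T)"], goal_cases)
    case (2 a)
    then obtain S T where a: "a = (S, T)" "S \<subseteq> pos p w" "card S = m" "T \<subseteq> S" "card T = l" by auto
    then have "card (S - T) = m - l"
      using finite_subset[OF a(4) fin[OF a(2)]] by (simp add: card_Diff_subset)
    with a show ?case by auto
  next
    case (4 b)
    then obtain T S where b: "b = (T, S)" "T \<subseteq> pos p w" "card T = l" "S \<subseteq> pos p w - T" "card S = m - l" by auto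
    then have "card (S \<union> T) = m" using fin[of S] fin[of T] \<open>l \<le> m\<close>
      by (subst card_Un_disjoint) auto
    with b show ?case by auto
  next
    case (5 a)
    then obtain S T where a: "a = (S, T)" "S \<subseteq> pos p w" "T \<subseteq> S" by auto
    have "set_at T (p + (h + k)) (set_at S (p + h) w) = set_at (S - T) (p + h) (set_at T (p + (h + k)) w)"
      using a by (intro nth_equalityI) auto
    with a show ?case by simp
  qed auto
  also have "\<dots> = (\<Sum>T | T \<subseteq> pos p w \<and> card T = l. \<Sum>S | S \<subseteq> pos p w - T \<and> card S = m - l.
      bas (set_at S (p + h) (set_at T (p + (h + k)) w)))"
    by (rule sum.Sigma[symmetric]) (simp_all add: finite_subsets_card)
  also have "\<dots> = split_op p (p + h) (m - l) (split_op p (p + (h + k)) l (bas w))"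
    unfolding split_op_def lin_ext_mon lin_ext_sum
  proof (intro sum.cong refl)
    fix T assume "T \<in> {T. T \<subseteq> pos p w \<and> card T = l}"
    then have "pos p (set_at T (p + (h + k)) w) = pos p w - T"
      using assms len[of T] by (subst pos_set_at) auto
    then show "{S. S \<subseteq> pos p w - T \<and> card S = m - l} = {S. S \<subseteq> pos p (set_at T (p + (h + k)) w) \<and> card S = m - l}"
      by simp
  qed
  finally show ?thesis .
qed

lemma sum_const_scl: "finite A \<Longrightarrow> (\<Sum>i\<in>A. x) = scl (of_nat (card A)) x"
  by (induction A rule: finite_induct) (auto simp: scl_add_left simp del: sum_constant)

text \<open>Merging undoes every choice of letters, so the scalar is the number of choices.\<close>

lemma merge_split_op:
  assumes "w \<in> NW (x @ (k + l) # y)" "0 < k" "0 < l"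
  defines "p \<equiv> sum_list x"
  shows "relabel_op (collapse p (k + l)) (split_op p (p + k) l (bas w)) = scl (of_nat ((k + l) choose l)) (bas w)"
proof -
  let ?S = "{T. T \<subseteq> pos p w \<and> card T = l}"
  have "relabel_op (collapse p (k + l)) (split_op p (p + k) l (bas w)) = (\<Sum>T\<in>?S. bas w)"
    unfolding split_op_def relabel_op_def lin_ext_mon lin_ext_sum
  proof (intro sum.cong refl)
    fix T assume "T \<in> ?S"
    then have T: "T \<subseteq> pos p w" by simp
    have c: "collapse p (k + l) (fst (w ! s)) = fst (w ! s)" if "s < length w" for s
      using NW_letters[OF assms(1) that] by (auto simp: collapse_def p_def)
    have "collapse p (k + l) (p + k) = p" using assms(3) by (simp add: collapse_def)
    moreover have "fst (w ! s) = p" if "s \<in> T" for s using that T by (auto simp: pos_def)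
    ultimately show "bas (relabel (collapse p (k + l)) (set_at T (p + k) w)) = bas w"
      using c by (intro arg_cong[where f = bas] nth_equalityI) (auto simp: prod_eq_iff)
  qed
  also have "\<dots> = scl (of_nat (card ?S)) (bas w)" by (rule sum_const_scl) simp
  also have "card ?S = (k + l) choose l"
    using n_subsets[OF finite_pos] NW_card_pos[OF assms(1)] assms(2) by (simp add: p_def)
  finally show ?thesis .
qed

text \<open>The letters of the merged strand are the disjoint union of those of the two strands, and
  the sum over dotted letters splits accordingly.\<close>

lemma dot_merge_op:
  assumes "w \<in> NW (x @ k # l # y)" "0 < k" "0 < l"
  defines "p \<equiv> sum_list x"
  shows "rung p p 1 (relabel_op (collapse p (k + l)) (bas w)) =
     relabel_op (collapse p (k + l)) (rung p p 1 (bas w)) + relabel_op (collapse p (k + l)) (rung (p + k) (p + k) 1 (bas w))"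
proof -
  let ?c = "collapse p (k + l)"
  have c: "?c (fst (w ! t)) = p \<longleftrightarrow> fst (w ! t) = p \<or> fst (w ! t) = p + k" if "t < length w" for t
    using NW_letters[OF assms(1) that] NW_letters[of w "x @ [k]" l y t] that assms(1-3)
    by (auto simp: collapse_def p_def split: if_splits)
  have pos: "pos p (relabel ?c w) = pos p w \<union> pos (p + k) w"
  proof (rule Set.set_eqI)
    show "t \<in> pos p (relabel ?c w) \<longleftrightarrow> t \<in> pos p w \<union> pos (p + k) w" for t
      using c[of t] by (cases "t < length w") (simp_all add: pos_def)
  qed
  have eq: "relabel ?c (shift_at t p 1 w) = shift_at t p 1 (relabel ?c w)"
     "relabel ?c (shift_at t (p + k) 1 w) = shift_at t p 1 (relabel ?c w)" if "t < length w" for t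
    using that assms by (intro relabel_shift_at; simp add: collapse_def)+
  have "rung p p 1 (relabel_op ?c (bas w)) =
     (\<Sum>t\<in>pos p w \<union> pos (p + k) w. scl (ksgn 1 (idx_parity (take t w))) (bas (shift_at t p 1 (relabel ?c w))))"
    by (simp add: relabel_op_def rung_def pos)
  also have "\<dots> = (\<Sum>t\<in>pos p w. scl (ksgn 1 (idx_parity (take t w))) (bas (shift_at t p 1 (relabel ?c w)))) +
      (\<Sum>t\<in>pos (p + k) w. scl (ksgn 1 (idx_parity (take t w))) (bas (shift_at t p 1 (relabel ?c w))))"
    using assms by (intro sum.union_disjoint) (auto simp: pos_def)
  also have "\<dots> = relabel_op ?c (rung p p 1 (bas w)) + relabel_op ?c (rung (p + k) (p + k) 1 (bas w))"
    by (simp add: rung_def relabel_op_def lin_ext_sum lin_ext_scl eq pos_less)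
  finally show ?thesis .
qed

text \<open>The dotted letter either stays behind or belongs to the chosen set; the two cases are
  the two dots after the split.\<close>

lemma dot_split_op:
  assumes "w \<in> NW (x @ (k + l) # y)" "0 < k" "0 < l"
  defines "p \<equiv> sum_list x"
  shows "split_op p (p + k) l (rung p p 1 (bas w)) =
     rung p p 1 (split_op p (p + k) l (bas w)) + rung (p + k) (p + k) 1 (split_op p (p + k) l (bas w))"
proof -
  let ?S = "{T. T \<subseteq> pos p w \<and> card T = l}"
  let ?K = "\<lambda>t. ksgn 1 (idx_parity (take t w))"
  have empty: "pos (p + k) w = {}"
    unfolding p_def using assms by (intro NW_pos_empty[OF assms(1)]; simp)
  have "split_op p (p + k) l (rung p p 1 (bas w)) = (\<Sum>t\<in>pos p w. \<Sum>T\<in>?S. scl (?K t) (bas (set_at T (p + k) (shift_at t p 1 w))))"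
    unfolding rung_def split_op_def lin_ext_mon lin_ext_sum lin_ext_scl scl_sum
  proof (intro sum.cong refl)
    fix t assume "t \<in> pos p w"
    then have "pos p (shift_at t p 1 w) = pos p w" by (auto simp: pos_shift_at pos_less)
    then show "{T. T \<subseteq> pos p (shift_at t p 1 w) \<and> card T = l} = ?S" by simp
  qed
  also have "\<dots> = (\<Sum>T\<in>?S. \<Sum>t\<in>pos p w. scl (?K t) (bas (set_at T (p + k) (shift_at t p 1 w))))"
    by (rule sum.swap)
  also have "\<dots> = (\<Sum>T\<in>?S. rung p p 1 (bas (set_at T (p + k) w)) + rung (p + k) (p + k) 1 (bas (set_at T (p + k) w)))"
  proof (intro sum.cong refl)
    fix T assume "T \<in> ?S"
    then have T: "T \<subseteq> pos p w" by simp
    then have Tl: "T \<subseteq> {..<length w}" using pos_subset by blast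
    have pos1: "pos p (set_at T (p + k) w) = pos p w - T" and pos2: "pos (p + k) (set_at T (p + k) w) = T"
      using assms empty by (simp_all add: pos_set_at[OF Tl])
    have eq1: "set_at T (p + k) (shift_at t p 1 w) = shift_at t p 1 (set_at T (p + k) w)" if "t \<in> pos p w - T" for t
      using that by (intro nth_equalityI) (auto simp: nth_shift_at pos_def)
    have eq2: "set_at T (p + k) (shift_at t p 1 w) = shift_at t (p + k) 1 (set_at T (p + k) w)" if "t \<in> T" for t
      using that Tl by (intro nth_equalityI) (auto simp: nth_shift_at)
    have "(\<Sum>t\<in>pos p w. scl (?K t) (bas (set_at T (p + k) (shift_at t p 1 w)))) =
      (\<Sum>t\<in>pos p w - T. scl (?K t) (bas (set_at T (p + k) (shift_at t p 1 w)))) +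
      (\<Sum>t\<in>T. scl (?K t) (bas (set_at T (p + k) (shift_at t p 1 w))))"
      by (rule sum.subset_diff[OF T]) simp
    also have "\<dots> = rung p p 1 (bas (set_at T (p + k) w)) + rung (p + k) (p + k) 1 (bas (set_at T (p + k) w))"
      unfolding rung_def lin_ext_mon pos1 pos2 parity_take_set_at
      by (intro arg_cong2[where f = "(+)"] sum.cong refl) (simp_all only: eq1 eq2)
    finally show "(\<Sum>t\<in>pos p w. scl (?K t) (bas (set_at T (p + k) (shift_at t p 1 w)))) = \<dots>" .
  qed
  also have "\<dots> = rung p p 1 (split_op p (p + k) l (bas w)) + rung (p + k) (p + k) 1 (split_op p (p + k) l (bas w))"
    by (simp add: split_op_def linear_opD[OF linear_rung] sum.distrib)
  finally show ?thesis .
qed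

text \<open>The same transposition serves for labels of strands and later for positions in a
  word.\<close>

definition swap_letter :: "nat \<Rightarrow> nat \<Rightarrow> nat" where
  "swap_letter p z = (if z = p then Suc p else if z = Suc p then p else z)"

definition swap_op :: "nat \<Rightarrow> tens \<Rightarrow> tens" where
  "swap_op p = relabel_op (swap_letter p)"

text \<open>Merging two thin strands gives two letters with the same label. Choosing one of them for
  the right strand either restores the word or exchanges the two labels.\<close>

lemma crossing_op:
  assumes "w \<in> NW (x @ 1 # 1 # y)"
  defines "p \<equiv> sum_list x"
  shows "split_op p (p + 1) 1 (relabel_op (collapse p 2) (bas w)) = bas w + swap_op p (bas w)"
proof -
  let ?c = "collapse p 2"
  have "card (pos p w) = 1" "card (pos (p + 1) w) = 1"
    using NW_card_pos[OF assms(1)] NW_card_pos[of w "x @ [1]" 1 y] assms(1) by (simp_all add: p_def)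
  then obtain s t where st: "pos p w = {s}" "pos (p + 1) w = {t}"
    by (meson card_1_singletonE)
  have s: "s < length w" "fst (w ! s) = p" and t: "t < length w" "fst (w ! t) = p + 1"
    using st by (auto simp: pos_def)
  have ne: "s \<noteq> t" using s t by auto
  have others: "fst (w ! i) \<noteq> p" "fst (w ! i) \<noteq> Suc p" if "i < length w" "i \<noteq> s" "i \<noteq> t" for i
    using st that by (auto simp: pos_def)
  have "pos p (relabel ?c w) = pos p w \<union> pos (p + 1) w"
  proof (rule Set.set_eqI)
    show "i \<in> pos p (relabel ?c w) \<longleftrightarrow> i \<in> pos p w \<union> pos (p + 1) w" for i
      by (cases "i < length w") (auto simp: pos_def collapse_def)
  qed
  then have "pos p (relabel ?c w) = {s, t}" unfolding st by (simp add: insert_commute)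
  moreover have "{T. T \<subseteq> {s, t} \<and> card T = 1} = {{s}, {t}}"
    by (auto simp: card_1_singleton_iff)
  moreover have "set_at {t} (p + 1) (relabel ?c w) = w"
  proof (intro nth_equalityI, goal_cases)
    case (2 i)
    then show ?case
      using s t ne others[of i] by (cases "i = s"; cases "i = t") (auto simp: collapse_def prod_eq_iff)
  qed simp
  moreover have "set_at {s} (p + 1) (relabel ?c w) = relabel (swap_letter p) w"
  proof (intro nth_equalityI, goal_cases)
    case (2 i)
    then show ?case
      using s t ne others[of i] by (cases "i = s"; cases "i = t") (auto simp: collapse_def swap_letter_def)
  qed simp
  ultimately show ?thesis
    using ne by (simp add: split_op_def relabel_op_def swap_op_def)
qed

section \<open>Words labelled by strand numbers\<close>

text \<open>Strand numbers start at 1, as in the weights. Parts \<open>0\<close> keep their number,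
  so a ladder that empties a strand does not renumber the others.\<close>

definition PW :: "nat list \<Rightarrow> idx list set" where
  "PW a = {w. \<forall>j. card (pos j w) = hat a j}"

definition offset :: "nat list \<Rightarrow> nat \<Rightarrow> nat" where
  "offset a j = sum_list (take (j - 1) a)"

definition below :: "idx list \<Rightarrow> nat \<Rightarrow> nat" where
  "below w j = card {t. t < length w \<and> fst (w ! t) < j}"

text \<open>Turns strand numbers into offsets without reference to the weight, even in the presence of strands
  labelled \<open>0\<close>.\<close>

definition CC_op :: "tens \<Rightarrow> tens" where
  "CC_op = lin_ext (\<lambda>w. bas (relabel (below w) w))"

lemma linear_CC [simp]: "linear_op CC_op"
  by (simp add: CC_op_def)

fun pbase :: "nat \<Rightarrow> nat list \<Rightarrow> nat list" where
  "pbase i [] = []"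
| "pbase i (k # a) = replicate k i @ pbase (Suc i) a"

lemma count_pbase: "count (mset (pbase i a)) j = (if i \<le> j \<and> j < i + length a then a ! (j - i) else 0)"
proof (induction a arbitrary: i)
  case (Cons k a)
  then show ?case by (auto simp: nth_Cons' Suc_diff_Suc le_Suc_eq not_less Suc_le_eq)
qed simp

lemma PW_mset: "w \<in> PW a \<longleftrightarrow> mset (map fst w) = mset (pbase 1 a)"
  unfolding PW_def multiset_eq_iff count_pos count_pbase
  by (auto simp: hat_def)

lemma map_offset_pbase: "map (offset (a @ b)) (pbase (Suc (length a)) b) = base (sum_list a) b"
proof (induction b arbitrary: a)
  case (Cons k b)
  have "map (offset (a @ k # b)) (pbase (Suc (Suc (length a))) b) = base (sum_list a + k) b"
    using Cons[of "a @ [k]"] by simp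
  moreover have "offset (a @ k # b) (Suc (length a)) = sum_list a" by (simp add: offset_def)
  ultimately show ?case by simp
qed simp

lemma map_offset_pbase_1: "map (offset a) (pbase 1 a) = base 0 a"
  using map_offset_pbase[of "[]" a] by simp

lemma relabel_PW:
  assumes "w \<in> PW a"
  shows "relabel (offset a) w \<in> NW a"
proof -
  have "mset (map fst (relabel (offset a) w)) = image_mset (offset a) (mset (map fst w))"
    by (simp add: relabel_def image_mset.compositionality o_def multiset.map_comp)
  also have "\<dots> = mset (map (offset a) (pbase 1 a))"
    using assms by (simp add: PW_mset)
  finally show ?thesis by (simp only: NW_def map_offset_pbase_1 mem_Collect_eq)
qed

text \<open>The letters smaller than \<open>j\<close> are exactly those of the strands before the
  \<open>j\<close>-th one, and there are as many as the thicknesses of these strands add up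
  to.\<close>

lemma below_PW:
  assumes "w \<in> PW a" "t < length w"
  shows "below w (fst (w ! t)) = offset a (fst (w ! t))"
proof -
  define j where "j = fst (w ! t)"
  have "t \<in> pos j w" using assms(2) by (simp add: pos_def j_def)
  then have "card (pos j w) \<noteq> 0" by auto
  then have "hat a j \<noteq> 0" using assms(1) by (simp only: PW_def mem_Collect_eq) simp
  then have j: "1 \<le> j" "j \<le> length a" by (auto simp: hat_def split: if_splits)
  have "below w j = card (\<Union>i\<in>{..<j}. pos i w)"
    unfolding below_def by (rule arg_cong[where f = card]) (auto simp: pos_def)
  also have "\<dots> = (\<Sum>i<j. card (pos i w))"
    by (rule card_UN_disjoint) (auto simp: pos_def)
  also have "\<dots> = (\<Sum>i<j. hat a i)" using assms(1) by (simp add: PW_def)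
  also have "\<dots> = (\<Sum>i<j - 1. a ! i)"
  proof -
    have "(\<Sum>i<j. hat a i) = (\<Sum>i<Suc (j - 1). hat a i)" using j by simp
    also have "\<dots> = hat a 0 + (\<Sum>i<j - 1. hat a (Suc i))" by (rule sum.lessThan_Suc_shift)
    also have "\<dots> = (\<Sum>i<j - 1. a ! i)" using j by (auto simp: hat_def intro!: sum.cong)
    finally show ?thesis .
  qed
  also have "\<dots> = offset a j"
    using j by (simp add: offset_def sum_list_sum_nth lessThan_atLeast0 min_def)
  finally show ?thesis by (simp add: j_def)
qed

lemma relabel_cong: "(\<And>t. t < length w \<Longrightarrow> \<phi> (fst (w ! t)) = \<psi> (fst (w ! t))) \<Longrightarrow> relabel \<phi> w = relabel \<psi> w"
  by (intro nth_equalityI) auto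

lemma CC_bas: "w \<in> PW a \<Longrightarrow> CC_op (bas w) = bas (relabel (offset a) w)"
  unfolding CC_op_def lin_ext_mon
  by (rule arg_cong[where f = bas], rule relabel_cong, rule below_PW)

lemma CC_typed: "v \<in> spn (PW a) \<Longrightarrow> CC_op v \<in> spn (NW a)"
  by (rule linear_op_spn[OF linear_CC]) (auto simp: CC_bas relabel_PW)

lemma offset_mono:
  assumes "1 \<le> j" "j < j'"
  shows "offset a j + hat a j \<le> offset a j'"
proof (cases "j \<le> length a")
  case True
  then have "take j a = take (j - 1) a @ [a ! (j - 1)]"
    using assms take_Suc_conv_app_nth[of "j - 1" a] by simp
  then have "offset a j + hat a j = sum_list (take j a)"
    using True assms by (simp add: offset_def hat_def)
  moreover have "take (j' - 1) a = take j a @ take (j' - 1 - j) (drop j a)"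
    using assms by (metis add_diff_inverse_nat less_imp_Suc_add diff_Suc_1 not_less_eq take_add less_irrefl_nat nat_less_le add.commute le_add2 add_Suc_right not_add_less2)
  ultimately show ?thesis by (simp add: offset_def)
next
  case False
  then show ?thesis using assms by (simp add: offset_def hat_def)
qed

lemma PW_letter:
  assumes "w \<in> PW a" "t < length w"
  shows "1 \<le> fst (w ! t)" "0 < hat a (fst (w ! t))" "fst (w ! t) \<le> length a"
proof -
  have "t \<in> pos (fst (w ! t)) w" using assms(2) by (simp add: pos_def)
  then have "card (pos (fst (w ! t)) w) \<noteq> 0" by auto
  then have "hat a (fst (w ! t)) \<noteq> 0" using assms(1) by (simp only: PW_def mem_Collect_eq) simp
  then show "1 \<le> fst (w ! t)" "0 < hat a (fst (w ! t))" "fst (w ! t) \<le> length a"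
    by (auto simp: hat_def split: if_splits)
qed

text \<open>Only nonempty strands have different offsets; an empty one shares its offset with the
  next. As no letter lies on an empty strand, relabelling words is still injective.\<close>

lemma offset_inj:
  assumes "1 \<le> i" "1 \<le> j" "0 < hat a i" "0 < hat a j" "offset a i = offset a j"
  shows "i = j"
proof (rule ccontr)
  assume "i \<noteq> j"
  then consider "i < j" | "j < i" by linarith
  then show False using offset_mono[of i j a] offset_mono[of j i a] assms by cases auto
qed

lemma pos_relabel_offset:
  assumes "w \<in> PW a" "1 \<le> j" "0 < hat a j"
  shows "pos (offset a j) (relabel (offset a) w) = pos j w"
  using PW_letter[OF assms(1)] offset_inj[of _ j a] assms(2,3) by (auto simp: pos_def)

lemma relabel_offset_inj:
  assumes "v \<in> PW a" "w \<in> PW a" "relabel (offset a) v = relabel (offset a) w"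
  shows "v = w"
proof (rule nth_equalityI)
  show len: "length v = length w" using assms(3) by (metis length_relabel)
  fix t assume t: "t < length v"
  have "relabel (offset a) v ! t = relabel (offset a) w ! t" using assms(3) by simp
  then have "offset a (fst (v ! t)) = offset a (fst (w ! t))" "snd (v ! t) = snd (w ! t)"
    using t len by simp_all
  then show "v ! t = w ! t"
    using PW_letter[OF assms(1) t] PW_letter[OF assms(2), of t] t len offset_inj by (auto simp: prod_eq_iff)
qed

lemma relabel_offset_surj:
  assumes "u \<in> NW a" "\<forall>k\<in>set a. 0 < k"
  obtains w where "w \<in> PW a" "relabel (offset a) w = u"
proof -
  have pb: "1 \<le> j \<and> 0 < hat a j" if "j \<in> set (pbase 1 a)" for j
  proof -
    have "count (mset (pbase 1 a)) j \<noteq> 0" using that by simp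
    then show ?thesis by (auto simp: count_pbase hat_def split: if_splits)
  qed
  then have inj: "inj_on (offset a) (set (pbase 1 a))"
    by (meson inj_onI offset_inj)
  define g where "g = inv_into (set (pbase 1 a)) (offset a)"
  have "mset (map fst u) = mset (map (offset a) (pbase 1 a))"
    using assms(1) by (simp only: NW_def mem_Collect_eq map_offset_pbase_1)
  note u = this
  then have "set (map fst u) = offset a ` set (pbase 1 a)"
    by (metis mset_eq_setD set_map)
  then have g: "offset a (g z) = z" if "z \<in> fst ` set u" for z
    using that by (auto simp: g_def f_inv_into_f)
  have "mset (map fst (relabel g u)) = image_mset g (mset (map fst u))"
    by (simp add: relabel_def image_mset.compositionality o_def multiset.map_comp)
  also have "\<dots> = mset (map (g \<circ> offset a) (pbase 1 a))"
    unfolding u by (simp add: image_mset.compositionality o_def multiset.map_comp)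
  also have "map (g \<circ> offset a) (pbase 1 a) = pbase 1 a"
    using inj by (intro map_idI) (simp add: g_def)
  finally have "relabel g u \<in> PW a" by (simp add: PW_mset)
  moreover have "relabel (offset a) (relabel g u) = u"
    using g by (intro nth_equalityI) (auto simp: prod_eq_iff)
  ultimately show thesis by (rule that)
qed

lemma CC_surj:
  assumes "v \<in> spn (NW a)" "\<forall>k\<in>set a. 0 < k"
  obtains v' where "v' \<in> spn (PW a)" "CC_op v' = v"
proof -
  have "\<exists>w'. w' \<in> PW a \<and> relabel (offset a) w' = w" if "w \<in> NW a" for w
    using relabel_offset_surj[OF that assms(2)] by metis
  then obtain h where h: "\<And>w. w \<in> NW a \<Longrightarrow> h w \<in> PW a \<and> relabel (offset a) (h w) = w" by metis
  let ?v = "lin_ext (\<lambda>w. bas (h w)) v"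
  have "?v \<in> spn (PW a)"
    by (rule linear_op_spn[OF _ _ assms(1)]) (use h in auto)
  moreover have "CC_op ?v = v"
  proof (rule linear_op_spn_eqI[OF assms(1), of "\<lambda>v. CC_op (lin_ext (\<lambda>w. bas (h w)) v)" "\<lambda>v. v"])
    show "linear_op (\<lambda>v. CC_op (lin_ext (\<lambda>w. bas (h w)) v))"
      by (intro linear_op_comp[OF linear_CC] linear_op_lin_ext)
    show "CC_op (lin_ext (\<lambda>w. bas (h w)) (bas w)) = bas w" if "w \<in> NW a" for w
      using h[OF that] by (simp add: CC_bas[of _ a])
  qed simp
  ultimately show thesis by (rule that)
qed

lemma offset_cases:
  assumes "1 \<le> j"
  shows "offset (x @ k # l # y) j = (if j \<le> length x + 1 then sum_list (take (j - 1) x)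
     else if j = length x + 2 then sum_list x + k
     else sum_list x + k + l + sum_list (take (j - length x - 3) y))"
proof -
  consider "j \<le> length x + 1" | "j = length x + 2" | m where "j = length x + 3 + m"
    by (metis add.commute add_2_eq_Suc add_Suc_right le_Suc_eq less_eqE not_less_eq_eq numeral_3_eq_3 One_nat_def add_Suc plus_1_eq_Suc)
  then show ?thesis
    using assms by cases (auto simp: offset_def)
qed

lemma hat_cases:
  "hat (x @ k # l # y) j = (if j = length x + 1 then k else if j = length x + 2 then l else
     if j \<le> length x then hat x j else hat y (j - length x - 2))"
proof -
  consider "j \<le> length x" | "j = length x + 1" | "j = length x + 2" | m where "j = length x + 3 + m"
    by (metis add.commute add_2_eq_Suc add_Suc_right le_Suc_eq less_eqE not_less_eq_eq numeral_3_eq_3 One_nat_def add_Suc plus_1_eq_Suc)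
  then show ?thesis
    by cases (auto simp: hat_def nth_append)
qed

lemma sum_list_take_le: "sum_list (take n x) \<le> sum_list x" for x :: "nat list"
  by (metis append_take_drop_id le_add1 sum_list_append)

section \<open>Ladders as rungs\<close>

lemma shift_at_PW:
  assumes "w \<in> PW a" "t \<in> pos c w" "b \<noteq> c" "hat a' = (hat a)(c := hat a c - 1, b := hat a b + 1)"
  shows "shift_at t b \<beta> w \<in> PW a'"
proof -
  have t: "t < length w" "fst (w ! t) = c" using assms(2) by (auto simp: pos_def)
  have "card (pos j (shift_at t b \<beta> w)) = hat a' j" for j
  proof -
    consider "j = b" | "j = c" | "j \<noteq> b" "j \<noteq> c" by blast
    then show ?thesis
    proof cases
      case 1
      then have "pos j (shift_at t b \<beta> w) = insert t (pos b w)" using t by (auto simp: pos_shift_at)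
      moreover have "t \<notin> pos b w" using t assms(3) by (auto simp: pos_def)
      ultimately show ?thesis using 1 assms by (simp add: PW_def)
    next
      case 2
      then have "pos j (shift_at t b \<beta> w) = pos c w - {t}" using t assms(3) by (auto simp: pos_shift_at)
      then show ?thesis using 2 assms by (simp add: PW_def)
    next
      case 3
      then have "pos j (shift_at t b \<beta> w) = pos j w" using t by (auto simp: pos_shift_at dest: pos_fst)
      then show ?thesis using 3 assms by (simp add: PW_def)
    qed
  qed
  then show ?thesis by (simp add: PW_def)
qed

lemma hat_E: "0 < l \<Longrightarrow> hat (x @ (k + 1) # (l - 1) # y) =
    (hat (x @ k # l # y))(length x + 2 := hat (x @ k # l # y) (length x + 2) - 1, length x + 1 := hat (x @ k # l # y) (length x + 1) + 1)"
  by (auto simp: fun_eq_iff hat_cases)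

lemma hat_F: "0 < k \<Longrightarrow> hat (x @ (k - 1) # (l + 1) # y) =
    (hat (x @ k # l # y))(length x + 1 := hat (x @ k # l # y) (length x + 1) - 1, length x + 2 := hat (x @ k # l # y) (length x + 2) + 1)"
  by (auto simp: fun_eq_iff hat_cases)

lemma rung_E_typed:
  assumes "v \<in> spn (PW (x @ k # l # y))"
  shows "rung (length x + 2) (length x + 1) \<beta> v \<in> spn (PW (x @ (k + 1) # (l - 1) # y))"
proof (rule linear_op_spn[OF linear_rung _ assms])
  fix w assume w: "w \<in> PW (x @ k # l # y)"
  have "shift_at t (length x + 1) \<beta> w \<in> PW (x @ (k + 1) # (l - 1) # y)" if "t \<in> pos (length x + 2) w" for t
  proof -
    have "card (pos (length x + 2) w) = l" using w by (simp add: PW_def hat_cases)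
    then have "0 < l" using that by (metis card_gt_0_iff empty_iff finite_pos)
    then show ?thesis using hat_E by (intro shift_at_PW[OF w that]) auto
  qed
  then show "rung (length x + 2) (length x + 1) \<beta> (bas w) \<in> spn (PW (x @ (k + 1) # (l - 1) # y))"
    by (auto simp: rung_def)
qed

lemma rung_F_typed:
  assumes "v \<in> spn (PW (x @ k # l # y))"
  shows "rung (length x + 1) (length x + 2) \<beta> v \<in> spn (PW (x @ (k - 1) # (l + 1) # y))"
proof (rule linear_op_spn[OF linear_rung _ assms])
  fix w assume w: "w \<in> PW (x @ k # l # y)"
  have "shift_at t (length x + 2) \<beta> w \<in> PW (x @ (k - 1) # (l + 1) # y)" if "t \<in> pos (length x + 1) w" for t
  proof -
    have "card (pos (length x + 1) w) = k" using w by (simp add: PW_def hat_cases)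
    then have "0 < k" using that by (metis card_gt_0_iff empty_iff finite_pos)
    then show ?thesis using hat_F by (intro shift_at_PW[OF w that]) auto
  qed
  then show "rung (length x + 1) (length x + 2) \<beta> (bas w) \<in> spn (PW (x @ (k - 1) # (l + 1) # y))"
    by (auto simp: rung_def)
qed

text \<open>In an \<open>E\<close> ladder all letters of the second strand but one go to the right
  part of the split. So the choice is that of the single letter that moves.\<close>

lemma subsets_card_pred:
  assumes "finite A" "0 < card A"
  shows "{T. T \<subseteq> A \<and> card T = card A - 1} = (\<lambda>t. A - {t}) ` A" "inj_on (\<lambda>t. A - {t}) A"
proof -
  show "inj_on (\<lambda>t. A - {t}) A" by (auto intro!: inj_onI)
  have "T \<in> (\<lambda>t. A - {t}) ` A" if "T \<subseteq> A" "card T = card A - 1" for T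
  proof -
    have "card (A - T) = 1"
      using that assms by (simp add: card_Diff_subset finite_subset)
    then obtain t where "A - T = {t}" by (meson card_1_singletonE)
    then have "t \<in> A" "T = A - {t}" using that by auto
    then show ?thesis by blast
  qed
  then show "{T. T \<subseteq> A \<and> card T = card A - 1} = (\<lambda>t. A - {t}) ` A"
    using assms by auto
qed

text \<open>The moving letter keeps the label \<open>p + k\<close> until the merge sends it to
  \<open>p\<close>. The others of its strand go to \<open>p + k + 1\<close>, which is the offset of
  the second strand in the new composition.\<close>

lemma ladder_E_word:
  assumes w: "w \<in> PW (x @ k # l # y)" and l: "0 < l" and t: "t \<in> pos (length x + 2) w"
  defines "p \<equiv> sum_list x" and "u \<equiv> relabel (offset (x @ k # l # y)) w"
  shows "relabel (collapse p (k + 1)) (shift_at t (p + k) \<beta> (set_at (pos (length x + 2) w - {t}) (p + k + 1) u)) =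
     relabel (offset (x @ (k + 1) # (l - 1) # y)) (shift_at t (length x + 1) \<beta> w)"
proof (rule nth_equalityI, goal_cases)
  case (2 s)
  then have s: "s < length w" by (simp add: u_def)
  have tl: "t < length w" "fst (w ! t) = length x + 2" using t by (auto simp: pos_def)
  let ?j = "fst (w ! s)"
  have j: "1 \<le> ?j" "0 < hat (x @ k # l # y) ?j" using PW_letter[OF w s] by auto
  have le: "sum_list (take n x) \<le> p" for n by (simp add: p_def sum_list_take_le)
  show ?case
  proof (cases "s = t")
    case True
    then show ?thesis using s tl
      by (simp add: nth_shift_at u_def) (simp add: collapse_def offset_cases p_def)
  next
    case False
    then have pos: "s \<in> pos (length x + 2) w \<longleftrightarrow> ?j = length x + 2" using s by (simp add: pos_def)
    consider "?j = length x + 2" | "?j \<le> length x + 1" | "?j > length x + 2" by linarith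
    then show ?thesis
    proof cases
      case 1
      with False s tl pos show ?thesis
        by (simp add: nth_shift_at u_def) (simp add: collapse_def offset_cases p_def)
    next
      case 2
      with False s tl pos j le[of "?j - 1"] show ?thesis
        by (simp add: nth_shift_at u_def) (simp add: collapse_def offset_cases p_def)
    next
      case 3
      with False s tl pos j l show ?thesis
        by (simp add: nth_shift_at u_def) (simp add: collapse_def offset_cases p_def)
    qed
  qed
qed (simp add: u_def)

text \<open>The moving letter goes to \<open>p + (k - 1)\<close>, the offset of the second strand
  afterwards, and the merge takes the letters at the old offset \<open>p + k\<close> there too. For
  \<open>k = 1\<close> this is the old label \<open>p\<close> of the moving letter.\<close>

lemma ladder_F_word:
  assumes w: "w \<in> PW (x @ k # l # y)" and k: "0 < k" and t: "t \<in> pos (length x + 1) w"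
  defines "p \<equiv> sum_list x" and "u \<equiv> relabel (offset (x @ k # l # y)) w"
  shows "relabel (collapse (p + (k - 1)) (1 + l)) (shift_at t (p + (k - 1)) \<beta> (set_at {t} (p + (k - 1)) u)) =
     relabel (offset (x @ (k - 1) # (l + 1) # y)) (shift_at t (length x + 2) \<beta> w)"
proof (rule nth_equalityI, goal_cases)
  case (2 s)
  then have s: "s < length w" by (simp add: u_def)
  have tl: "t < length w" "fst (w ! t) = length x + 1" using t by (auto simp: pos_def)
  let ?j = "fst (w ! s)"
  have j: "1 \<le> ?j" "0 < hat (x @ k # l # y) ?j" using PW_letter[OF w s] by auto
  have le: "sum_list (take n x) \<le> p" for n by (simp add: p_def sum_list_take_le)
  show ?case
  proof (cases "s = t")
    case True
    then show ?thesis using s tl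
      by (simp add: nth_shift_at u_def) (simp add: collapse_def offset_cases p_def)
  next
    case False
    consider "?j = length x + 2" | "?j \<le> length x + 1" | "?j > length x + 2" by linarith
    then show ?thesis
    proof cases
      case 1
      then have "0 < l" using j by (simp add: hat_cases)
      with 1 False s tl k show ?thesis
        by (simp add: nth_shift_at u_def) (simp add: collapse_def offset_cases p_def)
    next
      case 2
      have "collapse (p + (k - 1)) (1 + l) (sum_list (take (?j - 1) x)) = sum_list (take (?j - 1) x)"
        using le[of "?j - 1"] k by (auto simp: collapse_def)
      with 2 False s tl j show ?thesis
        by (simp add: nth_shift_at u_def) (simp add: offset_cases p_def)
    next
      case 3
      with False s tl j k show ?thesis
        by (simp add: nth_shift_at u_def) (simp add: collapse_def offset_cases p_def)
    qed
  qed
qed (simp add: u_def)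

lemma PW_card_pos: "w \<in> PW a \<Longrightarrow> card (pos j w) = hat a j"
  by (simp add: PW_def)

text \<open>Between split and merge the moving letter is alone on its strand. An odd rung there is
  the dot on the ladder; an even one counts letters and so is the identity, which is the second
  part. Hence the first part covers both kinds of ladder.\<close>

lemma ladder_E_op:
  assumes v: "v \<in> spn (PW (x @ k # l # y))" and l: "0 < l"
  defines "q \<equiv> sum_list x + k"
  shows "relabel_op (collapse (sum_list x) (k + 1)) (rung q q \<beta> (split_op q (q + 1) (l - 1) (CC_op v))) =
      CC_op (rung (length x + 2) (length x + 1) \<beta> v)" (is "?f v = ?g v")
    and "rung q q 0 (split_op q (q + 1) (l - 1) (CC_op v)) = split_op q (q + 1) (l - 1) (CC_op v)" (is "?f' v = ?g' v")
proof -
  let ?a = "x @ k # l # y"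
  let ?b = "x @ (k + 1) # (l - 1) # y"
  have *: "?f (bas w) = ?g (bas w) \<and> ?f' (bas w) = ?g' (bas w)" if w: "w \<in> PW ?a" for w
  proof -
    define u where "u = relabel (offset ?a) w"
    define A where "A = pos (length x + 2) w"
    have off: "offset ?a (length x + 2) = q" by (simp add: offset_cases q_def)
    have Al: "card A = l" using PW_card_pos[OF w] by (simp add: A_def hat_cases)
    have posA: "pos q u = A"
      using pos_relabel_offset[OF w, of "length x + 2"] l off by (simp add: hat_cases A_def u_def)
    have fin: "finite A" by (simp add: A_def)
    have sub: "{T. T \<subseteq> A \<and> card T = l - 1} = (\<lambda>t. A - {t}) ` A" "inj_on (\<lambda>t. A - {t}) A"
      using subsets_card_pred[OF fin] Al l by auto
    have lin: "CC_op (bas w) = bas u" using CC_bas[OF w] by (simp add: u_def)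
    have split: "split_op q (q + 1) (l - 1) (bas u) = (\<Sum>t\<in>A. bas (set_at (A - {t}) (q + 1) u))"
      unfolding split_op_def lin_ext_mon posA sub(1) by (subst sum.reindex[OF sub(2)]) simp
    have pos: "pos q (set_at (A - {t}) (q + 1) u) = {t}" if "t \<in> A" for t
    proof -
      have "A - {t} \<subseteq> {..<length u}" using pos_subset[of q u] posA by auto
      then have "pos q (set_at (A - {t}) (q + 1) u) = pos q u - (A - {t})" by (simp add: pos_set_at)
      then show ?thesis using that posA by auto
    qed
    have parity: "idx_parity (take t u) = idx_parity (take t w)" for t by (simp add: u_def)
    have r: "rung q q \<beta>' (split_op q (q + 1) (l - 1) (bas u)) = (\<Sum>t\<in>A. scl (ksgn \<beta>' (idx_parity (take t w)))
        (bas (shift_at t q \<beta>' (set_at (A - {t}) (q + 1) u))))" for \<beta>'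
      unfolding split linear_opD[OF linear_rung] unfolding rung_def lin_ext_mon
      by (intro sum.cong refl) (simp only: pos, simp add: parity)
    have word: "relabel (collapse (sum_list x) (k + 1)) (shift_at t q \<beta> (set_at (A - {t}) (q + 1) u)) =
        relabel (offset ?b) (shift_at t (length x + 1) \<beta> w)" if "t \<in> A" for t
      using ladder_E_word[OF w l, of t \<beta>] that by (simp add: A_def u_def q_def)
    have "shift_at t (length x + 1) \<beta> w \<in> PW ?b" if "t \<in> A" for t
      using hat_E[OF l] that unfolding A_def by (intro shift_at_PW[OF w]) auto
    then have CC: "CC_op (bas (shift_at t (length x + 1) \<beta> w)) = bas (relabel (offset ?b) (shift_at t (length x + 1) \<beta> w))"
      if "t \<in> A" for t using that by (intro CC_bas) simp
    have "?f (bas w) = (\<Sum>t\<in>A. scl (ksgn \<beta> (idx_parity (take t w))) (bas (relabel (offset ?b) (shift_at t (length x + 1) \<beta> w))))"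
      unfolding lin r linear_opD[OF linear_relabel_op]
      by (intro sum.cong refl) (simp only: relabel_op_def lin_ext_mon word)
    also have "\<dots> = ?g (bas w)"
      unfolding rung_def lin_ext_mon A_def[symmetric] linear_opD[OF linear_CC]
      by (intro sum.cong refl) (simp only: CC)
    finally have "?f (bas w) = ?g (bas w)" .
    moreover have "?f' (bas w) = ?g' (bas w)"
    proof -
      have "split_op q (q + 1) (l - 1) (bas u) \<in> spn {w. card (pos q w) = 1}"
        unfolding split by (intro spn_sum) (simp only: bas_spn mem_Collect_eq pos, simp)
      then have "rung q q 0 (split_op q (q + 1) (l - 1) (bas u)) = scl (of_nat 1) (split_op q (q + 1) (l - 1) (bas u))"
        by (rule rung_diagonal)
      then show ?thesis by (simp add: lin)
    qed
    ultimately show ?thesis by simp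
  qed
  show "?f v = ?g v"
    by (rule linear_op_spn_eqI[OF v, of ?f ?g])
      (use * in \<open>auto intro!: linear_op_comp[OF linear_relabel_op] linear_op_comp[OF linear_rung]
        linear_op_comp[OF linear_split_op] linear_op_comp[OF linear_CC]\<close>)
  show "?f' v = ?g' v"
    by (rule linear_op_spn_eqI[OF v, of ?f' ?g'])
      (use * in \<open>auto intro!: linear_op_comp[OF linear_rung] linear_op_comp[OF linear_split_op]\<close>)
qed

lemma ladder_F_op:
  assumes v: "v \<in> spn (PW (x @ k # l # y))" and k: "0 < k"
  defines "q \<equiv> sum_list x + (k - 1)"
  shows "relabel_op (collapse q (1 + l)) (rung q q \<beta> (split_op (sum_list x) q 1 (CC_op v))) =
      CC_op (rung (length x + 1) (length x + 2) \<beta> v)" (is "?f v = ?g v")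
    and "rung q q 0 (split_op (sum_list x) q 1 (CC_op v)) = split_op (sum_list x) q 1 (CC_op v)" (is "?f' v = ?g' v")
proof -
  let ?a = "x @ k # l # y"
  let ?b = "x @ (k - 1) # (l + 1) # y"
  have *: "?f (bas w) = ?g (bas w) \<and> ?f' (bas w) = ?g' (bas w)" if w: "w \<in> PW ?a" for w
  proof -
    define u where "u = relabel (offset ?a) w"
    define A where "A = pos (length x + 1) w"
    have off: "offset ?a (length x + 1) = sum_list x" by (simp add: offset_cases)
    have Al: "card A = k" using PW_card_pos[OF w] by (simp add: A_def hat_cases)
    have posA: "pos (sum_list x) u = A"
      using pos_relabel_offset[OF w, of "length x + 1"] k off by (simp add: hat_cases A_def u_def)
    have u: "u \<in> NW ?a" using relabel_PW[OF w] by (simp add: u_def)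
    have sub: "{T. T \<subseteq> A \<and> card T = 1} = (\<lambda>t. {t}) ` A" by (auto simp: card_1_singleton_iff)
    have lin: "CC_op (bas w) = bas u" using CC_bas[OF w] by (simp add: u_def)
    have split: "split_op (sum_list x) q 1 (bas u) = (\<Sum>t\<in>A. bas (set_at {t} q u))"
      unfolding split_op_def lin_ext_mon posA sub by (subst sum.reindex) auto
    have pos: "pos q (set_at {t} q u) = {t}" if "t \<in> A" for t
    proof -
      have "{t} \<subseteq> {..<length u}" using pos_subset[of "sum_list x" u] posA that by auto
      then have eq: "pos q (set_at {t} q u) = (pos q u - {t}) \<union> {t}" by (simp add: pos_set_at)
      show ?thesis
      \<comment> \<open>For \<open>k = 1\<close> the label \<open>q\<close> is the old label, which
        the single letter carries already; otherwise \<open>q\<close> is a label not yet in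
        use.\<close>
      proof (cases "k = 1")
        case True
        then obtain t' where "A = {t'}" using Al by (auto simp: card_1_singleton_iff)
        with that have "pos q u = {t}" using True posA by (simp add: q_def)
        with eq show ?thesis by simp
      next
        case False
        then have "pos q u = {}" unfolding q_def using k by (intro NW_pos_empty[OF u]) auto
        with eq show ?thesis by simp
      qed
    qed
    have parity: "idx_parity (take t u) = idx_parity (take t w)" for t by (simp add: u_def)
    have r: "rung q q \<beta>' (split_op (sum_list x) q 1 (bas u)) = (\<Sum>t\<in>A. scl (ksgn \<beta>' (idx_parity (take t w)))
        (bas (shift_at t q \<beta>' (set_at {t} q u))))" for \<beta>'
      unfolding split linear_opD[OF linear_rung] unfolding rung_def lin_ext_mon
      by (intro sum.cong refl) (simp only: pos, simp add: parity)
    have word: "relabel (collapse q (1 + l)) (shift_at t q \<beta> (set_at {t} q u)) =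
        relabel (offset ?b) (shift_at t (length x + 2) \<beta> w)" if "t \<in> A" for t
      using ladder_F_word[OF w k, of t \<beta>] that by (simp add: A_def u_def q_def)
    have "shift_at t (length x + 2) \<beta> w \<in> PW ?b" if "t \<in> A" for t
      using hat_F[OF k] that unfolding A_def by (intro shift_at_PW[OF w]) auto
    then have CC: "CC_op (bas (shift_at t (length x + 2) \<beta> w)) = bas (relabel (offset ?b) (shift_at t (length x + 2) \<beta> w))"
      if "t \<in> A" for t using that by (intro CC_bas) simp
    have "?f (bas w) = (\<Sum>t\<in>A. scl (ksgn \<beta> (idx_parity (take t w))) (bas (relabel (offset ?b) (shift_at t (length x + 2) \<beta> w))))"
      unfolding lin r linear_opD[OF linear_relabel_op]
      by (intro sum.cong refl) (simp only: relabel_op_def lin_ext_mon word)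
    also have "\<dots> = ?g (bas w)"
      unfolding rung_def lin_ext_mon A_def[symmetric] linear_opD[OF linear_CC]
      by (intro sum.cong refl) (simp only: CC)
    finally have "?f (bas w) = ?g (bas w)" .
    moreover have "?f' (bas w) = ?g' (bas w)"
    proof -
      have "split_op (sum_list x) q 1 (bas u) \<in> spn {w. card (pos q w) = 1}"
        unfolding split by (intro spn_sum) (simp only: bas_spn mem_Collect_eq pos, simp)
      then have "rung q q 0 (split_op (sum_list x) q 1 (bas u)) = scl (of_nat 1) (split_op (sum_list x) q 1 (bas u))"
        by (rule rung_diagonal)
      then show ?thesis by (simp add: lin)
    qed
    ultimately show ?thesis by simp
  qed
  show "?f v = ?g v"
    by (rule linear_op_spn_eqI[OF v, of ?f ?g])
      (use * in \<open>auto intro!: linear_op_comp[OF linear_relabel_op] linear_op_comp[OF linear_rung]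
        linear_op_comp[OF linear_split_op] linear_op_comp[OF linear_CC]\<close>)
  show "?f' v = ?g' v"
    by (rule linear_op_spn_eqI[OF v, of ?f' ?g'])
      (use * in \<open>auto intro!: linear_op_comp[OF linear_rung] linear_op_comp[OF linear_split_op]\<close>)
qed

lemma CC_dot:
  assumes v: "v \<in> spn (PW a)" and j: "1 \<le> j" "0 < hat a j"
  shows "rung (offset a j) (offset a j) 1 (CC_op v) = CC_op (rung j j 1 v)" (is "?f v = ?g v")
    and "rung j j 1 v \<in> spn (PW a)"
proof -
  have typed: "shift_at t j 1 w \<in> PW a" if "w \<in> PW a" "t \<in> pos j w" for w t
  proof -
    have "pos i (shift_at t j 1 w) = pos i w" for i
      using that(2) by (auto simp: pos_def nth_shift_at)
    with that(1) show ?thesis by (simp add: PW_def)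
  qed
  show "?f v = ?g v"
  proof (rule linear_op_spn_eqI[OF v, of ?f ?g])
    show "linear_op ?f" "linear_op ?g"
      by (intro linear_op_comp[OF linear_CC] linear_op_comp[OF linear_rung] linear_rung linear_CC)+
    fix w assume w: "w \<in> PW a"
    show "?f (bas w) = ?g (bas w)"
      unfolding CC_bas[OF w] rung_def lin_ext_mon pos_relabel_offset[OF w j] linear_opD[OF linear_CC]
      by (intro sum.cong refl) (simp only: CC_bas[OF typed[OF w]] relabel_shift_at pos_less parity_take_relabel)
  qed
  show "rung j j 1 v \<in> spn (PW a)"
    by (rule linear_op_spn[OF linear_rung _ v]) (auto simp: rung_def typed)
qed

section \<open>Soundness of the web relations\<close>

text \<open>Correspondence between a web in offset labels and an operator in strand numbers. The
  compositions may have empty strands, as they do in the middle of a product of ladders.\<close>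

definition acts :: "web \<Rightarrow> nat list \<Rightarrow> nat list \<Rightarrow> (tens \<Rightarrow> tens) \<Rightarrow> bool" where
  "acts f a b R \<longleftrightarrow> (\<forall>v\<in>spn (PW a). theta f (CC_op v) = CC_op (R v) \<and> R v \<in> spn (PW b))"

lemma acts_mult: "acts f a b R \<Longrightarrow> acts g b c S \<Longrightarrow> acts (g * f) a c (\<lambda>v. S (R v))"
  by (auto simp: acts_def theta_mult)

lemma acts_EE:
  assumes "a = x @ k # l # y" "b = x @ (k + 1) # (l - 1) # y" "i = length x"
  shows "acts (pad x y (EE k l)) a b (rung (i + 2) (i + 1) 0)"
    and "acts (pad x y (EE_bar k l)) a b (rung (i + 2) (i + 1) 1)"
proof -
  have "theta (pad x y (EE k l)) (CC_op v) = CC_op (rung (i + 2) (i + 1) 0 v) \<and>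
        theta (pad x y (EE_bar k l)) (CC_op v) = CC_op (rung (i + 2) (i + 1) 1 v)" if v: "v \<in> spn (PW a)" for v
  proof (cases "l = 0")
    case True
    \<comment> \<open>A ladder with a negative label is \<open>0\<close> by convention; the rung
      agrees with this because it finds no letter to move.\<close>
    have "rung (i + 2) (i + 1) \<beta> v = 0" for \<beta>
    proof (rule linear_op_spn_eqI[OF v linear_rung linear_op_zero])
      fix w assume "w \<in> PW a"
      then have "card (pos (i + 2) w) = 0" using True by (simp add: PW_card_pos assms hat_cases)
      then show "rung (i + 2) (i + 1) \<beta> (bas w) = 0" by (simp add: rung_def)
    qed
    then show ?thesis using True by (simp add: ladder_E_def EE_bar_def pad_linear theta_simps linear_opD[OF linear_CC])
  next
    case False
    then have l: "0 < l" by simp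
    let ?q = "sum_list x + k"
    have N: "CC_op v \<in> spn (NW ((x @ [k]) @ (1 + (l - 1)) # y))"
      using CC_typed[OF v] l by (simp add: assms)
    have 1: "theta (pad (x @ [k]) y (split 1 (l - 1))) (CC_op v) = split_op ?q (?q + 1) (l - 1) (CC_op v)"
      using theta_pad_split[OF N] by simp
    have T1: "split_op ?q (?q + 1) (l - 1) (CC_op v) \<in> spn (NW ((x @ [k]) @ 1 # (l - 1) # y))"
      using split_typed[OF N] by simp
    have 2: "theta (pad (x @ [k]) ((l - 1) # y) (dot 1)) (split_op ?q (?q + 1) (l - 1) (CC_op v)) =
      rung ?q ?q 1 (split_op ?q (?q + 1) (l - 1) (CC_op v))"
      using theta_pad_dot[OF T1] by simp
    have T2: "rung ?q ?q 1 (split_op ?q (?q + 1) (l - 1) (CC_op v)) \<in> spn (NW (x @ k # 1 # (l - 1) # y))"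
      using dot_typed[OF T1] by simp
    have 3: "theta (pad x ((l - 1) # y) (merge k 1)) u = relabel_op (collapse (sum_list x) (k + 1)) u"
      if "u \<in> spn (NW (x @ k # 1 # (l - 1) # y))" for u
      using theta_pad_merge[OF that] .
    have T1': "split_op ?q (?q + 1) (l - 1) (CC_op v) \<in> spn (NW (x @ k # 1 # (l - 1) # y))"
      using T1 by simp
    have v': "v \<in> spn (PW (x @ k # l # y))" using v by (simp add: assms)
    have "theta (pad x y (EE k l)) (CC_op v) = CC_op (rung (i + 2) (i + 1) 0 v)"
      using l 1 3[OF T1'] ladder_E_op(1)[OF v' l, of 0] ladder_E_op(2)[OF v' l] by (simp add: ladder_E_def pad_simps theta_mult assms)
    moreover have "theta (pad x y (EE_bar k l)) (CC_op v) = CC_op (rung (i + 2) (i + 1) 1 v)"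
      using l 1 2 3[OF T2] ladder_E_op(1)[OF v' l, of 1] by (simp add: EE_bar_def pad_simps theta_mult assms)
    ultimately show ?thesis by simp
  qed
  then show "acts (pad x y (EE k l)) a b (rung (i + 2) (i + 1) 0)"
    "acts (pad x y (EE_bar k l)) a b (rung (i + 2) (i + 1) 1)"
    using rung_E_typed assms by (auto simp: acts_def)
qed

lemma acts_FF:
  assumes "a = x @ k # l # y" "b = x @ (k - 1) # (l + 1) # y" "i = length x"
  shows "acts (pad x y (FF k l)) a b (rung (i + 1) (i + 2) 0)"
    and "acts (pad x y (FF_bar k l)) a b (rung (i + 1) (i + 2) 1)"
proof -
  have "theta (pad x y (FF k l)) (CC_op v) = CC_op (rung (i + 1) (i + 2) 0 v) \<and>
        theta (pad x y (FF_bar k l)) (CC_op v) = CC_op (rung (i + 1) (i + 2) 1 v)" if v: "v \<in> spn (PW a)" for v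
  proof (cases "k = 0")
    case True
    have "rung (i + 1) (i + 2) \<beta> v = 0" for \<beta>
    proof (rule linear_op_spn_eqI[OF v linear_rung linear_op_zero])
      fix w assume "w \<in> PW a"
      then have "card (pos (i + 1) w) = 0" using True by (simp add: PW_card_pos assms hat_cases)
      then show "rung (i + 1) (i + 2) \<beta> (bas w) = 0" by (simp add: rung_def)
    qed
    then show ?thesis using True by (simp add: ladder_F_def FF_bar_def pad_linear theta_simps linear_opD[OF linear_CC])
  next
    case False
    then have k: "0 < k" by simp
    let ?p = "sum_list x" and ?q = "sum_list x + (k - 1)"
    have N: "CC_op v \<in> spn (NW (x @ ((k - 1) + 1) # l # y))"
      using CC_typed[OF v] k by (simp add: assms)
    have 1: "theta (pad x (l # y) (split (k - 1) 1)) (CC_op v) = split_op ?p ?q 1 (CC_op v)"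
      using theta_pad_split[OF N] by simp
    have T1: "split_op ?p ?q 1 (CC_op v) \<in> spn (NW (x @ (k - 1) # 1 # l # y))"
      using split_typed[OF N] by simp
    then have T1': "split_op ?p ?q 1 (CC_op v) \<in> spn (NW ((x @ [k - 1]) @ 1 # l # y))" by simp
    have 2: "theta (pad (x @ [k - 1]) (l # y) (dot 1)) (split_op ?p ?q 1 (CC_op v)) =
      rung ?q ?q 1 (split_op ?p ?q 1 (CC_op v))"
      using theta_pad_dot[OF T1'] by simp
    have T2: "rung ?q ?q 1 (split_op ?p ?q 1 (CC_op v)) \<in> spn (NW ((x @ [k - 1]) @ 1 # l # y))"
      using dot_typed[OF T1'] by simp
    have 3: "theta (pad (x @ [k - 1]) y (merge 1 l)) u = relabel_op (collapse ?q (1 + l)) u"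
      if "u \<in> spn (NW ((x @ [k - 1]) @ 1 # l # y))" for u
      using theta_pad_merge[OF that] by simp
    have v': "v \<in> spn (PW (x @ k # l # y))" using v by (simp add: assms)
    have "theta (pad x y (FF k l)) (CC_op v) = CC_op (rung (i + 1) (i + 2) 0 v)"
      using k 1 3[OF T1'] ladder_F_op(1)[OF v' k, of 0] ladder_F_op(2)[OF v' k] by (simp add: ladder_F_def pad_simps theta_mult assms)
    moreover have "theta (pad x y (FF_bar k l)) (CC_op v) = CC_op (rung (i + 1) (i + 2) 1 v)"
      using k 1 2 3[OF T2] ladder_F_op(1)[OF v' k, of 1] by (simp add: FF_bar_def pad_simps theta_mult assms)
    ultimately show ?thesis by simp
  qed
  then show "acts (pad x y (FF k l)) a b (rung (i + 1) (i + 2) 0)"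
    "acts (pad x y (FF_bar k l)) a b (rung (i + 1) (i + 2) 1)"
    using rung_F_typed assms by (auto simp: acts_def)
qed

lemma acts_dot:
  assumes "a = x @ k # y" "0 < k" "i = length x"
  shows "acts (pad x y (dot k)) a a (rung (i + 1) (i + 1) 1)"
proof -
  have h: "0 < hat a (i + 1)" "1 \<le> i + 1" using assms by (simp_all add: hat_def)
  have off: "offset a (i + 1) = sum_list x" using assms by (simp add: offset_def)
  have "theta (pad x y (dot k)) (CC_op v) = CC_op (rung (i + 1) (i + 1) 1 v)" if "v \<in> spn (PW a)" for v
    using theta_pad_dot[of "CC_op v" x k y] CC_typed[OF that] CC_dot(1)[OF that h(2,1)] assms off by simp
  then show ?thesis using CC_dot(2)[OF _ h(2,1)] by (auto simp: acts_def)
qed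

lemma acts_diff: "acts f a b R \<Longrightarrow> acts g a b S \<Longrightarrow> acts (f - g) a b (\<lambda>v. R v - S v)"
  and acts_add: "acts f a b R \<Longrightarrow> acts g a b S \<Longrightarrow> acts (f + g) a b (\<lambda>v. R v + S v)"
  by (auto simp: acts_def theta_simps linear_opD[OF linear_CC])

text \<open>Every vector in offset labels comes from one in strand numbers, so an identity between
  rungs carries over to the webs.\<close>

lemma acts_eqI:
  assumes "acts f a b R" "acts g a c S" "\<And>v. v \<in> spn (PW a) \<Longrightarrow> R v = S v"
    and "\<forall>k\<in>set a. 0 < k" "v \<in> spn (NW a)"
  shows "theta f v = theta g v"
proof -
  obtain v' where "v' \<in> spn (PW a)" "CC_op v' = v" using CC_surj[OF assms(5,4)] by blast
  with assms show ?thesis by (auto simp: acts_def)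
qed

lemma rung_commutator_even:
  "rung c d \<gamma> (rung a b \<beta> v) - rung a b \<beta> (rung c d \<gamma> v) =
     (if b = c then rung a d (\<beta> + \<gamma>) v else 0) - (if d = a then rung c b (\<beta> + \<gamma>) v else 0)"
  if "\<beta> = 0 \<or> \<gamma> = 0"
  using rung_commutator[of c d \<gamma> a b \<beta> v] that by auto

lemma rung_commutator_odd:
  "rung c d 1 (rung a b 1 v) + rung a b 1 (rung c d 1 v) =
     (if b = c then rung a d 0 v else 0) + (if d = a then rung c b 0 v else 0)"
  using rung_commutator[of c d 1 a b 1 v] by (simp add: ksgn_one)

lemma PW_rung_diagonal: "v \<in> spn (PW a) \<Longrightarrow> rung j j 0 v = scl (of_nat (hat a j)) v"
  by (rule rung_diagonal, erule spn_mono[rotated]) (auto simp: PW_card_pos)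

text \<open>After translation every relation is a case of the supercommutator formula. On two
  strands, \<open>E\<close> and \<open>F\<close> are rungs in opposite directions and the commutator
  is diagonal. On three strands, both sides equal one and the same rung between the outer
  strands.\<close>

lemma local_sound_ladders:
  assumes "0 < h" "0 < k" "0 < l" "\<forall>k\<in>set (x @ y). 0 < k"
  shows "v \<in> spn (NW (x @ k # l # y)) \<Longrightarrow>
      theta (pad x y (EE (k - 1) (l + 1) * FF k l - FF (k + 1) (l - 1) * EE k l)) v =
      theta (pad x y (scl (of_nat k - of_nat l) (ident [k, l]))) v"
    and "v \<in> spn (NW (x @ k # l # y)) \<Longrightarrow>
      theta (pad x y (EE_bar (k - 1) (l + 1) * FF k l - FF (k + 1) (l - 1) * EE_bar k l)) v =
      theta (pad x y (pad [] [l] (dot k) - pad [k] [] (dot l))) v"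
    and "v \<in> spn (NW (x @ k # l # y)) \<Longrightarrow>
      theta (pad x y (EE (k - 1) (l + 1) * FF_bar k l - FF_bar (k + 1) (l - 1) * EE k l)) v =
      theta (pad x y (pad [] [l] (dot k) - pad [k] [] (dot l))) v"
    and "v \<in> spn (NW (x @ h # k # l # y)) \<Longrightarrow>
      theta (pad x y (on12 EE h (k + 1) (l - 1) * on23 EE h k l - on23 EE (h + 1) (k - 1) l * on12 EE h k l)) v =
      theta (pad x y (on12 EE_bar h (k + 1) (l - 1) * on23 EE_bar h k l
        + on23 EE_bar (h + 1) (k - 1) l * on12 EE_bar h k l)) v"
    and "v \<in> spn (NW (x @ h # k # l # y)) \<Longrightarrow>
      theta (pad x y (on23 FF (h - 1) (k + 1) l * on12 FF h k l - on12 FF h (k - 1) (l + 1) * on23 FF h k l)) v =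
      theta (pad x y (on23 FF_bar (h - 1) (k + 1) l * on12 FF_bar h k l
        + on12 FF_bar h (k - 1) (l + 1) * on23 FF_bar h k l)) v"
    and "v \<in> spn (NW (x @ h # k # l # y)) \<Longrightarrow>
      theta (pad x y (on12 EE h (k + 1) (l - 1) * on23 EE_bar h k l
        - on23 EE_bar (h + 1) (k - 1) l * on12 EE h k l)) v =
      theta (pad x y (on12 EE_bar h (k + 1) (l - 1) * on23 EE h k l
        - on23 EE (h + 1) (k - 1) l * on12 EE_bar h k l)) v"
    and "v \<in> spn (NW (x @ h # k # l # y)) \<Longrightarrow>
      theta (pad x y (on12 FF h (k - 1) (l + 1) * on23 FF_bar h k l
        - on23 FF_bar (h - 1) (k + 1) l * on12 FF h k l)) v =
      theta (pad x y (on12 FF_bar h (k - 1) (l + 1) * on23 FF h k l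
        - on23 FF (h - 1) (k + 1) l * on12 FF_bar h k l)) v"
proof -
  let ?a = "x @ k # l # y" and ?n = "length x"
  let ?E = "rung (?n + 2) (?n + 1)" and ?F = "rung (?n + 1) (?n + 2)"
  have pos2: "\<forall>k\<in>set ?a. 0 < k" using assms by auto
  have kl: "x @ (k - 1 + 1) # (l + 1 - 1) # y = ?a" "x @ (k + 1 - 1) # (l - 1 + 1) # y = ?a" using assms by simp_all
  note E0 = acts_EE(1)[where x = x and k = "k - 1" and l = "l + 1" and y = y, OF refl refl refl, unfolded kl]
    and E1 = acts_EE(2)[where x = x and k = "k - 1" and l = "l + 1" and y = y, OF refl refl refl, unfolded kl]
    and F0 = acts_FF(1)[where x = x and k = "k + 1" and l = "l - 1" and y = y, OF refl refl refl, unfolded kl]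
    and F1 = acts_FF(2)[where x = x and k = "k + 1" and l = "l - 1" and y = y, OF refl refl refl, unfolded kl]
  note e0 = acts_EE(1)[where x = x and k = k and l = l and y = y, OF refl refl refl] and e1 = acts_EE(2)[where x = x and k = k and l = l and y = y, OF refl refl refl]
    and f0 = acts_FF(1)[where x = x and k = k and l = l and y = y, OF refl refl refl] and f1 = acts_FF(2)[where x = x and k = k and l = l and y = y, OF refl refl refl]
  have d1: "acts (pad x y (pad [] [l] (dot k))) ?a ?a (rung (?n + 1) (?n + 1) 1)"
    using acts_dot[of ?a x k "l # y" ?n] assms by (simp add: pad_pad)
  have d2: "acts (pad x y (pad [k] [] (dot l))) ?a ?a (rung (?n + 2) (?n + 2) 1)"
    using acts_dot[of ?a "x @ [k]" l y "?n + 1"] assms by (simp add: pad_pad)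
  show "theta (pad x y (EE (k - 1) (l + 1) * FF k l - FF (k + 1) (l - 1) * EE k l)) v =
      theta (pad x y (scl (of_nat k - of_nat l) (ident [k, l]))) v" if v: "v \<in> spn (NW ?a)"
  proof -
    have id: "acts (pad x y (scl (of_nat k - of_nat l) (ident [k, l]))) ?a ?a (scl (of_nat k - of_nat l))"
      using CC_typed by (auto simp: acts_def pad_linear theta_simps theta_pad_ident linear_opD[OF linear_CC])
    have L: "acts (pad x y (EE (k - 1) (l + 1) * FF k l - FF (k + 1) (l - 1) * EE k l)) ?a ?a
      (\<lambda>v. ?E 0 (?F 0 v) - ?F 0 (?E 0 v))"
      unfolding pad_mult pad_linear by (intro acts_diff acts_mult[OF f0 E0] acts_mult[OF e0 F0])
    show ?thesis
    proof (rule acts_eqI[OF L id _ pos2 v])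
      fix v assume v: "v \<in> spn (PW ?a)"
      \<comment> \<open>Two diagonal even rungs remain, and they count the letters on the two
        strands.\<close>
      have "?E 0 (?F 0 v) - ?F 0 (?E 0 v) = scl (of_nat k) v - scl (of_nat l) v"
        by (subst rung_commutator_even) (simp_all add: PW_rung_diagonal[OF v] hat_cases)
      also have "\<dots> = scl (of_nat k - of_nat l) v"
        using scl_add_left[of "of_nat k" "- of_nat l" v] by simp
      finally show "?E 0 (?F 0 v) - ?F 0 (?E 0 v) = scl (of_nat k - of_nat l) v" .
    qed
  qed
  have D: "acts (pad x y (pad [] [l] (dot k) - pad [k] [] (dot l))) ?a ?a
      (\<lambda>v. rung (?n + 1) (?n + 1) 1 v - rung (?n + 2) (?n + 2) 1 v)"
    unfolding pad_linear by (rule acts_diff[OF d1 d2])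
  show "theta (pad x y (EE_bar (k - 1) (l + 1) * FF k l - FF (k + 1) (l - 1) * EE_bar k l)) v =
      theta (pad x y (pad [] [l] (dot k) - pad [k] [] (dot l))) v" if v: "v \<in> spn (NW ?a)"
  proof -
    have L: "acts (pad x y (EE_bar (k - 1) (l + 1) * FF k l - FF (k + 1) (l - 1) * EE_bar k l)) ?a ?a
      (\<lambda>v. ?E 1 (?F 0 v) - ?F 0 (?E 1 v))"
      unfolding pad_mult pad_linear by (intro acts_diff acts_mult[OF f0 E1] acts_mult[OF e1 F0])
    show ?thesis
      by (rule acts_eqI[OF L D _ pos2 v]) (subst rung_commutator_even, simp_all)
  qed
  show "theta (pad x y (EE (k - 1) (l + 1) * FF_bar k l - FF_bar (k + 1) (l - 1) * EE k l)) v =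
      theta (pad x y (pad [] [l] (dot k) - pad [k] [] (dot l))) v" if v: "v \<in> spn (NW ?a)"
  proof -
    have L: "acts (pad x y (EE (k - 1) (l + 1) * FF_bar k l - FF_bar (k + 1) (l - 1) * EE k l)) ?a ?a
      (\<lambda>v. ?E 0 (?F 1 v) - ?F 1 (?E 0 v))"
      unfolding pad_mult pad_linear by (intro acts_diff acts_mult[OF f1 E0] acts_mult[OF e0 F1])
    show ?thesis
      by (rule acts_eqI[OF L D _ pos2 v]) (subst rung_commutator_even, simp_all)
  qed

  let ?a = "x @ h # k # l # y"
  have pos3: "\<forall>k\<in>set ?a. 0 < k" using assms by auto
  have on12: "pad x y (pad [] [l] f) = pad x (l # y) f" for l f by (simp add: pad_pad)
  have on23: "pad x y (pad [h] [] f) = pad (x @ [h]) y f" for h f by (simp add: pad_pad)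
  let ?b = "x @ (h + 1) # k # (l - 1) # y" and ?c = "x @ (h - 1) # k # (l + 1) # y"
  have kk: "k + 1 - 1 = k" "k - 1 + 1 = k" using assms by simp_all
  have e1: "acts (pad (x @ [h]) y (EE k l)) ?a (x @ h # (k + 1) # (l - 1) # y) (rung (?n + 3) (?n + 2) 0)"
    "acts (pad (x @ [h]) y (EE_bar k l)) ?a (x @ h # (k + 1) # (l - 1) # y) (rung (?n + 3) (?n + 2) 1)"
    using acts_EE[of ?a "x @ [h]" k l y "x @ h # (k + 1) # (l - 1) # y" "?n + 1"] by (simp_all add: numeral_3_eq_3)
  have e2: "acts (pad x ((l - 1) # y) (EE h (k + 1))) (x @ h # (k + 1) # (l - 1) # y) ?b (rung (?n + 2) (?n + 1) 0)"
    "acts (pad x ((l - 1) # y) (EE_bar h (k + 1))) (x @ h # (k + 1) # (l - 1) # y) ?b (rung (?n + 2) (?n + 1) 1)"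
    by (rule acts_EE; simp only: kk)+
  have e3: "acts (pad x (l # y) (EE h k)) ?a (x @ (h + 1) # (k - 1) # l # y) (rung (?n + 2) (?n + 1) 0)"
    "acts (pad x (l # y) (EE_bar h k)) ?a (x @ (h + 1) # (k - 1) # l # y) (rung (?n + 2) (?n + 1) 1)"
    by (rule acts_EE; simp only: kk)+
  have e4: "acts (pad (x @ [h + 1]) y (EE (k - 1) l)) (x @ (h + 1) # (k - 1) # l # y) ?b (rung (?n + 3) (?n + 2) 0)"
    "acts (pad (x @ [h + 1]) y (EE_bar (k - 1) l)) (x @ (h + 1) # (k - 1) # l # y) ?b (rung (?n + 3) (?n + 2) 1)"
    using acts_EE[of "x @ (h + 1) # (k - 1) # l # y" "x @ [h + 1]" "k - 1" l y ?b "?n + 1"] assms by (simp_all add: numeral_3_eq_3)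
  have f1: "acts (pad (x @ [h]) y (FF k l)) ?a (x @ h # (k - 1) # (l + 1) # y) (rung (?n + 2) (?n + 3) 0)"
    "acts (pad (x @ [h]) y (FF_bar k l)) ?a (x @ h # (k - 1) # (l + 1) # y) (rung (?n + 2) (?n + 3) 1)"
    using acts_FF[of ?a "x @ [h]" k l y "x @ h # (k - 1) # (l + 1) # y" "?n + 1"] by (simp_all add: numeral_3_eq_3)
  have f2: "acts (pad x ((l + 1) # y) (FF h (k - 1))) (x @ h # (k - 1) # (l + 1) # y) ?c (rung (?n + 1) (?n + 2) 0)"
    "acts (pad x ((l + 1) # y) (FF_bar h (k - 1))) (x @ h # (k - 1) # (l + 1) # y) ?c (rung (?n + 1) (?n + 2) 1)"
    by (rule acts_FF; simp only: kk)+
  have f3: "acts (pad x (l # y) (FF h k)) ?a (x @ (h - 1) # (k + 1) # l # y) (rung (?n + 1) (?n + 2) 0)"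
    "acts (pad x (l # y) (FF_bar h k)) ?a (x @ (h - 1) # (k + 1) # l # y) (rung (?n + 1) (?n + 2) 1)"
    by (rule acts_FF; simp only: kk)+
  have f4: "acts (pad (x @ [h - 1]) y (FF (k + 1) l)) (x @ (h - 1) # (k + 1) # l # y) ?c (rung (?n + 2) (?n + 3) 0)"
    "acts (pad (x @ [h - 1]) y (FF_bar (k + 1) l)) (x @ (h - 1) # (k + 1) # l # y) ?c (rung (?n + 2) (?n + 3) 1)"
    using acts_FF[of "x @ (h - 1) # (k + 1) # l # y" "x @ [h - 1]" "k + 1" l y ?c "?n + 1"] assms by (simp_all add: numeral_3_eq_3)
  note E = acts_mult[OF e1(1) e2(1)] acts_mult[OF e1(1) e2(2)] acts_mult[OF e1(2) e2(1)] acts_mult[OF e1(2) e2(2)]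
    acts_mult[OF e3(1) e4(1)] acts_mult[OF e3(1) e4(2)] acts_mult[OF e3(2) e4(1)] acts_mult[OF e3(2) e4(2)]
  note F = acts_mult[OF f1(1) f2(1)] acts_mult[OF f1(1) f2(2)] acts_mult[OF f1(2) f2(1)] acts_mult[OF f1(2) f2(2)]
    acts_mult[OF f3(1) f4(1)] acts_mult[OF f3(1) f4(2)] acts_mult[OF f3(2) f4(1)] acts_mult[OF f3(2) f4(2)]
  assume v: "v \<in> spn (NW ?a)"
  show "theta (pad x y (on12 EE h (k + 1) (l - 1) * on23 EE h k l - on23 EE (h + 1) (k - 1) l * on12 EE h k l)) v =
      theta (pad x y (on12 EE_bar h (k + 1) (l - 1) * on23 EE_bar h k l
        + on23 EE_bar (h + 1) (k - 1) l * on12 EE_bar h k l)) v"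
    unfolding pad_mult pad_linear on12 on23
    by (rule acts_eqI[OF acts_diff[OF E(1) E(5)] acts_add[OF E(4) E(8)] _ pos3 v])
      (simp add: rung_commutator_even rung_commutator_odd)
  show "theta (pad x y (on23 FF (h - 1) (k + 1) l * on12 FF h k l - on12 FF h (k - 1) (l + 1) * on23 FF h k l)) v =
      theta (pad x y (on23 FF_bar (h - 1) (k + 1) l * on12 FF_bar h k l
        + on12 FF_bar h (k - 1) (l + 1) * on23 FF_bar h k l)) v"
    unfolding pad_mult pad_linear on12 on23
    by (rule acts_eqI[OF acts_diff[OF F(5) F(1)] acts_add[OF F(8) F(4)] _ pos3 v])
      (simp add: rung_commutator_even rung_commutator_odd)
  show "theta (pad x y (on12 EE h (k + 1) (l - 1) * on23 EE_bar h k l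
        - on23 EE_bar (h + 1) (k - 1) l * on12 EE h k l)) v =
      theta (pad x y (on12 EE_bar h (k + 1) (l - 1) * on23 EE h k l
        - on23 EE (h + 1) (k - 1) l * on12 EE_bar h k l)) v"
    unfolding pad_mult pad_linear on12 on23
    by (rule acts_eqI[OF acts_diff[OF E(3) E(6)] acts_diff[OF E(2) E(7)] _ pos3 v])
      (simp add: rung_commutator_even)
  show "theta (pad x y (on12 FF h (k - 1) (l + 1) * on23 FF_bar h k l
        - on23 FF_bar (h - 1) (k + 1) l * on12 FF h k l)) v =
      theta (pad x y (on12 FF_bar h (k - 1) (l + 1) * on23 FF h k l
        - on23 FF (h - 1) (k + 1) l * on12 FF_bar h k l)) v"
    unfolding pad_mult pad_linear on12 on23
    by (rule acts_eqI[OF acts_diff[OF F(3) F(6)] acts_diff[OF F(2) F(7)] _ pos3 v])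
      (simp add: rung_commutator_even)
qed

lemma linear_op_NW_eqI:
  assumes "v \<in> spn S" "\<And>w. w \<in> S \<Longrightarrow> f (bas w) = g (bas w)" "linear_op f" "linear_op g"
  shows "f v = g v"
  by (rule linear_op_spn_eqI[OF assms(1,3,4,2)])

lemma swap_rung:
  "swap_op p (rung p p \<beta> v) = rung (Suc p) (Suc p) \<beta> (swap_op p v)"
  "swap_op p (rung (Suc p) (Suc p) \<beta> v) = rung p p \<beta> (swap_op p v)"
  unfolding swap_op_def by (rule relabel_rung; auto simp: swap_letter_def)+

lemma crossing_sound:
  assumes v: "v \<in> spn (NW (x @ 1 # 1 # y))"
  shows "theta (pad x y (split 1 1 * merge 1 1)) v = v + swap_op (sum_list x) v"
proof -
  have M: "relabel_op (collapse (sum_list x) 2) v \<in> spn (NW (x @ (1 + 1) # y))"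
    using merge_typed[OF v] by (simp add: numeral_2_eq_2)
  have "split_op (sum_list x) (sum_list x + 1) 1 (relabel_op (collapse (sum_list x) 2) v) = v + swap_op (sum_list x) v"
    by (rule linear_op_NW_eqI[OF v], rule crossing_op)
      (simp_all add: linear_op_add linear_op_comp[OF linear_split_op] swap_op_def)
  then show ?thesis
    using theta_pad_merge[OF v] theta_pad_split[OF M] by (simp add: pad_mult theta_mult flip: numeral_2_eq_2)
qed

text \<open>The swap is the split after the merge minus the identity, and both of these preserve the
  span.\<close>

lemma swap_NW:
  assumes v: "v \<in> spn (NW (x @ 1 # 1 # y))"
  shows "swap_op (sum_list x) v \<in> spn (NW (x @ 1 # 1 # y))"
proof -
  have M: "relabel_op (collapse (sum_list x) 2) v \<in> spn (NW (x @ (1 + 1) # y))"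
    using merge_typed[OF v] by (simp add: numeral_2_eq_2)
  have "swap_op (sum_list x) v = split_op (sum_list x) (sum_list x + 1) 1 (relabel_op (collapse (sum_list x) 2) v) - v"
    by (rule linear_op_NW_eqI[OF v])
      (simp_all add: crossing_op[simplified] linear_op_diff linear_op_comp[OF linear_split_op] swap_op_def)
  then show ?thesis using split_typed[OF M] v by simp
qed

lemma NW_rung_diagonal:
  assumes "v \<in> spn (NW (x @ n # y))" "0 < n"
  shows "rung (sum_list x) (sum_list x) 0 v = scl (of_nat n) v"
  using assms by (intro rung_diagonal, elim spn_mono[rotated]) (auto simp: NW_card_pos)

text \<open>The relations between dots and merges or splits are shown for arbitrary thicknesses
  \<open>k\<close> and \<open>l\<close>; the left and right versions in the presentation are the
  cases in which one of them is 1.\<close>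

lemma local_sound_thin:
  assumes "0 < h" "0 < k" "0 < l"
  shows "v \<in> spn (NW (x @ h # k # l # y)) \<Longrightarrow>
      theta (pad x y (merge (h + k) l * pad [] [l] (merge h k))) v =
      theta (pad x y (merge h (k + l) * pad [h] [] (merge k l))) v"
    and "v \<in> spn (NW (x @ (h + k + l) # y)) \<Longrightarrow>
      theta (pad x y (pad [h] [] (split k l) * split h (k + l))) v =
      theta (pad x y (pad [] [l] (split h k) * split (h + k) l)) v"
    and "v \<in> spn (NW (x @ (k + l) # y)) \<Longrightarrow>
      theta (pad x y (merge k l * split k l)) v = theta (pad x y (scl (of_nat ((k + l) choose l)) (ident [k + l]))) v"
    and "v \<in> spn (NW (x @ k # y)) \<Longrightarrow>
      theta (pad x y (dot k * dot k)) v = theta (pad x y (scl (of_nat k) (ident [k]))) v"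
    and "v \<in> spn (NW (x @ k # l # y)) \<Longrightarrow>
      theta (pad x y (dot (k + l) * merge k l)) v =
      theta (pad x y (merge k l * pad [] [l] (dot k) + merge k l * pad [k] [] (dot l))) v"
    and "v \<in> spn (NW (x @ (k + l) # y)) \<Longrightarrow>
      theta (pad x y (split k l * dot (k + l))) v =
      theta (pad x y (pad [] [l] (dot k) * split k l + pad [k] [] (dot l) * split k l)) v"
    and "v \<in> spn (NW (x @ 1 # 1 # y)) \<Longrightarrow>
      theta (pad x y (split 1 1 * merge 1 1
        - (pad [] [1] (dot 1) * pad [1] [] (dot 1)) * split 1 1 * merge 1 1
            * (pad [] [1] (dot 1) * pad [1] [] (dot 1)))) v =
      theta (pad x y (scl 2 (ident [1, 1]))) v"
proof -
  let ?p = "sum_list x"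
  show "theta (pad x y (merge (h + k) l * pad [] [l] (merge h k))) v =
      theta (pad x y (merge h (k + l) * pad [h] [] (merge k l))) v" if v: "v \<in> spn (NW (x @ h # k # l # y))"
  proof -
    have v': "v \<in> spn (NW ((x @ [h]) @ k # l # y))" using v by simp
    have T: "relabel_op (collapse ?p (h + k)) v \<in> spn (NW (x @ (h + k) # l # y))"
      by (rule merge_typed[OF v])
    have T': "relabel_op (collapse (?p + h) (k + l)) v \<in> spn (NW (x @ h # (k + l) # y))"
      using merge_typed[OF v'] by simp
    have "collapse ?p (h + k + l) \<circ> collapse ?p (h + k) = collapse ?p (h + (k + l)) \<circ> collapse (?p + h) (k + l)"
      using assms by (auto simp: collapse_def fun_eq_iff)
    then show ?thesis
      using theta_pad_merge[OF v] theta_pad_merge[OF v'] theta_pad_merge[OF T] theta_pad_merge[OF T']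
      by (simp add: pad_simps theta_mult relabel_op_comp)
  qed
  show "theta (pad x y (pad [h] [] (split k l) * split h (k + l))) v =
      theta (pad x y (pad [] [l] (split h k) * split (h + k) l)) v" if v: "v \<in> spn (NW (x @ (h + k + l) # y))"
  proof -
    have v1: "v \<in> spn (NW (x @ (h + (k + l)) # y))" and v2: "v \<in> spn (NW (x @ ((h + k) + l) # y))"
      using v by (simp_all add: add.assoc)
    have T1: "split_op ?p (?p + h) (k + l) v \<in> spn (NW ((x @ [h]) @ (k + l) # y))"
      using split_typed[OF v1] by simp
    have T2: "split_op ?p (?p + (h + k)) l v \<in> spn (NW (x @ (h + k) # l # y))"
      by (rule split_typed[OF v2])
    have eq: "split_op (?p + h) (?p + (h + k)) l (split_op ?p (?p + h) (k + l) v) =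
       split_op ?p (?p + h) (k + l - l) (split_op ?p (?p + (h + k)) l v)"
      by (rule linear_op_NW_eqI[OF v], rule split_assoc_op)
        (use assms in \<open>simp_all add: linear_op_comp[OF linear_split_op]\<close>, use assms in linarith)
    show ?thesis
      using theta_pad_split[OF v1] theta_pad_split[OF v2] theta_pad_split[OF T1] theta_pad_split[OF T2] eq
      by (simp add: pad_simps theta_mult add.assoc)
  qed
  show "theta (pad x y (merge k l * split k l)) v = theta (pad x y (scl (of_nat ((k + l) choose l)) (ident [k + l]))) v"
    if v: "v \<in> spn (NW (x @ (k + l) # y))"
  proof -
    have "relabel_op (collapse ?p (k + l)) (split_op ?p (?p + k) l v) = scl (of_nat ((k + l) choose l)) v"
      by (rule linear_op_NW_eqI[OF v], rule merge_split_op)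
        (use assms in \<open>simp_all add: linear_op_comp[OF linear_relabel_op] linear_op_scl[OF linear_op_id(2)]\<close>)
    then show ?thesis
      using theta_pad_split[OF v] theta_pad_merge[OF split_typed[OF v]] theta_pad_ident[of v x "[k + l]" y] v
      by (simp add: pad_simps theta_mult theta_simps)
  qed
  show "theta (pad x y (dot k * dot k)) v = theta (pad x y (scl (of_nat k) (ident [k]))) v"
    if v: "v \<in> spn (NW (x @ k # y))"
    using theta_pad_dot[OF v assms(2)] theta_pad_dot[OF dot_typed[OF v] assms(2)] theta_pad_ident[of v x "[k]" y] v
    by (simp add: pad_simps theta_mult theta_simps rung_square NW_rung_diagonal[OF v assms(2)])
  show "theta (pad x y (dot (k + l) * merge k l)) v =
      theta (pad x y (merge k l * pad [] [l] (dot k) + merge k l * pad [k] [] (dot l))) v"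
    if v: "v \<in> spn (NW (x @ k # l # y))"
  proof -
    have v': "v \<in> spn (NW ((x @ [k]) @ l # y))" using v by simp
    have D1: "rung ?p ?p 1 v \<in> spn (NW (x @ k # l # y))" by (rule dot_typed[OF v])
    have D2: "rung (?p + k) (?p + k) 1 v \<in> spn (NW (x @ k # l # y))" using dot_typed[OF v'] by simp
    have eq: "rung ?p ?p 1 (relabel_op (collapse ?p (k + l)) v) =
     relabel_op (collapse ?p (k + l)) (rung ?p ?p 1 v) + relabel_op (collapse ?p (k + l)) (rung (?p + k) (?p + k) 1 v)"
      by (rule linear_op_NW_eqI[OF v], rule dot_merge_op)
        (use assms in \<open>simp_all add: linear_op_add linear_op_comp[OF linear_relabel_op] linear_op_comp[OF linear_rung]\<close>)
    show ?thesis
      using theta_pad_merge[OF v] theta_pad_dot[OF merge_typed[OF v]] theta_pad_dot[OF v] theta_pad_dot[OF v']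
        theta_pad_merge[OF D1] theta_pad_merge[OF D2] eq assms
      by (simp add: pad_simps theta_mult theta_simps)
  qed
  show "theta (pad x y (split k l * dot (k + l))) v =
      theta (pad x y (pad [] [l] (dot k) * split k l + pad [k] [] (dot l) * split k l)) v"
    if v: "v \<in> spn (NW (x @ (k + l) # y))"
  proof -
    have S: "split_op ?p (?p + k) l v \<in> spn (NW (x @ k # l # y))" by (rule split_typed[OF v])
    then have S': "split_op ?p (?p + k) l v \<in> spn (NW ((x @ [k]) @ l # y))" by simp
    have eq: "split_op ?p (?p + k) l (rung ?p ?p 1 v) =
     rung ?p ?p 1 (split_op ?p (?p + k) l v) + rung (?p + k) (?p + k) 1 (split_op ?p (?p + k) l v)"
      by (rule linear_op_NW_eqI[OF v], rule dot_split_op)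
        (use assms in \<open>simp_all add: linear_op_add linear_op_comp[OF linear_split_op] linear_op_comp[OF linear_rung]\<close>)
    show ?thesis
      using theta_pad_split[OF v] theta_pad_dot[OF v] theta_pad_split[OF dot_typed[OF v]]
        theta_pad_dot[OF S] theta_pad_dot[OF S'] eq assms
      by (simp add: pad_simps theta_mult theta_simps)
  qed
  show "theta (pad x y (split 1 1 * merge 1 1
        - (pad [] [1] (dot 1) * pad [1] [] (dot 1)) * split 1 1 * merge 1 1
            * (pad [] [1] (dot 1) * pad [1] [] (dot 1)))) v =
      theta (pad x y (scl 2 (ident [1, 1]))) v" if v: "v \<in> spn (NW (x @ 1 # 1 # y))"
  proof -
    let ?N = "spn (NW (x @ 1 # 1 # y))"
    let ?d1 = "rung ?p ?p 1" and ?d2 = "rung (Suc ?p) (Suc ?p) 1"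
    have D1: "theta (pad x (1 # y) (dot 1)) u = ?d1 u" "?d1 u \<in> ?N" if "u \<in> ?N" for u
      using theta_pad_dot[of u x 1 "1 # y"] dot_typed[of u x 1 "1 # y"] that by simp_all
    have D2: "theta (pad (x @ [1]) y (dot 1)) u = ?d2 u" "?d2 u \<in> ?N" if "u \<in> ?N" for u
      using theta_pad_dot[of u "x @ [1]" 1 y] dot_typed[of u "x @ [1]" 1 y] that by simp_all
    have sq1: "?d1 (?d1 u) = u" if "u \<in> ?N" for u
      using NW_rung_diagonal[of u x 1 "1 # y"] that by (simp add: rung_square)
    have sq2: "?d2 (?d2 u) = u" if "u \<in> ?N" for u
      using NW_rung_diagonal[of u "x @ [1]" 1 y] that by (simp add: rung_square)
    have anti: "?d2 (?d1 u) = - ?d1 (?d2 u)" for u by (rule rung_anticommute) simp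
    let ?v = "?d1 (?d2 v)"
    have vN: "?v \<in> ?N" "?d2 v \<in> ?N" using v D1(2) D2(2) by blast+
    have S: "swap_op ?p ?v \<in> ?N" by (rule swap_NW[OF vN(1)])
    have SN: "swap_op ?p v \<in> ?N" by (rule swap_NW[OF v])
    \<comment> \<open>The product of the two dots squares to minus the identity and changes its sign
      when it passes the swap \<open>s\<close>, which exchanges the dots. So multiplying
      \<open>1 + s\<close> by it on both sides gives \<open>- 1 + s\<close>.\<close>
    have "?d1 (?d2 ?v) = - v"
      using sq1[OF v] sq2[OF v] vN D1 D2 v sq1 sq2 by (simp add: anti linear_opD[OF linear_rung])
    moreover have "?d1 (?d2 (swap_op ?p ?v)) = swap_op ?p v"
      using sq1[OF SN] sq2[OF D1(2)[OF SN]] by (simp add: swap_rung)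
    ultimately have eq: "?d1 (?d2 (?v + swap_op ?p ?v)) = - v + swap_op ?p v"
      by (simp add: linear_opD[OF linear_rung])
    have "theta (pad x y ((pad [] [1] (dot 1) * pad [1] [] (dot 1)) * split 1 1 * merge 1 1
            * (pad [] [1] (dot 1) * pad [1] [] (dot 1)))) v = ?d1 (?d2 (?v + swap_op ?p ?v))"
      using crossing_sound[OF vN(1)] v vN S D1 D2 by (simp add: pad_simps theta_mult)
    then have "theta (pad x y (split 1 1 * merge 1 1
        - (pad [] [1] (dot 1) * pad [1] [] (dot 1)) * split 1 1 * merge 1 1
            * (pad [] [1] (dot 1) * pad [1] [] (dot 1)))) v = v + swap_op ?p v - (- v + swap_op ?p v)"
      using crossing_sound[OF v] eq by (simp add: pad_linear theta_simps)
    also have "\<dots> = scl 2 v" using scl_add_left[of 1 1 v] by simp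
    also have "\<dots> = theta (pad x y (scl 2 (ident [1, 1]))) v"
      using theta_pad_ident[of v x "[1, 1]" y] v by (simp add: pad_linear theta_simps)
    finally show ?thesis .
  qed
qed

section \<open>From the local relations to the relations of the presentation\<close>

lemma local_sound:
  assumes "local_relation s f g" "\<forall>k\<in>set (x @ y). 0 < k" "v \<in> spn (NW (x @ s @ y))"
  shows "theta (pad x y f) v = theta (pad x y g) v"
  using assms
proof cases
  case (merge_assoc h k l)
  then show ?thesis using local_sound_thin(1)[of h k l] assms(3) by simp
next
  case (split_assoc h k l)
  then show ?thesis using local_sound_thin(2)[of h k l] assms(3) by simp
next
  case (merge_split k l)
  then show ?thesis using local_sound_thin(3)[of 1 k l] assms(3) by simp
next
  case (dot_dot k)
  then show ?thesis using local_sound_thin(4)[of 1 k 1] assms(3) by simp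
next
  case (dot_merge_left k)
  then show ?thesis using local_sound_thin(5)[of 1 1 k] assms(3) by simp
next
  case (dot_split_left k)
  then show ?thesis using local_sound_thin(6)[of 1 1 k] assms(3) by simp
next
  case (dot_merge_right k)
  then show ?thesis using local_sound_thin(5)[of 1 k 1] assms(3) by simp
next
  case (dot_split_right k)
  then show ?thesis using local_sound_thin(6)[of 1 k 1] assms(3) by simp
next
  case dots_crossing
  then show ?thesis using local_sound_thin(7)[of 1 1 1] assms(3) by simp
next
  case (EF k l)
  then show ?thesis using local_sound_ladders(1)[of 1 k l] assms(2,3) by simp
next
  case (E_bar_F k l)
  then show ?thesis using local_sound_ladders(2)[of 1 k l] assms(2,3) by simp
next
  case (E_F_bar k l)
  then show ?thesis using local_sound_ladders(3)[of 1 k l] assms(2,3) by simp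
next
  case (E1_E2 h k l)
  then show ?thesis using local_sound_ladders(4)[of h k l] assms(2,3) by simp
next
  case (F2_F1 h k l)
  then show ?thesis using local_sound_ladders(5)[of h k l] assms(2,3) by simp
next
  case (E1_E2_bar h k l)
  then show ?thesis using local_sound_ladders(6)[of h k l] assms(2,3) by simp
next
  case (F1_F2_bar h k l)
  then show ?thesis using local_sound_ladders(7)[of h k l] assms(2,3) by simp
qed

text \<open>Besides fixing the source this excludes a constant term, which tells these elements
  apart from the relation that the idempotents sum up to \<open>1\<close>.\<close>

definition sourced :: "nat list \<Rightarrow> web \<Rightarrow> bool" where
  "sourced s f \<longleftrightarrow> (\<forall>w\<in>keys f. w \<noteq> [] \<and> gen_src (last w) = s)"

lemma theta_gen_prj: "theta_gen g (prj (gen_src g) v) = theta_gen g v"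
  by (cases g) (simp_all add: prj_id)

text \<open>The first generator to act projects to \<open>s\<close> anyway. So identities shown on
  vectors of source \<open>s\<close> extend to all vectors.\<close>

lemma theta_prj:
  assumes "sourced s f"
  shows "theta f (prj s v) = theta f v"
proof -
  have "foldr theta_gen w (prj s v) = foldr theta_gen w v" if "w \<in> keys f" for w
  proof -
    have "w \<noteq> []" "gen_src (last w) = s" using assms that by (auto simp: sourced_def)
    then obtain w' g where "w = w' @ [g]" "gen_src g = s" by (metis append_butlast_last_id)
    then show ?thesis using theta_gen_prj[of g v] by simp
  qed
  then show ?thesis by (simp add: theta_def lin_ext_def)
qed

lemma sourced_bas: "sourced s (bas w) \<longleftrightarrow> w \<noteq> [] \<and> gen_src (last w) = s"
  by (simp add: sourced_def)

lemma sourced_closed: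
  "sourced s 0" "sourced s f \<Longrightarrow> sourced s g \<Longrightarrow> sourced s (f + g)"
  "sourced s f \<Longrightarrow> sourced s g \<Longrightarrow> sourced s (f - g)" "sourced s f \<Longrightarrow> sourced s (scl c f)"
  using keys_add[of f g] keys_diff[of f g] keys_scl[of c f] by (auto simp: sourced_def)

lemma sourced_mult: "sourced s g \<Longrightarrow> sourced s (f * g)"
proof (unfold sourced_def, rule ballI)
  fix w assume "\<forall>w\<in>keys g. w \<noteq> [] \<and> gen_src (last w) = s" "w \<in> keys (f * g)"
  then show "w \<noteq> [] \<and> gen_src (last w) = s"
    using keys_mult[of f g] by (fastforce simp: plus_list_def)
qed

lemma gen_src_pad: "gen_src (pad_gen x y g) = erase x @ gen_src g @ erase y"
  by (cases g) simp_all

lemma sourced_pad: "sourced s f \<Longrightarrow> t = erase x @ s @ erase y \<Longrightarrow> sourced t (pad x y f)"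
proof -
  assume *: "sourced s f" "t = erase x @ s @ erase y"
  have "keys (pad x y f) \<subseteq> {w. w \<noteq> [] \<and> gen_src (last w) = t}"
    unfolding pad_def
  proof (rule keys_lin_ext)
    fix w assume "w \<in> keys f"
    then show "keys (bas (map (pad_gen x y) w)) \<subseteq> {w. w \<noteq> [] \<and> gen_src (last w) = t}"
      using * by (auto simp: sourced_def last_map gen_src_pad)
  qed
  then show ?thesis by (auto simp: sourced_def)
qed

lemma sourced_local:
  "s = erase [k, l] \<Longrightarrow> sourced s (merge k l)" "s = erase [k + l] \<Longrightarrow> sourced s (split k l)"
  "0 < k \<Longrightarrow> s = [k] \<Longrightarrow> sourced s (dot k)" "s = erase a \<Longrightarrow> sourced s (ident a)"
  by (auto simp: merge_def split_def dot_def ident_def sourced_bas)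

lemma sourced_ladder:
  "s = erase [k, l] \<Longrightarrow> sourced s (EE k l)" "s = erase [k, l] \<Longrightarrow> sourced s (FF k l)"
  "s = erase [k, l] \<Longrightarrow> sourced s (EE_bar k l)" "s = erase [k, l] \<Longrightarrow> sourced s (FF_bar k l)"
  unfolding ladder_E_def ladder_F_def EE_bar_def FF_bar_def
  by (cases "l < 1"; cases "k < 1"; simp only: if_True if_False;
      (intro sourced_closed sourced_mult sourced_pad[OF sourced_local(2)[OF refl]]; simp)?)+

lemma sourced_local_relation: "local_relation s f g \<Longrightarrow> sourced s f \<and> sourced s g"
  by (induction rule: local_relation.induct)
     (intro conjI sourced_closed sourced_mult sourced_local sourced_ladder sourced_pad[OF sourced_local(1)[OF refl]]
        sourced_pad[OF sourced_local(2)[OF refl]] sourced_pad[OF sourced_local(3)[OF _ refl]]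
        sourced_pad[OF sourced_ladder(1)[OF refl]] sourced_pad[OF sourced_ladder(2)[OF refl]]
        sourced_pad[OF sourced_ladder(3)[OF refl]] sourced_pad[OF sourced_ladder(4)[OF refl]]; simp)+

lemma sorted_base: "sorted (base p a)"
proof (induction a arbitrary: p)
  case (Cons k a)
  then show ?case by (auto simp: sorted_append in_set_replicate dest!: base_bounds)
qed simp

lemma base_inj:
  assumes "base p a = base p b" "\<forall>k\<in>set a. 0 < k" "\<forall>k\<in>set b. 0 < k"
  shows "a = b"
  using assms
proof (induction a arbitrary: p b)
  case Nil
  then show ?case by (cases b) auto
next
  case (Cons k a)
  then obtain l b' where b: "b = l # b'" by (cases b) auto
  have "count (mset (base p (k # a))) p = count (mset (base p b)) p" using Cons.prems by simp
  then have "k = l" using Cons.prems by (simp add: b count_base_out)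
  moreover from this have "base (p + k) a = base (p + k) b'" using Cons.prems(1) by (simp add: b)
  then have "a = b'" using Cons.prems by (intro Cons.IH) (simp_all add: b)
  ultimately show ?case by (simp add: b)
qed

text \<open>The sorted word of labels determines a composition without empty strands. The sizes may
  differ, since words of all lengths live in one type.\<close>

lemma NW_disjoint:
  assumes "w \<in> NW a" "w \<in> NW b" "a \<in> compositions r" "b \<in> compositions r'"
  shows "a = b"
proof -
  have "mset (base 0 a) = mset (base 0 b)" using assms by (simp add: NW_def)
  then have "sort (base 0 b) = base 0 a" by (rule properties_for_sort[OF _ sorted_base])
  moreover have "sort (base 0 b) = base 0 b" by (rule sorted_sort_id[OF sorted_base])
  ultimately have "base 0 a = base 0 b" by (simp only:)
  moreover have "\<forall>k\<in>set a. 0 < k" "\<forall>k\<in>set b. 0 < k" using assms(3,4) by (simp_all add: compositions_def)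
  ultimately show ?thesis by (rule base_inj)
qed

lemma prj_other: "v \<in> spn (NW b) \<Longrightarrow> a \<in> compositions r \<Longrightarrow> b \<in> compositions r' \<Longrightarrow> a \<noteq> b \<Longrightarrow> prj a v = 0"
  by (rule linear_op_spn_eqI[of _ "NW b" _ "\<lambda>v. 0"]) (auto simp: prj_def dest: NW_disjoint)

text \<open>The condition on the empty word removes the relation that the idempotents of one size
  sum up to \<open>1\<close>; that relation fails on words of another size.\<close>

theorem theta_relation:
  assumes "x \<in> web_relations r" "lookup x [] = 0"
  shows "theta x v = 0"
  using assms(1)
proof cases
  case web_unit
  have "lookup (1 :: web) [] = 1" by (simp add: bas_Nil[symmetric] del: single_one)
  then have "lookup x [] = - 1" unfolding web_unit
    by (simp add: lookup_minus lookup_sum lookup_single)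
  with assms(2) show ?thesis by simp
next
  case (idem_idem a b)
  then show ?thesis
    by (cases "a = b") (simp_all add: theta_simps theta_mult prj_id prj_other[OF prj_spn])
next
  case (idem_gen w)
  have "theta (bas [Idm (gen_tgt w)] * bas [w] * bas [Idm (gen_src w)]) v = theta_gen w v"
    by (simp add: theta_mult theta_simps theta_gen_prj prj_id[OF theta_gen_typed])
  then show ?thesis by (simp add: idem_gen theta_simps)
next
  case (superinterchange x' f y g z)
  have "sym_pos h" if "\<forall>k\<in>set (src h @ tgt h). 0 < k" for h using that by (cases h) auto
  then have "sym_pos f" "sym_pos g" using superinterchange(2,3) by (auto simp: compositions_def)
  then show ?thesis
    unfolding superinterchange(1) theta_simps(2) by (simp only: theta_interchange diff_self)
next
  case (local s f g x' y)
  have pos: "\<forall>k\<in>set (x' @ y). 0 < k" using local(3) by (auto simp: compositions_def)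
  then have er: "erase x' = x'" "erase y = y" by (auto simp: filter_id_conv)
  have src: "sourced (x' @ s @ y) (pad x' y f)" "sourced (x' @ s @ y) (pad x' y g)"
    using sourced_local_relation[OF local(2)] by (auto intro!: sourced_pad simp: er)
  have "theta (pad x' y f) v = theta (pad x' y g) v"
    using local_sound[OF local(2) pos prj_spn] theta_prj[OF src(1)] theta_prj[OF src(2)] by metis
  then show ?thesis by (simp add: local(1) theta_simps)
qed

definition NWs :: "nat \<Rightarrow> idx list set" where
  "NWs r = (\<Union>a\<in>compositions r. NW a)"

lemma theta_unit:
  assumes "v \<in> spn (NWs r)"
  shows "theta (\<Sum>a\<in>compositions r. bas [Idm a]) v = v"
proof (rule linear_op_spn_eqI[OF assms linear_theta linear_op_id(2)])
  fix w assume "w \<in> NWs r"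
  then obtain b where b: "b \<in> compositions r" "w \<in> NW b" by (auto simp: NWs_def)
  have "(\<Sum>a\<in>compositions r. prj a (bas w)) = (\<Sum>a\<in>compositions r. if a = b then bas w else 0)"
    by (intro sum.cong refl) (use b in \<open>auto simp: prj_def dest: NW_disjoint\<close>)
  then show "theta (\<Sum>a\<in>compositions r. bas [Idm a]) (bas w) = bas w"
    using b by (simp add: theta_simps finite_compositions)
qed

lemma theta_NWs:
  assumes "keys x \<subseteq> lists (web_gens r)" "v \<in> spn (NWs r)"
  shows "theta x v \<in> spn (NWs r)"
proof -
  have gen: "theta_gen g u \<in> spn (NWs r)" if "g \<in> web_gens r" for g u
    by (rule spn_mono[OF _ theta_gen_typed[of g]]) (use that in \<open>auto simp: NWs_def web_gens_def\<close>)
  have "foldr theta_gen w v \<in> spn (NWs r)" if "w \<in> lists (web_gens r)" for w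
    using that by (cases w) (auto simp: assms(2) gen)
  then show ?thesis
    unfolding theta_def spn_def mem_Collect_eq using assms(1) by (intro keys_lin_ext) blast
qed

section \<open>The locally unital web algebra as a type\<close>

text \<open>The relations of all web algebras are imposed at once, except for those which say that the idempotents
  of a given size sum up to \<open>1\<close>. This gives a ring type that contains all the web algebras.\<close>

inductive_set web_ideal :: "web set" where
  zero: "0 \<in> web_ideal"
| step: "x \<in> web_relations r \<Longrightarrow> lookup x [] = 0 \<Longrightarrow> y \<in> web_ideal \<Longrightarrow> u * x * v + y \<in> web_ideal"

lemma web_ideal_add: "x \<in> web_ideal \<Longrightarrow> y \<in> web_ideal \<Longrightarrow> x + y \<in> web_ideal"
  by (induction rule: web_ideal.induct) (auto simp: add.assoc intro: web_ideal.step)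

lemma web_ideal_mult: "x \<in> web_ideal \<Longrightarrow> a * x * b \<in> web_ideal"
proof (induction rule: web_ideal.induct)
  case (step x r y u v)
  then have "(a * u) * x * (v * b) + a * y * b \<in> web_ideal" by (intro web_ideal.step)
  then show ?case by (simp add: algebra_simps)
qed (simp add: web_ideal.zero)

lemma web_ideal_closed:
  assumes "x \<in> web_ideal"
  shows "a * x \<in> web_ideal" "x * b \<in> web_ideal" "- x \<in> web_ideal"
  using web_ideal_mult[OF assms, of a 1] web_ideal_mult[OF assms, of 1 b] web_ideal_mult[OF assms, of "-1" 1]
  by simp_all

lemma theta_web_ideal: "x \<in> web_ideal \<Longrightarrow> theta x v = 0"
  by (induction arbitrary: v rule: web_ideal.induct)
    (simp_all add: theta_simps theta_mult theta_relation linear_opD[OF linear_theta])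

quotient_type wq = web / "\<lambda>x y. x - y \<in> web_ideal"
proof (rule equivpI)
  show "reflp (\<lambda>x y. x - y \<in> web_ideal)" by (rule reflpI) (simp add: web_ideal.zero)
  show "symp (\<lambda>x y. x - y \<in> web_ideal)"
    by (rule sympI) (use web_ideal_closed(3) in force)
  show "transp (\<lambda>x y. x - y \<in> web_ideal)"
    by (rule transpI) (use web_ideal_add in force)
qed

instantiation wq :: ring_1
begin

lift_definition zero_wq :: wq is 0 .
lift_definition one_wq :: wq is 1 .
lift_definition plus_wq :: "wq \<Rightarrow> wq \<Rightarrow> wq" is "(+)"
  by (drule (1) web_ideal_add) (simp add: algebra_simps)
lift_definition uminus_wq :: "wq \<Rightarrow> wq" is uminus
  by (drule web_ideal_closed(3)) simp
lift_definition minus_wq :: "wq \<Rightarrow> wq \<Rightarrow> wq" is "(-)"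
  by (drule web_ideal_closed(3)[of "_ - _", rotated], drule (1) web_ideal_add) (simp add: algebra_simps)
lift_definition times_wq :: "wq \<Rightarrow> wq \<Rightarrow> wq" is "(*)"
proof -
  fix a b c d :: web assume "a - b \<in> web_ideal" "c - d \<in> web_ideal"
  then have "(a - b) * c + b * (c - d) \<in> web_ideal"
    by (intro web_ideal_add web_ideal_closed)
  then show "a * c - b * d \<in> web_ideal" by (simp add: algebra_simps)
qed

instance
proof
  show "(0::wq) \<noteq> 1"
  proof transfer
    \<comment> \<open>The quotient is not trivial because elements of the ideal act by zero, while
      \<open>1\<close> acts as the identity.\<close>
    have "keys (bas ([] :: idx list)) \<noteq> {}" by simp
    then have "bas ([] :: idx list) \<noteq> 0" by (metis keys_zero)
    then have "theta (0 - 1) (bas []) \<noteq> 0" unfolding theta_simps(2) by (simp add: theta_simps)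
    then show "0 - 1 \<notin> web_ideal" using theta_web_ideal by blast
  qed
qed (transfer; simp add: algebra_simps web_ideal.zero)+

end

abbreviation q :: "web \<Rightarrow> wq" where "q \<equiv> abs_wq"

lemma q_simps: "q (x + y) = q x + q y" "q (x - y) = q x - q y" "q (x * y) = q x * q y" "q 0 = 0" "q 1 = 1" "q (- x) = - q x"
  by (simp_all add: plus_wq.abs_eq minus_wq.abs_eq times_wq.abs_eq zero_wq.abs_eq one_wq.abs_eq uminus_wq.abs_eq)

lemma q_eq_iff: "q x = q y \<longleftrightarrow> x - y \<in> web_ideal"
  by (rule wq.abs_eq_iff)

lemma q_surj: obtains x where "q x = z"
  using Quotient_abs_rep[OF Quotient_wq] by metis

lemma theta_q_cong: "q x = q y \<Longrightarrow> theta x v = theta y v"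
  using theta_web_ideal[of "x - y" v] by (simp add: q_eq_iff theta_simps)

text \<open>As \<open>wq\<close> is a mere ring type, complex scalars enter as the central elements
  \<open>cq c\<close>.\<close>

definition cq :: "complex \<Rightarrow> wq" where
  "cq c = q (scl c 1)"

lemma q_scl: "q (scl c x) = cq c * q x"
  by (simp add: cq_def scl_mult flip: q_simps)

lemma cq_commute: "z * cq c = cq c * z"
proof -
  obtain x where x: "q x = z" by (rule q_surj)
  show ?thesis unfolding x[symmetric] cq_def q_simps(3)[symmetric] by (simp add: scl_mult)
qed

lemma cq_left_commute: "z * (cq c * w) = cq c * (z * w)"
  by (simp add: cq_commute flip: mult.assoc)

lemma cq_simps: "cq 0 = 0" "cq 1 = 1" "cq (a + b) = cq a + cq b" "cq (a - b) = cq a - cq b" "cq (- a) = - cq a"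
  "cq a * cq b = cq (a * b)" "cq a * (cq b * z) = cq (a * b) * z"
  using scl_add_left[of a "- b" "1 :: web"]
  by (simp_all add: cq_def q_simps scl_add_left scl_mult mult.commute flip: q_simps mult.assoc)

lemma cq_inverse: "c \<noteq> 0 \<Longrightarrow> cq (1 / c) * (cq c * z) = z"
  by (simp only: cq_simps(7)) (simp add: cq_simps(2))

lemma wq_halve: "z + z = w + w \<Longrightarrow> z = w" for z w :: wq
proof -
  assume "z + z = w + w"
  then have "cq (1/2) * (z + z) = cq (1/2) * (w + w)" by simp
  moreover have "cq (1/2) * (u + u) = u" for u
  proof -
    have "cq (1/2) * (u + u) = cq (1/2 + 1/2) * u" by (simp only: distrib_left distrib_right cq_simps)
    then show ?thesis by (simp add: cq_simps)
  qed
  ultimately show ?thesis by simp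
qed

section \<open>Relations between layers\<close>

text \<open>Lists of positive labels, possibly empty, since there may be no strands to the left or
  right of a web.\<close>

definition pl :: "nat list \<Rightarrow> bool" where
  "pl a \<longleftrightarrow> (\<forall>k\<in>set a. 0 < k)"

lemma pl_simps [simp]: "pl []" "pl (k # a) \<longleftrightarrow> 0 < k \<and> pl a" "pl (a @ b) \<longleftrightarrow> pl a \<and> pl b"
  "0 < k \<Longrightarrow> pl (replicate n k)"
  by (auto simp: pl_def)

lemma erase_pl: "pl a \<Longrightarrow> erase a = a"
  by (auto simp: pl_def filter_id_conv)

lemma compositions_pl: "a \<in> compositions r \<longleftrightarrow> a \<noteq> [] \<and> pl a \<and> sum_list a = r"
  by (simp add: compositions_def pl_def)

definition L :: "nat list \<Rightarrow> web_symbol \<Rightarrow> nat list \<Rightarrow> wq" where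
  "L x g y = q (bas [Layer x g y])"

definition J :: "nat list \<Rightarrow> wq" where
  "J a = q (bas [Idm a])"

lemma q_relation: "x \<in> web_relations r \<Longrightarrow> lookup x [] = 0 \<Longrightarrow> q x = 0"
  using web_ideal.step[of x r 0 1 1] web_ideal.zero q_eq_iff[of x 0] by (simp add: q_simps)

lemma lookup_bas_Cons [simp]: "lookup (bas (g # w)) [] = 0"
  by (simp add: lookup_single)

lemma J_idem: "pl a \<Longrightarrow> a \<noteq> [] \<Longrightarrow> J a * J a = J a"
  using q_relation[OF web_relations.idem_idem[of a "sum_list a" a]]
  by (simp add: compositions_pl bas_mult lookup_minus) (simp add: J_def q_simps flip: bas_mult[of "[_]" "[_]", simplified])

lemma J_orthogonal: "a \<in> compositions r \<Longrightarrow> b \<in> compositions r \<Longrightarrow> a \<noteq> b \<Longrightarrow> J a * J b = 0"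
  using q_relation[OF web_relations.idem_idem[of a r b]]
  by (simp add: bas_mult) (simp add: J_def q_simps flip: bas_mult[of "[_]" "[_]", simplified])

lemma src_ne [simp]: "src g \<noteq> []" "tgt g \<noteq> []"
  by (cases g; simp)+

lemma sum_src: "sum_list (tgt g) = sum_list (src g)"
  by (cases g) simp_all

lemma pl_sym: "sym_pos g \<Longrightarrow> pl (src g)" "sym_pos g \<Longrightarrow> pl (tgt g)"
  by (cases g; simp)+

lemma pl_sym_conv: "pl (src g) \<Longrightarrow> pl (tgt g) \<Longrightarrow> sym_pos g"
  by (cases g) simp_all

lemma L_J_J:
  assumes "sym_pos g" "pl x" "pl y"
  shows "L x g y = J (x @ tgt g @ y) * L x g y * J (x @ src g @ y)"
proof -
  have "Layer x g y \<in> web_gens (sum_list (x @ src g @ y))"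
    using assms pl_sym[OF assms(1)] by (simp add: web_gens_def compositions_pl sum_src)
  from q_relation[OF web_relations.idem_gen[OF this]]
  have "q (bas [Layer x g y]) = q (bas [Idm (x @ tgt g @ y), Layer x g y, Idm (x @ src g @ y)])"
    by (simp add: bas_mult lookup_minus q_simps(2))
  then show ?thesis unfolding L_def J_def q_simps(3)[symmetric] bas_mult append.simps .
qed

lemma J_L:
  assumes "sym_pos g" "pl x" "pl y" "b = x @ tgt g @ y"
  shows "J b * L x g y = L x g y" "J b * (L x g y * z) = L x g y * z"
proof -
  have "J b * (J b * L x g y * J (x @ src g @ y)) = J b * L x g y * J (x @ src g @ y)"
    using J_idem[of b] assms pl_sym by (simp flip: mult.assoc)
  then show "J b * L x g y = L x g y" using L_J_J[OF assms(1-3)] assms(4) by simp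
  then show "J b * (L x g y * z) = L x g y * z" by (simp flip: mult.assoc)
qed

lemma L_J:
  assumes "sym_pos g" "pl x" "pl y" "b = x @ src g @ y"
  shows "L x g y * J b = L x g y" "L x g y * (J b * z) = L x g y * z"
proof -
  have "J (x @ tgt g @ y) * L x g y * J b * J b = J (x @ tgt g @ y) * L x g y * J b"
    using J_idem[of b] assms pl_sym by (simp add: mult.assoc)
  then show "L x g y * J b = L x g y" using L_J_J[OF assms(1-3)] assms(4) by simp
  then show "L x g y * (J b * z) = L x g y * z" by (simp flip: mult.assoc)
qed

lemma L_interchange:
  assumes "sym_pos f" "sym_pos g" "pl x" "pl y" "pl z"
  shows "L (x @ tgt f @ y) g z * L x f (y @ src g @ z) =
    cq (koszul (sym_parity f * sym_parity g)) * (L x f (y @ tgt g @ z) * L (x @ src f @ y) g z)"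
proof -
  have "x @ src f @ y @ src g @ z \<in> compositions (sum_list (x @ src f @ y @ src g @ z))"
    "x @ tgt f @ y @ tgt g @ z \<in> compositions (sum_list (x @ src f @ y @ src g @ z))"
    using assms pl_sym by (simp_all add: compositions_pl sum_src)
  from q_relation[OF web_relations.superinterchange[OF this]] show ?thesis
    by (simp add: bas_mult lookup_minus lookup_scl q_simps(2) q_scl) (simp add: L_def bas_mult flip: q_simps(3))
qed

lemma local_relation_pl: "local_relation s f g \<Longrightarrow> s \<noteq> [] \<and> pl s"
  by (induction rule: local_relation.induct) simp_all

lemma sourced_lookup: "sourced s f \<Longrightarrow> lookup f [] = 0"
  by (auto simp: sourced_def in_keys_iff)

lemma q_local:
  assumes "local_relation s f g" "pl x" "pl y"
  shows "q (pad x y f) = q (pad x y g)"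
proof -
  have "x @ s @ y \<in> compositions (sum_list (x @ s @ y))"
    using assms local_relation_pl[OF assms(1)] by (simp add: compositions_pl)
  moreover have "lookup (pad x y f - pad x y g) [] = 0"
    using sourced_local_relation[OF assms(1)] sourced_pad[OF _ refl, of s f x y] sourced_pad[OF _ refl, of s g x y]
    by (simp add: lookup_minus sourced_lookup)
  ultimately show ?thesis using q_relation[OF web_relations.local[OF assms(1)]] by (simp add: q_simps)
qed

text \<open>The ladder relations on \<open>(1, n)\<close> and on \<open>(2, 1)\<close> will be
  evaluated explicitly. One of the ladders then empties a strand, which has to disappear from the
  padding.\<close>

lemma pad_zero: "pad (0 # x) y = pad x y" "pad (x @ [0]) y = pad x y" "pad x (0 # y) = pad x y"
proof -
  have "pad_gen (0 # x) y g = pad_gen x y g" "pad_gen (x @ [0]) y g = pad_gen x y g" "pad_gen x (0 # y) g = pad_gen x y g" for g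
    by (cases g; simp)+
  then show "pad (0 # x) y = pad x y" "pad (x @ [0]) y = pad x y" "pad x (0 # y) = pad x y"
    by (simp_all add: pad_def cong: map_cong)
qed

lemma q_pad:
  assumes "pl x" "pl y"
  shows "0 < k \<Longrightarrow> 0 < l \<Longrightarrow> q (pad x y (merge k l)) = L x (Merge k l) y"
    "0 < k \<Longrightarrow> 0 < l \<Longrightarrow> q (pad x y (split k l)) = L x (Split k l) y"
    "0 < k \<Longrightarrow> q (pad x y (dot k)) = L x (Dot k) y"
    "q (pad x y (ident a)) = J (x @ erase a @ y)"
  using assms
  by (simp_all add: merge_def split_def dot_def ident_def pad_bas L_def J_def erase_pl)

lemma q_bas: "q (pad x y (f * g)) = q (pad x y f) * q (pad x y g)" "q (pad x y (f + g)) = q (pad x y f) + q (pad x y g)"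
   "q (pad x y (f - g)) = q (pad x y f) - q (pad x y g)" "q (pad x y (scl c f)) = cq c * q (pad x y f)"
   "q (pad x y (pad u v f)) = q (pad (x @ u) (v @ y) f)"
  by (simp_all add: pad_simps q_simps q_scl)

lemma L_merge_assoc:
  assumes "pl x" "pl y" "0 < h" "0 < k" "0 < l"
  shows "L x (Merge (h + k) l) y * L x (Merge h k) (l # y) = L x (Merge h (k + l)) y * L (x @ [h]) (Merge k l) y"
  using q_local[OF local_relation.merge_assoc[of h k l], of x y] assms
  by (simp add: q_bas q_pad)

lemma L_split_assoc:
  assumes "pl x" "pl y" "0 < h" "0 < k" "0 < l"
  shows "L (x @ [h]) (Split k l) y * L x (Split h (k + l)) y = L x (Split h k) (l # y) * L x (Split (h + k) l) y"
  using q_local[OF local_relation.split_assoc[of h k l], of x y] assms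
  by (simp add: q_bas q_pad)

lemma L_merge_split:
  assumes "pl x" "pl y" "0 < k" "0 < l"
  shows "L x (Merge k l) y * L x (Split k l) y = cq (of_nat ((k + l) choose l)) * J (x @ (k + l) # y)"
  using q_local[OF local_relation.merge_split[of k l], of x y] assms
  by (simp add: q_bas q_pad)

lemma L_dot_dot:
  assumes "pl x" "pl y" "0 < k"
  shows "L x (Dot k) y * L x (Dot k) y = cq (of_nat k) * J (x @ k # y)"
  using q_local[OF local_relation.dot_dot[of k], of x y] assms
  by (simp add: q_bas q_pad)

lemma L_dot_merge:
  assumes "pl x" "pl y" "0 < k"
  shows "L x (Dot (Suc k)) y * L x (Merge 1 k) y = L x (Merge 1 k) y * (L x (Dot 1) (k # y) + L (x @ [1]) (Dot k) y)"
  using q_local[OF local_relation.dot_merge_left[of k], of x y] assms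
  by (simp add: q_bas q_pad distrib_left)

lemma L_dot_split:
  assumes "pl x" "pl y"
  shows "L x (Split 1 1) y * L x (Dot 2) y = (L x (Dot 1) (1 # y) + L (x @ [1]) (Dot 1) y) * L x (Split 1 1) y"
  using q_local[OF local_relation.dot_split_left[of 1], of x y] assms
  by (simp add: q_bas q_pad distrib_right numeral_2_eq_2)

text \<open>Twice the symmetrizer of two thin strands; the crossing will be
  \<open>T - 1\<close>.\<close>

definition T :: "nat list \<Rightarrow> nat list \<Rightarrow> wq" where
  "T x y = L x (Split 1 1) y * L x (Merge 1 1) y"

lemma T_dots:
  assumes "pl x" "pl y"
  shows "T x y - (L x (Dot 1) (1 # y) * L (x @ [1]) (Dot 1) y) * T x y * (L x (Dot 1) (1 # y) * L (x @ [1]) (Dot 1) y) =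
    cq 2 * J (x @ 1 # 1 # y)"
  using q_local[OF local_relation.dots_crossing, of x y] assms
  by (simp add: q_bas q_pad T_def mult.assoc)

text \<open>The relation \<open>EF - FE = 1 - n\<close> on \<open>(1, n)\<close>. In
  \<open>EF\<close> the first strand becomes empty, so that \<open>F\<close> is the merge and
  \<open>E\<close> the split. The relation expresses a split after a merge by thinner ones.\<close>

lemma split_merge_one:
  assumes "pl x" "pl y" "1 < n"
  shows "L x (Split 1 n) y * L x (Merge 1 n) y = cq (1 - of_nat n) * J (x @ 1 # n # y) +
     L (x @ [1]) (Merge 1 (n - 1)) y * T x ((n - 1) # y) * L (x @ [1]) (Split 1 (n - 1)) y"
  using q_local[OF local_relation.EF[of 1 n], of x y] assms
  by (simp add: ladder_E_def ladder_F_def q_bas q_pad pad_zero merge_def[of 0] split_def[of 0]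
      J_L L_J T_def mult.assoc algebra_simps)

text \<open>The same relation on \<open>(2, 1)\<close>, where the second strand becomes empty in
  \<open>FE\<close>. Comparison with the previous lemma for \<open>n = 2\<close> will give the braid
  relation.\<close>

lemma split_merge_two:
  assumes "pl x" "pl y"
  shows "L x (Split 2 1) y * L x (Merge 2 1) y = L x (Merge 1 1) (1 # y) * T (x @ [1]) y * L x (Split 1 1) (1 # y) - J (x @ 2 # 1 # y)"
  using q_local[OF local_relation.EF[of 2 1], of x y] assms
  by (simp add: ladder_E_def ladder_F_def q_bas q_pad pad_zero merge_def[of _ 0] split_def[of _ 0]
      J_L L_J T_def mult.assoc algebra_simps cq_simps numeral_2_eq_2)

section \<open>Full merges\<close>

abbreviation ones :: "nat \<Rightarrow> nat list" where "ones n \<equiv> replicate n 1"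

text \<open>Thin strands are added on the left, one at a time. For \<open>k = 1\<close> the value is
  an idempotent and not the unit of the ring, so that the idempotents of source and target are
  absorbed; the value for \<open>k = 0\<close> is a default.\<close>

fun mg :: "nat list \<Rightarrow> nat \<Rightarrow> nat list \<Rightarrow> wq" where
  "mg x 0 y = 1"
| "mg x (Suc 0) y = J (x @ [1] @ y)"
| "mg x (Suc (Suc k)) y = L x (Merge 1 (Suc k)) y * mg (x @ [1]) (Suc k) y"

text \<open>The rightmost strands are merged first, while everything to the left of them is still
  thin; this explains the context \<open>x @ ones k\<close> of the remaining factor.\<close>

fun ml :: "nat list \<Rightarrow> nat list \<Rightarrow> nat list \<Rightarrow> wq" where
  "ml x [] y = 1"
| "ml x (k # a) y = mg x k (a @ y) * ml (x @ ones k) a y"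

lemma ones_snoc: "replicate n z @ z # a = replicate (Suc n) z @ a" "replicate n z @ [z] = replicate (Suc n) z"
  by (simp_all add: replicate_app_Cons_same)

lemma mg_step: "0 < k \<Longrightarrow> mg x (Suc k) y = L x (Merge 1 k) y * mg (x @ [1]) k y"
  by (cases k) simp_all

lemma mg_induct [consumes 1, case_names one step]:
  assumes "0 < k" "\<And>x. P x 1" "\<And>x k. 0 < k \<Longrightarrow> P (x @ [1]) k \<Longrightarrow> P x (Suc k)"
  shows "P x k"
  using assms(1)
proof (induction k arbitrary: x)
  case (Suc k)
  then show ?case using assms(2,3) by (cases "k = 0") auto
qed simp

lemma J_mg: "0 < k \<Longrightarrow> pl x \<Longrightarrow> pl y \<Longrightarrow> J (x @ k # y) * mg x k y = mg x k y"
proof (induction x k rule: mg_induct)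
  case (step x k)
  then show ?case by (simp add: mg_step J_L)
qed (simp add: J_idem)

lemma mg_J: "0 < k \<Longrightarrow> pl x \<Longrightarrow> pl y \<Longrightarrow> mg x k y * J (x @ ones k @ y) = mg x k y"
proof (induction x k rule: mg_induct)
  case (step x k)
  then show ?case by (simp add: mg_step mult.assoc)
qed (simp add: J_idem)

lemma J_mg_commute: "0 < k \<Longrightarrow> pl x \<Longrightarrow> pl y \<Longrightarrow> J (x @ k # y) * mg x k y = mg x k y * J (x @ ones k @ y)"
  by (simp only: J_mg mg_J)

text \<open>Merges are even and lie beside \<open>g\<close>, so the superinterchange law applies
  without a sign, even if \<open>g\<close> is a dot.\<close>

lemma L_mg_right:
  assumes "0 < k" "sym_pos g" "pl x" "pl y" "pl z"
  shows "L x g (z @ k # y) * mg (x @ src g @ z) k y = mg (x @ tgt g @ z) k y * L x g (z @ ones k @ y)"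
  using assms
proof (induction z k rule: mg_induct)
  case (step z k)
  have "L x g (z @ Suc k # y) * mg (x @ src g @ z) (Suc k) y =
    L x g (z @ Suc k # y) * L (x @ src g @ z) (Merge 1 k) y * mg (x @ src g @ z @ [1]) k y"
    using step by (simp add: mg_step mult.assoc)
  also have "L x g (z @ Suc k # y) * L (x @ src g @ z) (Merge 1 k) y = L (x @ tgt g @ z) (Merge 1 k) y * L x g ((z @ [1]) @ k # y)"
    using L_interchange[of g "Merge 1 k" x z y] step by (simp add: koszul_one cq_simps)
  also have "\<dots> * mg (x @ src g @ z @ [1]) k y = L (x @ tgt g @ z) (Merge 1 k) y * (mg (x @ tgt g @ z @ [1]) k y * L x g ((z @ [1]) @ ones k @ y))"
    using step by (simp add: mult.assoc)
  also have "\<dots> = mg (x @ tgt g @ z) (Suc k) y * L x g (z @ ones (Suc k) @ y)"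
    using step by (simp add: mg_step mult.assoc)
  finally show ?case .
next
  case (one z)
  then show ?case by (simp add: L_J J_L)
qed

lemma L_mg_left:
  assumes "0 < k" "sym_pos g" "pl x" "pl y" "pl z"
  shows "L (x @ k # z) g y * mg x k (z @ src g @ y) = mg x k (z @ tgt g @ y) * L (x @ ones k @ z) g y"
  using assms
proof (induction x k rule: mg_induct)
  case (step x k)
  have p: "pl (src g)" "pl (tgt g)" using pl_sym step by blast+
  have "L (x @ Suc k # z) g y * mg x (Suc k) (z @ src g @ y) =
    L (x @ Suc k # z) g y * L x (Merge 1 k) (z @ src g @ y) * mg (x @ [1]) k (z @ src g @ y)"
    using step by (simp add: mg_step mult.assoc)
  also have "L (x @ Suc k # z) g y * L x (Merge 1 k) (z @ src g @ y) = L x (Merge 1 k) (z @ tgt g @ y) * L ((x @ [1]) @ k # z) g y"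
    using L_interchange[of "Merge 1 k" g x z y] step by (simp add: koszul_one cq_simps)
  also have "\<dots> * mg (x @ [1]) k (z @ src g @ y) = L x (Merge 1 k) (z @ tgt g @ y) * (mg (x @ [1]) k (z @ tgt g @ y) * L ((x @ [1]) @ ones k @ z) g y)"
    using step by (simp only: mult.assoc pl_simps) simp
  also have "\<dots> = mg x (Suc k) (z @ tgt g @ y) * L (x @ ones (Suc k) @ z) g y"
    using step by (simp add: mg_step mult.assoc)
  finally show ?case .
next
  case (one x)
  then show ?case using pl_sym[of g] by (simp add: L_J J_L)
qed

lemma ones_sum [simp]: "replicate a z @ replicate b z = replicate (a + b) z"
    "replicate a z @ replicate b z @ y = replicate (a + b) z @ y"
  by (simp_all add: replicate_add)

lemma ml_append: "ml x (a @ b) y = ml x a (b @ y) * ml (x @ ones (sum_list a)) b y"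
  by (induction a arbitrary: x) (simp_all add: mult.assoc)

lemma L_ml_right:
  assumes "sym_pos g" "pl x" "pl y" "pl z" "pl b"
  shows "L x g (z @ b @ y) * ml (x @ src g @ z) b y = ml (x @ tgt g @ z) b y * L x g (z @ ones (sum_list b) @ y)"
  using assms
proof (induction b arbitrary: z)
  case (Cons k b)
  have "L x g (z @ (k # b) @ y) * ml (x @ src g @ z) (k # b) y =
    (L x g (z @ k # b @ y) * mg (x @ src g @ z) k (b @ y)) * ml (x @ src g @ z @ ones k) b y"
    by (simp add: mult.assoc)
  also have "L x g (z @ k # b @ y) * mg (x @ src g @ z) k (b @ y) = mg (x @ tgt g @ z) k (b @ y) * L x g (z @ ones k @ b @ y)"
    using Cons by (intro L_mg_right) auto
  also have "\<dots> * ml (x @ src g @ z @ ones k) b y = mg (x @ tgt g @ z) k (b @ y) * (L x g ((z @ ones k) @ b @ y) * ml (x @ src g @ (z @ ones k)) b y)"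
    by (simp add: mult.assoc)
  also have "L x g ((z @ ones k) @ b @ y) * ml (x @ src g @ (z @ ones k)) b y = ml (x @ tgt g @ (z @ ones k)) b y * L x g ((z @ ones k) @ ones (sum_list b) @ y)"
    using Cons by (intro Cons.IH) auto
  finally show ?case by (simp add: mult.assoc)
qed simp

lemma L_ml_left:
  assumes "sym_pos g" "pl x" "pl y" "pl z" "pl b"
  shows "L (x @ b @ z) g y * ml x b (z @ src g @ y) = ml x b (z @ tgt g @ y) * L (x @ ones (sum_list b) @ z) g y"
  using assms
proof (induction b arbitrary: x)
  case (Cons k b)
  have "L (x @ (k # b) @ z) g y * ml x (k # b) (z @ src g @ y) =
    (L (x @ k # (b @ z)) g y * mg x k ((b @ z) @ src g @ y)) * ml (x @ ones k) b (z @ src g @ y)"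
    by (simp add: mult.assoc)
  also have "L (x @ k # (b @ z)) g y * mg x k ((b @ z) @ src g @ y) = mg x k ((b @ z) @ tgt g @ y) * L (x @ ones k @ (b @ z)) g y"
    using Cons by (intro L_mg_left) auto
  also have "\<dots> * ml (x @ ones k) b (z @ src g @ y) = mg x k ((b @ z) @ tgt g @ y) * (L ((x @ ones k) @ b @ z) g y * ml (x @ ones k) b (z @ src g @ y))"
    by (simp add: mult.assoc)
  also have "L ((x @ ones k) @ b @ z) g y * ml (x @ ones k) b (z @ src g @ y) = ml (x @ ones k) b (z @ tgt g @ y) * L ((x @ ones k) @ ones (sum_list b) @ z) g y"
    using Cons by (intro Cons.IH) auto
  finally show ?case by (simp add: mult.assoc)
qed simp

lemma J_ml_commute: "pl x \<Longrightarrow> pl y \<Longrightarrow> pl b \<Longrightarrow> J (x @ b @ y) * ml x b y = ml x b y * J (x @ ones (sum_list b) @ y)"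
proof (induction b arbitrary: x)
  case (Cons k b)
  then have "J (x @ (k # b) @ y) * ml x (k # b) y = (J (x @ k # (b @ y)) * mg x k (b @ y)) * ml (x @ ones k) b y"
    by (simp add: mult.assoc)
  also have "J (x @ k # (b @ y)) * mg x k (b @ y) = mg x k (b @ y) * J (x @ ones k @ (b @ y))"
    using Cons by (intro J_mg_commute) auto
  also have "\<dots> * ml (x @ ones k) b y = mg x k (b @ y) * (J ((x @ ones k) @ b @ y) * ml (x @ ones k) b y)"
    by (simp add: mult.assoc)
  also have "J ((x @ ones k) @ b @ y) * ml (x @ ones k) b y = ml (x @ ones k) b y * J ((x @ ones k) @ ones (sum_list b) @ y)"
    using Cons by (intro Cons.IH) auto
  finally show ?case by (simp add: mult.assoc)
qed simp

lemma J_ml: "a \<noteq> [] \<Longrightarrow> pl a \<Longrightarrow> J a * ml [] a [] = ml [] a []"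
proof (cases a)
  case (Cons k b)
  assume "pl a"
  then have "J (k # b) * mg [] k b = mg [] k b" using J_mg[of k "[]" b] by (simp add: Cons)
  then show ?thesis by (simp add: Cons flip: mult.assoc)
qed simp

lemma ml_J: "a \<noteq> [] \<Longrightarrow> pl a \<Longrightarrow> ml [] a [] * J (ones (sum_list a)) = ml [] a []"
  using J_ml_commute[of "[]" "[]" a] J_ml[of a] by simp

lemma T_ml_right:
  assumes "pl x" "pl y" "pl z" "pl b"
  shows "T x (z @ b @ y) * ml (x @ 1 # 1 # z) b y = ml (x @ 1 # 1 # z) b y * T x (z @ ones (sum_list b) @ y)"
  using L_ml_right[of "Merge 1 1" x y z b] L_ml_right[of "Split 1 1" x y z b] assms
  by (simp add: T_def mult.assoc) (simp flip: mult.assoc)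

section \<open>Webs between thin strands\<close>

text \<open>The webs on the leftmost \<open>N\<close> thin strands generated by \<open>T\<close> and dots, as functions of the strands
  to their right.\<close>

inductive_set BF :: "nat \<Rightarrow> (nat list \<Rightarrow> wq) set" for N :: nat where
  cross: "i + 2 + j = N \<Longrightarrow> (\<lambda>y. T (ones i) (ones j @ y)) \<in> BF N"
| dot: "i + 1 + j = N \<Longrightarrow> (\<lambda>y. L (ones i) (Dot 1) (ones j @ y)) \<in> BF N"
| id: "(\<lambda>y. J (ones N @ y)) \<in> BF N"
| scal: "\<beta> \<in> BF N \<Longrightarrow> (\<lambda>y. cq c * \<beta> y) \<in> BF N"
| add: "\<beta> \<in> BF N \<Longrightarrow> \<gamma> \<in> BF N \<Longrightarrow> (\<lambda>y. \<beta> y + \<gamma> y) \<in> BF N"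
| mult: "\<beta> \<in> BF N \<Longrightarrow> \<gamma> \<in> BF N \<Longrightarrow> (\<lambda>y. \<beta> y * \<gamma> y) \<in> BF N"

text \<open>The reason why elements of \<open>BF\<close> are functions of the strands on the right:
  the same web occurs beside the merged strands \<open>b\<close> and beside the thin ones.\<close>

lemma BF_slide: "\<beta> \<in> BF N \<Longrightarrow> pl y \<Longrightarrow> pl b \<Longrightarrow>
    \<beta> (b @ y) * ml (ones N) b y = ml (ones N) b y * \<beta> (ones (sum_list b) @ y)"
proof (induction arbitrary: rule: BF.induct)
  case (cross i j)
  have "ones N = ones i @ 1 # 1 # ones j" by (simp add: replicate_app_Cons_same flip: cross(1))
  then show ?case using T_ml_right[of "ones i" y "ones j" b] cross by simp
next
  case (dot i j)
  have "ones N = ones i @ 1 # ones j" by (simp add: replicate_app_Cons_same flip: dot(1))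
  then show ?case using L_ml_right[of "Dot 1" "ones i" y "ones j" b] dot by simp
next
  case id
  then show ?case using J_ml_commute[of "ones N" y b] by simp
next
  case (scal \<beta> c)
  then show ?case by (simp add: mult.assoc cq_left_commute)
next
  case (add \<beta> \<gamma>)
  then show ?case by (simp add: distrib_left distrib_right)
next
  case (mult \<beta> \<gamma>)
  then show ?case by (simp add: mult.assoc) (simp flip: mult.assoc)
qed

lemma BF_ones: "\<beta> \<in> BF N \<Longrightarrow> (\<lambda>y. \<beta> (ones m @ y)) \<in> BF (N + m)"
proof (induction rule: BF.induct)
  case (cross i j)
  then show ?case using BF.cross[of i "j + m" "N + m"] by simp
next
  case (dot i j)
  then show ?case using BF.dot[of i "j + m" "N + m"] by simp
next
  case id
  then show ?case using BF.id[of "N + m"] by simp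
qed (rule BF.intros; assumption)+

text \<open>By associativity, merging the results of two total merges is one total merge.\<close>

lemma merge_ml:
  assumes "0 < k" "0 < l" "pl x" "pl y"
  shows "L x (Merge k l) y * ml x [k, l] y = ml x [k + l] y"
proof -
  have "L x (Merge k l) y * (mg x k (l # y) * mg (x @ ones k) l y) = mg x (k + l) y"
    using assms
  proof (induction x k rule: mg_induct)
    case (step x k)
    have "L x (Merge (Suc k) l) y * L x (Merge 1 k) (l # y) = L x (Merge 1 (k + l)) y * L (x @ [1]) (Merge k l) y"
      using L_merge_assoc[of x y 1 k l] step by simp
    then have "L x (Merge (Suc k) l) y * (mg x (Suc k) (l # y) * mg (x @ ones (Suc k)) l y) =
      L x (Merge 1 (k + l)) y * (L (x @ [1]) (Merge k l) y * (mg (x @ [1]) k (l # y) * mg ((x @ [1]) @ ones k) l y))"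
      using step(1) by (simp add: mg_step flip: mult.assoc)
    then show ?case using step by (simp add: mg_step)
  next
    case (one x)
    then show ?case using J_L(2)
      by (simp add: mg_step mult.assoc[symmetric] L_J)
  qed
  then show ?thesis by (simp add: mult.assoc)
qed

text \<open>By the Leibniz rule a dot on the merged strand becomes the sum of the dots on the thin
  strands below.\<close>

lemma dot_ml:
  assumes "0 < k"
  shows "\<exists>\<beta>\<in>BF (p + k). \<forall>y. pl y \<longrightarrow> L (ones p) (Dot k) y * ml (ones p) [k] y = ml (ones p) [k] y * \<beta> y"
  using assms
proof (induction k arbitrary: p)
  case (Suc k)
  show ?case
  proof (cases "k = 0")
    case True
    show ?thesis
      by (rule bexI[OF _ BF.dot[of p 0 "p + Suc k"]]) (use True in \<open>auto simp: L_J J_L\<close>)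
  next
    case False
    then obtain \<beta> where \<beta>: "\<beta> \<in> BF (Suc p + k)"
      "\<And>y. pl y \<Longrightarrow> L (ones (Suc p)) (Dot k) y * mg (ones (Suc p)) k y = mg (ones (Suc p)) k y * \<beta> y"
      using Suc.IH[of "Suc p"] by auto
    have "L (ones p) (Dot (Suc k)) y * mg (ones p) (Suc k) y =
       mg (ones p) (Suc k) y * (L (ones p) (Dot 1) (ones k @ y) + \<beta> y)" if y: "pl y" for y
    proof -
      have 1: "L (ones p) (Dot (Suc k)) y * L (ones p) (Merge 1 k) y =
         L (ones p) (Merge 1 k) y * (L (ones p) (Dot 1) (k # y) + L (ones (Suc p)) (Dot k) y)"
        using L_dot_merge[of "ones p" y k] False y by (simp only: pl_simps ones_snoc append_Nil2, simp?)
      have 2: "L (ones p) (Dot 1) (k # y) * mg (ones (Suc p)) k y = mg (ones (Suc p)) k y * L (ones p) (Dot 1) (ones k @ y)"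
        using L_mg_right[of k "Dot 1" "ones p" y "[]"] False y by (simp only: ones_snoc src.simps tgt.simps append_Nil append_Nil2 pl_simps, simp?)
      have "L (ones p) (Dot (Suc k)) y * mg (ones p) (Suc k) y =
        (L (ones p) (Dot (Suc k)) y * L (ones p) (Merge 1 k) y) * mg (ones (Suc p)) k y"
        using False by (simp only: mg_step ones_snoc append_Nil2 mult.assoc, simp?)
      also have "\<dots> = L (ones p) (Merge 1 k) y * (mg (ones (Suc p)) k y * (L (ones p) (Dot 1) (ones k @ y) + \<beta> y))"
        unfolding 1 by (simp only: mult.assoc distrib_left distrib_right 2 \<beta>(2)[OF y])
      finally show ?thesis using False by (simp only: mg_step ones_snoc append_Nil2 mult.assoc, simp?)
    qed
    moreover have "(\<lambda>y. L (ones p) (Dot 1) (ones k @ y) + \<beta> y) \<in> BF (p + Suc k)"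
    proof -
      have "(\<lambda>y. L (ones p) (Dot 1) (ones k @ y)) \<in> BF (p + Suc k)" by (rule BF.dot) simp
      moreover have "\<beta> \<in> BF (p + Suc k)" using \<beta>(1) by simp
      ultimately show ?thesis by (rule BF.add)
    qed
    ultimately show ?thesis
      by (intro bexI[of _ "\<lambda>y. L (ones p) (Dot 1) (ones k @ y) + \<beta> y"]) simp_all
  qed
qed simp

lemma BF_sum: "\<beta> \<in> BF N \<Longrightarrow> \<gamma> \<in> BF N \<Longrightarrow> (\<lambda>y. cq c * \<beta> y + \<gamma> y) \<in> BF N"
  by (intro BF.add BF.scal)

text \<open>Each use of \<open>split_merge_one\<close> leaves, below the smaller total merge,
  \<open>1 - n\<close> times the identity plus \<open>T\<close> on the first two strands on top of
  the web for one strand less.\<close>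

lemma split_one_mg:
  assumes "0 < n"
  shows "\<exists>\<beta>\<in>BF (p + Suc n). \<forall>y. pl y \<longrightarrow>
    L (ones p) (Split 1 n) y * mg (ones p) (Suc n) y = mg (ones (Suc p)) n y * \<beta> y"
  using assms
proof (induction n arbitrary: p)
  case (Suc m)
  show ?case
  proof (cases "m = 0")
    case True
    have "L (ones p) (Split 1 1) y * mg (ones p) 2 y = mg (ones (Suc p)) 1 y * T (ones p) y" if "pl y" for y
      using that by (simp add: numeral_2_eq_2 T_def L_J J_L replicate_app_Cons_same flip: mult.assoc)
    moreover have "(\<lambda>y. T (ones p) (ones 0 @ y)) \<in> BF (p + 2)" by (rule BF.cross) simp
    ultimately show ?thesis
      by (intro bexI[of _ "\<lambda>y. T (ones p) y"]) (simp_all add: True numeral_2_eq_2)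
  next
    case False
    let ?n = "Suc m"
    obtain \<beta> where \<beta>: "\<beta> \<in> BF (Suc p + Suc m)"
      "\<And>y. pl y \<Longrightarrow> L (ones (Suc p)) (Split 1 m) y * mg (ones (Suc p)) (Suc m) y = mg (ones (Suc (Suc p))) m y * \<beta> y"
      using Suc.IH[of "Suc p"] False by auto
    have eq: "L (ones p) (Split 1 ?n) y * mg (ones p) (Suc ?n) y =
        mg (ones (Suc p)) ?n y * (cq (1 - of_nat ?n) * J (ones (p + Suc ?n) @ y) + T (ones p) (ones m @ y) * \<beta> y)"
      if y: "pl y" for y
    proof -
      let ?M = "mg (ones (Suc p)) ?n y"
      have 1: "L (ones p) (Split 1 ?n) y * L (ones p) (Merge 1 ?n) y = cq (1 - of_nat ?n) * J (ones (Suc p) @ ?n # y) +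
         L (ones (Suc p)) (Merge 1 m) y * T (ones p) (m # y) * L (ones (Suc p)) (Split 1 m) y"
        using split_merge_one[of "ones p" y ?n] False y by (simp add: ones_snoc append_Nil2)
      have 2: "T (ones p) (m # y) * mg (ones (Suc (Suc p))) m y = mg (ones (Suc (Suc p))) m y * T (ones p) (ones m @ y)"
        using T_ml_right[of "ones p" y "[]" "[m]"] y False by (simp add: ones_snoc append_Nil2)
      have 3: "?M = L (ones (Suc p)) (Merge 1 m) y * mg (ones (Suc (Suc p))) m y"
        using False by (simp only: mg_step ones_snoc append_Nil2, simp?)
      have 4: "J (ones (Suc p) @ ?n # y) * ?M = ?M * J (ones (p + Suc ?n) @ y)"
        using J_mg_commute[of ?n "ones (Suc p)" y] y by (simp add: replicate_app_Cons_same)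
      have "L (ones p) (Split 1 ?n) y * mg (ones p) (Suc ?n) y = (L (ones p) (Split 1 ?n) y * L (ones p) (Merge 1 ?n) y) * ?M"
        by (simp only: mg_step zero_less_Suc ones_snoc append_Nil2 mult.assoc)
      also have "\<dots> = cq (1 - of_nat ?n) * (J (ones (Suc p) @ ?n # y) * ?M) +
         L (ones (Suc p)) (Merge 1 m) y * (T (ones p) (m # y) * (L (ones (Suc p)) (Split 1 m) y * ?M))"
        unfolding 1 by (simp only: distrib_right mult.assoc)
      also have "L (ones (Suc p)) (Split 1 m) y * ?M = mg (ones (Suc (Suc p))) m y * \<beta> y"
        using \<beta>(2)[OF y] .
      also have "T (ones p) (m # y) * (mg (ones (Suc (Suc p))) m y * \<beta> y) = mg (ones (Suc (Suc p))) m y * (T (ones p) (ones m @ y) * \<beta> y)"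
        by (simp only: 2 mult.assoc[symmetric])
      also have "L (ones (Suc p)) (Merge 1 m) y * (mg (ones (Suc (Suc p))) m y * (T (ones p) (ones m @ y) * \<beta> y)) =
         ?M * (T (ones p) (ones m @ y) * \<beta> y)"
        by (simp only: 3 mult.assoc)
      also have "J (ones (Suc p) @ ?n # y) * ?M = ?M * J (ones (p + Suc ?n) @ y)" by (rule 4)
      finally show ?thesis by (simp only: distrib_left cq_left_commute)
    qed
    have mem: "(\<lambda>y. cq (1 - of_nat ?n) * J (ones (p + Suc ?n) @ y) + T (ones p) (ones m @ y) * \<beta> y) \<in> BF (p + Suc ?n)"
    proof -
      have "(\<lambda>y. T (ones p) (ones m @ y)) \<in> BF (p + Suc ?n)" by (rule BF.cross) simp
      moreover have "\<beta> \<in> BF (p + Suc ?n)" using \<beta>(1) by simp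
      ultimately show ?thesis by (intro BF.add[OF BF.scal[OF BF.id] BF.mult])
    qed
    show ?thesis by (rule bexI[OF _ mem]) (intro allI impI, rule eq)
  qed
qed simp

text \<open>Splitting the left part of \<open>(k + 1, l)\<close> once more into
  \<open>(1, k)\<close> and merging it again costs the factor \<open>k + 1\<close>. By
  coassociativity the thin strand can then be split off first, and the induction hypothesis handles
  the rest. The factor is divided out at the end.\<close>

lemma split_mg:
  assumes "0 < k" "0 < l"
  shows "\<exists>\<beta>\<in>BF (p + (k + l)). \<forall>y. pl y \<longrightarrow>
    L (ones p) (Split k l) y * mg (ones p) (k + l) y = mg (ones p) k (l # y) * mg (ones (p + k)) l y * \<beta> y"
  using assms(1)
proof (induction k arbitrary: p)
  case (Suc k)
  show ?case
  proof (cases "k = 0")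
    case True
    obtain \<beta> where \<beta>: "\<beta> \<in> BF (p + Suc l)"
      "\<And>y. pl y \<Longrightarrow> L (ones p) (Split 1 l) y * mg (ones p) (Suc l) y = mg (ones (Suc p)) l y * \<beta> y"
      using split_one_mg[OF assms(2), of p] by blast
    have "mg (ones p) 1 (l # y) * (mg (ones (Suc p)) l y * z) = mg (ones (Suc p)) l y * z" if "pl y" for y z
      using J_mg[of l "ones (Suc p)" y] that assms(2) by (simp add: replicate_app_Cons_same flip: mult.assoc)
    then show ?thesis using \<beta> True by (intro bexI[of _ \<beta>]) (simp_all add: mult.assoc)
  next
    case False
    obtain \<beta> where \<beta>: "\<beta> \<in> BF (Suc p + (k + l))"
      "\<And>y. pl y \<Longrightarrow> L (ones (Suc p)) (Split k l) y * mg (ones (Suc p)) (k + l) y = mg (ones (Suc p)) k (l # y) * mg (ones (Suc p + k)) l y * \<beta> y"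
      using Suc.IH[of "Suc p"] False by auto
    obtain \<gamma> where \<gamma>: "\<gamma> \<in> BF (p + Suc (k + l))"
      "\<And>y. pl y \<Longrightarrow> L (ones p) (Split 1 (k + l)) y * mg (ones p) (Suc (k + l)) y = mg (ones (Suc p)) (k + l) y * \<gamma> y"
      using split_one_mg[of "k + l" p] assms(2) by auto
    let ?c = "cq (1 / of_nat (Suc k))"
    have eq: "L (ones p) (Split (Suc k) l) y * mg (ones p) (Suc k + l) y =
        mg (ones p) (Suc k) (l # y) * mg (ones (p + Suc k)) l y * (?c * (\<beta> y * \<gamma> y))" if y: "pl y" for y
    proof -
      let ?X = "L (ones p) (Split (Suc k) l) y * mg (ones p) (Suc k + l) y"
      have 1: "L (ones p) (Merge 1 k) (l # y) * L (ones p) (Split 1 k) (l # y) = cq (of_nat (Suc k)) * J (ones p @ Suc k # l # y)"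
        using L_merge_split[of "ones p" "l # y" 1 k] y assms(2) False by simp
      have 2: "L (ones p) (Split 1 k) (l # y) * L (ones p) (Split (Suc k) l) y = L (ones (Suc p)) (Split k l) y * L (ones p) (Split 1 (k + l)) y"
        using L_split_assoc[of "ones p" y 1 k l] y assms(2) False by (simp add: ones_snoc append_Nil2)
      have "cq (of_nat (Suc k)) * ?X = (L (ones p) (Merge 1 k) (l # y) * L (ones p) (Split 1 k) (l # y)) * ?X"
        unfolding 1 using J_L[of "Split (Suc k) l" "ones p" y] y assms(2) by (simp add: mult.assoc)
      also have "\<dots> = L (ones p) (Merge 1 k) (l # y) * (L (ones p) (Split 1 k) (l # y) * L (ones p) (Split (Suc k) l) y) * mg (ones p) (Suc k + l) y"
        by (simp only: mult.assoc)
      also have "\<dots> = L (ones p) (Merge 1 k) (l # y) * (L (ones (Suc p)) (Split k l) y * (L (ones p) (Split 1 (k + l)) y * mg (ones p) (Suc (k + l)) y))"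
        unfolding 2 by (simp add: mult.assoc)
      also have "\<dots> = L (ones p) (Merge 1 k) (l # y) * ((L (ones (Suc p)) (Split k l) y * mg (ones (Suc p)) (k + l) y) * \<gamma> y)"
        unfolding \<gamma>(2)[OF y] by (simp only: mult.assoc)
      also have "\<dots> = (L (ones p) (Merge 1 k) (l # y) * mg (ones (Suc p)) k (l # y)) * mg (ones (Suc p + k)) l y * (\<beta> y * \<gamma> y)"
        unfolding \<beta>(2)[OF y] by (simp only: mult.assoc)
      also have "L (ones p) (Merge 1 k) (l # y) * mg (ones (Suc p)) k (l # y) = mg (ones p) (Suc k) (l # y)"
        using False by (simp only: mg_step ones_snoc append_Nil2, simp?)
      finally have "?c * (cq (of_nat (Suc k)) * ?X) = ?c * (mg (ones p) (Suc k) (l # y) * mg (ones (Suc p + k)) l y * (\<beta> y * \<gamma> y))"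
        by (rule arg_cong)
      moreover have "?c * (cq (of_nat (Suc k)) * ?X) = ?X"
        by (rule cq_inverse) (simp del: of_nat_Suc)
      ultimately have "?X = ?c * (mg (ones p) (Suc k) (l # y) * mg (ones (Suc p + k)) l y * (\<beta> y * \<gamma> y))"
        by (rule trans[OF sym, rotated])
      then show ?thesis by (simp only: cq_left_commute[of "mg _ _ _ * mg _ _ _"] add_Suc_right add_Suc)
    qed
    have mem: "(\<lambda>y. ?c * (\<beta> y * \<gamma> y)) \<in> BF (p + (Suc k + l))"
    proof -
      have "\<beta> \<in> BF (p + (Suc k + l))" "\<gamma> \<in> BF (p + (Suc k + l))" using \<beta>(1) \<gamma>(1) by simp_all
      then show ?thesis by (rule BF.scal[OF BF.mult])
    qed
    show ?thesis by (rule bexI[OF _ mem]) (intro allI impI, rule eq)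
  qed
qed simp

lemma sym_ml:
  assumes "sym_pos g"
  shows "\<exists>\<beta>\<in>BF (p + sum_list (src g)). \<forall>y. pl y \<longrightarrow>
    L (ones p) g y * ml (ones p) (src g) y = ml (ones p) (tgt g) y * \<beta> y"
proof (cases g)
  case (Merge k l)
  have "L (ones p) g y * ml (ones p) (src g) y = ml (ones p) (tgt g) y * J (ones (p + (k + l)) @ y)" if "pl y" for y
    using merge_ml[of k l "ones p" y] mg_J[of "k + l" "ones p" y] that assms Merge by simp
  then show ?thesis
    by (intro bexI[of _ "\<lambda>y. J (ones (p + (k + l)) @ y)"], unfold Merge src.simps tgt.simps)
      (simp del: ml.simps, simp only: sum_list.Cons sum_list.Nil add_0_right BF.id)
next
  case (Split k l)
  then obtain \<beta> where "\<beta> \<in> BF (p + (k + l))" "\<forall>y. pl y \<longrightarrow>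
    L (ones p) (Split k l) y * mg (ones p) (k + l) y = mg (ones p) k (l # y) * mg (ones (p + k)) l y * \<beta> y"
    using split_mg[of k l p] assms by auto
  then show ?thesis by (intro bexI[of _ \<beta>]) (simp_all add: Split)
next
  case (Dot k)
  then show ?thesis using dot_ml[of k p] assms by simp
qed

text \<open>The total merges left of \<open>g\<close> are slid past it, and those right of it past
  the thin web that \<open>g\<close> becomes. In between, \<open>g\<close> meets only the total
  merge of its own source.\<close>

theorem L_ml:
  assumes "sym_pos g" "pl x" "pl y"
  shows "\<exists>\<beta>\<in>BF (sum_list (x @ src g @ y)).
    L x g y * ml [] (x @ src g @ y) [] = ml [] (x @ tgt g @ y) [] * \<beta> []"
proof -
  let ?p = "sum_list x" and ?n = "sum_list (src g)"
  obtain \<beta> where \<beta>: "\<beta> \<in> BF (?p + ?n)"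
    "\<And>y. pl y \<Longrightarrow> L (ones ?p) g y * ml (ones ?p) (src g) y = ml (ones ?p) (tgt g) y * \<beta> y"
    using sym_ml[OF assms(1), of ?p] by blast
  have "L x g y * ml [] (x @ src g @ y) [] =
    (L x g y * ml [] x (src g @ y)) * ml (ones ?p) (src g) y * ml (ones (?p + ?n)) y []"
    by (simp add: ml_append mult.assoc)
  also have "L x g y * ml [] x (src g @ y) = ml [] x (tgt g @ y) * L (ones ?p) g y"
    using L_ml_left[OF assms(1), of "[]" y "[]" x] assms by simp
  also have "\<dots> * ml (ones ?p) (src g) y * ml (ones (?p + ?n)) y [] =
     ml [] x (tgt g @ y) * ml (ones ?p) (tgt g) y * (\<beta> y * ml (ones (?p + ?n)) y [])"
    using \<beta>(2)[OF assms(3)] by (simp only: mult.assoc)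
  also have "\<beta> y * ml (ones (?p + ?n)) y [] = ml (ones (?p + ?n)) y [] * \<beta> (ones (sum_list y))"
    using BF_slide[OF \<beta>(1), of "[]" y] assms by simp
  finally have "L x g y * ml [] (x @ src g @ y) [] = ml [] (x @ tgt g @ y) [] * \<beta> (ones (sum_list y) @ [])"
    by (simp add: ml_append mult.assoc sum_src)
  moreover have "(\<lambda>y'. \<beta> (ones (sum_list y) @ y')) \<in> BF (sum_list (x @ src g @ y))"
    using BF_ones[OF \<beta>(1), of "sum_list y"] by (simp add: add.assoc)
  ultimately show ?thesis by (intro bexI) simp_all
qed

section \<open>Right inverses of total merges\<close>

definition even_webs :: "nat \<Rightarrow> wq set" where
  "even_webs r = {q f | f. keys f \<subseteq> lists (web_gens r) \<and> f \<in> homogeneous gen_parity 0}"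

lemma word_parity_append: "word_parity par (u @ v) = word_parity par u + word_parity par v"
  by (simp add: word_parity_def)

lemma homogeneous_mult:
  assumes "f \<in> homogeneous par p" "g \<in> homogeneous par p'"
  shows "f * g \<in> homogeneous par (p + p')"
  using keys_mult[of f g] assms by (fastforce simp: homogeneous_def plus_list_def word_parity_append)

lemma homogeneous_linear:
  "0 \<in> homogeneous par p" "f \<in> homogeneous par p \<Longrightarrow> g \<in> homogeneous par p \<Longrightarrow> f + g \<in> homogeneous par p"
  "f \<in> homogeneous par p \<Longrightarrow> scl c f \<in> homogeneous par p"
  using keys_add[of f g] keys_scl[of c f] by (auto simp: homogeneous_def)

lemma even_webs_mult: "z \<in> even_webs r \<Longrightarrow> w \<in> even_webs r \<Longrightarrow> z * w \<in> even_webs r"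
proof -
  assume "z \<in> even_webs r" "w \<in> even_webs r"
  then obtain f g where fg: "z = q f" "w = q g" "keys f \<subseteq> lists (web_gens r)" "keys g \<subseteq> lists (web_gens r)"
    "f \<in> homogeneous gen_parity 0" "g \<in> homogeneous gen_parity 0" by (auto simp: even_webs_def)
  have "f * g \<in> homogeneous gen_parity 0" using homogeneous_mult[OF fg(5,6)] by simp
  then show ?thesis using fg keys_mult_lists[OF fg(3,4)] unfolding even_webs_def
    by (intro CollectI exI[of _ "f * g"]) (simp add: q_simps)
qed

lemma even_webs_cq: "z \<in> even_webs r \<Longrightarrow> cq c * z \<in> even_webs r"
proof -
  assume "z \<in> even_webs r"
  then obtain f where f: "z = q f" "keys f \<subseteq> lists (web_gens r)" "f \<in> homogeneous gen_parity 0"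
    by (auto simp: even_webs_def)
  then show ?thesis using keys_scl[of c f] homogeneous_linear(3) unfolding even_webs_def
    by (intro CollectI exI[of _ "scl c f"]) (auto simp: q_scl)
qed

lemma even_webs_one: "1 \<in> even_webs r"
  unfolding even_webs_def
  by (intro CollectI exI[of _ 1]) (auto simp: q_simps homogeneous_def word_parity_def zero_list_def)

lemma even_webs_J: "pl a \<Longrightarrow> a \<noteq> [] \<Longrightarrow> r = sum_list a \<Longrightarrow> J a \<in> even_webs r"
  unfolding even_webs_def J_def
  by (intro CollectI exI[of _ "bas [Idm a]"]) (auto simp: homogeneous_def word_parity_def web_gens_def compositions_pl)

lemma even_webs_L: "sym_pos g \<Longrightarrow> sym_parity g = 0 \<Longrightarrow> pl x \<Longrightarrow> pl y \<Longrightarrow> r = sum_list (x @ src g @ y) \<Longrightarrow> L x g y \<in> even_webs r"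
  unfolding even_webs_def L_def
  by (intro CollectI exI[of _ "bas [Layer x g y]"])
    (auto simp: homogeneous_def word_parity_def web_gens_def compositions_pl pl_sym sum_src)

lemma even_webs_mg: "0 < k \<Longrightarrow> pl x \<Longrightarrow> pl y \<Longrightarrow> r = sum_list (x @ k # y) \<Longrightarrow> mg x k y \<in> even_webs r"
proof (induction x k rule: mg_induct)
  case (one x)
  then show ?case by (simp add: even_webs_J)
next
  case (step x k)
  then show ?case by (simp add: mg_step) (intro even_webs_mult even_webs_L step.IH; simp)
qed

lemma sum_list_ones [simp]: "sum_list (replicate n (Suc 0)) = n"
  by (simp add: sum_list_replicate)

lemma even_webs_ml: "pl x \<Longrightarrow> pl y \<Longrightarrow> pl b \<Longrightarrow> r = sum_list (x @ b @ y) \<Longrightarrow> ml x b y \<in> even_webs r"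
proof (induction b arbitrary: x)
  case (Cons k b)
  show ?case unfolding ml.simps
    by (rule even_webs_mult[OF even_webs_mg Cons.IH]) (use Cons.prems in simp_all)
qed (simp add: even_webs_one)

text \<open>A merge after a split of one thin strand is a nonzero multiple of the identity, so the
  rescaled splits in reverse order are a right inverse. It is kept as an even web of size
  \<open>r\<close>, since it must later act on vectors without changing parity.\<close>

lemma mg_right_inverse:
  assumes "0 < k" "pl x" "pl y" "r = sum_list (x @ k # y)"
  shows "\<exists>R\<in>even_webs r. mg x k y * R = J (x @ k # y)"
  using assms
proof (induction x k rule: mg_induct)
  case (one x)
  then show ?case by (intro bexI[of _ "J (x @ 1 # y)"]) (simp_all add: J_idem even_webs_J)
next
  case (step x k)
  then obtain R where R: "R \<in> even_webs r" "mg (x @ [1]) k y * R = J (x @ 1 # k # y)" by auto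
  let ?R = "R * (cq (1 / of_nat (Suc k)) * L x (Split 1 k) y)"
  have "mg x (Suc k) y * ?R = cq (1 / of_nat (Suc k)) * (L x (Merge 1 k) y * ((mg (x @ [1]) k y * R) * L x (Split 1 k) y))"
    using step by (simp only: mg_step cq_left_commute[of R] cq_left_commute[of "L x (Merge 1 k) y"] cq_left_commute[of "mg (x @ [1]) k y"] mult.assoc)
  also have "\<dots> = cq (1 / of_nat (Suc k)) * (cq (of_nat (Suc k)) * J (x @ Suc k # y))"
    using step L_merge_split[of x y 1 k] unfolding R(2) by (simp add: J_L del: of_nat_Suc)
  also have "\<dots> = J (x @ Suc k # y)"
    by (rule cq_inverse) (simp del: of_nat_Suc)
  finally have "mg x (Suc k) y * ?R = J (x @ Suc k # y)" .
  moreover have "?R \<in> even_webs r"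
    using step by (intro even_webs_mult even_webs_cq even_webs_L R) simp_all
  ultimately show ?case by blast
qed

lemma ml_right_inverse:
  assumes "a \<noteq> []" "pl a" "pl x" "r = sum_list (x @ a)"
  shows "\<exists>R\<in>even_webs r. ml x a [] * R = J (x @ a)"
  using assms
proof (induction a arbitrary: x)
  case (Cons k b)
  then obtain R where R: "R \<in> even_webs r" "mg x k b * R = J (x @ k # b)"
    using mg_right_inverse[of k x b r] by auto
  show ?case
  proof (cases "b = []")
    case True
    then show ?thesis using R by auto
  next
    case False
    then obtain S where S: "S \<in> even_webs r" "ml (x @ ones k) b [] * S = J ((x @ ones k) @ b)"
      using Cons.IH[of "x @ ones k"] Cons.prems by auto
    have "ml x (k # b) [] * (S * R) = mg x k b * (ml (x @ ones k) b [] * S) * R"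
      by (simp add: mult.assoc)
    also have "\<dots> = J (x @ k # b)"
      unfolding S(2) using mg_J[of k x b] Cons.prems R(2) by simp
    finally show ?thesis using even_webs_mult[OF S(1) R(1)] by blast
  qed
qed simp

section \<open>The Sergeev relations between thin strands\<close>

lemma slide_comp: "l * s = s' * l' \<Longrightarrow> l' * m = m' * l'' \<Longrightarrow> l * (s * m) = (s' * m') * l''" for l :: wq
  by (metis mult.assoc)

lemma L_T_right:
  assumes "sym_pos g" "pl x" "pl y" "pl z"
  shows "L (x @ 1 # 1 # z) g y * T x (z @ src g @ y) = T x (z @ tgt g @ y) * L (x @ 1 # 1 # z) g y"
  unfolding T_def
  by (rule slide_comp)
    (use L_interchange[of "Split 1 1" g x z y] L_interchange[of "Merge 1 1" g x z y] assms
      in \<open>simp_all add: koszul_one cq_simps\<close>)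

lemma L_T_left:
  assumes "sym_pos g" "pl x" "pl y" "pl z"
  shows "T (x @ tgt g @ z) y * L x g (z @ 1 # 1 # y) = L x g (z @ 1 # 1 # y) * T (x @ src g @ z) y"
proof -
  have "L x g (z @ 1 # 1 # y) * T (x @ src g @ z) y = T (x @ tgt g @ z) y * L x g (z @ 1 # 1 # y)"
    unfolding T_def
    by (rule slide_comp)
      (use L_interchange[of g "Split 1 1" x z y] L_interchange[of g "Merge 1 1" x z y] assms
        in \<open>simp_all add: koszul_one cq_simps\<close>)
  then show ?thesis by simp
qed

lemma T_T_commute:
  assumes "pl x" "pl y" "pl z"
  shows "T (x @ 1 # 1 # z) y * T x (z @ 1 # 1 # y) = T x (z @ 1 # 1 # y) * T (x @ 1 # 1 # z) y"
proof -
  have "L (x @ 1 # 1 # z) (Split 1 1) y * T x (z @ 2 # y) = T x (z @ 1 # 1 # y) * L (x @ 1 # 1 # z) (Split 1 1) y"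
    "L (x @ 1 # 1 # z) (Merge 1 1) y * T x (z @ 1 # 1 # y) = T x (z @ 2 # y) * L (x @ 1 # 1 # z) (Merge 1 1) y"
    using L_T_right[of "Split 1 1" x y z] L_T_right[of "Merge 1 1" x y z] assms by (simp_all add: numeral_2_eq_2)
  then have "L (x @ 1 # 1 # z) (Split 1 1) y * (L (x @ 1 # 1 # z) (Merge 1 1) y * T x (z @ 1 # 1 # y)) =
      T x (z @ 1 # 1 # y) * (L (x @ 1 # 1 # z) (Split 1 1) y * L (x @ 1 # 1 # z) (Merge 1 1) y)"
    by (metis mult.assoc)
  then show ?thesis by (simp only: T_def[of "x @ 1 # 1 # z"] mult.assoc)
qed

text \<open>The merge after the split in the middle is the binomial coefficient 2. Hence
  \<open>T - 1\<close> is an involution.\<close>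

lemma T_square: "pl x \<Longrightarrow> pl y \<Longrightarrow> T x y * T x y = T x y + T x y"
proof -
  assume p: "pl x" "pl y"
  have "T x y * T x y = L x (Split 1 1) y * (L x (Merge 1 1) y * L x (Split 1 1) y) * L x (Merge 1 1) y"
    by (simp only: T_def mult.assoc)
  also have "\<dots> = cq 2 * (L x (Split 1 1) y * (J (x @ 2 # y) * L x (Merge 1 1) y))"
    using L_merge_split[of x y 1 1] p by (simp add: cq_left_commute[of "L _ _ _"] mult.assoc numeral_2_eq_2)
  also have "J (x @ 2 # y) * L x (Merge 1 1) y = L x (Merge 1 1) y"
    using p by (intro J_L) (simp_all add: numeral_2_eq_2)
  also have "cq 2 * (L x (Split 1 1) y * L x (Merge 1 1) y) = T x y + T x y"
    using cq_simps(3)[of 1 1] by (simp add: T_def cq_simps distrib_right mult_2)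
  finally show ?thesis .
qed

text \<open>Three thin strands are merged into one and split again. By associativity the last merge
  and the first split can be taken as \<open>(1, 2)\<close> or as \<open>(2, 1)\<close>; expanding
  them by the ladder relation gives the two sides.\<close>

lemma T_braid:
  assumes "pl x" "pl y"
  shows "T x (1 # y) * T (x @ [1]) y * T x (1 # y) - T x (1 # y) = T (x @ [1]) y * T x (1 # y) * T (x @ [1]) y - T (x @ [1]) y"
proof -
  let ?s = "L (x @ [1]) (Split 1 1) y" and ?m = "L (x @ [1]) (Merge 1 1) y"
  let ?s' = "L x (Split 1 1) (1 # y)" and ?m' = "L x (Merge 1 1) (1 # y)"
  have eq: "L x (Split 1 2) y * L x (Merge 1 2) y = ?m * T x (1 # y) * ?s - J (x @ 1 # 2 # y)"
    using split_merge_one[of x y 2] assms by (simp add: cq_simps)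
  have Jm: "J (x @ 1 # 2 # y) * ?m = ?m" using assms by (intro J_L) (simp_all add: numeral_2_eq_2)
  have Jm': "J (x @ 2 # 1 # y) * ?m' = ?m'" using assms by (intro J_L) (simp_all add: numeral_2_eq_2)
  have sa: "?s * L x (Split 1 2) y = ?s' * L x (Split 2 1) y"
    using L_split_assoc[of x y 1 1 1] assms by (simp add: numeral_2_eq_2)
  have ma: "L x (Merge 1 2) y * ?m = L x (Merge 2 1) y * ?m'"
    using L_merge_assoc[of x y 1 1 1] assms by (simp add: numeral_2_eq_2)
  have "?s * (L x (Split 1 2) y * L x (Merge 1 2) y) * ?m = T (x @ [1]) y * T x (1 # y) * T (x @ [1]) y - T (x @ [1]) y"
    unfolding eq right_diff_distrib left_diff_distrib mult.assoc Jm by (simp only: T_def[of "x @ [1]"] mult.assoc)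
  moreover have "?s * (L x (Split 1 2) y * L x (Merge 1 2) y) * ?m = ?s' * (L x (Split 2 1) y * L x (Merge 2 1) y) * ?m'"
    by (simp only: mult.assoc ma) (simp only: sa mult.assoc[symmetric])
  moreover have "?s' * (L x (Split 2 1) y * L x (Merge 2 1) y) * ?m' = T x (1 # y) * T (x @ [1]) y * T x (1 # y) - T x (1 # y)"
    unfolding split_merge_two[OF assms] right_diff_distrib left_diff_distrib mult.assoc Jm' by (simp only: T_def[of x] mult.assoc)
  ultimately show ?thesis by simp
qed

text \<open>The crossing is only known to commute with the sum of the dots and, up to a correction, with their
  product. Together this suffices to slide a single dot through it.\<close>

lemma slide_from_symmetric:
  fixes x y t e :: wq
  assumes e: "e * x = x" "x * e = x" "e * y = y" "y * e = y" "e * t = t" "t * e = t"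
    and sq: "x * x = e" "y * y = e" and anti: "y * x = - (x * y)"
    and sum: "t * (x + y) = (x + y) * t" and prod: "t - (x * y) * t * (x * y) = e + e"
  shows "t * x - x = y * t - y" "t * y - y = x * t - x"
proof -
  have xxw: "x * (x * w) = e * w" and yyw: "y * (y * w) = e * w" and yxw: "y * (x * w) = - (x * (y * w))" for w
    using sq anti by (simp_all flip: mult.assoc)
  have ew: "e * (x * w) = x * w" "e * (y * w) = y * w" "e * (t * w) = t * w" for w
    using e by (simp_all flip: mult.assoc)
  note S = sq xxw yyw yxw anti ew e mult.assoc
  \<comment> \<open>As \<open>x * y\<close> squares to \<open>- e\<close>, multiplying by it removes
    one of the two factors around \<open>t\<close>.\<close>
  have "(x * y) * (t - (x * y) * t * (x * y)) = (x * y) * (e + e)" by (simp only: prod)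
  then have 1: "x * (y * t) + t * (x * y) = x * y + x * y"
    by (simp add: S algebra_simps)
  then have "x * (x * (y * t) + t * (x * y)) = x * (x * y + x * y)" by (rule arg_cong)
  then have 2: "y * t + x * (t * (x * y)) = y + y"
    by (simp add: S distrib_left)
  have sum': "t * x + t * y = x * t + y * t" using sum by (simp add: distrib_left distrib_right)
  \<comment> \<open>The other symmetric relation, multiplied by \<open>x * y\<close> on the right,
    consists of the terms that the facts 2 and 4 evaluate; adding everything up gives twice the
    claim.\<close>
  have "(t * x + t * y) * (x * y) = (x * t + y * t) * (x * y)" by (simp only: sum')
  then have 3: "t * y - t * x = x * (t * (x * y)) + y * (t * (x * y))"
    by (simp add: S distrib_right)
  have "y * (x * (y * t) + t * (x * y)) = y * (x * y + x * y)" using 1 by (rule arg_cong)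
  then have 4: "y * (t * (x * y)) = x * t - x - x"
    by (simp add: S distrib_left algebra_simps)
  have group: "A + B - C - C = (D + D - B) + (A - E - E) \<Longrightarrow> (C - E) + (C - E) = (B - D) + (B - D)"
    for A B C D E :: wq by (simp add: algebra_simps)
  have "x * (t * (x * y)) = y + y - y * t" "t * y = x * t + y * t - t * x"
    using 2 sum' by (simp_all add: algebra_simps)
  then have "x * t + y * t - t * x - t * x = (y + y - y * t) + (x * t - x - x)"
    using 3 by (simp only: 4)
  then have "(t * x - x) + (t * x - x) = (y * t - y) + (y * t - y)" by (rule group)
  then show "t * x - x = y * t - y" by (rule wq_halve)
  then have tx: "t * x = y * t - y + x" by (simp add: algebra_simps)
  have ty: "t * y = x * t + y * t - t * x" using sum' by (simp add: algebra_simps)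
  show "t * y - y = x * t - x" unfolding ty tx by (simp add: algebra_simps)
qed

section \<open>Crossings and dots on \<open>r\<close> thin strands, numbered from 0\<close>

definition Tr :: "nat \<Rightarrow> nat \<Rightarrow> wq" where
  "Tr r i = T (ones i) (ones (r - Suc (Suc i)))"

definition Dr :: "nat \<Rightarrow> nat \<Rightarrow> wq" where
  "Dr r i = L (ones i) (Dot 1) (ones (r - Suc i))"

text \<open>The unit of the ring is subtracted, not the idempotent of the thin strands. So
  \<open>Sr r i\<close> is an involution in the whole ring, and products of crossings need no
  idempotents.\<close>

definition Sr :: "nat \<Rightarrow> nat \<Rightarrow> wq" where
  "Sr r i = Tr r i - 1"

lemma ones_split: "i < r \<Longrightarrow> ones r = ones i @ 1 # ones (r - Suc i)"
  "Suc i < r \<Longrightarrow> ones r = ones i @ 1 # 1 # ones (r - Suc (Suc i))"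
  by (simp_all add: replicate_app_Cons_same flip: replicate_Suc)

lemma Tr_J:
  assumes "Suc i < r"
  shows "J (ones r) * Tr r i = Tr r i" "Tr r i * J (ones r) = Tr r i"
proof -
  have e: "J (ones r) = J (ones i @ 1 # 1 # ones (r - Suc (Suc i)))"
    by (simp only: ones_split(2)[OF assms, symmetric])
  show "J (ones r) * Tr r i = Tr r i" "Tr r i * J (ones r) = Tr r i"
    unfolding e Tr_def T_def by (simp_all add: J_L L_J mult.assoc)
qed

lemma Dr_J:
  assumes "i < r"
  shows "J (ones r) * Dr r i = Dr r i" "Dr r i * J (ones r) = Dr r i"
proof -
  have e: "J (ones r) = J (ones i @ 1 # ones (r - Suc i))"
    by (simp only: ones_split(1)[OF assms, symmetric])
  show "J (ones r) * Dr r i = Dr r i" "Dr r i * J (ones r) = Dr r i"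
    unfolding e Dr_def by (simp_all add: J_L L_J)
qed

lemma Sr_J: "Suc i < r \<Longrightarrow> J (ones r) * Sr r i = Sr r i * J (ones r)"
  using Tr_J[of i r] by (simp add: Sr_def algebra_simps)

lemma Sr_square: "Suc i < r \<Longrightarrow> Sr r i * Sr r i = 1"
  using T_square[of "ones i" "ones (r - Suc (Suc i))"] by (simp add: Sr_def Tr_def algebra_simps)

lemma Sr_commute: "Suc i < j \<Longrightarrow> Suc j < r \<Longrightarrow> Sr r j * Sr r i = Sr r i * Sr r j"
proof -
  assume ij: "Suc i < j" "Suc j < r"
  let ?z = "ones (j - Suc (Suc i))" and ?y = "ones (r - Suc (Suc j))"
  have "ones j = ones i @ 1 # 1 # ?z" using ij by (intro ones_split(2)) simp
  moreover have "ones (r - Suc (Suc i)) = ?z @ 1 # 1 # ?y"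
  proof -
    have "r - Suc (Suc i) - Suc (Suc (j - Suc (Suc i))) = r - Suc (Suc j)" using ij by simp
    then show ?thesis using ones_split(2)[of "j - Suc (Suc i)" "r - Suc (Suc i)"] ij by simp
  qed
  ultimately have "Tr r j * Tr r i = Tr r i * Tr r j"
    using T_T_commute[of "ones i" ?y ?z] by (simp add: Tr_def)
  then show ?thesis by (simp add: Sr_def algebra_simps)
qed

lemma Sr_braid: "Suc (Suc i) < r \<Longrightarrow> Sr r (Suc i) * Sr r i * Sr r (Suc i) = Sr r i * Sr r (Suc i) * Sr r i"
proof -
  assume i: "Suc (Suc i) < r"
  then have "ones (r - Suc (Suc i)) = 1 # ones (r - Suc (Suc (Suc i)))"
    by (simp add: Suc_diff_Suc flip: replicate_Suc)
  moreover have "ones (Suc i) = ones i @ [1]" by (simp add: replicate_append_same)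
  ultimately have "Tr r i * Tr r (Suc i) * Tr r i - Tr r i = Tr r (Suc i) * Tr r i * Tr r (Suc i) - Tr r (Suc i)"
    using T_braid[of "ones i" "ones (r - Suc (Suc (Suc i)))"] unfolding Tr_def by simp
  moreover have "Tr r i * Tr r i = Tr r i + Tr r i" "Tr r (Suc i) * Tr r (Suc i) = Tr r (Suc i) + Tr r (Suc i)"
    unfolding Tr_def by (rule T_square; simp)+
  ultimately show ?thesis by (simp add: Sr_def algebra_simps)
qed

lemma Dr_square:
  assumes "i < r"
  shows "Dr r i * Dr r i = J (ones r)"
  unfolding ones_split(1)[OF assms] Dr_def
  using L_dot_dot[of "ones i" "ones (r - Suc i)" 1] by (simp add: cq_simps)

lemma Dr_anticommute_less: "i < j \<Longrightarrow> j < r \<Longrightarrow> Dr r j * Dr r i = - (Dr r i * Dr r j)"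
proof -
  assume ij: "i < j" "j < r"
  let ?z = "ones (j - Suc i)" and ?y = "ones (r - Suc j)"
  have "ones j = ones i @ 1 # ?z" using ij by (intro ones_split(1)) simp
  moreover have "ones (r - Suc i) = ?z @ 1 # ?y"
  proof -
    have "r - Suc i - Suc (j - Suc i) = r - Suc j" using ij by simp
    then show ?thesis using ones_split(1)[of "j - Suc i" "r - Suc i"] ij by simp
  qed
  ultimately show ?thesis
    using L_interchange[of "Dot 1" "Dot 1" "ones i" ?z ?y] by (simp add: Dr_def koszul_one cq_simps)
qed

lemma Dr_anticommute: "i \<noteq> j \<Longrightarrow> i < r \<Longrightarrow> j < r \<Longrightarrow> Dr r j * Dr r i = - (Dr r i * Dr r j)"
  using Dr_anticommute_less[of i j r] Dr_anticommute_less[of j i r] by (cases "i < j") auto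

lemma Sr_Dr_far:
  assumes "j \<noteq> i" "j \<noteq> Suc i" "Suc i < r" "j < r"
  shows "Sr r i * Dr r j = Dr r j * Sr r i"
proof -
  have "Tr r i * Dr r j = Dr r j * Tr r i"
  proof (cases "j < i")
    case True
    let ?z = "ones (i - Suc j)" and ?y = "ones (r - Suc (Suc i))"
    have "ones i = ones j @ 1 # ?z" using True by (rule ones_split(1))
    moreover have "ones (r - Suc j) = ?z @ 1 # 1 # ?y"
    proof -
      have "r - Suc j - Suc (Suc (i - Suc j)) = r - Suc (Suc i)" using True by simp
      then show ?thesis using ones_split(2)[of "i - Suc j" "r - Suc j"] True assms by simp
    qed
    ultimately show ?thesis
      using L_T_left[of "Dot 1" "ones j" ?y ?z] by (simp add: Dr_def Tr_def)
  next
    case False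
    then have ij: "Suc i < j" using assms by simp
    let ?z = "ones (j - Suc (Suc i))" and ?y = "ones (r - Suc j)"
    have "ones j = ones i @ 1 # 1 # ?z" using ij by (rule ones_split(2))
    moreover have "ones (r - Suc (Suc i)) = ?z @ 1 # ?y"
    proof -
      have "r - Suc (Suc i) - Suc (j - Suc (Suc i)) = r - Suc j" using ij by simp
      then show ?thesis using ones_split(1)[of "j - Suc (Suc i)" "r - Suc (Suc i)"] ij assms by simp
    qed
    ultimately show ?thesis
      using L_T_right[of "Dot 1" "ones i" ?y ?z] by (simp add: Dr_def Tr_def)
  qed
  then show ?thesis by (simp add: Sr_def algebra_simps)
qed

lemma Sr_Dr_near:
  assumes "Suc i < r"
  shows "Sr r i * Dr r i = Dr r (Suc i) * Sr r i" "Sr r i * Dr r (Suc i) = Dr r i * Sr r i"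
proof -
  let ?x = "ones i" and ?y = "ones (r - Suc (Suc i))"
  have o: "ones (r - Suc i) = 1 # ?y" using assms by (simp add: Suc_diff_Suc flip: replicate_Suc)
  have o': "ones (Suc i) = ?x @ [1]" by (simp add: replicate_append_same)
  have D: "Dr r i = L ?x (Dot 1) (1 # ?y)" "Dr r (Suc i) = L (?x @ [1]) (Dot 1) ?y"
    unfolding Dr_def o o' by simp_all
  have dm: "L ?x (Dot 2) ?y * L ?x (Merge 1 1) ?y = L ?x (Merge 1 1) ?y * (Dr r i + Dr r (Suc i))"
    using L_dot_merge[of ?x ?y 1] by (simp add: D numeral_2_eq_2)
  have ds: "L ?x (Split 1 1) ?y * L ?x (Dot 2) ?y = (Dr r i + Dr r (Suc i)) * L ?x (Split 1 1) ?y"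
    using L_dot_split[of ?x ?y] by (simp add: D)
  have "Tr r i * (Dr r i + Dr r (Suc i)) = L ?x (Split 1 1) ?y * (L ?x (Dot 2) ?y * L ?x (Merge 1 1) ?y)"
    unfolding dm by (simp only: Tr_def T_def mult.assoc)
  also have "\<dots> = (Dr r i + Dr r (Suc i)) * Tr r i"
    unfolding mult.assoc[symmetric] ds by (simp only: Tr_def T_def mult.assoc)
  finally have sum: "Tr r i * (Dr r i + Dr r (Suc i)) = (Dr r i + Dr r (Suc i)) * Tr r i" .
  have "Tr r i - (Dr r i * Dr r (Suc i)) * Tr r i * (Dr r i * Dr r (Suc i)) = cq 2 * J (ones r)"
    unfolding ones_split(2)[OF assms] using T_dots[of ?x ?y] by (simp add: D Tr_def)
  also have "\<dots> = J (ones r) + J (ones r)" using cq_simps(3)[of 1 1] by (simp add: cq_simps distrib_right mult_2)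
  finally have prod: "Tr r i - (Dr r i * Dr r (Suc i)) * Tr r i * (Dr r i * Dr r (Suc i)) = J (ones r) + J (ones r)" .
  have i: "i < r" using assms by simp
  have anti: "Dr r (Suc i) * Dr r i = - (Dr r i * Dr r (Suc i))"
    by (rule Dr_anticommute) (use assms in simp_all)
  note slide = slide_from_symmetric[OF Dr_J[OF i] Dr_J[OF assms] Tr_J[OF assms] Dr_square[OF i] Dr_square[OF assms] anti sum prod]
  from slide show "Sr r i * Dr r i = Dr r (Suc i) * Sr r i" "Sr r i * Dr r (Suc i) = Dr r i * Sr r i"
    by (simp_all add: Sr_def algebra_simps)
qed

lemma Sr_Dr:
  assumes "Suc i < r" "j < r"
  shows "Sr r i * Dr r j = Dr r (swap_letter i j) * Sr r i"
  using Sr_Dr_near[OF assms(1)] Sr_Dr_far[of j i r] assms by (auto simp: swap_letter_def)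

section \<open>The regular module of thin webs\<close>

text \<open>A representative of a coset of the symmetric group on the first \<open>n\<close> values
  in that on \<open>n + 1\<close> values: the cycle that takes \<open>n\<close> down to
  \<open>j\<close>.\<close>

definition cyc :: "nat \<Rightarrow> nat \<Rightarrow> nat \<Rightarrow> wq" where
  "cyc r j n = prod_list (map (Sr r) [j..<n])"

text \<open>Closes the gap that \<open>j\<close> leaves among the values.\<close>

definition del :: "nat \<Rightarrow> nat \<Rightarrow> nat" where
  "del j m = (if j < m then m - 1 else m)"

text \<open>The web for a permutation, given as the list of its values from right to left: the last value \<open>j\<close> is
  reached by the cycle \<open>cyc r j\<close> after permuting the other positions.\<close>

function bp :: "nat \<Rightarrow> nat list \<Rightarrow> wq" where
  "bp r [] = 1"
| "bp r (j # u) = cyc r j (length u) * bp r (map (del j) u)"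
  by pat_completeness auto
termination by (relation "measure (length \<circ> snd)") simp_all

lemma prod_list_commute: "(\<And>a. a \<in> set xs \<Longrightarrow> z * f a = f a * z) \<Longrightarrow> z * prod_list (map f xs) = prod_list (map f xs) * z"
  for z :: wq
proof (induction xs)
  case (Cons a xs)
  have "z * f a = f a * z" using Cons.prems by simp
  moreover have "z * prod_list (map f xs) = prod_list (map f xs) * z" using Cons by simp
  ultimately show ?case by (simp add: mult.assoc) (metis mult.assoc)
qed simp

lemma Sr_cyc_far: "Suc i < j \<Longrightarrow> n < r \<Longrightarrow> Sr r i * cyc r j n = cyc r j n * Sr r i"
  unfolding cyc_def by (rule prod_list_commute, rule Sr_commute[symmetric]) auto

lemma Sr_cyc_extend: "i < n \<Longrightarrow> Sr r i * cyc r (Suc i) n = cyc r i n"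
  by (simp add: cyc_def upt_conv_Cons)

lemma Sr_cyc_shorten: "i < n \<Longrightarrow> n < r \<Longrightarrow> Sr r i * cyc r i n = cyc r (Suc i) n"
  by (simp add: Sr_square flip: Sr_cyc_extend mult.assoc)

text \<open>Here the braid relation enters: the crossing commutes with the factors up to
  \<open>i - 1\<close>, meets the pair \<open>i\<close>, \<open>i + 1\<close>, and comes out one
  strand lower.\<close>

lemma Sr_cyc_inside:
  assumes "j \<le> i" "Suc i < n" "n < r"
  shows "Sr r (Suc i) * cyc r j n = cyc r j n * Sr r i"
proof -
  have "[j..<n] = [j..<i] @ [i..<n]" using upt_add_eq_append[of j i "n - i"] assms by simp
  moreover have "[i..<n] = i # Suc i # [Suc (Suc i)..<n]" using assms by (simp add: upt_conv_Cons)
  ultimately have u: "[j..<n] = [j..<i] @ [i, Suc i] @ [Suc (Suc i)..<n]" by simp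
  let ?A = "prod_list (map (Sr r) [j..<i])" and ?B = "prod_list (map (Sr r) [Suc (Suc i)..<n])"
  have A: "Sr r (Suc i) * ?A = ?A * Sr r (Suc i)"
    by (rule prod_list_commute, rule Sr_commute) (use assms in auto)
  have B: "Sr r i * ?B = ?B * Sr r i"
    by (rule prod_list_commute, rule Sr_commute[symmetric]) (use assms in auto)
  have "Sr r (Suc i) * cyc r j n = (Sr r (Suc i) * ?A) * Sr r i * Sr r (Suc i) * ?B"
    by (simp add: cyc_def u mult.assoc)
  also have "\<dots> = ?A * (Sr r (Suc i) * Sr r i * Sr r (Suc i)) * ?B" unfolding A by (simp only: mult.assoc)
  also have "\<dots> = ?A * Sr r i * Sr r (Suc i) * (Sr r i * ?B)"
    using Sr_braid[of i r] assms by (simp add: mult.assoc)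
  also have "\<dots> = cyc r j n * Sr r i" unfolding B by (simp add: cyc_def u mult.assoc)
  finally show ?thesis .
qed

text \<open>Shows that the webs of permutations form a left module over the crossings, without using
  reduced words. The cases compare \<open>i\<close> and \<open>i + 1\<close> with the value
  \<open>j\<close>, which determines the coset: either the crossing changes the coset, or it passes
  through the cycle and acts on the remaining values.\<close>

lemma bp_swap:
  assumes "distinct u" "set u = {..<length u}" "Suc i < length u" "length u \<le> r"
  shows "Sr r i * bp r u = bp r (map (swap_letter i) u)"
  using assms
proof (induction "length u" arbitrary: u i)
  case (Suc m)
  then obtain j u' where u: "u = j # u'" by (cases u) auto
  have len: "length u' = m" using Suc u by simp
  have "insert j (set u') = {..<Suc m}" using Suc.prems(2) by (simp add: u len)
  moreover have j': "j \<notin> set u'" using Suc.prems(1) by (simp add: u)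
  ultimately have setu: "set u' = {..<Suc m} - {j}" and "j \<in> {..<Suc m}" by blast+
  then have j: "j \<le> m" "j \<notin> set u'" using j' by simp_all
  let ?v = "map (del j) u'"
  \<comment> \<open>With \<open>j\<close> removed and the gap closed, the rest is again a list of
    all values below its length, so that the induction hypothesis applies.\<close>
  have "inj_on (del j) (set u')"
    by (rule inj_onI) (auto simp: setu del_def split: if_splits)
  then have dist: "distinct ?v" using Suc.prems(1) by (simp add: u distinct_map)
  have setv: "set ?v = {..<length ?v}"
  proof -
    have "set ?v \<subseteq> {..<m}" using j(1) by (auto simp: setu del_def)
    moreover have "card (set ?v) = m" using distinct_card[OF dist] len by simp
    ultimately show ?thesis using card_subset_eq[of "{..<m}" "set ?v"] len by simp
  qed
  have IH: "Suc k < m \<Longrightarrow> Sr r k * bp r ?v = bp r (map (swap_letter k) ?v)" for k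
    using Suc.hyps(1)[of ?v k] dist setv len Suc.prems(4) u by simp
  have r: "m < r" using Suc.prems u len by simp
  have lhs: "Sr r i * bp r u = (Sr r i * cyc r j m) * bp r ?v"
    by (simp only: u bp.simps len mult.assoc)
  have rhs: "bp r (map (swap_letter i) u) =
      cyc r (swap_letter i j) m * bp r (map (del (swap_letter i j)) (map (swap_letter i) u'))"
    by (simp only: u list.map bp.simps length_map len)
  consider "Suc i < j" | "Suc i = j" | "i = j" | i' where "i = Suc i'" "j \<le> i'"
    by (cases i) (auto, linarith+)
  then show ?case
  proof cases
    case 1
    have v: "map (swap_letter i) ?v = map (del j) (map (swap_letter i) u')"
      using 1 j by (auto simp: swap_letter_def del_def)
    have sw: "swap_letter i j = j" using 1 by (simp add: swap_letter_def)
    have "Suc i < m" using 1 j(1) by simp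
    from IH[OF this] show ?thesis
      unfolding lhs rhs sw v[symmetric] Sr_cyc_far[OF 1 r] by (simp only: mult.assoc)
  next
    case 2
    have v: "map (del i) (map (swap_letter i) u') = ?v"
      using 2 j by (auto simp: swap_letter_def del_def)
    have sw: "swap_letter i j = i" using 2 by (simp add: swap_letter_def)
    have "i < m" using 2 j(1) by simp
    from Sr_cyc_extend[OF this, of r] show ?thesis unfolding lhs rhs sw v by (simp only: 2)
  next
    case 3
    have v: "map (del (Suc i)) (map (swap_letter i) u') = ?v"
      using 3 j by (auto simp: swap_letter_def del_def)
    have sw: "swap_letter i j = Suc i" using 3 by (simp add: swap_letter_def)
    have "i < m" using Suc.prems(3) u len by simp
    from Sr_cyc_shorten[OF this r] show ?thesis unfolding lhs rhs sw v by (simp only: 3)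
  next
    case 4
    have v: "map (swap_letter i') ?v = map (del j) (map (swap_letter i) u')"
      unfolding map_map
    proof (rule map_cong[OF refl])
      fix x assume "x \<in> set u'"
      then have "x \<noteq> j" using j(2) by blast
      then show "(swap_letter i' \<circ> del j) x = (del j \<circ> swap_letter i) x"
        using 4 by (auto simp: swap_letter_def del_def)
    qed
    have sw: "swap_letter i j = j" using 4 by (simp add: swap_letter_def)
    have i': "Suc i' < m" using Suc.prems(3) u len 4 by simp
    have c: "Sr r i * cyc r j m = cyc r j m * Sr r i'"
      unfolding 4(1) by (rule Sr_cyc_inside[OF 4(2) i' r])
    from IH[OF i'] show ?thesis unfolding lhs rhs sw v[symmetric] c by (simp only: mult.assoc)
  qed
qed simp

section \<open>The thin web attached to a word with distinct letters\<close>

definition Er :: "nat \<Rightarrow> wq" where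
  "Er r = J (ones r)"

lemma Er_simps:
  "Suc i < r \<Longrightarrow> Er r * Tr r i = Tr r i" "Suc i < r \<Longrightarrow> Tr r i * Er r = Tr r i"
  "i < r \<Longrightarrow> Er r * Dr r i = Dr r i" "i < r \<Longrightarrow> Dr r i * Er r = Dr r i"
  "i < r \<Longrightarrow> Dr r i * Dr r i = Er r" "Suc i < r \<Longrightarrow> Er r * Sr r i = Sr r i * Er r"
  "0 < r \<Longrightarrow> Er r * Er r = Er r"
  using Tr_J[of i r] Dr_J[of i r] Dr_square[of i r] Sr_J[of i r] J_idem[of "ones r"] by (simp_all add: Er_def)

text \<open>The dots of the barred letters in the order of the word; the order matters because dots
  anticommute.\<close>

definition dprod :: "nat \<Rightarrow> idx list \<Rightarrow> wq" where
  "dprod r w = prod_list (map (\<lambda>(j, b). if b = 1 then Dr r j else 1) w)"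

text \<open>The web that is meant to carry \<open>v0 r\<close> to \<open>w\<close>: a permutation of
  the strands, then dots on top. The labels are reversed because \<open>bp\<close> reads them from
  right to left. The idempotent is added only once, as the crossings live in the whole ring.\<close>

definition Phi :: "nat \<Rightarrow> idx list \<Rightarrow> wq" where
  "Phi r w = dprod r w * bp r (rev (map fst w)) * Er r"

lemma dprod_Cons: "dprod r ((j, b) # w) = (if b = 1 then Dr r j else 1) * dprod r w"
  by (simp add: dprod_def)

lemma dprod_Er: "(\<And>i. i \<in> set w \<Longrightarrow> fst i < r) \<Longrightarrow> Er r * dprod r w = dprod r w * Er r"
  unfolding dprod_def by (rule prod_list_commute) (auto simp: Er_simps split: prod.splits)

lemma cyc_Er: "n < r \<Longrightarrow> Er r * cyc r j n = cyc r j n * Er r"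
  unfolding cyc_def by (rule prod_list_commute) (auto simp: Er_simps)

lemma bp_Er: "length u \<le> r \<Longrightarrow> Er r * bp r u = bp r u * Er r"
proof (induction "length u" arbitrary: u)
  case (Suc m)
  then obtain j u' where u: "u = j # u'" by (cases u) auto
  have "Er r * cyc r j (length u') = cyc r j (length u') * Er r" using Suc.prems by (intro cyc_Er) (simp add: u)
  moreover have "Er r * bp r (map (del j) u') = bp r (map (del j) u') * Er r"
    using Suc.hyps u Suc.prems by simp
  ultimately show ?case by (simp add: u mult.assoc) (metis mult.assoc)
qed simp

text \<open>The new dot anticommutes past the dots of the letters before position \<open>t\<close>,
  which yields the sign of the superderivation, and then creates or cancels the dot of its own
  letter.\<close>

lemma dprod_dot:
  assumes "distinct (map fst w)" "\<And>i. i \<in> set w \<Longrightarrow> fst i < r" "t < length w" "fst (w ! t) = j"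
  shows "Dr r j * dprod r w * Er r = cq (koszul (idx_parity (take t w))) * (dprod r (shift_at t j 1 w) * Er r)"
  using assms
proof (induction w arbitrary: t)
  case (Cons i w)
  obtain m b where i: "i = (m, b)" by (cases i)
  have dE: "Er r * dprod r w = dprod r w * Er r" using Cons.prems by (intro dprod_Er) auto
  have m: "m < r" using Cons.prems(2)[of i] i by simp
  have EE: "Er r * Er r = Er r" using m by (intro Er_simps) simp
  show ?case
  proof (cases t)
    case 0
    then have mj: "m = j" using Cons.prems by (simp add: i)
    show ?thesis
    proof (cases "b = 1")
      case True
      have "Dr r j * dprod r (i # w) * Er r = (Dr r j * Dr r j) * dprod r w * Er r"
        by (simp add: i True mj dprod_Cons mult.assoc)
      also have "\<dots> = dprod r w * (Er r * Er r)" using m mj by (simp add: Er_simps dE mult.assoc)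
      also have "\<dots> = dprod r (shift_at t j 1 (i # w)) * Er r"
        unfolding EE using True by (simp add: 0 i mj shift_at_def dprod_Cons)
      finally show ?thesis by (simp add: 0 koszul_one word_parity_def cq_simps)
    next
      case False
      then have "b = 0" by (cases b) auto
      then show ?thesis by (simp add: 0 i mj shift_at_def dprod_Cons koszul_one word_parity_def cq_simps)
    qed
  next
    case (Suc t')
    have t': "t' < length w" "fst (w ! t') = j" using Cons.prems Suc by simp_all
    have "j \<noteq> m" using Cons.prems(1) t' by (auto simp: i)
    have j: "j < r" using Cons.prems(2)[of "w ! t'"] t' by auto
    have IH: "Dr r j * dprod r w * Er r = cq (koszul (idx_parity (take t' w))) * (dprod r (shift_at t' j 1 w) * Er r)"
      using Cons t' by (intro Cons.IH) auto
    have par: "idx_parity (take t (i # w)) = b + idx_parity (take t' w)"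
      by (simp add: Suc i word_parity_def)
    have sh: "shift_at t j 1 (i # w) = i # shift_at t' j 1 w" by (simp add: Suc shift_at_def)
    show ?thesis
    proof (cases "b = 1")
      case True
      have anti: "Dr r j * Dr r m = - (Dr r m * Dr r j)"
        using \<open>j \<noteq> m\<close> m j by (intro Dr_anticommute) auto
      have "Dr r j * dprod r (i # w) * Er r = (Dr r j * Dr r m) * dprod r w * Er r"
        by (simp add: i True dprod_Cons mult.assoc)
      also have "\<dots> = - (Dr r m * (Dr r j * dprod r w * Er r))" unfolding anti by (simp add: mult.assoc)
      also have "\<dots> = cq (- koszul (idx_parity (take t' w))) * (Dr r m * (dprod r (shift_at t' j 1 w) * Er r))"
        unfolding IH by (simp add: cq_left_commute[of "Dr r m"] cq_simps)
      finally show ?thesis unfolding par sh by (simp add: i True dprod_Cons koszul_add koszul_one mult.assoc)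
    next
      case False
      then have "b = 0" by (cases b) auto
      then show ?thesis using IH unfolding par sh by (simp add: i dprod_Cons)
    qed
  qed
qed simp

lemma dprod_swap:
  assumes "Suc i < r" "\<And>k. k \<in> set w \<Longrightarrow> fst k < r"
  shows "Sr r i * dprod r w = dprod r (relabel (swap_letter i) w) * Sr r i"
  using assms(2)
proof (induction w)
  case Nil
  then show ?case by (simp add: dprod_def relabel_def)
next
  case (Cons k w)
  obtain j b where k: "k = (j, b)" by (cases k)
  have j: "j < r" using Cons.prems[of k] k by simp
  have IH: "Sr r i * dprod r w = dprod r (relabel (swap_letter i) w) * Sr r i" using Cons by simp
  have "Sr r i * ((if b = 1 then Dr r j else 1) * z) = (if b = 1 then Dr r (swap_letter i j) else 1) * (Sr r i * z)" for z
    using Sr_Dr[OF assms(1) j] by (simp flip: mult.assoc)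
  then show ?case by (simp add: k dprod_Cons relabel_def IH[unfolded relabel_def] mult.assoc)
qed

lemma base_ones: "base p (ones n) = [p..<p + n]"
  by (induction n arbitrary: p) (simp_all add: upt_conv_Cons)

lemma NW_ones:
  assumes "w \<in> NW (ones r)"
  shows "distinct (map fst w)" "set (map fst w) = {..<r}" "length w = r" "i \<in> set w \<Longrightarrow> fst i < r"
proof -
  have m: "mset (map fst w) = mset [0..<r]" using assms base_ones[of 0 r] by (simp add: NW_def)
  show "distinct (map fst w)" using mset_eq_imp_distinct_iff[OF m] by simp
  show s: "set (map fst w) = {..<r}" using mset_eq_setD[OF m] by (simp add: lessThan_atLeast0)
  show "length w = r" using mset_eq_length[OF m] by simp
  show "i \<in> set w \<Longrightarrow> fst i < r" using s by auto
qed

lemma Phi_dot: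
  assumes w: "w \<in> NW (ones r)" and t: "t < r" "fst (w ! t) = j"
  shows "Dr r j * Phi r w = cq (koszul (idx_parity (take t w))) * Phi r (shift_at t j 1 w)"
proof -
  note W = NW_ones[OF w]
  let ?b = "bp r (rev (map fst w))"
  have "0 < r" using t by simp
  have bE: "Er r * ?b = ?b * Er r" using W(3) by (intro bp_Er) simp
  have fst: "map fst (shift_at t j 1 w) = map fst w"
    using t W(3) by (intro nth_equalityI) (auto simp: nth_shift_at)
  have E: "?b * Er r = Er r * (?b * Er r)"
    using Er_simps(7)[OF \<open>0 < r\<close>] bE by (metis mult.assoc)
  have "Dr r j * Phi r w = (Dr r j * dprod r w * Er r) * (?b * Er r)"
    unfolding Phi_def by (simp only: mult.assoc E[symmetric])
  also have "\<dots> = cq (koszul (idx_parity (take t w))) * (dprod r (shift_at t j 1 w) * (Er r * (?b * Er r)))"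
    using dprod_dot[OF W(1) W(4) _ t(2)] t(1) W(3) by (simp add: mult.assoc)
  also have "\<dots> = cq (koszul (idx_parity (take t w))) * Phi r (shift_at t j 1 w)"
    unfolding Phi_def fst E[symmetric] by (simp only: mult.assoc)
  finally show ?thesis .
qed

lemma Phi_swap:
  assumes w: "w \<in> NW (ones r)" and i: "Suc i < r"
  shows "Sr r i * Phi r w = Phi r (relabel (swap_letter i) w)"
proof -
  note W = NW_ones[OF w]
  have "Sr r i * bp r (rev (map fst w)) = bp r (map (swap_letter i) (rev (map fst w)))"
    using W(1-3) i by (intro bp_swap) simp_all
  moreover have "map (swap_letter i) (rev (map fst w)) = rev (map fst (relabel (swap_letter i) w))"
    by (simp add: relabel_def rev_map)
  ultimately have "Sr r i * bp r (rev (map fst w)) = bp r (rev (map fst (relabel (swap_letter i) w)))" by simp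
  moreover have "Sr r i * dprod r w = dprod r (relabel (swap_letter i) w) * Sr r i"
    by (rule dprod_swap[OF i W(4)])
  ultimately show ?thesis unfolding Phi_def by (metis mult.assoc)
qed

definition v0 :: "nat \<Rightarrow> idx list" where
  "v0 r = map (\<lambda>j. (j, 0)) [0..<r]"

lemma map_fst_v0: "map fst (v0 r) = [0..<r]"
  by (simp add: v0_def o_def)

lemma v0_NW: "v0 r \<in> NW (ones r)"
  by (simp only: NW_def mem_Collect_eq map_fst_v0 base_ones add_0)

lemma bp_rev_upt: "bp r (rev [0..<n]) = 1"
proof (induction n)
  case (Suc n)
  have "map (del n) (rev [0..<n]) = rev [0..<n]" by (intro map_idI) (auto simp: del_def)
  with Suc show ?case by (simp add: cyc_def)
qed simp

lemma Phi_v0: "Phi r (v0 r) = Er r"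
proof -
  have "prod_list (map (\<lambda>(j, b). if b = 1 then Dr r j else 1) (map (\<lambda>j. (j, 0 :: bit)) js)) = 1" for js
    by (induction js) simp_all
  then have "dprod r (v0 r) = 1" by (simp only: dprod_def v0_def)
  then show ?thesis by (simp only: Phi_def map_fst_v0 bp_rev_upt mult_1_left)
qed

text \<open>The linear extension of \<open>Phi\<close>. Representatives are used because
  \<open>lin_ext\<close> takes values in combinations of words and not in \<open>wq\<close>.\<close>

definition PHI :: "nat \<Rightarrow> tens \<Rightarrow> wq" where
  "PHI r v = q (lin_ext (\<lambda>w. rep_wq (Phi r w)) v)"

lemma PHI_simps:
  "PHI r (u + v) = PHI r u + PHI r v" "PHI r (scl c v) = cq c * PHI r v" "PHI r 0 = 0" "PHI r (bas w) = Phi r w"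
  "PHI r (\<Sum>i\<in>A. f i) = (\<Sum>i\<in>A. PHI r (f i))"
proof -
  show *: "PHI r (u + v) = PHI r u + PHI r v" "PHI r (scl c v) = cq c * PHI r v" "PHI r 0 = 0" for u v c
    by (simp_all add: PHI_def lin_ext_add lin_ext_scl q_simps q_scl)
  show "PHI r (bas w) = Phi r w" by (simp add: PHI_def Quotient_abs_rep[OF Quotient_wq])
  show "PHI r (\<Sum>i\<in>A. f i) = (\<Sum>i\<in>A. PHI r (f i))"
    by (induction A rule: infinite_finite_induct) (simp_all add: *)
qed

lemma PHI_intertwine:
  assumes "linear_op f" "\<And>w. w \<in> S \<Longrightarrow> PHI r (f (bas w)) = z * Phi r w" "v \<in> spn S"
  shows "PHI r (f v) = z * PHI r v"
proof (induction v rule: linear_induct)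
  case (step c w y)
  then show ?case
    using assms(2)[OF spn_keys[OF assms(3)]]
    by (simp add: linear_opD[OF assms(1)] PHI_simps distrib_left cq_left_commute[of z])
qed (simp add: linear_opD[OF assms(1)] PHI_simps)

text \<open>The property is closed under sums and products, so it has to be checked on dots and
  crossings only. Evaluated at \<open>v0 r\<close> it recovers \<open>z\<close> on thin strands from
  its action.\<close>

definition intertwined :: "nat \<Rightarrow> wq \<Rightarrow> bool" where
  "intertwined r z \<longleftrightarrow> (\<exists>f. q f = z \<and> (\<forall>v\<in>spn (NW (ones r)). theta f v \<in> spn (NW (ones r)) \<and> PHI r (theta f v) = z * PHI r v))"

lemma BF_intertwined:
  assumes "\<beta> \<in> BF r" "0 < r"
  shows "intertwined r (\<beta> [])"
  using assms(1)
proof (induction rule: BF.induct)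
  case (cross i j)
  then have j: "j = r - Suc (Suc i)" "Suc i < r" by auto
  let ?f = "pad (ones i) (ones j) (split 1 1 * merge 1 1)"
  have o: "NW (ones r) = NW (ones i @ 1 # 1 # ones j)" using ones_split(2)[OF j(2)] j(1) by (simp only:)
  have q: "q ?f = Tr r i" by (simp add: q_bas q_pad Tr_def T_def j(1))
  have th: "theta ?f v = v + swap_op i v" if "v \<in> spn (NW (ones r))" for v
    using crossing_sound[of v "ones i" "ones j"] that unfolding o by (simp add: sum_list_replicate)
  have "swap_op i v \<in> spn (NW (ones r))" if "v \<in> spn (NW (ones r))" for v
    using swap_NW[of v "ones i" "ones j"] that unfolding o by (simp add: sum_list_replicate)
  moreover have "PHI r (v + swap_op i v) = Tr r i * PHI r v" if v: "v \<in> spn (NW (ones r))" for v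
  proof (rule PHI_intertwine[OF _ _ v])
    show "linear_op (\<lambda>v. v + swap_op i v)" by (intro linear_op_add) (simp_all add: swap_op_def)
    fix w assume "w \<in> NW (ones r)"
    from Phi_swap[OF this j(2)] show "PHI r (bas w + swap_op i (bas w)) = Tr r i * Phi r w"
      by (simp add: swap_op_def relabel_op_def PHI_simps Sr_def left_diff_distrib diff_eq_eq add.commute)
  qed
  ultimately have "intertwined r (Tr r i)"
    using q th unfolding intertwined_def by (intro exI[of _ ?f]) simp
  then show ?case by (simp only: Tr_def j(1) append_Nil2)
next
  case (dot i j)
  then have j: "j = r - Suc i" "i < r" by auto
  let ?f = "pad (ones i) (ones j) (dot 1)"
  have o: "NW (ones r) = NW (ones i @ 1 # ones j)" using ones_split(1)[OF j(2)] j(1) by (simp only:)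
  have q: "q ?f = Dr r i" by (simp add: q_pad Dr_def j(1))
  have th: "theta ?f v = rung i i 1 v" "rung i i 1 v \<in> spn (NW (ones r))" if "v \<in> spn (NW (ones r))" for v
    using theta_pad_dot[of v "ones i" 1 "ones j"] dot_typed[of v "ones i" 1 "ones j"] that
    unfolding o by (simp_all add: sum_list_replicate)
  have "PHI r (rung i i 1 v) = Dr r i * PHI r v" if v: "v \<in> spn (NW (ones r))" for v
  proof (rule PHI_intertwine[OF linear_rung _ v])
    fix w assume w: "w \<in> NW (ones r)"
    note W = NW_ones[OF w]
    have "card (pos i w) = 1"
      using NW_card_pos[of w "ones i" 1 "ones j"] w unfolding o by (simp add: sum_list_replicate)
    then obtain t where t: "pos i w = {t}" by (meson card_1_singletonE)
    then have t': "t < r" "fst (w ! t) = i" using W(3) by (auto simp: pos_def)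
    show "PHI r (rung i i 1 (bas w)) = Dr r i * Phi r w"
      using Phi_dot[OF w t'] by (simp add: rung_def t PHI_simps ksgn_def)
  qed
  then have "intertwined r (Dr r i)"
    using q th unfolding intertwined_def by (intro exI[of _ ?f]) simp
  then show ?case by (simp only: Dr_def j(1) append_Nil2)
next
  case id
    have E: "PHI r v = J (ones r) * PHI r v" if v: "v \<in> spn (NW (ones r))" for v
    proof (rule PHI_intertwine[OF linear_op_id(2) _ v])
      fix w assume w: "w \<in> NW (ones r)"
      note W = NW_ones[OF w]
      have "Er r * Phi r w = Phi r w"
        using dprod_Er[of w r] bp_Er[of "rev (map fst w)" r] W assms(2) Er_simps(7)[of r]
        by (simp add: Phi_def) (metis mult.assoc)
      then show "PHI r (bas w) = J (ones r) * Phi r w" by (simp add: PHI_simps Er_def)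
    qed
    then show ?case unfolding intertwined_def
      by (intro exI[of _ "bas [Idm (ones r)]"]) (simp add: J_def theta_simps prj_id)
next
  case (scal \<beta> c)
  then obtain f where "q f = \<beta> []" "\<forall>v\<in>spn (NW (ones r)). theta f v \<in> spn (NW (ones r)) \<and> PHI r (theta f v) = \<beta> [] * PHI r v"
    by (auto simp: intertwined_def)
  then show ?case unfolding intertwined_def
    by (intro exI[of _ "scl c f"]) (simp add: q_scl theta_simps PHI_simps mult.assoc)
next
  case (add \<beta> \<gamma>)
  then obtain f g where "q f = \<beta> []" "\<forall>v\<in>spn (NW (ones r)). theta f v \<in> spn (NW (ones r)) \<and> PHI r (theta f v) = \<beta> [] * PHI r v"
    "q g = \<gamma> []" "\<forall>v\<in>spn (NW (ones r)). theta g v \<in> spn (NW (ones r)) \<and> PHI r (theta g v) = \<gamma> [] * PHI r v"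
    by (auto simp: intertwined_def)
  then show ?case unfolding intertwined_def
    by (intro exI[of _ "f + g"]) (simp add: q_simps theta_simps PHI_simps distrib_right)
next
  case (mult \<beta> \<gamma>)
  then obtain f g where "q f = \<beta> []" "\<forall>v\<in>spn (NW (ones r)). theta f v \<in> spn (NW (ones r)) \<and> PHI r (theta f v) = \<beta> [] * PHI r v"
    "q g = \<gamma> []" "\<forall>v\<in>spn (NW (ones r)). theta g v \<in> spn (NW (ones r)) \<and> PHI r (theta g v) = \<gamma> [] * PHI r v"
    by (auto simp: intertwined_def)
  then show ?case unfolding intertwined_def
    by (intro exI[of _ "f * g"]) (simp add: q_simps theta_mult mult.assoc)
qed

section \<open>Faithfulness\<close>

lemma ml_ones: "0 < n \<Longrightarrow> ml (ones i) (ones n) [] = J (ones (i + n))"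
proof (induction n arbitrary: i)
  case (Suc n)
  have "ml (ones (Suc i)) (ones n) [] = (if n = 0 then 1 else J (ones (Suc i + n)))"
    using Suc.IH[of "Suc i"] by (cases "n = 0") simp_all
  moreover have "mg (ones i) 1 (ones n) = J (ones (i + Suc n))"
    by (simp add: replicate_app_Cons_same)
  ultimately show ?case
    using J_idem[of "ones (Suc i + n)"] by (cases "n = 0") (simp_all add: ones_snoc)
qed simp

lemma BF_zero: "(\<lambda>y. 0) \<in> BF r"
  using BF.scal[OF BF.id, of 0 r] by (simp add: cq_simps)

lemma word_ml:
  assumes "set ws \<subseteq> web_gens r" "a \<in> compositions r"
  shows "\<exists>b\<in>compositions r. \<exists>\<beta>\<in>BF r. q (bas ws) * ml [] a [] = ml [] b [] * \<beta> []"
  using assms(1)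
proof (induction ws)
  case Nil
  have "ml [] a [] = ml [] a [] * J (ones r @ [])"
    using ml_J[of a] assms(2) by (simp add: compositions_pl)
  moreover have "q (bas []) = 1" by (simp add: bas_Nil q_simps)
  ultimately show ?case using assms(2) BF.id[of r] by (intro bexI[of _ a] bexI[of _ "\<lambda>y. J (ones r @ y)"]) simp_all
next
  case (Cons g ws)
  then obtain b \<beta> where b: "b \<in> compositions r" "\<beta> \<in> BF r" "q (bas ws) * ml [] a [] = ml [] b [] * \<beta> []"
    by auto
  have eq: "q (bas (g # ws)) * ml [] a [] = q (bas [g]) * ml [] b [] * \<beta> []"
    using b(3) by (simp add: mult.assoc q_simps bas_mult flip: b(3)) (simp add: bas_mult flip: mult.assoc q_simps(3))
  have g: "gen_src g \<in> compositions r" "gen_tgt g \<in> compositions r" using Cons.prems by (auto simp: web_gens_def)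
  have Jb: "J b * ml [] b [] = ml [] b []" using b(1) by (intro J_ml) (auto simp: compositions_pl)
  show ?case
  proof (cases "gen_src g = b")
    case False
    \<comment> \<open>A generator with another source kills the total merge; this case is harmless
      as \<open>0\<close> belongs to \<open>BF\<close>.\<close>
    have "q (bas [g]) * J b = 0"
    proof (cases g)
      case (Idm c)
      then show ?thesis using J_orthogonal[of c r b] g False b(1) by (simp add: J_def)
    next
      case (Layer x h y)
      have h: "sym_pos h" "pl x" "pl y" using g Layer by (auto simp: compositions_pl intro: pl_sym_conv)
      have "L x h y * J b = L x h y * (J (x @ src h @ y) * J b)"
        using L_J(1)[OF h refl] by (simp flip: mult.assoc)
      also have "\<dots> = 0" using J_orthogonal[of "x @ src h @ y" r b] g False b(1) Layer by simp
      finally show ?thesis by (simp add: Layer L_def)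
    qed
    then have "q (bas [g]) * ml [] b [] = 0" by (metis Jb mult.assoc mult_zero_left)
    then have "q (bas (g # ws)) * ml [] a [] = ml [] a [] * 0" by (simp add: eq)
    then show ?thesis using assms(2) BF_zero by (intro bexI[of _ a] bexI[of _ "\<lambda>y. 0"])
  next
    case True
    show ?thesis
    proof (cases g)
      case (Idm c)
      then have "q (bas (g # ws)) * ml [] a [] = ml [] b [] * \<beta> []" using eq True Jb by (simp add: J_def)
      then show ?thesis using b by blast
    next
      case (Layer x h y)
      have h: "sym_pos h" "pl x" "pl y" using g Layer by (auto simp: compositions_pl intro: pl_sym_conv)
      obtain \<gamma> where \<gamma>: "\<gamma> \<in> BF r" "L x h y * ml [] b [] = ml [] (gen_tgt g) [] * \<gamma> []"
      proof -
        have s: "sum_list (x @ src h @ y) = r" "x @ src h @ y = b" "x @ tgt h @ y = gen_tgt g"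
          using True g(1) Layer by (auto simp: compositions_pl)
        show ?thesis using L_ml[OF h, unfolded s(1), unfolded s(2,3)] that by blast
      qed
      then have "q (bas (g # ws)) * ml [] a [] = ml [] (gen_tgt g) [] * (\<gamma> [] * \<beta> [])"
        using eq by (simp add: Layer L_def mult.assoc)
      then show ?thesis using g(2) BF.mult[OF \<gamma>(1) b(2)]
        by (intro bexI[of _ "gen_tgt g"] bexI[of _ "\<lambda>y. \<gamma> y * \<beta> y"])
    qed
  qed
qed

text \<open>Different words of \<open>x\<close> may lead to different targets. The idempotent of
  \<open>b\<close> selects one of them, so that the contributions have a common total merge and can
  be added.\<close>

lemma web_ml:
  assumes "keys x \<subseteq> lists (web_gens r)" "a \<in> compositions r" "b \<in> compositions r"
  shows "\<exists>\<beta>\<in>BF r. J b * q x * ml [] a [] = ml [] b [] * \<beta> []"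
proof (induction x rule: linear_induct)
  case zero
  then show ?case using BF_zero by (intro bexI[of _ "\<lambda>y. 0"]) (simp_all add: q_simps)
next
  case (step c w y)
  then obtain \<beta> where \<beta>: "\<beta> \<in> BF r" "J b * q y * ml [] a [] = ml [] b [] * \<beta> []" by blast
  have "set w \<subseteq> web_gens r" using step(2) assms(1) by auto
  then obtain b' \<gamma> where \<gamma>: "b' \<in> compositions r" "\<gamma> \<in> BF r" "q (bas w) * ml [] a [] = ml [] b' [] * \<gamma> []"
    using word_ml[of w r a] assms(2) by blast
  have J: "J a * ml [] a [] = ml [] a []" if "a \<in> compositions r" for a
    using that by (intro J_ml) (auto simp: compositions_pl)
  have "\<exists>\<delta>\<in>BF r. J b * q (bas w) * ml [] a [] = ml [] b [] * \<delta> []"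
  proof (cases "b = b'")
    case True
    then have "J b * q (bas w) * ml [] a [] = ml [] b [] * \<gamma> []"
      using \<gamma>(3) J[OF \<gamma>(1)] by (metis mult.assoc)
    then show ?thesis using \<gamma>(2) by blast
  next
    case False
    then have "J b * ml [] b' [] = 0"
      using J_orthogonal[OF assms(3) \<gamma>(1)] J[OF \<gamma>(1)] by (metis mult.assoc mult_zero_left)
    then have "J b * q (bas w) * ml [] a [] = ml [] b [] * 0"
      using \<gamma>(3) by (metis mult.assoc mult_zero_left mult_zero_right)
    then show ?thesis using BF_zero by (intro bexI[of _ "\<lambda>y. 0"])
  qed
  then obtain \<delta> where \<delta>: "\<delta> \<in> BF r" "J b * q (bas w) * ml [] a [] = ml [] b [] * \<delta> []" by blast
  have "J b * q (scl c (bas w) + y) * ml [] a [] = cq c * (J b * q (bas w) * ml [] a []) + J b * q y * ml [] a []"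
    by (simp add: q_simps q_scl distrib_left distrib_right mult.assoc cq_left_commute[of "J b"])
  also have "\<dots> = ml [] b [] * (cq c * \<delta> [] + \<beta> [])"
    unfolding \<delta>(2) \<beta>(2) by (simp add: distrib_left cq_left_commute[of "ml [] b []"])
  finally show ?case using BF_sum[OF \<delta>(1) \<beta>(1), of c] by (intro bexI[of _ "\<lambda>y. cq c * \<delta> y + \<beta> y"])
qed

lemma even_webs_rep: "z \<in> even_webs r \<Longrightarrow> \<exists>f. q f = z \<and> keys f \<subseteq> lists (web_gens r)"
  by (auto simp: even_webs_def)

text \<open>Composition with the total merge of \<open>a\<close> below and a right inverse for
  \<open>b\<close> on top gives a web between thin strands, from which the given web can be
  recovered. On thin strands it is a combination of dots and crossings, and \<open>PHI\<close> reads
  it off from its value at \<open>v0 r\<close>.\<close>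

theorem faithful:
  assumes x: "keys x \<subseteq> lists (web_gens r)" and a: "a \<in> compositions r" and b: "b \<in> compositions r"
    and zero: "\<And>v. theta (bas [Idm b] * x * bas [Idm a]) v = 0"
  shows "J b * q x * J a = 0"
proof -
  have r: "0 < r" using a by (cases a) (auto simp: compositions_pl)
  have one: "ones r \<in> compositions r" using r by (simp add: compositions_pl sum_list_replicate)
  have ab: "a \<noteq> []" "pl a" "sum_list a = r" "b \<noteq> []" "pl b" "sum_list b = r" using a b by (simp_all add: compositions_pl)
  let ?M = "\<lambda>a. ml [] a []"
  obtain Ra where Ra: "Ra \<in> even_webs r" "?M a * Ra = J a" using ml_right_inverse[of a "[]" r] ab by auto
  obtain Rb where Rb: "Rb \<in> even_webs r" "?M b * Rb = J b" using ml_right_inverse[of b "[]" r] ab by auto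
  obtain fR where fR: "q fR = Rb" "keys fR \<subseteq> lists (web_gens r)" using even_webs_rep[OF Rb(1)] by blast
  have "?M a \<in> even_webs r" using ab by (intro even_webs_ml) simp_all
  then obtain fM where fM: "q fM = ?M a" "keys fM \<subseteq> lists (web_gens r)" using even_webs_rep by blast
  let ?x = "bas [Idm b] * x * bas [Idm a]"
  have kx: "keys ?x \<subseteq> lists (web_gens r)"
    using a b by (intro keys_mult_lists x) (auto simp: web_gens_def)
  let ?z = "Rb * (J b * q x * J a) * ?M a"
  have z: "q (fR * ?x * fM) = ?z" by (simp add: q_simps fR fM J_def)
  have kz: "keys (fR * ?x * fM) \<subseteq> lists (web_gens r)" by (intro keys_mult_lists kx fR fM)
  have M1: "?M (ones r) = Er r" using ml_ones[OF r, of 0] by (simp add: Er_def)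
  have "\<exists>\<beta>\<in>BF r. J (ones r) * q (fR * ?x * fM) * ?M (ones r) = ?M (ones r) * \<beta> []"
    by (rule web_ml[OF kz one one])
  then obtain \<beta> where \<beta>: "\<beta> \<in> BF r" "Er r * ?z * Er r = Er r * \<beta> []"
    unfolding z M1 by (auto simp: Er_def)
  obtain f where f: "q f = \<beta> []" "\<forall>v\<in>spn (NW (ones r)). theta f v \<in> spn (NW (ones r)) \<and> PHI r (theta f v) = \<beta> [] * PHI r v"
    using BF_intertwined[OF \<beta>(1) r] by (auto simp: intertwined_def)
  let ?I = "bas [Idm (ones r)]"
  \<comment> \<open>Up to idempotents, \<open>f\<close> and the given combination of words have the
    same class and hence the same action, even if they differ in the free algebra.\<close>
  have "q (?I * f) = q (?I * (fR * ?x * fM) * ?I)"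
    using \<beta>(2) z f(1) by (simp add: q_simps(3) Er_def J_def)
  then have "theta (?I * f) (bas (v0 r)) = theta (?I * (fR * ?x * fM) * ?I) (bas (v0 r))"
    by (rule theta_q_cong)
  also have "\<dots> = 0" unfolding theta_mult[of "_ * _"] theta_mult[of fR] theta_mult[of ?I] 
    using zero by (simp add: theta_mult linear_opD[OF linear_theta])
  finally have "theta f (bas (v0 r)) = 0"
    using f(2) v0_NW[of r] by (simp add: theta_mult) (simp add: theta_simps prj_id)
  then have "\<beta> [] * Er r = 0"
    using f(2) v0_NW[of r] by (metis PHI_simps(3,4) Phi_v0 bas_spn)
  moreover have EE: "Er r * Er r = Er r" using r by (rule Er_simps(7))
  ultimately have ez: "Er r * ?z * Er r = 0" using \<beta>(2) by (metis mult.assoc mult_zero_right)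
  have ME: "?M a * Er r = ?M a" "?M b * Er r = ?M b" using ml_J[of a] ml_J[of b] ab by (simp_all add: Er_def)
  have Ja: "J a * J a = J a" "J b * J b = J b" using J_idem ab by simp_all
  \<comment> \<open>This undoes the passage to thin strands, since \<open>?M b * Rb\<close> and
    \<open>?M a * Ra\<close> are the idempotents of \<open>b\<close> and \<open>a\<close>.\<close>
  have "J b * q x * J a = (?M b * Er r) * Rb * (J b * q x * J a) * (?M a * Er r) * Ra"
    unfolding ME mult.assoc Ra(2) Ja using Ja(2) Rb(2) by (metis mult.assoc)
  also have "\<dots> = ?M b * (Er r * ?z * Er r) * Ra" by (simp only: mult.assoc)
  finally show ?thesis by (simp add: ez)
qed

section \<open>From the common ideal to the relation ideal of one size\<close>

definition kill :: "nat \<Rightarrow> web \<Rightarrow> web" where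
  "kill r = lin_ext (\<lambda>w. if set w \<subseteq> web_gens r then bas w else 0)"

lemma linear_kill: "linear_op (kill r)"
  by (simp add: kill_def)

lemma kill_bas: "kill r (bas w) = (if set w \<subseteq> web_gens r then bas w else 0)"
  by (simp add: kill_def)

lemma kill_mult: "kill r (f * g) = kill r f * kill r g"
proof (induction f rule: linear_induct)
  case (step c w f)
  have "kill r (bas w * g) = kill r (bas w) * kill r g"
    by (induction g rule: linear_induct)
       (simp_all add: algebra_simps scl_mult bas_mult linear_opD[OF linear_kill] kill_bas)
  then show ?case
    by (simp add: algebra_simps scl_mult linear_opD[OF linear_kill] step.IH)
qed (simp add: linear_opD[OF linear_kill])

lemma kill_id: "keys f \<subseteq> lists (web_gens r) \<Longrightarrow> kill r f = f"
  by (rule linear_op_spn_eqI[of _ "lists (web_gens r)", OF _ linear_kill linear_op_id(2)])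
    (auto simp: spn_def kill_def)

lemma keys_kill: "keys (kill r f) \<subseteq> lists (web_gens r)"
  unfolding kill_def by (rule keys_lin_ext) auto

text \<open>Without a constant term every word of the relation contains a generator, and a generator
  has only one size.\<close>

lemma kill_relation:
  assumes "x \<in> web_relations r'" "r' \<noteq> r" "lookup x [] = 0"
  shows "kill r x = 0"
proof (rule linear_op_eqI[OF linear_kill linear_op_zero])
  fix w assume w: "w \<in> keys x"
  then have "w \<in> lists (web_gens r')" using web_relations_subset[of r'] assms(1) by auto
  moreover have "w \<noteq> []" using w assms(3) by (auto simp: in_keys_iff)
  ultimately obtain g where "g \<in> set w" "g \<in> web_gens r'" by (cases w) auto
  then have "\<not> set w \<subseteq> web_gens r" using assms(2) by (auto simp: web_gens_def compositions_def)
  then show "kill r (bas w) = 0" by (simp add: kill_def)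
qed

lemma relation_ideal_closed:
  assumes "R \<subseteq> carrier (free_superalgebra G par)"
  defines "I \<equiv> relation_ideal G par R"
  shows "ideal I (free_superalgebra G par)" "R \<subseteq> I" "0 \<in> I"
    "x \<in> I \<Longrightarrow> y \<in> I \<Longrightarrow> x + y \<in> I" "x \<in> I \<Longrightarrow> keys x \<subseteq> lists G"
    "x \<in> I \<Longrightarrow> keys z \<subseteq> lists G \<Longrightarrow> z * x \<in> I" "x \<in> I \<Longrightarrow> keys z \<subseteq> lists G \<Longrightarrow> x * z \<in> I"
    "x \<in> I \<Longrightarrow> scl c x \<in> I" "x \<in> I \<Longrightarrow> - x \<in> I"
proof -
  interpret A: ring "free_superalgebra G par" by (rule ring_free_superalgebra)
  show "ideal I (free_superalgebra G par)"
    unfolding I_def relation_ideal_def using assms(1) by (rule A.genideal_ideal)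
  then interpret I: ideal I "free_superalgebra G par" .
  show "R \<subseteq> I" unfolding I_def relation_ideal_def using assms(1) by (rule A.genideal_self)
  show "0 \<in> I" using I.zero_closed by simp
  show "x + y \<in> I" if "x \<in> I" "y \<in> I" for x y using I.a_closed[OF that] by simp
  show "keys x \<subseteq> lists G" if "x \<in> I" for x using I.a_subset that by auto
  show l: "z * x \<in> I" if "x \<in> I" "keys z \<subseteq> lists G" for x z using I.I_l_closed[OF that(1), of z] that by simp
  show "x * z \<in> I" if "x \<in> I" "keys z \<subseteq> lists G" for x z using I.I_r_closed[OF that(1), of z] that by simp
  show s: "scl c x \<in> I" if "x \<in> I" for x c
  proof -
    have "keys (scl c 1 :: 'a list \<Rightarrow>\<^sub>0 complex) \<subseteq> lists G" using keys_scl[of c 1] by (auto simp: zero_list_def)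
    then show ?thesis using l[OF that, of "scl c 1"] by (simp add: scl_mult)
  qed
  show "- x \<in> I" if "x \<in> I" for x using s[OF that, of "-1"] by simp
qed

definition WI :: "nat \<Rightarrow> web set" where
  "WI r = relation_ideal (web_gens r) gen_parity (web_relations r)"

lemmas WI_closed = relation_ideal_closed[OF web_relations_subset, folded WI_def]

text \<open>The map \<open>kill r\<close> is multiplicative, fixes the relations of size
  \<open>r\<close> and annihilates the others. So imposing the relations of all sizes at once has
  created no new relations in size \<open>r\<close>.\<close>

lemma kill_web_ideal: "x \<in> web_ideal \<Longrightarrow> kill r x \<in> WI r"
proof (induction rule: web_ideal.induct)
  case zero
  then show ?case by (simp add: linear_opD[OF linear_kill] WI_closed(3))
next
  case (step x r' y u v)
  have "kill r x \<in> WI r"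
  proof (cases "r' = r")
    case True
    then have "kill r x = x" using step(1) web_relations_subset[of r] by (intro kill_id) auto
    then show ?thesis using step(1) True WI_closed(2) by auto
  next
    case False
    then show ?thesis using kill_relation[OF step(1)] step(2) by (simp add: WI_closed(3))
  qed
  then have "kill r u * kill r x * kill r v \<in> WI r" by (intro WI_closed keys_kill)
  with step.IH show ?case by (simp add: kill_mult linear_opD[OF linear_kill] WI_closed(4))
qed

lemma WI_sum: "(\<And>i. i \<in> A \<Longrightarrow> f i \<in> WI r) \<Longrightarrow> (\<Sum>i\<in>A. f i) \<in> WI r"
  by (induction A rule: infinite_finite_induct) (auto intro: WI_closed)

text \<open>The relation that was left out of \<open>web_ideal\<close> enters here: modulo it,
  \<open>x\<close> is the sum of its blocks between idempotents, and each block is covered by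
  \<open>faithful\<close>.\<close>

theorem theta_injective:
  assumes x: "keys x \<subseteq> lists (web_gens r)" and zero: "\<And>v. v \<in> spn (NWs r) \<Longrightarrow> theta x v = 0"
  shows "x \<in> WI r"
proof -
  let ?I = "\<lambda>a. bas [Idm a] :: web"
  let ?U = "\<Sum>a\<in>compositions r. ?I a"
  have kI: "keys (?I a) \<subseteq> lists (web_gens r)" if "a \<in> compositions r" for a
    using that by (auto simp: web_gens_def)
  have kU: "keys ?U \<subseteq> lists (web_gens r)"
    using kI by (intro order.trans[OF keys_sum]) blast
  have part: "?I b * x * ?I a \<in> WI r" if "a \<in> compositions r" "b \<in> compositions r" for a b
  proof -
    have "prj a v \<in> spn (NWs r)" for v
      by (rule spn_mono[OF _ prj_spn[of a]]) (use that in \<open>auto simp: NWs_def\<close>)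
    then have "theta (?I b * x * ?I a) v = 0" for v
      using zero by (simp add: theta_mult) (simp add: theta_simps linear_opD[OF linear_prj])
    then have "J b * q x * J a = 0" by (rule faithful[OF x that])
    then have "q (?I b * x * ?I a) = q 0" by (simp add: q_simps J_def)
    then have "?I b * x * ?I a \<in> web_ideal" by (simp add: q_eq_iff)
    then have "kill r (?I b * x * ?I a) \<in> WI r" by (rule kill_web_ideal)
    moreover have "keys (?I b * x * ?I a) \<subseteq> lists (web_gens r)"
      by (intro keys_mult_lists kI x that)
    ultimately show ?thesis by (simp only: kill_id)
  qed
  have "?U * x * ?U = (\<Sum>b\<in>compositions r. \<Sum>a\<in>compositions r. ?I b * x * ?I a)"
    by (simp only: sum_distrib_left sum_distrib_right) (rule sum.swap)
  then have UxU: "?U * x * ?U \<in> WI r" using part by (simp only:) (intro WI_sum)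
  have U1: "?U - 1 \<in> WI r" using WI_closed(2) web_relations.web_unit by blast
  have "x = ?U * x * ?U + - ((?U - 1) * x) + - (?U * x * (?U - 1))"
    by (simp add: algebra_simps)
  moreover have "\<dots> \<in> WI r"
    by (rule WI_closed(4)[OF WI_closed(4)[OF UxU WI_closed(9)[OF WI_closed(7)[OF U1 x]]]
        WI_closed(9)[OF WI_closed(6)[OF U1 keys_mult_lists[OF kU x]]]])
  ultimately show ?thesis by metis
qed

text \<open>On words of size \<open>r\<close> the sum of the idempotents does act as the identity,
  so the relation excluded so far holds there as well.\<close>

lemma theta_WI:
  assumes "x \<in> WI r" "v \<in> spn (NWs r)"
  shows "theta x v = 0"
proof -
  define A where "A = free_superalgebra (web_gens r) gen_parity"
  interpret A: ring A unfolding A_def by (rule ring_free_superalgebra)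
  note carr = free_superalgebra_simps[of "web_gens r" gen_parity, folded A_def]
  let ?J = "{x \<in> carrier A. \<forall>v\<in>spn (NWs r). theta x v = 0}"
  have "ideal ?J A"
  proof (rule idealI)
    show "ring A" by (rule A.ring_axioms)
    show "subgroup ?J (add_monoid A)"
    proof (rule A.add.subgroupI)
      fix x assume x: "x \<in> ?J"
      have "\<ominus>\<^bsub>A\<^esub> x = - x"
        by (rule A.minus_equality) (use x in \<open>auto simp: carr\<close>)
      moreover have "theta (- x) v = 0" if "v \<in> spn (NWs r)" for v
        using theta_simps(3)[of "-1" x v] x that by simp
      ultimately show "\<ominus>\<^bsub>A\<^esub> x \<in> ?J" using x by (auto simp: carr)
    next
      fix x y assume "x \<in> ?J" "y \<in> ?J"
      then show "x \<oplus>\<^bsub>A\<^esub> y \<in> ?J"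
        using A.a_closed[of x y] by (auto simp: carr theta_simps)
    next
      have "\<zero>\<^bsub>A\<^esub> \<in> ?J" by (auto simp: carr theta_simps)
      then show "?J \<noteq> {}" by blast
    qed auto
  next
    fix a x assume *: "a \<in> ?J" "x \<in> carrier A"
    then show "x \<otimes>\<^bsub>A\<^esub> a \<in> ?J"
      using A.m_closed[of x a] by (auto simp: carr theta_mult linear_opD[OF linear_theta])
    have "theta x v \<in> spn (NWs r)" if "v \<in> spn (NWs r)" for v
      using * that by (auto simp: carr intro!: theta_NWs)
    with * show "a \<otimes>\<^bsub>A\<^esub> x \<in> ?J"
      using A.m_closed[of a x] by (auto simp: carr theta_mult)
  qed
  moreover have "web_relations r \<subseteq> ?J"
  proof
    fix x assume x: "x \<in> web_relations r"
    then have "theta x v = 0" if "v \<in> spn (NWs r)" for v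
    proof (cases "lookup x [] = 0")
      case True
      then show ?thesis by (rule theta_relation[OF x])
    next
      case False
      from x have "x = (\<Sum>a\<in>compositions r. bas [Idm a]) - 1"
      proof cases
        case (local s f g x' y)
        then have "lookup x [] = 0"
          using sourced_local_relation[OF local(2)] sourced_pad[OF _ refl, of s f x' y] sourced_pad[OF _ refl, of s g x' y]
          by (simp add: lookup_minus sourced_lookup)
        with False show ?thesis by simp
      qed (use False in \<open>auto simp: bas_mult lookup_minus lookup_scl split: if_splits\<close>)
      then show ?thesis using theta_unit[OF that] by (simp add: theta_simps)
    qed
    then show "x \<in> ?J" using x web_relations_subset[of r] by (auto simp: A_def)
  qed
  ultimately have "Idl\<^bsub>A\<^esub> (web_relations r) \<subseteq> ?J"
    by (rule A.genideal_minimal)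
  then show ?thesis
    using assms by (auto simp: WI_def relation_ideal_def A_def)
qed

section \<open>The action of the Sergeev superalgebra\<close>

lemma linear_gen_act [simp]: "linear_op (sergeev_gen_act g)"
  by (simp add: linear_op_def gen_act_linear)

definition swp :: "nat \<Rightarrow> idx list \<Rightarrow> idx list" where
  "swp n w = w[n := w ! Suc n, Suc n := w ! n]"

lemma length_swp [simp]: "length (swp n w) = length w"
  by (simp add: swp_def)

lemma nth_swp: "Suc n < length w \<Longrightarrow> t < length w \<Longrightarrow> swp n w ! t = w ! (swap_letter n t)"
  by (auto simp: swp_def nth_list_update swap_letter_def)

lemma swap_letter_simps [simp]: "swap_letter n (swap_letter n t) = t" "swap_letter n n = Suc n" "swap_letter n (Suc n) = n"
  by (auto simp: swap_letter_def)

lemma swap_letter_less: "Suc n < m \<Longrightarrow> t < m \<Longrightarrow> swap_letter n t < m"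
  by (auto simp: swap_letter_def)

lemma SS_bas: "sergeev_gen_act (SS (Suc n)) (bas w) = scl (ksgn (snd (w ! n)) (snd (w ! Suc n))) (bas (swp n w))"
  by (simp add: ksgn_def swp_def)

definition tog :: "nat \<Rightarrow> idx list \<Rightarrow> idx list" where
  "tog n w = w[n := bar (w ! n)]"

lemma length_tog [simp]: "length (tog n w) = length w"
  by (simp add: tog_def)

lemma nth_tog: "n < length w \<Longrightarrow> t < length w \<Longrightarrow> tog n w ! t = (if t = n then (fst (w ! n), snd (w ! n) + 1) else w ! t)"
  by (cases "w ! n") (simp add: tog_def nth_list_update)

text \<open>The sign in \<open>PP\<close> is absorbed into the Koszul sign: the parity is taken over
  the letters up to and including the one that changes.\<close>

lemma CC_bas': "n < length w \<Longrightarrow> sergeev_gen_act (CC (Suc n)) (bas w) =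
    scl (koszul (idx_parity (take (Suc n) w)) * \<i>) (bas (tog n w))"
  unfolding tog_def by (rule CC_act_bas)

lemma sergeev_gens_cases:
  assumes "g \<in> sergeev_gens r"
  obtains n where "g = SS (Suc n)" "Suc n < r" | n where "g = CC (Suc n)" "n < r"
proof -
  consider i where "g = SS i" "1 \<le> i" "i < r" | i where "g = CC i" "1 \<le> i" "i \<le> r"
    using assms by (auto simp: sergeev_gens_def)
  then show thesis
  proof cases
    case 1
    then show thesis using that(1)[of "i - 1"] by simp
  next
    case 2
    then show thesis using that(2)[of "i - 1"] by simp
  qed
qed

declare sergeev_gen_act.simps [simp del]

definition Wl :: "nat \<Rightarrow> idx list set" where
  "Wl r = {w. length w = r}"

text \<open>Tested on generators only; \<open>free_act_supercommutes\<close> will extend it to the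
  whole superalgebra.\<close>

definition supercommutes :: "nat \<Rightarrow> bit \<Rightarrow> idx list set \<Rightarrow> (tens \<Rightarrow> tens) \<Rightarrow> bool" where
  "supercommutes r p S f \<longleftrightarrow> (\<forall>g\<in>sergeev_gens r. \<forall>v\<in>spn S.
     f (sergeev_gen_act g v) = scl (ksgn p (sergeev_parity g)) (sergeev_gen_act g (f v)))"

lemma supercommutesI:
  assumes f: "linear_op f"
    and "\<And>n w. Suc n < r \<Longrightarrow> w \<in> S \<Longrightarrow> f (sergeev_gen_act (SS (Suc n)) (bas w)) = sergeev_gen_act (SS (Suc n)) (f (bas w))"
    and "\<And>n w. n < r \<Longrightarrow> w \<in> S \<Longrightarrow> f (sergeev_gen_act (CC (Suc n)) (bas w)) = scl (ksgn p 1) (sergeev_gen_act (CC (Suc n)) (f (bas w)))"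
  shows "supercommutes r p S f"
  unfolding supercommutes_def
proof (intro ballI)
  fix g v assume g: "g \<in> sergeev_gens r" and v: "v \<in> spn S"
  let ?f = "\<lambda>v. f (sergeev_gen_act g v)" and ?g = "\<lambda>v. scl (ksgn p (sergeev_parity g)) (sergeev_gen_act g (f v))"
  have "?f v = ?g v"
  proof (rule linear_op_spn_eqI[OF v, of ?f ?g])
    show "linear_op ?f" by (rule linear_op_comp[OF f linear_gen_act])
    show "linear_op ?g" by (rule linear_op_scl[OF linear_op_comp[OF linear_gen_act f]])
    show "?f (bas w) = ?g (bas w)" if "w \<in> S" for w
      using g that assms(2,3) by (elim sergeev_gens_cases) auto
  qed
  then show "f (sergeev_gen_act g v) = scl (ksgn p (sergeev_parity g)) (sergeev_gen_act g (f v))" .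
qed

lemma relabel_swp: "Suc n < length w \<Longrightarrow> relabel \<phi> (swp n w) = swp n (relabel \<phi> w)"
  by (intro nth_equalityI) (auto simp: nth_swp swap_letter_less)

lemma relabel_tog: "n < length w \<Longrightarrow> relabel \<phi> (tog n w) = tog n (relabel \<phi> w)"
  by (intro nth_equalityI) (auto simp: nth_tog)

lemma supercommutes_relabel: "supercommutes r 0 (Wl r) (relabel_op \<phi>)"
  by (rule supercommutesI)
    (auto simp: Wl_def SS_bas CC_bas' relabel_op_def lin_ext_scl relabel_swp relabel_tog)

lemma take_parity_swp: "Suc n < length w \<Longrightarrow> idx_parity (take m (swp n w)) =
    idx_parity (take m w) + (if m = Suc n then snd (w ! n) + snd (w ! Suc n) else 0)"
  unfolding swp_def by (rule take_parity_swap)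

lemma take_parity_tog: "n < length w \<Longrightarrow> idx_parity (take m (tog n w)) = idx_parity (take m w) + (if n < m then 1 else 0)"
  unfolding tog_def by (rule take_parity_bar)

text \<open>An exchange of neighbours carries the letter hit by the rung to the other place. What
  its sign gains or loses by the parity of the neighbour is compensated by the sign of the exchange,
  where its own parity has changed by \<open>\<beta>\<close>.\<close>

lemma supercommutes_rung: "supercommutes r \<beta> (Wl r) (rung a b \<beta>)"
proof (rule supercommutesI)
  fix n w assume n: "Suc n < r" and "w \<in> Wl r"
  then have w: "length w = r" by (simp add: Wl_def)
  let ?x = "snd (w ! n)" and ?y = "snd (w ! Suc n)"
  have eq: "scl (ksgn ?x ?y * ksgn \<beta> (idx_parity (take (swap_letter n t) (swp n w)))) (bas (shift_at (swap_letter n t) b \<beta> (swp n w))) =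
      scl (ksgn \<beta> (idx_parity (take t w)) * ksgn (snd (shift_at t b \<beta> w ! n)) (snd (shift_at t b \<beta> w ! Suc n))) (bas (swp n (shift_at t b \<beta> w)))"
    if t: "t < r" for t
  proof (rule scl_bas_cong)
    show "shift_at (swap_letter n t) b \<beta> (swp n w) = swp n (shift_at t b \<beta> w)"
      using t n w by (intro nth_equalityI) (auto simp: nth_shift_at nth_swp swap_letter_def)
    let ?p = "idx_parity (take n w)"
    have pS: "idx_parity (take (Suc n) w) = ?p + ?x" using n w by (simp add: word_parity_take_Suc)
    consider "t = n" | "t = Suc n" | "t \<noteq> n" "t \<noteq> Suc n" by blast
    then show "ksgn ?x ?y * ksgn \<beta> (idx_parity (take (swap_letter n t) (swp n w))) =
      ksgn \<beta> (idx_parity (take t w)) * ksgn (snd (shift_at t b \<beta> w ! n)) (snd (shift_at t b \<beta> w ! Suc n))"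
    proof cases
      case 1
      have "idx_parity (take (Suc n) (swp n w)) = ?p + ?y"
        using n w pS by (simp add: take_parity_swp add.assoc)
      moreover have "snd (shift_at t b \<beta> w ! n) = ?x + \<beta>" "snd (shift_at t b \<beta> w ! Suc n) = ?y"
        using 1 n w by (simp_all add: nth_shift_at)
      ultimately show ?thesis by (simp add: 1 ksgn_add mult_ac)
    next
      case 2
      have "idx_parity (take n (swp n w)) = ?p"
        using n w by (simp add: take_parity_swp)
      moreover have "snd (shift_at t b \<beta> w ! n) = ?x" "snd (shift_at t b \<beta> w ! Suc n) = ?y + \<beta>"
        using 2 n w by (simp_all add: nth_shift_at)
      ultimately show ?thesis by (simp add: 2 pS ksgn_add ksgn_commute[of ?x \<beta>] mult_ac)
    next
      case 3
      then have "swap_letter n t = t" by (simp add: swap_letter_def)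
      moreover have "idx_parity (take t (swp n w)) = idx_parity (take t w)" using 3 n w by (simp add: take_parity_swp)
      moreover have "snd (shift_at t b \<beta> w ! n) = ?x" "snd (shift_at t b \<beta> w ! Suc n) = ?y"
        using 3 n w t by (simp_all add: nth_shift_at)
      ultimately show ?thesis by (simp add: mult.commute)
    qed
  qed
  have "rung a b \<beta> (sergeev_gen_act (SS (Suc n)) (bas w)) = (\<Sum>t\<in>pos a (swp n w).
      scl (ksgn ?x ?y * ksgn \<beta> (idx_parity (take t (swp n w)))) (bas (shift_at t b \<beta> (swp n w))))"
    by (simp add: SS_bas linear_opD[OF linear_rung]) (simp add: rung_def scl_sum)
  also have "\<dots> = (\<Sum>t\<in>pos a w. scl (ksgn \<beta> (idx_parity (take t w)) *
      ksgn (snd (shift_at t b \<beta> w ! n)) (snd (shift_at t b \<beta> w ! Suc n))) (bas (swp n (shift_at t b \<beta> w))))"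
  \<comment> \<open>The letter at position \<open>t\<close> after the exchange was at position
    \<open>swap_letter n t\<close> before it.\<close>
  proof (rule sum.reindex_bij_witness[where i = "swap_letter n" and j = "swap_letter n"], goal_cases)
    case (2 t)
    then show ?case using n w by (auto simp: pos_def nth_swp swap_letter_less)
  next
    case (4 t)
    then show ?case using n w by (auto simp: pos_def nth_swp swap_letter_less)
  next
    case (5 t)
    then have "swap_letter n t < r" using n w by (simp add: pos_def swap_letter_less)
    from eq[OF this] show ?case by simp
  qed simp_all
  also have "\<dots> = sergeev_gen_act (SS (Suc n)) (rung a b \<beta> (bas w))"
    by (simp add: rung_def linear_opD[OF linear_gen_act] SS_bas)
  finally show "rung a b \<beta> (sergeev_gen_act (SS (Suc n)) (bas w)) = sergeev_gen_act (SS (Suc n)) (rung a b \<beta> (bas w))" .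
next
  fix n w assume n: "n < r" and "w \<in> Wl r"
  then have w: "length w = r" by (simp add: Wl_def)
  have pos: "pos a (tog n w) = pos a w" using n w by (auto simp: pos_def nth_tog)
  have kk: "koszul (p + \<beta>) = koszul p * ksgn \<beta> 1" for p by (simp add: ksgn_def koszul_add)
  have eq: "scl (koszul (idx_parity (take (Suc n) w)) * \<i> * ksgn \<beta> (idx_parity (take t (tog n w)))) (bas (shift_at t b \<beta> (tog n w))) =
      scl (ksgn \<beta> 1 * (ksgn \<beta> (idx_parity (take t w)) * (koszul (idx_parity (take (Suc n) (shift_at t b \<beta> w))) * \<i>))) (bas (tog n (shift_at t b \<beta> w)))"
    if t: "t \<in> pos a w" for t
  proof (rule scl_bas_cong)
    have tl: "t < length w" using t by (simp add: pos_def)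
    show "shift_at t b \<beta> (tog n w) = tog n (shift_at t b \<beta> w)"
      using tl n w by (intro nth_equalityI) (auto simp: nth_shift_at nth_tog add.assoc add.commute[of \<beta>])
    show "koszul (idx_parity (take (Suc n) w)) * \<i> * ksgn \<beta> (idx_parity (take t (tog n w))) =
      ksgn \<beta> 1 * (ksgn \<beta> (idx_parity (take t w)) * (koszul (idx_parity (take (Suc n) (shift_at t b \<beta> w))) * \<i>))"
      using tl n w by (cases "n < t") (simp_all add: take_parity_tog take_parity_shift_at ksgn_add kk mult_ac)
  qed
  have "rung a b \<beta> (sergeev_gen_act (CC (Suc n)) (bas w)) = (\<Sum>t\<in>pos a w.
      scl (koszul (idx_parity (take (Suc n) w)) * \<i> * ksgn \<beta> (idx_parity (take t (tog n w)))) (bas (shift_at t b \<beta> (tog n w))))"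
    using n w by (simp add: CC_bas' linear_opD[OF linear_rung]) (simp add: rung_def scl_sum pos)
  also have "\<dots> = (\<Sum>t\<in>pos a w. scl (ksgn \<beta> 1 * (ksgn \<beta> (idx_parity (take t w)) *
      (koszul (idx_parity (take (Suc n) (shift_at t b \<beta> w))) * \<i>))) (bas (tog n (shift_at t b \<beta> w))))"
    by (rule sum.cong[OF refl eq])
  also have "\<dots> = scl (ksgn \<beta> 1) (sergeev_gen_act (CC (Suc n)) (rung a b \<beta> (bas w)))"
    using n w by (simp add: rung_def linear_opD[OF linear_gen_act] CC_bas' scl_sum)
  finally show "rung a b \<beta> (sergeev_gen_act (CC (Suc n)) (bas w)) = scl (ksgn \<beta> 1) (sergeev_gen_act (CC (Suc n)) (rung a b \<beta> (bas w)))" .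
qed simp

section \<open>Splits as divided powers\<close>

text \<open>Another rung adds one letter to the chosen set. Every set of \<open>l + 1\<close>
  letters arises in \<open>l + 1\<close> ways, which turns the factorial of \<open>l\<close> into
  that of \<open>l + 1\<close>.\<close>

lemma rung_pow_bas:
  assumes "a \<noteq> b"
  shows "(rung a b 0 ^^ l) (bas w) = scl (fact l) (split_op a b l (bas w))"
proof (induction l)
  case 0
  then show ?case by (simp add: split_op_empty)
next
  case (Suc l)
  let ?A = "pos a w"
  have fin: "finite X" if "X \<subseteq> ?A" for X using that finite_pos finite_subset by blast
  have len: "X \<subseteq> {..<length w}" if "X \<subseteq> ?A" for X using that pos_subset by blast
  let ?P = "Sigma {X. X \<subseteq> ?A \<and> card X = l} (\<lambda>X. ?A - X)" and ?Q = "Sigma {X. X \<subseteq> ?A \<and> card X = Suc l} (\<lambda>X. X)"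
  have "rung a b 0 (split_op a b l (bas w)) = (\<Sum>X | X \<subseteq> ?A \<and> card X = l. \<Sum>t\<in>?A - X. bas (set_at (insert t X) b w))"
    unfolding split_op_def lin_ext_mon linear_opD[OF linear_rung]
  proof (intro sum.cong refl)
    fix X assume "X \<in> {X. X \<subseteq> ?A \<and> card X = l}"
    then have X: "X \<subseteq> {..<length w}" "X \<subseteq> ?A" using len by auto
    have "pos a (set_at X b w) = ?A - X" using assms by (simp add: pos_set_at[OF X(1)])
    moreover have "shift_at t b 0 (set_at X b w) = set_at (insert t X) b w" if "t \<in> ?A - X" for t
      using that by (intro nth_equalityI) (auto simp: nth_shift_at pos_def)
    ultimately show "rung a b 0 (bas (set_at X b w)) = (\<Sum>t\<in>?A - X. bas (set_at (insert t X) b w))"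
      by (simp add: rung_def)
  qed
  also have "\<dots> = (\<Sum>(X, t)\<in>?P. bas (set_at (insert t X) b w))"
    by (rule sum.Sigma) (simp_all add: finite_subsets_card)
  also have "\<dots> = (\<Sum>(X, t)\<in>?Q. bas (set_at X b w))"
  proof (rule sum.reindex_bij_witness[where i = "\<lambda>(X, t). (X - {t}, t)" and j = "\<lambda>(X, t). (insert t X, t)"], goal_cases)
    case (2 p)
    then show ?case using fin by (auto simp: card_insert_disjoint)
  next
    case (4 p)
    then show ?case using fin by auto
  qed (auto simp: insert_absorb)
  also have "\<dots> = (\<Sum>X | X \<subseteq> ?A \<and> card X = Suc l. \<Sum>t\<in>X. bas (set_at X b w))"
    by (rule sum.Sigma[symmetric]) (auto simp: finite_subsets_card fin)
  also have "\<dots> = scl (of_nat (Suc l)) (split_op a b (Suc l) (bas w))"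
    unfolding split_op_def lin_ext_mon scl_sum
    by (intro sum.cong refl) (simp add: sum_const_scl fin del: sum_constant of_nat_Suc)
  finally have "rung a b 0 (split_op a b l (bas w)) = scl (of_nat (Suc l)) (split_op a b (Suc l) (bas w))" .
  then show ?case using Suc by (simp add: linear_opD[OF linear_rung] mult.commute del: of_nat_Suc)
qed

lemma linear_pow: "linear_op f \<Longrightarrow> linear_op (f ^^ l)" for f :: "tens \<Rightarrow> tens"
proof (induction l)
  case 0
  then show ?case by (simp add: linear_op_id(2)[unfolded id_def[symmetric]] linear_op_id)
next
  case (Suc l)
  then show ?case using linear_op_comp[of f "f ^^ l"] by (simp add: o_def)
qed

lemma divided_power_rung:
  assumes "a \<noteq> b"
  shows "divided_power (rung a b 0) l v = split_op a b l v"
proof (rule linear_op_eqI[OF _ linear_split_op])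
  show "linear_op (divided_power (rung a b 0) l)"
    unfolding divided_power_def[abs_def] by (rule linear_op_scl[OF linear_pow[OF linear_rung]])
  show "divided_power (rung a b 0) l (bas w) = split_op a b l (bas w)" for w
    by (simp add: divided_power_def rung_pow_bas[OF assms])
qed

text \<open>A split is a divided power of an even rung, and rungs have been dealt with.\<close>

lemma supercommutes_split:
  assumes "p \<noteq> b"
  shows "supercommutes r 0 (Wl r) (split_op p b l)"
  unfolding supercommutes_def
proof (intro ballI)
  fix g v assume g: "g \<in> sergeev_gens r" and v: "v \<in> spn (Wl r)"
  have Wl: "(rung p b 0 ^^ m) v \<in> spn (Wl r)" for m
  proof (induction m)
    case (Suc m)
    have "rung p b 0 u \<in> spn (Wl r)" if "u \<in> spn (Wl r)" for u
      by (rule linear_op_spn[OF linear_rung _ that]) (auto simp: rung_def Wl_def)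
    with Suc show ?case by simp
  qed (simp add: v)
  have "(rung p b 0 ^^ m) (sergeev_gen_act g v) = sergeev_gen_act g ((rung p b 0 ^^ m) v)" for m
  proof (induction m)
    case (Suc m)
    then show ?case using supercommutes_rung[of r 0 p b] Wl[of m] g by (simp add: supercommutes_def)
  qed simp
  then show "split_op p b l (sergeev_gen_act g v) = scl (ksgn 0 (sergeev_parity g)) (sergeev_gen_act g (split_op p b l v))"
    by (simp add: divided_power_rung[OF assms, symmetric] divided_power_def linear_opD[OF linear_gen_act])
qed

lemma mset_swp: "Suc n < length w \<Longrightarrow> mset (map fst (swp n w)) = mset (map fst w)"
  using mset_swap[of "Suc n" "map fst w" n] by (simp add: swp_def map_update)

lemma map_fst_tog: "n < length w \<Longrightarrow> map fst (tog n w) = map fst w"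
  by (intro nth_equalityI) (auto simp: nth_tog)

lemma NW_swp: "Suc n < length w \<Longrightarrow> swp n w \<in> NW a \<longleftrightarrow> w \<in> NW a"
  and NW_tog: "n < length w \<Longrightarrow> tog n w \<in> NW a \<longleftrightarrow> w \<in> NW a"
  by (simp_all only: NW_def mem_Collect_eq mset_swp map_fst_tog)

lemma supercommutes_prj: "supercommutes r 0 (Wl r) (prj a)"
  by (rule supercommutesI) (auto simp: Wl_def SS_bas CC_bas' prj_def lin_ext_scl NW_swp NW_tog gen_act_linear)

lemma NW_length: "w \<in> NW a \<Longrightarrow> length w = sum_list a"
proof -
  assume "w \<in> NW a"
  then have "size (mset (map fst w)) = size (mset (base 0 a))" by (simp only: NW_def mem_Collect_eq)
  moreover have "length (base p a) = sum_list a" for p by (induction a arbitrary: p) auto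
  ultimately show ?thesis by simp
qed

lemma spn_NW_Wl: "v \<in> spn (NW a) \<Longrightarrow> r = sum_list a \<Longrightarrow> v \<in> spn (Wl r)"
  by (rule spn_mono[rotated]) (auto simp: Wl_def NW_length)

lemma spn_NWs_Wl: "v \<in> spn (NWs r) \<Longrightarrow> v \<in> spn (Wl r)"
  by (rule spn_mono[rotated]) (auto simp: Wl_def NWs_def NW_length compositions_def)

lemma supercommutes_comp:
  assumes "supercommutes r p S f" "supercommutes r p' S' g" "\<And>v. v \<in> spn S' \<Longrightarrow> g v \<in> spn S" "linear_op f"
  shows "supercommutes r (p + p') S' (\<lambda>v. f (g v))"
  using assms by (auto simp: supercommutes_def linear_opD[OF assms(4)] ksgn_add mult.commute)

lemma web_gens_layer: "Layer x g y \<in> web_gens r \<Longrightarrow> sym_pos g \<and> pl x \<and> pl y \<and> sum_list (x @ src g @ y) = r"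
  by (auto simp: web_gens_def compositions_pl intro: pl_sym_conv)

lemma supercommutes_theta_gen:
  assumes "g \<in> web_gens r"
  shows "supercommutes r (gen_parity g) (Wl r) (theta_gen g)"
proof (cases g)
  case (Idm a)
  then have "theta_gen g = prj a" by auto
  then show ?thesis using supercommutes_prj Idm by simp
next
  case (Layer x h y)
  then have h: "sym_pos h" "sum_list (x @ src h @ y) = r" using web_gens_layer assms by blast+
  have "supercommutes r (sym_parity h) (Wl r) (sym_op (sum_list x) h)"
    using h(1) by (cases h) (simp_all add: supercommutes_relabel supercommutes_split supercommutes_rung)
  then have "supercommutes r (sym_parity h + 0) (Wl r) (\<lambda>v. sym_op (sum_list x) h (prj (x @ src h @ y) v))"
    by (rule supercommutes_comp[OF _ supercommutes_prj]) (rule spn_NW_Wl[OF prj_spn h(2)[symmetric]], rule linear_sym_op)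
  moreover have "theta_gen g = (\<lambda>v. sym_op (sum_list x) h (prj (x @ src h @ y) v))" by (auto simp: Layer)
  ultimately show ?thesis by (simp add: Layer)
qed

lemma supercommutes_theta:
  assumes "keys x \<subseteq> lists (web_gens r)" "x \<in> homogeneous gen_parity p"
  shows "supercommutes r p (NWs r) (theta x)"
  unfolding supercommutes_def
proof (intro ballI)
  fix g v assume g: "g \<in> sergeev_gens r" and v: "v \<in> spn (NWs r)"
  have word: "foldr theta_gen ws (sergeev_gen_act g v) = scl (ksgn (word_parity gen_parity ws) (sergeev_parity g))
      (sergeev_gen_act g (foldr theta_gen ws v))" if "ws \<in> lists (web_gens r)" for ws
    using that
  proof (induction ws)
    case Nil
    then show ?case by (simp add: word_parity_def)
  next
    case (Cons h ws)
    have "foldr theta_gen ws v \<in> spn (NWs r)"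
      using theta_NWs[of "bas ws" r v] Cons.hyps v by (simp add: theta_simps)
    then show ?case
      using Cons supercommutes_theta_gen[of h r] g spn_NWs_Wl
      by (simp add: supercommutes_def linear_opD[OF linear_theta_gen] word_parity_def ksgn_add mult_ac)
  qed
  have "theta x (sergeev_gen_act g v) = (\<Sum>ws\<in>keys x. scl (lookup x ws) (scl (ksgn p (sergeev_parity g)) (sergeev_gen_act g (foldr theta_gen ws v))))"
    unfolding theta_def lin_ext_def
  proof (rule sum.cong[OF refl])
    fix ws assume "ws \<in> keys x"
    then have "ws \<in> lists (web_gens r)" "word_parity gen_parity ws = p" using assms by (auto simp: homogeneous_def)
    then show "scl (lookup x ws) (foldr theta_gen ws (sergeev_gen_act g v)) =
        scl (lookup x ws) (scl (ksgn p (sergeev_parity g)) (sergeev_gen_act g (foldr theta_gen ws v)))"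
      using word by metis
  qed
  then show "theta x (sergeev_gen_act g v) = scl (ksgn p (sergeev_parity g)) (sergeev_gen_act g (theta x v))"
    by (simp add: theta_def lin_ext_def linear_opD[OF linear_gen_act] scl_sum mult.commute)
qed

section \<open>Parity of the operators of webs\<close>

lemma parity_shift_at: "t < length w \<Longrightarrow> idx_parity (shift_at t b \<beta> w) = idx_parity w + \<beta>"
  using take_parity_shift_at[of t w "length w" b \<beta>] by simp

lemma homogeneous_bas: "bas w \<in> homogeneous snd p \<longleftrightarrow> idx_parity w = p"
  by (simp add: homogeneous_def)

lemma homogeneous_spn: "homogeneous snd p = spn {w. idx_parity w = p}"
  by (auto simp: homogeneous_def spn_def)

lemma parity_relabel [simp]: "idx_parity (relabel \<phi> w) = idx_parity w"
  using parity_take_relabel[of "length w" \<phi> w] by (metis length_relabel order_refl take_all)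

lemma parity_set_at [simp]: "idx_parity (set_at X b w) = idx_parity w"
  using parity_take_set_at[of "length w" X b w] by (metis length_set_at order_refl take_all)

lemma prj_homogeneous: "v \<in> homogeneous snd p \<Longrightarrow> prj a v \<in> homogeneous snd p"
  unfolding homogeneous_spn by (rule linear_op_spn[OF linear_prj]) (simp_all add: prj_def)

lemma theta_gen_homogeneous:
  assumes "v \<in> homogeneous snd p"
  shows "theta_gen g v \<in> homogeneous snd (p + gen_parity g)"
proof (cases g)
  case (Idm a)
  then show ?thesis using prj_homogeneous[OF assms] by simp
next
  case (Layer x h y)
  have "sym_op k h u \<in> homogeneous snd (p + sym_parity h)" if "u \<in> homogeneous snd p" for k u
    using that unfolding homogeneous_spn
  proof (rule linear_op_spn[OF linear_sym_op, rotated])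
    fix w assume "w \<in> {w. idx_parity w = p}"
    then show "sym_op k h (bas w) \<in> spn {w. idx_parity w = p + sym_parity h}"
      by (cases h) (auto simp: relabel_op_def split_op_def rung_def parity_shift_at pos_less)
  qed
  from this[OF prj_homogeneous[OF assms]] show ?thesis by (simp add: Layer)
qed

lemma theta_homogeneous:
  assumes "x \<in> homogeneous gen_parity p" "v \<in> homogeneous snd p'"
  shows "theta x v \<in> homogeneous snd (p + p')"
proof -
  have "foldr theta_gen ws v \<in> homogeneous snd (word_parity gen_parity ws + p')" for ws
  proof (induction ws)
    case Nil
    then show ?case using assms(2) by (simp add: word_parity_def)
  next
    case (Cons g ws)
    then show ?case using theta_gen_homogeneous[OF Cons, of g] by (simp add: word_parity_def ac_simps)
  qed
  then show ?thesis using assms(1) unfolding theta_def lin_ext_def homogeneous_spn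
    by (intro spn_sum) (auto simp: homogeneous_def)
qed

section \<open>The supercommutant on words with distinct letters\<close>

lemma swp_append: "swp (length p) (p @ x # y # s) = p @ y # x # s"
  by (simp add: swp_def nth_append list_update_append)

text \<open>The letter required next is carried to the front of the rest by exchanges with its left
  neighbours, and so on.\<close>

lemma adjacent_swaps_induct:
  assumes "\<And>w n. mset w = mset u \<Longrightarrow> P w \<Longrightarrow> Suc n < length w \<Longrightarrow> P (swp n w)"
    and "P u" "mset u = mset v"
  shows "P v"
proof -
  have P: "P (p @ y # x # s)" if "P (p @ x # y # s)" "mset (p @ x # y # s) = mset u" for p x y s
    using assms(1)[OF that(2,1), of "length p"] by (simp add: swp_append)
  have front: "P (p @ x # s @ t)" if "P (p @ s @ x # t)" "mset (p @ s @ x # t) = mset u" for p s x t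
    using that
  proof (induction s arbitrary: t rule: rev_induct)
    case (snoc y s)
    have "P (p @ s @ x # y # t)" using P[of "p @ s" y x t] snoc.prems by simp
    moreover have "mset (p @ s @ x # y # t) = mset u" using snoc.prems(2) by (simp add: add_mset_commute)
    ultimately show ?case using snoc.IH[of "y # t"] by simp
  qed simp
  have "P (p @ v)" if "P (p @ w)" "mset w = mset v" "mset (p @ w) = mset u" for p w v
    using that
  proof (induction v arbitrary: p w)
    case (Cons x v)
    then have "x \<in> set w" by (metis list.set_intros(1) mset_eq_setD)
    then obtain s t where w: "w = s @ x # t" by (meson split_list)
    have "P ((p @ [x]) @ s @ t)" using front[of p s x t] Cons.prems w by simp
    moreover have "mset (s @ t) = mset v" "mset ((p @ [x]) @ s @ t) = mset u" using Cons.prems w by auto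
    ultimately have "P ((p @ [x]) @ v)" by (rule Cons.IH)
    then show ?case by simp
  qed simp
  from this[of "[]" u v] show ?thesis using assms(2,3) by simp
qed

lemma NW_ones_iff: "w \<in> NW (ones r) \<longleftrightarrow> mset (map fst w) = mset [0..<r]"
  by (simp only: NW_def mem_Collect_eq base_ones add_0)

text \<open>Starting from \<open>v0 r\<close>, the bars are set one after the other while the word
  is still sorted; then exchanges of neighbours arrange the letters. In the proof \<open>f j\<close>
  is the bar that the letter \<open>j\<close> has in \<open>w\<close>.\<close>

lemma NW_ones_induct [consumes 1, case_names v0 swp tog]:
  assumes w: "w \<in> NW (ones r)"
    and v0: "P (v0 r)"
    and swp: "\<And>w n. w \<in> NW (ones r) \<Longrightarrow> P w \<Longrightarrow> Suc n < r \<Longrightarrow> P (swp n w)"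
    and tog: "\<And>w n. w \<in> NW (ones r) \<Longrightarrow> P w \<Longrightarrow> n < r \<Longrightarrow> P (tog n w)"
  shows "P w"
proof -
  define f where "f j = the (map_of w j)" for j
  note W = NW_ones[OF w]
  let ?u = "\<lambda>n. map (\<lambda>j. (j, if j < n then f j else 0)) [0..<r]"
  have u: "?u n \<in> NW (ones r)" for n unfolding NW_ones_iff by (simp add: o_def)
  have "P (?u n)" if "n \<le> r" for n
    using that
  proof (induction n)
    case 0
    then show ?case using v0 by (simp add: v0_def)
  next
    case (Suc n)
    show ?case
    proof (cases "f n = 0")
      case True
      then have "?u (Suc n) = ?u n" by (intro map_cong) (auto simp: less_Suc_eq)
      moreover have "P (?u n)" using Suc by simp
      ultimately show ?thesis by (simp only:)
    next
      case False
      then have "f n = 1" by simp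
      then have "?u (Suc n) = tog n (?u n)" using Suc.prems by (intro nth_equalityI) (auto simp: nth_tog less_Suc_eq)
      moreover have "P (tog n (?u n))" using tog[OF u, of n n] Suc by simp
      ultimately show ?thesis by (simp only:)
    qed
  qed
  then have Pu: "P (?u r)" by simp
  have fw: "f (fst z) = snd z" if "z \<in> set w" for z
    using map_of_is_SomeI[OF W(1), of "fst z" "snd z"] that by (simp add: f_def)
  have "map (\<lambda>j. (j, f j)) (map fst w) = w" unfolding map_map o_def by (rule map_idI) (simp add: fw)
  then have "mset w = mset (map (\<lambda>j. (j, f j)) (map fst w))" by simp
  also have "\<dots> = mset (map (\<lambda>j. (j, f j)) [0..<r])"
    using w[unfolded NW_ones_iff] by (metis mset_map)
  also have "map (\<lambda>j. (j, f j)) [0..<r] = ?u r" by auto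
  finally have m: "mset (?u r) = mset w" by simp
  have "P w \<and> w \<in> NW (ones r)"
  proof (rule adjacent_swaps_induct[where u = "?u r", OF _ _ m])
    fix w' n assume w': "mset w' = mset (?u r)" "P w' \<and> w' \<in> NW (ones r)" "Suc n < length w'"
    then show "P (swp n w') \<and> swp n w' \<in> NW (ones r)"
      using swp[of w' n] NW_ones(3)[of w' r] by (simp add: NW_swp)
  qed (use Pu u in blast)
  then show ?thesis by simp
qed

lemma ksgn_square: "ksgn p p' * ksgn p p' = 1"
  by (simp add: ksgn_def koszul_square)

lemma bas_swp: "bas (swp n w) = scl (ksgn (snd (w ! n)) (snd (w ! Suc n))) (sergeev_gen_act (SS (Suc n)) (bas w))"
  by (simp add: SS_bas ksgn_square)

lemma koszul_nonzero [simp]: "koszul p \<noteq> 0"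
  by (simp add: koszul_def)

lemma bas_tog: "n < length w \<Longrightarrow> bas (tog n w) = scl (1 / (koszul (idx_parity (take (Suc n) w)) * \<i>)) (sergeev_gen_act (CC (Suc n)) (bas w))"
  by (simp add: CC_bas')

lemma sergeev_gens_Suc: "Suc n < r \<Longrightarrow> SS (Suc n) \<in> sergeev_gens r" "n < r \<Longrightarrow> CC (Suc n) \<in> sergeev_gens r"
  by (auto simp: sergeev_gens_def)

text \<open>The words with distinct letters span a cyclic module generated by \<open>v0 r\<close>:
  each word is obtained from it by Sergeev generators and nonzero scalars.\<close>

lemma supercommutes_eqI:
  assumes F: "linear_op F" "supercommutes r p (NW (ones r)) F" and G: "linear_op G" "supercommutes r p (NW (ones r)) G"
    and eq: "F (bas (v0 r)) = G (bas (v0 r))" and v: "v \<in> spn (NW (ones r))"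
  shows "F v = G v"
proof (rule linear_op_spn_eqI[OF v F(1) G(1)])
  have step: "F (sergeev_gen_act g (bas w)) = G (sergeev_gen_act g (bas w))"
    if "w \<in> NW (ones r)" "F (bas w) = G (bas w)" "g \<in> sergeev_gens r" for g w
    using F(2) G(2) that unfolding supercommutes_def by simp
  fix w assume "w \<in> NW (ones r)"
  then show "F (bas w) = G (bas w)"
  proof (induction rule: NW_ones_induct)
    case (swp w n)
    then show ?case unfolding bas_swp using step sergeev_gens_Suc
      by (simp only: linear_opD[OF F(1)] linear_opD[OF G(1)])
  next
    case (tog w n)
    have "n < length w" using NW_ones(3)[OF tog.hyps(1)] tog.hyps(2) by simp
    then show ?case using step[OF tog.hyps(1) tog.IH] sergeev_gens_Suc tog.hyps(2)
      by (simp only: bas_tog linear_opD[OF F(1)] linear_opD[OF G(1)])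
  qed (rule eq)
qed

definition webs :: "nat \<Rightarrow> bit \<Rightarrow> web set" where
  "webs r p = spn {ws \<in> lists (web_gens r). word_parity gen_parity ws = p}"

lemma webs_iff: "z \<in> webs r p \<longleftrightarrow> keys z \<subseteq> lists (web_gens r) \<and> z \<in> homogeneous gen_parity p"
  by (auto simp: webs_def spn_def homogeneous_def)

lemma webs_closed: "z \<in> webs r p \<Longrightarrow> scl c z \<in> webs r p" "(\<And>i. i \<in> A \<Longrightarrow> f i \<in> webs r p) \<Longrightarrow> (\<Sum>i\<in>A. f i) \<in> webs r p"
  "z \<in> webs r p \<Longrightarrow> w \<in> webs r p \<Longrightarrow> z + w \<in> webs r p" "z \<in> webs r p \<Longrightarrow> w \<in> webs r p \<Longrightarrow> z - w \<in> webs r p"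
  unfolding webs_def by auto

lemma webs_mult: "z \<in> webs r p \<Longrightarrow> w \<in> webs r p' \<Longrightarrow> z * w \<in> webs r (p + p')"
  unfolding webs_iff using homogeneous_mult keys_mult_lists by blast

lemma webs_bas: "bas ws \<in> webs r p \<longleftrightarrow> ws \<in> lists (web_gens r) \<and> word_parity gen_parity ws = p"
  by (simp add: webs_def)

lemma webs_one: "1 \<in> webs r 0"
  using webs_bas[of "[]" r 0] by (simp add: word_parity_def bas_Nil)

lemma pl_erase: "pl a \<Longrightarrow> erase a = a"
  by (simp add: pl_def filter_id_conv)

text \<open>In \<open>v0 r\<close> the letter at each position is the position itself. So exchanging
  two labels by a web is exchanging two positions by a Sergeev generator.\<close>

lemma theta_swap_v0:
  assumes "Suc n < r"
  shows "\<exists>y\<in>webs r 0. theta y (bas (v0 r)) = sergeev_gen_act (SS (Suc n)) (bas (v0 r))"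
proof -
  obtain m where o: "ones r = ones n @ 1 # 1 # ones m" using ones_split(2)[OF assms] by blast
  let ?ws = "[Layer (ones n) (Split 1 1) (ones m), Layer (ones n) (Merge 1 1) (ones m)]"
  have r: "sum_list (ones r) = r" by (simp add: sum_list_replicate)
  then have r': "n + (2 + m) = r" unfolding o by (simp add: sum_list_replicate)
  let ?y = "bas ?ws - 1 :: web"
  have "pad (ones n) (ones m) (split 1 1 * merge 1 1) = bas ?ws"
    by (simp add: pad_mult split_def merge_def pad_bas bas_mult pl_erase)
  moreover have v: "bas (v0 r) \<in> spn (NW (ones n @ 1 # 1 # ones m))" using v0_NW[of r] by (simp only: o bas_spn)
  ultimately have "theta (bas ?ws) (bas (v0 r)) = bas (v0 r) + swap_op (sum_list (ones n)) (bas (v0 r))"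
    using crossing_sound[OF v] by simp
  then have "theta ?y (bas (v0 r)) = bas (relabel (swap_letter n) (v0 r))"
    by (simp add: theta_simps(2) swap_op_def relabel_op_def sum_list_replicate)
  also have "relabel (swap_letter n) (v0 r) = swp n (v0 r)"
    using assms by (intro nth_equalityI) (auto simp: v0_def nth_swp swap_letter_def)
  also have "bas \<dots> = sergeev_gen_act (SS (Suc n)) (bas (v0 r))"
    using assms by (simp add: SS_bas v0_def)
  finally have "theta ?y (bas (v0 r)) = sergeev_gen_act (SS (Suc n)) (bas (v0 r))" .
  moreover have "bas ?ws \<in> webs r 0"
    using r' by (simp add: webs_bas word_parity_def web_gens_def compositions_pl sum_list_replicate)
  ultimately show ?thesis using webs_closed(4)[OF _ webs_one] by blast
qed

text \<open>The same for dots, up to a scalar that stems from the square root of \<open>- 1\<close>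
  in the Clifford action.\<close>

lemma theta_dot_v0:
  assumes "n < r"
  shows "\<exists>y\<in>webs r 1. \<exists>c. c \<noteq> 0 \<and> theta y (bas (v0 r)) = scl c (sergeev_gen_act (CC (Suc n)) (bas (v0 r)))"
proof -
  obtain m where o: "ones r = ones n @ 1 # ones m" using ones_split(1)[OF assms] by blast
  let ?ws = "[Layer (ones n) (Dot 1) (ones m)]"
  have "sum_list (ones r) = r" by (simp add: sum_list_replicate)
  then have r': "n + (1 + m) = r" unfolding o by (simp add: sum_list_replicate)
  have v: "bas (v0 r) \<in> spn (NW (ones n @ src (Dot 1) @ ones m))" using v0_NW[of r] by (simp only: o bas_spn src.simps append_Cons append_Nil)
  have "theta (bas ?ws) (bas (v0 r)) = rung n n 1 (bas (v0 r))"
    using theta_layer[OF v] by (simp add: sum_list_replicate)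
  also have "pos n (v0 r) = {n}" using assms by (auto simp: pos_def v0_def)
  then have "rung n n 1 (bas (v0 r)) = scl (ksgn 1 (idx_parity (take n (v0 r)))) (bas (shift_at n n 1 (v0 r)))"
    by (simp add: rung_def)
  also have "shift_at n n 1 (v0 r) = tog n (v0 r)"
    using assms by (intro nth_equalityI) (auto simp: v0_def nth_tog nth_shift_at)
  also have "bas \<dots> = scl (1 / (koszul (idx_parity (take (Suc n) (v0 r))) * \<i>)) (sergeev_gen_act (CC (Suc n)) (bas (v0 r)))"
    by (rule bas_tog) (simp add: assms v0_def)
  finally have "theta (bas ?ws) (bas (v0 r)) = scl (ksgn 1 (idx_parity (take n (v0 r))) * (1 / (koszul (idx_parity (take (Suc n) (v0 r))) * \<i>)))
      (sergeev_gen_act (CC (Suc n)) (bas (v0 r)))"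
    by (simp only: scl_scl)
  moreover have "ksgn 1 (idx_parity (take n (v0 r))) * (1 / (koszul (idx_parity (take (Suc n) (v0 r))) * \<i>)) \<noteq> 0"
    by (simp add: ksgn_def)
  moreover have "bas ?ws \<in> webs r 1"
    using r' by (simp add: webs_bas word_parity_def web_gens_def compositions_pl sum_list_replicate)
  ultimately show ?thesis by blast
qed

lemma NW_ones_NWs: "0 < r \<Longrightarrow> NW (ones r) \<subseteq> NWs r"
  unfolding NWs_def by (rule UN_upper) (simp add: compositions_pl sum_list_replicate)

lemma idx_parity_swp: "Suc n < length w \<Longrightarrow> idx_parity (swp n w) = idx_parity w"
  using take_parity_swp[of n w "length w"] by simp

lemma idx_parity_tog: "n < length w \<Longrightarrow> idx_parity (tog n w) = idx_parity w + 1"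
  using take_parity_tog[of n w "length w"] by simp

text \<open>Let \<open>z\<close> take \<open>v0 r\<close> to \<open>w\<close>, and let
  \<open>y\<close> take it to its image under a Sergeev generator \<open>g\<close>. Since
  \<open>z\<close> supercommutes with \<open>g\<close>, the product \<open>z * y\<close>, in which
  \<open>y\<close> acts first, takes \<open>v0 r\<close> to the image of \<open>w\<close> under
  \<open>g\<close> up to a nonzero scalar.\<close>

lemma theta_v0_word:
  assumes "w \<in> NW (ones r)" "0 < r"
  shows "\<exists>z\<in>webs r (idx_parity w). theta z (bas (v0 r)) = bas w"
proof -
  have v: "bas (v0 r) \<in> spn (NWs r)" using NW_ones_NWs[OF assms(2)] v0_NW[of r] by auto
  have step: "\<exists>z'\<in>webs r (p + p'). theta z' (bas (v0 r)) = scl c (sergeev_gen_act g (bas w))"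
    if z: "z \<in> webs r p" "theta z (bas (v0 r)) = bas w" and g: "g \<in> sergeev_gens r"
      and y: "y \<in> webs r p'" "theta y (bas (v0 r)) = scl d (sergeev_gen_act g (bas (v0 r)))" "d \<noteq> 0"
    for z p p' c d g w y
  proof -
    let ?s = "ksgn p (sergeev_parity g)"
    have "theta (z * y) (bas (v0 r)) = scl d (theta z (sergeev_gen_act g (bas (v0 r))))"
      by (simp add: theta_mult y linear_opD[OF linear_theta])
    also have "theta z (sergeev_gen_act g (bas (v0 r))) = scl ?s (sergeev_gen_act g (bas w))"
      using supercommutes_theta[of z r p] z g v by (simp add: webs_iff supercommutes_def)
    finally have "theta (scl (c / d * ?s) (z * y)) (bas (v0 r)) = scl (c * (?s * ?s)) (sergeev_gen_act g (bas w))"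
      using y(3) by (simp add: theta_simps)
    moreover have "scl (c / d * ?s) (z * y) \<in> webs r (p + p')" using webs_mult[OF z(1) y(1)] by (rule webs_closed)
    ultimately show ?thesis using ksgn_square by (metis mult.right_neutral)
  qed
  from assms(1) show ?thesis
  proof (induction rule: NW_ones_induct)
    case v0
    have "idx_parity (v0 r) = 0" by (simp add: v0_def word_parity_def o_def)
    then show ?case using webs_one by (intro bexI[of _ 1]) simp_all
  next
    case (swp w n)
    obtain z where z: "z \<in> webs r (idx_parity w)" "theta z (bas (v0 r)) = bas w" using swp.IH by blast
    obtain y where y: "y \<in> webs r 0" "theta y (bas (v0 r)) = scl 1 (sergeev_gen_act (SS (Suc n)) (bas (v0 r)))"
      using theta_swap_v0[OF swp.hyps(2)] by auto
    have "Suc n < length w" using NW_ones(3)[OF swp.hyps(1)] swp.hyps(2) by simp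
    then show ?case using step[OF z sergeev_gens_Suc(1)[OF swp.hyps(2)] y] by (simp add: bas_swp idx_parity_swp)
  next
    case (tog w n)
    obtain z where z: "z \<in> webs r (idx_parity w)" "theta z (bas (v0 r)) = bas w" using tog.IH by blast
    obtain y c where y: "y \<in> webs r 1" "theta y (bas (v0 r)) = scl c (sergeev_gen_act (CC (Suc n)) (bas (v0 r)))"
      "c \<noteq> 0" using theta_dot_v0[OF tog.hyps(2)] by auto
    have "n < length w" using NW_ones(3)[OF tog.hyps(1)] tog.hyps(2) by simp
    then show ?case using step[OF z sergeev_gens_Suc(2)[OF tog.hyps(2)] y] by (simp add: bas_tog idx_parity_tog)
  qed
qed

lemma theta_v0:
  assumes u: "u \<in> spn (NW (ones r))" "u \<in> homogeneous snd p" and r: "0 < r"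
  shows "\<exists>z\<in>webs r p. theta z (bas (v0 r)) = u"
proof -
  have "\<exists>z\<in>webs r p. theta z (bas (v0 r)) = bas w" if "w \<in> keys u" for w
    using theta_v0_word[of w r] spn_keys[OF u(1) that] u(2) that r by (auto simp: homogeneous_def)
  then obtain Z where Z: "\<And>w. w \<in> keys u \<Longrightarrow> Z w \<in> webs r p \<and> theta (Z w) (bas (v0 r)) = bas w" by metis
  have "theta (\<Sum>w\<in>keys u. scl (lookup u w) (Z w)) (bas (v0 r)) = (\<Sum>w\<in>keys u. scl (lookup u w) (bas w))"
    unfolding theta_simps by (rule sum.cong) (simp_all add: Z)
  also have "\<dots> = u" using lin_ext_bas_self[of u] by (simp add: lin_ext_def)
  finally show ?thesis using Z by (intro bexI[of _ "\<Sum>w\<in>keys u. scl (lookup u w) (Z w)"]) (auto intro: webs_closed)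
qed

lemma supercommutes_mono: "supercommutes r p S f \<Longrightarrow> S' \<subseteq> S \<Longrightarrow> supercommutes r p S' f"
  using spn_mono by (fastforce simp: supercommutes_def)

text \<open>Both sides supercommute, so it suffices to realise the value at
  \<open>v0 r\<close>.\<close>

lemma theta_full_ones:
  assumes G: "linear_op G" "supercommutes r p (NW (ones r)) G" "\<And>v. v \<in> spn (NW (ones r)) \<Longrightarrow> G v \<in> spn (NW (ones r))"
    "G (bas (v0 r)) \<in> homogeneous snd p" and r: "0 < r"
  shows "\<exists>z\<in>webs r p. \<forall>v\<in>spn (NW (ones r)). theta z v = G v"
proof -
  obtain z where z: "z \<in> webs r p" "theta z (bas (v0 r)) = G (bas (v0 r))"
    using theta_v0[OF G(3,4) r] v0_NW[of r] by auto
  have "supercommutes r p (NW (ones r)) (theta z)"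
    using z(1) by (intro supercommutes_mono[OF supercommutes_theta NW_ones_NWs[OF r]]) (simp_all add: webs_iff)
  then have "theta z v = G v" if "v \<in> spn (NW (ones r))" for v
    using that by (rule supercommutes_eqI[OF linear_theta _ G(1,2) z(2)])
  with z(1) show ?thesis by blast
qed

section \<open>Fullness\<close>

text \<open>The total merge and its right inverse, with their equations in \<open>wq\<close> turned
  into equations between operators.\<close>

lemma merge_all_rep:
  assumes "a \<in> compositions r"
  obtains m R where "m \<in> webs r 0" "R \<in> webs r 0"
    "\<And>v. theta m (prj (ones r) v) = theta m v" "\<And>v. prj a (theta m v) = theta m v" "\<And>v. theta m (theta R v) = prj a v"
proof -
  have a: "a \<noteq> []" "pl a" "sum_list a = r" using assms by (simp_all add: compositions_pl)
  have "ml [] a [] \<in> even_webs r" using a by (intro even_webs_ml) simp_all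
  then obtain m where m: "q m = ml [] a []" "m \<in> webs r 0" by (auto simp: even_webs_def webs_iff)
  obtain R' where "R' \<in> even_webs r" "ml [] a [] * R' = J a" using ml_right_inverse[of a "[]" r] a by auto
  then obtain R where R: "R \<in> webs r 0" "q (m * R) = q (bas [Idm a])"
    by (auto simp: even_webs_def webs_iff q_simps m J_def)
  have "q (m * bas [Idm (ones r)]) = q m" using ml_J[of a] a by (simp add: q_simps m J_def)
  from theta_q_cong[OF this] have 1: "theta m (prj (ones r) v) = theta m v" for v
    by (simp add: theta_mult) (simp add: theta_simps)
  have "q (bas [Idm a] * m) = q m" using J_ml[of a] a by (simp add: q_simps m J_def)
  from theta_q_cong[OF this] have 2: "prj a (theta m v) = theta m v" for v
    by (simp add: theta_mult) (simp add: theta_simps)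
  from theta_q_cong[OF R(2)] have "theta m (theta R v) = prj a v" for v
    by (simp add: theta_mult) (simp add: theta_simps)
  from that[OF m(2) R(1) 1 2 this] show thesis .
qed

lemma webs_Idm: "a \<in> compositions r \<Longrightarrow> bas [Idm a] \<in> webs r 0"
  by (simp add: webs_bas web_gens_def word_parity_def)

text \<open>A block from \<open>a\<close> to \<open>b\<close> is transported to thin strands by the
  total merge of \<open>a\<close> and the right inverse for \<open>b\<close>, realised there by a
  web, and transported back by the right inverse for \<open>a\<close> and the total merge of
  \<open>b\<close>.\<close>

theorem theta_full:
  assumes F: "linear_op F" "supercommutes r p (NWs r) F" "\<And>v. v \<in> spn (NWs r) \<Longrightarrow> F v \<in> spn (NWs r)"
    "\<And>p' v. v \<in> spn (NWs r) \<Longrightarrow> v \<in> homogeneous snd p' \<Longrightarrow> F v \<in> homogeneous snd (p + p')" and r: "0 < r"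
  shows "\<exists>x\<in>webs r p. \<forall>v\<in>spn (NWs r). theta x v = F v"
proof -
  have theta_NWs': "theta z v \<in> spn (NWs r)" if "z \<in> webs r p'" "v \<in> spn (NWs r)" for z p' v
    using theta_NWs[of z r v] that by (simp add: webs_iff)
  have comm: "supercommutes r p' (NWs r) (theta z)" if "z \<in> webs r p'" for z p'
    using supercommutes_theta[of z r p'] that by (simp add: webs_iff)
  have prj_NWs: "prj a v \<in> spn (NWs r)" if "a \<in> compositions r" for a v
    by (rule spn_mono[OF _ prj_spn[of a]]) (use that in \<open>auto simp: NWs_def\<close>)
  have ones: "ones r \<in> compositions r" using r by (simp add: compositions_pl sum_list_replicate)
  have block: "\<exists>x\<in>webs r p. \<forall>v\<in>spn (NWs r). theta x v = prj b (F (prj a v))"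
    if ab: "a \<in> compositions r" "b \<in> compositions r" for a b
  proof -
    obtain m R where m: "m \<in> webs r 0" "R \<in> webs r 0"
      "\<And>v. theta m (prj (ones r) v) = theta m v" "\<And>v. prj a (theta m v) = theta m v" "\<And>v. theta m (theta R v) = prj a v"
      by (rule merge_all_rep[OF ab(1)], rule that)
    obtain m' R' where m': "m' \<in> webs r 0" "R' \<in> webs r 0"
      "\<And>v. theta m' (prj (ones r) v) = theta m' v" "\<And>v. prj b (theta m' v) = theta m' v" "\<And>v. theta m' (theta R' v) = prj b v"
      by (rule merge_all_rep[OF ab(2)], rule that)
    \<comment> \<open>The right inverse \<open>R'\<close> is only known to be an even web of size
      \<open>r\<close>; the idempotents cut it down to the source \<open>b\<close> and to thin
      strands as target.\<close>
    define A where "A = bas [Idm (ones r)] * (R' * bas [Idm b])"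
    have A: "A \<in> webs r 0" unfolding A_def
      using webs_mult[OF webs_Idm[OF ones] webs_mult[OF m'(2) webs_Idm[OF ab(2)]]] by simp
    have thA: "theta A v = prj (ones r) (theta R' (prj b v))" for v
      unfolding A_def theta_mult by (simp add: theta_simps)
    let ?G = "\<lambda>v. theta A (F (theta m v))"
    have lin: "linear_op ?G" by (rule linear_op_comp[OF linear_theta linear_op_comp[OF F(1) linear_theta]])
    have "supercommutes r (p + 0) (NWs r) (\<lambda>v. F (theta m v))"
      by (rule supercommutes_comp[OF F(2) comm[OF m(1)] theta_NWs'[OF m(1)] F(1)])
    then have "supercommutes r (0 + (p + 0)) (NWs r) ?G"
      by (rule supercommutes_comp[OF comm[OF A] _ _ linear_theta]) (rule F(3)[OF theta_NWs'[OF m(1)]])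
    then have sc: "supercommutes r p (NW (ones r)) ?G" using supercommutes_mono NW_ones_NWs[OF r] by simp
    have typed: "?G v \<in> spn (NW (ones r))" for v by (simp add: thA)
    have v0: "bas (v0 r) \<in> spn (NWs r)" using NW_ones_NWs[OF r] v0_NW[of r] by auto
    have v0h: "bas (v0 r) \<in> homogeneous snd 0" by (simp add: homogeneous_bas) (simp add: v0_def word_parity_def o_def)
    have tha: "theta z v \<in> homogeneous snd (s + t)" if "z \<in> webs r s" "v \<in> homogeneous snd t" for z s t v
      using theta_homogeneous that by (simp add: webs_iff)
    have "?G (bas (v0 r)) \<in> homogeneous snd (0 + (p + (0 + 0)))"
      by (rule tha[OF A F(4)[OF theta_NWs'[OF m(1) v0] tha[OF m(1) v0h]]])
    then have "?G (bas (v0 r)) \<in> homogeneous snd p" by simp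
    from theta_full_ones[OF lin sc typed this r] obtain z where z: "z \<in> webs r p"
      "\<And>v. v \<in> spn (NW (ones r)) \<Longrightarrow> theta z v = ?G v" by blast
    let ?x = "m' * (z * (bas [Idm (ones r)] * R))"
    have "?x \<in> webs r (0 + (p + (0 + 0)))" using m'(1) z(1) webs_Idm[OF ones] m(2) by (intro webs_mult)
    moreover have "theta ?x v = prj b (F (prj a v))" if "v \<in> spn (NWs r)" for v
    proof -
      have "theta (bas [Idm (ones r)] * R) v = prj (ones r) (theta R v)" by (simp add: theta_mult) (simp add: theta_simps)
      then have "theta ?x v = theta m' (?G (prj (ones r) (theta R v)))" by (simp add: theta_mult z(2))
      also have "\<dots> = theta m' (theta R' (prj b (F (prj a v))))" by (simp only: thA m'(3) m(3,5))
      also have "\<dots> = prj b (F (prj a v))" by (simp only: m'(5) prj_id[OF prj_spn])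
      finally show ?thesis .
    qed
    ultimately show ?thesis by (intro bexI[of _ ?x]) simp_all
  qed
  obtain X where X: "\<And>a b. a \<in> compositions r \<Longrightarrow> b \<in> compositions r \<Longrightarrow> X a b \<in> webs r p \<and> (\<forall>v\<in>spn (NWs r). theta (X a b) v = prj b (F (prj a v)))"
    using block by metis
  let ?X = "\<Sum>b\<in>compositions r. \<Sum>a\<in>compositions r. X a b"
  have unit: "(\<Sum>a\<in>compositions r. prj a v) = v" if "v \<in> spn (NWs r)" for v
    using theta_unit[OF that] by (simp add: theta_simps)
  have "theta ?X v = F v" if v: "v \<in> spn (NWs r)" for v
  proof -
    have "theta ?X v = (\<Sum>b\<in>compositions r. \<Sum>a\<in>compositions r. prj b (F (prj a v)))"
      unfolding theta_simps using X v by (intro sum.cong refl) blast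
    also have "\<dots> = (\<Sum>b\<in>compositions r. prj b (F (\<Sum>a\<in>compositions r. prj a v)))"
      by (simp add: linear_opD[OF linear_prj] linear_opD[OF F(1)])
    also have "\<dots> = F v" using unit[OF v] unit[OF F(3)[OF v]] by simp
    finally show ?thesis .
  qed
  moreover have "?X \<in> webs r p" using X by (intro webs_closed) blast
  ultimately show ?thesis by blast
qed

section \<open>Passing between strand numbers and offsets\<close>

definition compress :: "idx list \<Rightarrow> idx list" where
  "compress w = relabel (below w) w"

lemma CC_compress: "CC_op (bas w) = bas (compress w)"
  by (simp add: CC_op_def compress_def)

lemma compress_PW: "w \<in> PW a \<Longrightarrow> compress w = relabel (offset a) w"
  unfolding compress_def by (rule relabel_cong, rule below_PW)

lemma bij_compress_PW:
  assumes "a \<in> compositions r"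
  shows "bij_betw compress (PW a) (NW a)"
  unfolding bij_betw_def
proof (intro conjI inj_onI Set.set_eqI iffI)
  fix v w assume "v \<in> PW a" "w \<in> PW a" "compress v = compress w"
  then show "v = w" using relabel_offset_inj[of v a w] by (simp add: compress_PW)
next
  fix u assume "u \<in> compress ` PW a"
  then show "u \<in> NW a" by (auto simp: compress_PW relabel_PW)
next
  fix u assume "u \<in> NW a"
  moreover have "\<forall>k\<in>set a. 0 < k" using assms by (simp add: compositions_def)
  ultimately obtain w where "w \<in> PW a" "relabel (offset a) w = u" by (rule relabel_offset_surj)
  then show "u \<in> compress ` PW a" by (metis compress_PW imageI)
qed

definition PWs :: "nat \<Rightarrow> idx list set" where
  "PWs r = (\<Union>a\<in>compositions r. PW a)"

text \<open>Injectivity extends from one composition to all of them, because the words in offset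
  labels of different compositions are disjoint.\<close>

lemma bij_compress: "bij_betw compress (PWs r) (NWs r)"
proof -
  have NW: "compress w \<in> NW a" if "a \<in> compositions r" "w \<in> PW a" for a w
    using bij_betwE[OF bij_compress_PW[OF that(1)]] that(2) by blast
  have "inj_on compress (PWs r)"
  proof (rule inj_onI)
    fix v w assume "v \<in> PWs r" "w \<in> PWs r" and eq: "compress v = compress w"
    then obtain a b where ab: "a \<in> compositions r" "v \<in> PW a" "b \<in> compositions r" "w \<in> PW b" by (auto simp: PWs_def)
    then have "a = b" using NW[of a v] NW[of b w] eq NW_disjoint[of "compress v" a b r r] by simp
    then show "v = w" using ab eq bij_betw_imp_inj_on[OF bij_compress_PW[OF ab(1)]] by (auto dest: inj_onD)
  qed
  moreover have "compress ` PWs r = NWs r"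
    unfolding PWs_def NWs_def image_UN using bij_betw_imp_surj_on[OF bij_compress_PW] by simp
  ultimately show ?thesis by (simp add: bij_betw_def)
qed

definition expand :: "nat \<Rightarrow> idx list \<Rightarrow> idx list" where
  "expand r = inv_into (PWs r) compress"

lemma expand_compress: "w \<in> PWs r \<Longrightarrow> expand r (compress w) = w"
  unfolding expand_def by (rule inv_into_f_f[OF bij_betw_imp_inj_on[OF bij_compress]])

lemma compress_expand: "w \<in> NWs r \<Longrightarrow> compress (expand r w) = w"
  unfolding expand_def by (rule bij_betw_inv_into_right[OF bij_compress])

lemma expand_PWs: "w \<in> NWs r \<Longrightarrow> expand r w \<in> PWs r"
  unfolding expand_def by (rule bij_betw_apply[OF bij_betw_inv_into[OF bij_compress]])

definition CCi :: "nat \<Rightarrow> tens \<Rightarrow> tens" where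
  "CCi r = lin_ext (\<lambda>w. bas (expand r w))"

lemma linear_CCi [simp]: "linear_op (CCi r)"
  by (simp add: CCi_def)

lemma CCi_CC:
  assumes "v \<in> spn (PWs r)"
  shows "CCi r (CC_op v) = v"
proof (rule linear_op_spn_eqI[OF assms, of "\<lambda>v. CCi r (CC_op v)" "\<lambda>v. v"])
  show "linear_op (\<lambda>v. CCi r (CC_op v))" by (rule linear_op_comp[OF linear_CCi linear_CC])
  show "CCi r (CC_op (bas w)) = bas w" if "w \<in> PWs r" for w
    using that by (simp add: CC_compress CCi_def expand_compress)
qed simp

lemma CC_CCi:
  assumes "v \<in> spn (NWs r)"
  shows "CC_op (CCi r v) = v"
proof (rule linear_op_spn_eqI[OF assms, of "\<lambda>v. CC_op (CCi r v)" "\<lambda>v. v"])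
  show "linear_op (\<lambda>v. CC_op (CCi r v))" by (rule linear_op_comp[OF linear_CC linear_CCi])
  show "CC_op (CCi r (bas w)) = bas w" if "w \<in> NWs r" for w
    using that by (simp add: CC_compress CCi_def compress_expand)
qed simp

lemma CC_PWs: "v \<in> spn (PWs r) \<Longrightarrow> CC_op v \<in> spn (NWs r)"
  by (rule linear_op_spn[OF linear_CC]) (auto simp: CC_compress bij_betwE[OF bij_compress])

lemma CCi_NWs: "v \<in> spn (NWs r) \<Longrightarrow> CCi r v \<in> spn (PWs r)"
  by (rule linear_op_spn[OF linear_CCi]) (auto simp: CCi_def expand_PWs)

lemma PW_PWs: "a \<in> compositions r \<Longrightarrow> PW a \<subseteq> PWs r"
  by (auto simp: PWs_def)

lemma parity_compress: "idx_parity (compress w) = idx_parity w"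
  by (simp add: compress_def)

lemma CC_homogeneous: "v \<in> homogeneous snd p \<Longrightarrow> CC_op v \<in> homogeneous snd p"
  unfolding homogeneous_spn by (rule linear_op_spn[OF linear_CC]) (simp_all add: CC_compress parity_compress)

lemma CCi_homogeneous:
  assumes "v \<in> homogeneous snd p" "v \<in> spn (NWs r)"
  shows "CCi r v \<in> homogeneous snd p"
proof -
  have "v \<in> spn ({w. idx_parity w = p} \<inter> NWs r)" using assms unfolding homogeneous_spn spn_def by blast
  then show ?thesis unfolding homogeneous_spn
    by (rule linear_op_spn[OF linear_CCi, rotated]) (auto simp: CCi_def, metis compress_expand parity_compress)
qed

text \<open>The relabelling depends on the multiset of letters only, not on their order or their
  bars. This is why \<open>compress\<close> commutes with the Sergeev generators.\<close>

lemma below_mset: "below w j = size (filter_mset (\<lambda>i. i < j) (mset (map fst w)))"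
proof -
  have "below w j = length (filter (\<lambda>z. fst z < j) w)" by (simp add: below_def length_filter_conv_card)
  also have "\<dots> = length (filter (\<lambda>i. i < j) (map fst w))" by (simp add: filter_map o_def)
  also have "\<dots> = size (filter_mset (\<lambda>i. i < j) (mset (map fst w)))" by (metis mset_filter size_mset)
  finally show ?thesis .
qed

lemma compress_swp: "Suc n < length w \<Longrightarrow> compress (swp n w) = swp n (compress w)"
proof -
  assume n: "Suc n < length w"
  have "below (swp n w) = below w" by (rule ext) (simp only: below_mset mset_swp[OF n])
  then show ?thesis by (simp only: compress_def relabel_swp[OF n])
qed

lemma compress_tog: "n < length w \<Longrightarrow> compress (tog n w) = tog n (compress w)"
proof -
  assume n: "n < length w"
  have "below (tog n w) = below w" by (rule ext) (simp only: below_mset map_fst_tog[OF n])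
  then show ?thesis by (simp only: compress_def relabel_tog[OF n])
qed

lemma supercommutes_CC: "supercommutes r 0 (Wl r) CC_op"
proof (rule supercommutesI)
  have take: "idx_parity (take m (compress w)) = idx_parity (take m w)" for m w by (simp add: compress_def)
  have snd: "snd (compress w ! m) = snd (w ! m)" if "m < length w" for m w using that by (simp add: compress_def)
  have len: "length (compress w) = length w" for w by (simp add: compress_def)
  show "CC_op (sergeev_gen_act (SS (Suc n)) (bas w)) = sergeev_gen_act (SS (Suc n)) (CC_op (bas w))"
    if "Suc n < r" "w \<in> Wl r" for n w
    using that by (simp add: Wl_def SS_bas linear_opD[OF linear_CC] CC_compress compress_swp snd)
  show "CC_op (sergeev_gen_act (CC (Suc n)) (bas w)) = scl (ksgn 0 1) (sergeev_gen_act (CC (Suc n)) (CC_op (bas w)))"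
    if "n < r" "w \<in> Wl r" for n w
    using that by (simp add: Wl_def CC_bas' linear_opD[OF linear_CC] CC_compress compress_tog take len)
qed simp

lemma PW_swp: "Suc n < length w \<Longrightarrow> swp n w \<in> PW a \<longleftrightarrow> w \<in> PW a"
  and PW_tog: "n < length w \<Longrightarrow> tog n w \<in> PW a \<longleftrightarrow> w \<in> PW a"
  by (simp_all only: PW_mset mset_swp map_fst_tog)

lemma PW_length: "w \<in> PW a \<Longrightarrow> length w = sum_list a"
  using NW_length[OF relabel_PW[of w a]] by simp

lemma PWs_Wl: "PWs r \<subseteq> Wl r"
  by (auto simp: PWs_def Wl_def PW_length compositions_def)

definition gen_closed :: "nat \<Rightarrow> idx list set \<Rightarrow> bool" where
  "gen_closed r S \<longleftrightarrow> S \<subseteq> PWs r \<and> (\<forall>g\<in>sergeev_gens r. \<forall>v\<in>spn S. sergeev_gen_act g v \<in> spn S)"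

lemma gen_closed_PW: "a \<in> compositions r \<Longrightarrow> gen_closed r (PW a)"
  unfolding gen_closed_def
proof (intro conjI ballI PW_PWs)
  fix g v assume a: "a \<in> compositions r" and g: "g \<in> sergeev_gens r" and v: "v \<in> spn (PW a)"
  show "sergeev_gen_act g v \<in> spn (PW a)"
  proof (rule linear_op_spn[OF linear_gen_act _ v])
    fix w assume w: "w \<in> PW a"
    then have "length w = r" using a by (simp add: PW_length compositions_def)
    with g w show "sergeev_gen_act g (bas w) \<in> spn (PW a)"
      by (elim sergeev_gens_cases) (simp_all add: SS_bas CC_bas' PW_swp PW_tog)
  qed
qed

lemma gen_closed_PWs: "gen_closed r (PWs r)"
  unfolding gen_closed_def
proof (intro conjI ballI subset_refl)
  fix g v assume g: "g \<in> sergeev_gens r" and v: "v \<in> spn (PWs r)"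
  show "sergeev_gen_act g v \<in> spn (PWs r)"
  proof (rule linear_op_spn[OF linear_gen_act _ v])
    fix w assume "w \<in> PWs r"
    then obtain a where a: "a \<in> compositions r" "w \<in> PW a" by (auto simp: PWs_def)
    then have "sergeev_gen_act g (bas w) \<in> spn (PW a)" using gen_closed_PW[OF a(1)] g by (simp add: gen_closed_def)
    then show "sergeev_gen_act g (bas w) \<in> spn (PWs r)" using spn_mono[OF PW_PWs[OF a(1)]] by blast
  qed
qed

lemma supercommutes_CCi: "supercommutes r 0 (NWs r) (CCi r)"
  unfolding supercommutes_def
proof (intro ballI)
  fix g v assume g: "g \<in> sergeev_gens r" and v: "v \<in> spn (NWs r)"
  let ?u = "CCi r v"
  have u: "?u \<in> spn (PWs r)" using v by (rule CCi_NWs)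
  have "?u \<in> spn (Wl r)" using u spn_mono[OF PWs_Wl] by blast
  then have "CC_op (sergeev_gen_act g ?u) = sergeev_gen_act g (CC_op ?u)"
    using supercommutes_CC[of r] g by (simp add: supercommutes_def)
  then have "CC_op (sergeev_gen_act g ?u) = sergeev_gen_act g v" using CC_CCi[OF v] by simp
  moreover have "sergeev_gen_act g ?u \<in> spn (PWs r)" using gen_closed_PWs[of r] g u by (simp add: gen_closed_def)
  ultimately have "CCi r (sergeev_gen_act g v) = sergeev_gen_act g ?u" using CCi_CC by metis
  then show "CCi r (sergeev_gen_act g v) = scl (ksgn 0 (sergeev_parity g)) (sergeev_gen_act g (CCi r v))" by simp
qed

section \<open>Homomorphisms over the Sergeev superalgebra\<close>

text \<open>Homomorphisms of parity \<open>p\<close>, but as operators on all combinations of words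
  and tested on Sergeev generators, so that they can be compared with \<open>theta\<close>.\<close>

definition good :: "nat \<Rightarrow> idx list set \<Rightarrow> idx list set \<Rightarrow> bit \<Rightarrow> (tens \<Rightarrow> tens) \<Rightarrow> bool" where
  "good r S S' p F \<longleftrightarrow> linear_op F \<and> (\<forall>v\<in>spn S. F v \<in> spn S') \<and>
     (\<forall>p'. \<forall>v\<in>spn S. v \<in> homogeneous snd p' \<longrightarrow> F v \<in> homogeneous snd (p + p')) \<and> supercommutes r p S F"

lemma length_composition: "a \<in> compositions r \<Longrightarrow> length a \<le> r"
proof -
  have "length b \<le> sum_list b" if "\<forall>k\<in>set b. 0 < k" for b :: "nat list"
    using that by (induction b) auto
  then show "a \<in> compositions r \<Longrightarrow> length a \<le> r" by (auto simp: compositions_def)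
qed

lemma PW_idx_words: "a \<in> compositions r \<Longrightarrow> PW a \<subseteq> idx_words r"
proof
  fix w assume a: "a \<in> compositions r" and w: "w \<in> PW a"
  have "length a \<le> r" using a by (rule length_composition)
  then show "w \<in> idx_words r"
    using PW_length[OF w] PW_letter[OF w] a by (fastforce simp: idx_words_def compositions_def in_set_conv_nth)
qed

lemma spn_tensor_space: "S \<subseteq> PWs r \<Longrightarrow> v \<in> spn S \<Longrightarrow> v \<in> tensor_space r"
  using PW_idx_words by (fastforce simp: PWs_def spn_def tensor_space_def)

text \<open>Elements of the Sergeev superalgebra are cosets. To compute their action, a homogeneous
  one is represented by a homogeneous combination of words, and a generator by itself.\<close>

lemma grade_sergeev:
  "h \<in> grade (sergeev r) p \<Longrightarrow> \<exists>x. keys x \<subseteq> lists (sergeev_gens r) \<and> x \<in> homogeneous sergeev_parity p \<and> x \<in> h \<and> h \<in> carrier (sergeev r)"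
  "g \<in> sergeev_gens r \<Longrightarrow> \<exists>h\<in>grade (sergeev r) (sergeev_parity g). bas [g] \<in> h \<and> h \<in> carrier (sergeev r)"
proof -
  define A where "A = free_superalgebra (sergeev_gens r) sergeev_parity"
  define I where "I = relation_ideal (sergeev_gens r) sergeev_parity (sergeev_relations r)"
  interpret A: ring A unfolding A_def by (rule ring_free_superalgebra)
  note carr = free_superalgebra_simps[of "sergeev_gens r" sergeev_parity, folded A_def]
  have "ideal I A" unfolding I_def relation_ideal_def A_def[symmetric]
    by (rule A.genideal_ideal) (use sergeev_relations_subset[of r] in \<open>auto simp: A_def\<close>)
  then interpret I: ideal I A .
  have mem: "x \<in> I +>\<^bsub>A\<^esub> x" if "x \<in> carrier A" for x using that by (rule I.a_rcos_self)
  have gr: "grade (sergeev r) p = (\<lambda>x. I +>\<^bsub>A\<^esub> x) ` (carrier A \<inter> homogeneous sergeev_parity p)" for p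
    by (simp add: sergeev_def presented_def super_quotient_def A_def I_def free_superalgebra_def)
  have ca: "carrier (sergeev r) = (\<lambda>x. I +>\<^bsub>A\<^esub> x) ` carrier A"
    by (auto simp: sergeev_def presented_def super_quotient_def A_def I_def FactRing_def A_RCOSETS_def')
  show "\<exists>x. keys x \<subseteq> lists (sergeev_gens r) \<and> x \<in> homogeneous sergeev_parity p \<and> x \<in> h \<and> h \<in> carrier (sergeev r)"
    if "h \<in> grade (sergeev r) p"
    using that mem unfolding gr ca by (auto simp: carr)
  show "\<exists>h\<in>grade (sergeev r) (sergeev_parity g). bas [g] \<in> h \<and> h \<in> carrier (sergeev r)" if "g \<in> sergeev_gens r"
    unfolding gr ca by (rule bexI[of _ "I +>\<^bsub>A\<^esub> bas [g]"])
      (use mem that in \<open>auto simp: carr homogeneous_def word_parity_def\<close>)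
qed

lemma free_act_supercommutes:
  assumes F: "good r S S' p F" and S: "gen_closed r S"
    and x: "keys x \<subseteq> lists (sergeev_gens r)" "x \<in> homogeneous sergeev_parity p'" and v: "v \<in> spn S"
  shows "F (sergeev_free_act x v) = scl (ksgn p p') (sergeev_free_act x (F v))"
proof -
  have lin: "linear_op F" using F by (simp add: good_def)
  have word: "F (foldr sergeev_gen_act ws v) = scl (ksgn p (word_parity sergeev_parity ws)) (foldr sergeev_gen_act ws (F v))"
      "foldr sergeev_gen_act ws v \<in> spn S" if "ws \<in> lists (sergeev_gens r)" for ws
    using that
  proof (induction ws)
    case (Cons g ws)
    case 1
    then show ?case using Cons F by (simp add: good_def supercommutes_def gen_act_linear word_parity_def ksgn_add)
    case 2
    then show ?case using Cons S by (simp add: gen_closed_def)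
  qed (simp_all add: word_parity_def v)
  have "F (sergeev_free_act x v) = (\<Sum>ws\<in>keys x. scl (lookup x ws) (scl (ksgn p p') (foldr sergeev_gen_act ws (F v))))"
    unfolding sergeev_free_act_def lin_ext_def linear_opD[OF lin]
  proof (rule sum.cong[OF refl])
    fix ws assume "ws \<in> keys x"
    then have "ws \<in> lists (sergeev_gens r)" "word_parity sergeev_parity ws = p'" using x by (auto simp: homogeneous_def)
    then show "scl (lookup x ws) (F (foldr sergeev_gen_act ws v)) = scl (lookup x ws) (scl (ksgn p p') (foldr sergeev_gen_act ws (F v)))"
      using word(1) by metis
  qed
  then show ?thesis by (simp add: sergeev_free_act_def lin_ext_def scl_sum mult.commute)
qed

text \<open>The map is extended by zero to the words outside \<open>S\<close>.\<close>

lemma linear_maps_spn: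
  assumes "f \<in> linear_maps (spn S) N"
  obtains F where "linear_op F" "f = restrict F (spn S)"
proof -
  define F where "F = lin_ext (\<lambda>w. if w \<in> S then f (bas w) else 0)"
  have add: "f (u + v) = f u + f v" "f (scl c v) = scl c (f v)" if "u \<in> spn S" "v \<in> spn S" for u v c
    using assms that by (auto simp: linear_maps_def)
  have f0: "f 0 = 0" using add(2)[of 0 0 0] by simp
  have "F v = f v \<and> v \<in> spn S" if "v \<in> spn S" for v
    by (rule linear_induct[where x = v])
      (use spn_keys[OF that] in \<open>auto simp: F_def lin_ext_add lin_ext_scl add f0\<close>)
  then have "f = restrict F (spn S)"
    using assms by (intro ext) (auto simp: linear_maps_def PiE_def extensional_def restrict_def)
  with that[of F] show thesis by (simp add: F_def)
qed

lemma ksgn_koszul: "ksgn p p' = koszul (p * p')"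
  by (simp add: ksgn_def)

text \<open>On tensor space the action of a coset may be computed with any representative. So
  commuting with all cosets and commuting with the generators are the same.\<close>

theorem sergeev_hom_grade_iff:
  assumes S: "gen_closed r S" "gen_closed r S'"
  shows "f \<in> sergeev_hom_grade r (spn S) (spn S') p \<longleftrightarrow> (\<exists>F. good r S S' p F \<and> f = restrict F (spn S))"
proof
  have ts: "u \<in> spn S \<Longrightarrow> u \<in> tensor_space r" "u \<in> spn S' \<Longrightarrow> u \<in> tensor_space r" for u
    using S spn_tensor_space by (auto simp: gen_closed_def)
  {
    assume f: "f \<in> sergeev_hom_grade r (spn S) (spn S') p"
    then obtain F where F: "linear_op F" "f = restrict F (spn S)"
      using linear_maps_spn[of f S "spn S'"] by (auto simp: sergeev_hom_grade_def)
    have fF: "f v = F v" if "v \<in> spn S" for v using that F(2) by simp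
    have typed: "F v \<in> spn S'" if "v \<in> spn S" for v
    proof -
      have "f \<in> spn S \<rightarrow>\<^sub>E spn S'" using f by (simp add: sergeev_hom_grade_def linear_maps_def)
      then show ?thesis using PiE_mem[of f "spn S" "\<lambda>_. spn S'" v] that fF[OF that] by simp
    qed
    have "F v \<in> homogeneous snd (p + p')" if "v \<in> spn S" "v \<in> homogeneous snd p'" for v p'
    proof -
      have "f ` (spn S \<inter> homogeneous snd p') \<subseteq> homogeneous snd (p + p')" using f by (simp add: sergeev_hom_grade_def)
      then have "f v \<in> homogeneous snd (p + p')" using that by (simp only: image_subset_iff) simp
      then show ?thesis by (simp only: fF[OF that(1)])
    qed
    moreover have "supercommutes r p S F"
      unfolding supercommutes_def
    proof (intro ballI)
      fix g v assume g: "g \<in> sergeev_gens r" and v: "v \<in> spn S"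
      obtain h where h: "h \<in> grade (sergeev r) (sergeev_parity g)" "bas [g] \<in> h" "h \<in> carrier (sergeev r)"
        using grade_sergeev(2)[OF g] by blast
      have act: "sergeev_act h u = sergeev_gen_act g u" if "u \<in> tensor_space r" for u
        using sergeev_act_eq[OF h(3,2) that] by (simp add: free_act_bas)
      have "f (sergeev_act h v) = scl (koszul (p * sergeev_parity g)) (sergeev_act h (f v))"
        using f h(1) v by (simp add: sergeev_hom_grade_def)
      moreover have "sergeev_gen_act g v \<in> spn S" using S(1) g v by (simp add: gen_closed_def)
      ultimately show "F (sergeev_gen_act g v) = scl (ksgn p (sergeev_parity g)) (sergeev_gen_act g (F v))"
        using act[OF ts(1)[OF v]] act[OF ts(2)[OF typed[OF v]]] fF v by (simp add: ksgn_koszul)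
    qed
    ultimately show "\<exists>F. good r S S' p F \<and> f = restrict F (spn S)"
      using F typed by (auto simp: good_def)
  next
    assume "\<exists>F. good r S S' p F \<and> f = restrict F (spn S)"
    then obtain F where F: "good r S S' p F" and f: "f = restrict F (spn S)" by blast
    have lin: "linear_op F" and typed: "\<And>v. v \<in> spn S \<Longrightarrow> F v \<in> spn S'" using F by (simp_all add: good_def)
    have fF: "f v = F v" if "v \<in> spn S" for v using that f by simp
    have "f \<in> linear_maps (spn S) (spn S')"
      unfolding linear_maps_def using typed by (auto simp: f linear_opD[OF lin])
    moreover have "f ` (spn S \<inter> homogeneous snd p') \<subseteq> homogeneous snd (p + p')" for p'
      using F by (auto simp: fF good_def)
    moreover have "f (sergeev_act h v) = scl (koszul (p * p')) (sergeev_act h (f v))"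
      if h: "h \<in> grade (sergeev r) p'" and v: "v \<in> spn S" for p' h v
    proof -
      obtain x where x: "keys x \<subseteq> lists (sergeev_gens r)" "x \<in> homogeneous sergeev_parity p'" "x \<in> h" "h \<in> carrier (sergeev r)"
        using grade_sergeev(1)[OF h] by blast
      have "foldr sergeev_gen_act ws v \<in> spn S" if "ws \<in> lists (sergeev_gens r)" for ws
        using that by (induction ws) (use S(1) v in \<open>simp_all add: gen_closed_def\<close>)
      then have "sergeev_free_act x v \<in> spn S"
        unfolding sergeev_free_act_def lin_ext_def using x(1) by (intro spn_sum spn_closed(3)) blast
      then show ?thesis
        using free_act_supercommutes[OF F S(1) x(1,2) v] sergeev_act_eq[OF x(4,3) ts(1)[OF v]]
          sergeev_act_eq[OF x(4,3) ts(2)[OF typed[OF v]]] v by (simp add: fF ksgn_koszul)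
    qed
    ultimately show "f \<in> sergeev_hom_grade r (spn S) (spn S') p" by (simp add: sergeev_hom_grade_def)
  }
qed

section \<open>Permutation supermodules as spans\<close>

lemma weight_words_hat:
  assumes "a \<in> compositions r"
  shows "weight_words r (hat a) = PW a"
  using PW_idx_words[OF assms] by (auto simp: weight_words_def PW_def pos_def length_filter_conv_card)

lemma perm_module_hat: "a \<in> compositions r \<Longrightarrow> perm_module r (hat a) = spn (PW a)"
  by (simp add: perm_module_def spn_def weight_words_hat)

lemma sum_hat:
  assumes "length a \<le> r"
  shows "(\<Sum>k=1..r. hat a k) = sum_list a"
proof -
  have "(\<Sum>k=1..r. hat a k) = (\<Sum>k=1..length a. hat a k)"
    using assms by (intro sum.mono_neutral_right) (auto simp: hat_def)
  also have "\<dots> = (\<Sum>i<length a. a ! i)"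
    by (rule sum.reindex_bij_witness[where i = Suc and j = "\<lambda>k. k - 1"]) (auto simp: hat_def)
  finally show ?thesis by (simp add: sum_list_sum_nth lessThan_atLeast0)
qed

lemma weights'_hat:
  assumes "0 < r"
  shows "weights' r = hat ` compositions r"
proof (intro Set.set_eqI iffI)
  fix \<mu> assume "\<mu> \<in> hat ` compositions r"
  then obtain a where a: "a \<in> compositions r" "\<mu> = hat a" by blast
  have len: "length a \<le> r" using a(1) by (rule length_composition)
  have "sum_list a = r" and pos: "\<And>i. i < length a \<Longrightarrow> 0 < a ! i" using a(1) by (auto simp: compositions_def)
  then have "hat a \<in> weights r" using sum_hat[OF len] len by (auto simp: weights_def hat_def)
  moreover have "hat a l = 0" if "hat a k = 0" "1 \<le> k" "k \<le> l" for k l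
  proof (cases "l \<le> length a")
    case True
    then have "k \<le> length a" "k - 1 < length a" using that by simp_all
    then show ?thesis using that pos[of "k - 1"] by (simp add: hat_def)
  qed (simp add: hat_def)
  ultimately show "\<mu> \<in> weights' r" by (auto simp: weights'_def a(2))
next
  fix \<mu> assume \<mu>: "\<mu> \<in> weights' r"
  \<comment> \<open>The number of nonzero entries: the first zero follows directly after them, at
    the latest at \<open>r + 1\<close>.\<close>
  define m where "m = (LEAST m. \<mu> (Suc m) = 0)"
  have out: "\<mu> k = 0" if "k \<notin> {1..r}" for k using \<mu> that by (simp add: weights'_def weights_def)
  have sum: "(\<Sum>k=1..r. \<mu> k) = r" using \<mu> by (simp add: weights'_def weights_def)
  have m0: "\<mu> (Suc m) = 0" unfolding m_def by (rule LeastI[of _ r]) (simp add: out)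
  have mr: "m \<le> r" unfolding m_def by (rule Least_le) (simp add: out)
  have pos: "0 < \<mu> (Suc i)" if "i < m" for i using not_less_Least[of i "\<lambda>m. \<mu> (Suc m) = 0"] that by (simp add: m_def)
  have after: "\<mu> k = 0" if "m < k" for k
  proof (cases "k \<le> r")
    case True
    then have "Suc m \<in> {1..r}" "k \<in> {Suc m..r}" using that by simp_all
    then show ?thesis using \<mu> m0 unfolding weights'_def by blast
  qed (simp add: out)
  define a where "a = map (\<lambda>i. \<mu> (Suc i)) [0..<m]"
  have hat: "hat a = \<mu>"
  proof
    fix k show "hat a k = \<mu> k"
      using after[of k] out[of 0] by (cases k) (auto simp: hat_def a_def)
  qed
  have "sum_list a = r" using sum_hat[of a r] mr sum hat by (simp add: a_def)
  moreover from this have "a \<noteq> []" using assms by auto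
  ultimately have "a \<in> compositions r" using pos by (auto simp: compositions_def a_def)
  then show "\<mu> \<in> hat ` compositions r" using hat by blast
qed

lemma perm_module_sum_spn:
  assumes "0 < r"
  shows "perm_module_sum r = spn (PWs r)"
proof (intro Set.set_eqI iffI)
  fix v assume "v \<in> perm_module_sum r"
  then obtain x where x: "v = (\<Sum>\<mu>\<in>weights' r. x \<mu>)" "\<And>\<mu>. \<mu> \<in> weights' r \<Longrightarrow> x \<mu> \<in> perm_module r \<mu>"
    by (auto simp: perm_module_sum_def)
  have "x \<mu> \<in> spn (PWs r)" if "\<mu> \<in> weights' r" for \<mu>
  proof -
    have "\<mu> \<in> hat ` compositions r" using that by (simp only: weights'_hat[OF assms])
    then obtain a where a: "a \<in> compositions r" "\<mu> = hat a" by blast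
    then have "x \<mu> \<in> spn (PW a)" using x(2)[OF that] by (simp add: perm_module_hat)
    then show ?thesis by (rule spn_mono[OF PW_PWs[OF a(1)]])
  qed
  then show "v \<in> spn (PWs r)" unfolding x(1) by (rule spn_sum)
next
  fix v assume v: "v \<in> spn (PWs r)"
  \<comment> \<open>A word has only one weight, so in the sum of the projections exactly one keeps
    it.\<close>
  have "(\<Sum>\<mu>\<in>weights' r. proj r \<mu> v) = v"
  proof (rule linear_op_spn_eqI[OF v, of "\<lambda>v. \<Sum>\<mu>\<in>weights' r. proj r \<mu> v" "\<lambda>v. v"])
    show "linear_op (\<lambda>v. \<Sum>\<mu>\<in>weights' r. proj r \<mu> v)"
      by (simp add: linear_op_def proj_def lin_ext_add lin_ext_scl sum.distrib scl_sum)
    fix w assume "w \<in> PWs r"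
    then obtain a where a: "a \<in> compositions r" "w \<in> PW a" by (auto simp: PWs_def)
    then have "w \<in> weight_words r (hat a)" by (simp add: weight_words_hat)
    then have "w \<in> weight_words r \<mu> \<longleftrightarrow> \<mu> = hat a" for \<mu> by (auto simp: weight_words_def)
    moreover have "hat a \<in> weights' r" using a(1) by (simp add: weights'_hat[OF assms])
    ultimately show "(\<Sum>\<mu>\<in>weights' r. proj r \<mu> (bas w)) = bas w"
      by (simp add: proj_def finite_weights')
  qed simp
  moreover have "proj r \<mu> v \<in> perm_module r \<mu>" for \<mu>
    unfolding proj_def perm_module_def mem_Collect_eq by (rule keys_lin_ext) simp
  ultimately show "v \<in> perm_module_sum r" unfolding perm_module_sum_def mem_Collect_eq
    by (intro exI[of _ "\<lambda>\<mu>. proj r \<mu> v"]) simp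
qed

lemma linear_proj [simp]: "linear_op (proj r \<mu>)"
  by (simp add: proj_def)

lemma proj_id: "a \<in> compositions r \<Longrightarrow> v \<in> spn (PW a) \<Longrightarrow> proj r (hat a) v = v"
  by (rule linear_op_spn_eqI[of v "PW a" "proj r (hat a)" "\<lambda>v. v"]) (simp_all add: proj_def weight_words_hat)

lemma proj_typed: "a \<in> compositions r \<Longrightarrow> proj r (hat a) v \<in> spn (PW a)"
  unfolding proj_def spn_def mem_Collect_eq by (rule keys_lin_ext) (simp add: weight_words_hat)

lemma CC_proj:
  assumes a: "a \<in> compositions r" and v: "v \<in> spn (PWs r)"
  shows "CC_op (proj r (hat a) v) = prj a (CC_op v)"
proof (rule linear_op_spn_eqI[OF v, of "\<lambda>v. CC_op (proj r (hat a) v)" "\<lambda>v. prj a (CC_op v)"])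
  show "linear_op (\<lambda>v. CC_op (proj r (hat a) v))" by (rule linear_op_comp[OF linear_CC linear_proj])
  show "linear_op (\<lambda>v. prj a (CC_op v))" by (rule linear_op_comp[OF linear_prj linear_CC])
  fix w assume "w \<in> PWs r"
  then obtain b where b: "b \<in> compositions r" "w \<in> PW b" by (auto simp: PWs_def)
  have NW: "compress w \<in> NW b" using bij_betwE[OF bij_compress_PW[OF b(1)]] b(2) by blast
  have "w \<in> PW a \<longleftrightarrow> compress w \<in> NW a"
    using NW NW_disjoint[OF NW _ b(1) a] b(2) bij_betwE[OF bij_compress_PW[OF a]] by blast
  then show "CC_op (proj r (hat a) (bas w)) = prj a (CC_op (bas w))"
    by (simp add: proj_def weight_words_hat[OF a] CC_compress prj_def linear_opD[OF linear_CC])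
qed

section \<open>Merges, splits and dots as divided powers\<close>

text \<open>If the exponent is the number of all letters \<open>a\<close>, the divided power leaves
  no choice and merely renames the strand.\<close>

lemma split_op_all:
  assumes "card (pos a w) = n"
  shows "split_op a b n (bas w) = bas (relabel (\<lambda>z. if z = a then b else z) w)"
proof -
  have "{T'. T' \<subseteq> pos a w \<and> card T' = n} = {pos a w}"
    using assms card_subset_eq[OF finite_pos, of _ a w] by auto
  moreover have "set_at (pos a w) b w = relabel (\<lambda>z. if z = a then b else z) w"
    by (intro nth_equalityI) (auto simp: pos_def prod_eq_iff)
  ultimately show ?thesis by (simp add: split_op_def)
qed

lemma op_prod_Cons: "op_prod (f # fs) v = f (op_prod fs v)"
  by (simp add: op_prod_def)

lemma relabel_relabel: "relabel \<phi> (relabel \<psi> w) = relabel (\<lambda>z. \<phi> (\<psi> z)) w"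
  by (intro nth_equalityI) auto

text \<open>The first operator to act moves all letters \<open>i + 1\<close> to \<open>i\<close>,
  which merges the two strands. Each later one moves a whole strand down to the number that has just
  become vacant.\<close>

lemma e_chain:
  assumes w: "w \<in> PW a" and t: "i \<le> t" and i: "1 \<le> i"
  shows "op_prod (map (\<lambda>t. divided_power (e_op t) (hat a (t + 1))) (rev [i..<t])) (bas w) =
    bas (relabel (\<lambda>z. if i < z \<and> z \<le> t then z - 1 else z) w)"
  using t
proof (induction t rule: dec_induct)
  case base
  have "relabel (\<lambda>z. if i < z \<and> z \<le> i then z - 1 else z) w = w"
    by (intro nth_equalityI) (auto simp: prod_eq_iff)
  then show ?case by (simp add: op_prod_def)
next
  case (step t)
  let ?u = "relabel (\<lambda>z. if i < z \<and> z \<le> t then z - 1 else z) w"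
  have pu: "pos (t + 1) ?u = pos (t + 1) w" using i step(1) by (auto simp: pos_def split: if_splits)
  then have "card (pos (t + 1) ?u) = hat a (t + 1)" using PW_card_pos[OF w] by simp
  then have "divided_power (e_op t) (hat a (t + 1)) (bas ?u) = bas (relabel (\<lambda>z. if z = t + 1 then t else z) ?u)"
    unfolding e_op_rung by (subst divided_power_rung) (simp, rule split_op_all)
  also have "relabel (\<lambda>z. if z = t + 1 then t else z) ?u = relabel (\<lambda>z. if i < z \<and> z \<le> Suc t then z - 1 else z) w"
    unfolding relabel_relabel by (rule relabel_cong) (use i step(1) in auto)
  finally show ?case using step by (simp add: op_prod_Cons)
qed

text \<open>Starting from the last strand, every strand is moved up by one to make room. The number
  \<open>r\<close> is vacant at the start because \<open>length b < r\<close>.\<close>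

lemma f_chain:
  assumes w: "w \<in> PW b" and len: "length b < r" and t: "t \<le> r"
    and c: "\<And>s. t \<le> s \<Longrightarrow> s < r \<Longrightarrow> hat a (s + 1) = hat b s"
  shows "op_prod (map (\<lambda>t. divided_power (f_op t) (hat a (t + 1))) [t..<r]) (bas w) =
    bas (relabel (\<lambda>z. if t \<le> z then z + 1 else z) w)"
  using t c
proof (induction t rule: inc_induct)
  case base
  have "relabel (\<lambda>z. if r \<le> z then z + 1 else z) w = w"
    using PW_letter(3)[OF w] len by (intro nth_equalityI) (fastforce simp: prod_eq_iff)+
  then show ?case by (simp add: op_prod_def)
next
  case (step t)
  let ?u = "relabel (\<lambda>z. if Suc t \<le> z then z + 1 else z) w"
  have "pos t ?u = pos t w" by (auto simp: pos_def split: if_splits)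
  then have "card (pos t ?u) = hat a (t + 1)" using PW_card_pos[OF w] step.prems[of t] step.hyps by simp
  then have "divided_power (f_op t) (hat a (t + 1)) (bas ?u) = bas (relabel (\<lambda>z. if z = t then t + 1 else z) ?u)"
    unfolding f_op_rung by (subst divided_power_rung) (simp, rule split_op_all)
  also have "relabel (\<lambda>z. if z = t then t + 1 else z) ?u = relabel (\<lambda>z. if t \<le> z then z + 1 else z) w"
    unfolding relabel_relabel by (rule relabel_cong) auto
  finally show ?case using step by (simp add: op_prod_Cons upt_conv_Cons)
qed

lemma hat_merged: "hat (x @ n # y) j = (if j = length x + 1 then n else if j \<le> length x then hat x j else hat y (j - length x - 1))"
proof -
  consider "j \<le> length x" | "j = length x + 1" | m where "j = length x + 2 + m"
    by (metis add.commute add_2_eq_Suc add_Suc_right le_Suc_eq less_eqE not_less_eq_eq One_nat_def plus_1_eq_Suc)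
  then show ?thesis by cases (auto simp: hat_def nth_append)
qed

lemma offset_merged:
  assumes "1 \<le> j"
  shows "offset (x @ n # y) j = (if j \<le> length x + 1 then sum_list (take (j - 1) x)
     else sum_list x + n + sum_list (take (j - length x - 2) y))"
proof -
  consider "j \<le> length x + 1" | m where "j = length x + 2 + m"
    by (metis add.commute add_2_eq_Suc add_Suc_right le_Suc_eq less_eqE not_less_eq_eq One_nat_def plus_1_eq_Suc)
  then show ?thesis using assms by cases (auto simp: offset_def)
qed

lemma linear_op_prod: "(\<And>f. f \<in> set fs \<Longrightarrow> linear_op f) \<Longrightarrow> linear_op (op_prod fs)"
proof (induction fs)
  case Nil
  then show ?case by (simp add: op_prod_def)
next
  case (Cons f fs)
  have "linear_op f" "linear_op (op_prod fs)" using Cons.prems Cons.IH by simp_all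
  then have "linear_op (\<lambda>v. f (op_prod fs v))" by (rule linear_op_comp)
  then show ?case by (simp only: op_prod_Cons[symmetric])
qed

lemma linear_divided_power: "linear_op f \<Longrightarrow> linear_op (divided_power f n)"
  unfolding divided_power_def[abs_def] by (rule linear_op_scl[OF linear_pow])

lemma linear_chain:
  "linear_op (op_prod (map (\<lambda>t. divided_power (e_op t) (m t)) ts))"
  "linear_op (op_prod (map (\<lambda>t. divided_power (f_op t) (m t)) ts))"
  by (rule linear_op_prod, auto simp: e_op_rung f_op_rung linear_divided_power)+

text \<open>Most of the divided powers only renumber strands and become invisible in offset labels,
  where the merge alone remains.\<close>

lemma merge_formula:
  assumes a: "a = x @ k # l # y" "a \<in> compositions r" and v: "v \<in> spn (PWs r)"
  shows "CC_op (op_prod (map (\<lambda>t. divided_power (e_op t) (hat a (t + 1))) (rev [length x + 1..<r])) (proj r (hat a) v)) =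
    theta (bas [Layer x (Merge k l) y]) (CC_op v)"
    and "op_prod (map (\<lambda>t. divided_power (e_op t) (hat a (t + 1))) (rev [length x + 1..<r])) (proj r (hat a) v) \<in> spn (PWs r)"
proof -
  let ?i = "length x + 1" and ?b = "x @ (k + l) # y"
  let ?E = "op_prod (map (\<lambda>t. divided_power (e_op t) (hat a (t + 1))) (rev [length x + 1..<r]))"
  let ?\<sigma> = "\<lambda>z. if ?i < z \<and> z \<le> r then z - 1 else z"
  have hata: "hat a j = (if j = ?i then k else if j = ?i + 1 then l else
     if j \<le> length x then hat x j else hat y (j - length x - 2))" for j
    unfolding a(1) by (simp only: hat_cases) simp
  have hatb: "hat ?b j = (if j = ?i then k + l else if j \<le> length x then hat x j else hat y (j - length x - 1))" for j
    by (simp only: hat_merged)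
  have offa: "offset a j = (if j \<le> ?i then sum_list (take (j - 1) x)
     else if j = ?i + 1 then sum_list x + k
     else sum_list x + k + l + sum_list (take (j - length x - 3) y))" if "1 \<le> j" for j
    unfolding a(1) using offset_cases[OF that, of x k l y] by simp
  have offb: "offset ?b j = (if j \<le> ?i then sum_list (take (j - 1) x)
     else sum_list x + (k + l) + sum_list (take (j - length x - 2) y))" if "1 \<le> j" for j
    using offset_merged[OF that, of x "k + l" y] by simp
  have kl: "0 < k" "0 < l" using a by (auto simp: compositions_def)
  have len: "length a \<le> r" using a(2) by (rule length_composition)
  have b: "?b \<in> compositions r" using a by (auto simp: compositions_def)
  have word: "?E (bas w) \<in> spn (PW ?b) \<and> CC_op (?E (bas w)) = relabel_op (collapse (sum_list x) (k + l)) (CC_op (bas w))"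
    if w: "w \<in> PW a" for w
  proof -
    have letter: "1 \<le> fst (w ! t)" "fst (w ! t) \<le> r" if "t < length w" for t using PW_letter[OF w that] len by simp_all
    have E: "?E (bas w) = bas (relabel ?\<sigma> w)" by (rule e_chain[OF w]) (use len a(1) in simp_all)
    have mem: "relabel ?\<sigma> w \<in> PW ?b"
      unfolding PW_def mem_Collect_eq
    proof
      fix j
      have "pos j (relabel ?\<sigma> w) = (if j < ?i then pos j w else if j = ?i then pos ?i w \<union> pos (?i + 1) w else pos (j + 1) w)"
        (is "?L = ?R")
      proof (rule Set.set_eqI)
        fix t
        show "t \<in> ?L \<longleftrightarrow> t \<in> ?R" using letter[of t] by (auto simp: pos_def split: if_splits)
      qed
      moreover have "pos ?i w \<inter> pos (?i + 1) w = {}" by (auto simp: pos_def)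
      ultimately show "card (pos j (relabel ?\<sigma> w)) = hat ?b j"
        using PW_card_pos[OF w] by (simp add: card_Un_disjoint hata hatb)
    qed
    from mem have "CC_op (?E (bas w)) = bas (relabel (offset ?b) (relabel ?\<sigma> w))" unfolding E by (rule CC_bas)
    \<comment> \<open>Behind the merged strands the number drops by one and the offset stays; in
      front of them both are unchanged.\<close>
    also have "relabel (offset ?b) (relabel ?\<sigma> w) = relabel (collapse (sum_list x) (k + l)) (relabel (offset a) w)"
      unfolding relabel_relabel
    proof (rule relabel_cong)
      fix t assume "t < length w"
      then have z: "1 \<le> fst (w ! t)" "fst (w ! t) \<le> r" by (rule letter)+
      show "offset ?b (?\<sigma> (fst (w ! t))) = collapse (sum_list x) (k + l) (offset a (fst (w ! t)))"
      proof (cases "fst (w ! t)" "?i" rule: linorder_cases)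
        case less
        then show ?thesis using z sum_list_take_le[of "fst (w ! t) - 1" x]
          by (simp add: offa offb collapse_def)
      next
        case equal
        then show ?thesis using z by (simp add: offa offb collapse_def)
      next
        case greater
        show ?thesis
        proof (cases "fst (w ! t) = ?i + 1")
          case True
          then show ?thesis using z kl by (simp add: offa offb collapse_def)
        next
          case False
          then obtain m where "fst (w ! t) = length x + 3 + m" using greater less_iff_Suc_add[of "?i + 1" "fst (w ! t)"] by auto
          then show ?thesis using z by (simp add: offa offb collapse_def)
        qed
      qed
    qed
    finally have "CC_op (?E (bas w)) = relabel_op (collapse (sum_list x) (k + l)) (CC_op (bas w))"
      by (simp add: CC_bas[OF w] relabel_op_def)
    moreover have "?E (bas w) \<in> spn (PW ?b)" unfolding E bas_spn by (rule mem)
    ultimately show ?thesis by (rule conjI[rotated])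
  qed
  have "CC_op (?E u) = relabel_op (collapse (sum_list x) (k + l)) (CC_op u)" if u: "u \<in> spn (PW a)" for u
  proof (rule linear_op_spn_eqI[OF u, of "\<lambda>u. CC_op (?E u)" "\<lambda>u. relabel_op (collapse (sum_list x) (k + l)) (CC_op u)"])
    show "linear_op (\<lambda>u. CC_op (?E u))" by (rule linear_op_comp[OF linear_CC linear_chain(1)])
    show "linear_op (\<lambda>u. relabel_op (collapse (sum_list x) (k + l)) (CC_op u))" by (rule linear_op_comp[OF linear_relabel_op linear_CC])
  qed (rule word[THEN conjunct2])
  from this[OF proj_typed[OF a(2)]] show "CC_op (?E (proj r (hat a) v)) = theta (bas [Layer x (Merge k l) y]) (CC_op v)"
    using CC_proj[OF a(2) v] a(1) by (simp add: theta_simps)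
  have "?E (proj r (hat a) v) \<in> spn (PW ?b)"
    by (rule linear_op_spn[OF linear_chain(1) word[THEN conjunct1] proj_typed[OF a(2)]])
  then show "?E (proj r (hat a) v) \<in> spn (PWs r)" by (rule spn_mono[OF PW_PWs[OF b]])
qed

text \<open>All factors but the last one to act renumber the strands behind; the last, with exponent
  \<open>l\<close>, moves \<open>l\<close> letters to the number made vacant and thereby splits the
  strand.\<close>

lemma split_formula:
  assumes a: "a = x @ k # l # y" "a \<in> compositions r" and v: "v \<in> spn (PWs r)"
  shows "CC_op (op_prod (map (\<lambda>t. divided_power (f_op t) (hat a (t + 1))) [length x + 1..<r]) (proj r (hat (x @ (k + l) # y)) v)) =
    theta (bas [Layer x (Split k l) y]) (CC_op v)"
    and "op_prod (map (\<lambda>t. divided_power (f_op t) (hat a (t + 1))) [length x + 1..<r]) (proj r (hat (x @ (k + l) # y)) v) \<in> spn (PWs r)"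
proof -
  let ?i = "length x + 1" and ?b = "x @ (k + l) # y"
  let ?E = "op_prod (map (\<lambda>t. divided_power (f_op t) (hat a (t + 1))) [length x + 1..<r])"
  let ?\<tau> = "\<lambda>z. if ?i + 1 \<le> z then z + 1 else z"
  have hata: "hat a j = (if j = ?i then k else if j = ?i + 1 then l else
     if j \<le> length x then hat x j else hat y (j - length x - 2))" for j
    unfolding a(1) by (simp only: hat_cases) simp
  have hatb: "hat ?b j = (if j = ?i then k + l else if j \<le> length x then hat x j else hat y (j - length x - 1))" for j
    by (simp only: hat_merged)
  have offa: "offset a j = (if j \<le> ?i then sum_list (take (j - 1) x)
     else if j = ?i + 1 then sum_list x + k
     else sum_list x + k + l + sum_list (take (j - length x - 3) y))" if "1 \<le> j" for j
    unfolding a(1) using offset_cases[OF that, of x k l y] by simp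
  have offb: "offset ?b j = (if j \<le> ?i then sum_list (take (j - 1) x)
     else sum_list x + (k + l) + sum_list (take (j - length x - 2) y))" if "1 \<le> j" for j
    using offset_merged[OF that, of x "k + l" y] by simp
  have kl: "0 < k" "0 < l" using a by (auto simp: compositions_def)
  have b: "?b \<in> compositions r" using a kl by (auto simp: compositions_def)
  have len: "length a \<le> r" using a(2) by (rule length_composition)
  then have lenb: "length ?b < r" by (simp add: a(1))
  have word: "?E (bas w) \<in> spn (PW a) \<and> CC_op (?E (bas w)) = split_op (sum_list x) (sum_list x + k) l (CC_op (bas w))"
    if w: "w \<in> PW ?b" for w
  proof -
    let ?u = "relabel ?\<tau> w"
    have letter: "1 \<le> fst (w ! t)" if "t < length w" for t using PW_letter[OF w that] by simp
    have "op_prod (map (\<lambda>t. divided_power (f_op t) (hat a (t + 1))) [?i + 1..<r]) (bas w) = bas ?u"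
    proof (rule f_chain[OF w lenb])
      show "hat a (s + 1) = hat ?b s" if "?i + 1 \<le> s" for s
        unfolding hata hatb using that by simp
    qed (use lenb in simp)
    moreover have "[?i..<r] = ?i # [?i + 1..<r]" using lenb by (simp add: upt_conv_Cons)
    ultimately have "?E (bas w) = divided_power (f_op ?i) (hat a (?i + 1)) (bas ?u)" by (simp only: list.map op_prod_Cons)
    also have "hat a (?i + 1) = l" by (simp add: hata)
    also have "divided_power (f_op ?i) l (bas ?u) = split_op ?i (?i + 1) l (bas ?u)"
      unfolding f_op_rung by (rule divided_power_rung) simp
    also have "pos ?i ?u = pos ?i w" by (auto simp: pos_def split: if_splits)
    then have "split_op ?i (?i + 1) l (bas ?u) = (\<Sum>X | X \<subseteq> pos ?i w \<and> card X = l. bas (set_at X (?i + 1) ?u))"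
      by (simp add: split_op_def)
    finally have E: "?E (bas w) = (\<Sum>X | X \<subseteq> pos ?i w \<and> card X = l. bas (set_at X (?i + 1) ?u))" .
    have typed: "set_at X (?i + 1) ?u \<in> PW a \<and> CC_op (bas (set_at X (?i + 1) ?u)) = bas (set_at X (sum_list x + k) (relabel (offset ?b) w))"
      if X: "X \<subseteq> pos ?i w" "card X = l" for X
    proof -
      have Xl: "X \<subseteq> {..<length ?u}" using subset_trans[OF X(1) pos_subset] by simp
      have mem: "set_at X (?i + 1) ?u \<in> PW a"
        unfolding PW_def mem_Collect_eq
      proof
        fix j
        have pu: "pos j ?u = (if j \<le> ?i then pos j w else if j = ?i + 1 then {} else pos (j - 1) w)"
          by (auto simp: pos_def split: if_splits)
        have dis: "pos m w \<inter> X = {}" if "m \<noteq> ?i" for m using X(1) that by (auto simp: pos_def)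
        have fin: "finite X" using X(1) finite_pos finite_subset by blast
        consider "j < ?i" | "j = ?i" | "j = ?i + 1" | "?i + 1 < j" by linarith
        then show "card (pos j (set_at X (?i + 1) ?u)) = hat a j"
        proof cases
          case 1
          then have "pos j (set_at X (?i + 1) ?u) = pos j w"
            unfolding pos_set_at[OF Xl] pu using 1 dis[of j] by auto
          then show ?thesis using 1 PW_card_pos[OF w] by (simp add: hata hatb)
        next
          case 2
          then have "pos j (set_at X (?i + 1) ?u) = pos ?i w - X"
            unfolding pos_set_at[OF Xl] pu by auto
          then show ?thesis using 2 PW_card_pos[OF w, of ?i] X fin
            by (simp add: card_Diff_subset hata hatb)
        next
          case 3
          then have "pos j (set_at X (?i + 1) ?u) = X"
            unfolding pos_set_at[OF Xl] pu by auto
          then show ?thesis using 3 X by (simp add: hata)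
        next
          case 4
          then have "j - 1 \<noteq> ?i" by linarith
          from dis[OF this] have dis4: "pos (j - 1) w \<inter> X = {}" .
          have "pos j (set_at X (?i + 1) ?u) = pos (j - 1) w"
            unfolding pos_set_at[OF Xl] pu using 4 dis4 by auto
          moreover obtain m where "j = length x + 3 + m" using 4 less_iff_Suc_add[of "?i + 1" j] by auto
          ultimately show ?thesis by (simp only: PW_card_pos[OF w] hata hatb) simp
        qed
      qed
      from mem have "CC_op (bas (set_at X (?i + 1) ?u)) = bas (relabel (offset a) (set_at X (?i + 1) ?u))" by (rule CC_bas)
      also have "relabel (offset a) (set_at X (?i + 1) ?u) = set_at X (sum_list x + k) (relabel (offset a) ?u)"
        by (rule relabel_set_at) (simp add: offa)
      also have "relabel (offset a) ?u = relabel (offset ?b) w"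
        unfolding relabel_relabel
      proof (rule relabel_cong)
        fix t assume "t < length w"
        then have z: "1 \<le> fst (w ! t)" by (rule letter)
        show "offset a (?\<tau> (fst (w ! t))) = offset ?b (fst (w ! t))"
        proof (cases "fst (w ! t) \<le> ?i")
          case True
          then show ?thesis using z by (simp add: offa offb)
        next
          case False
          then obtain m where "fst (w ! t) = length x + 2 + m" using less_iff_Suc_add[of "?i" "fst (w ! t)"] by auto
          then show ?thesis using z by (simp add: offa offb)
        qed
      qed
      finally show ?thesis using mem by (rule conjI[rotated])
    qed
    have "pos (offset ?b ?i) (relabel (offset ?b) w) = pos ?i w"
      by (rule pos_relabel_offset[OF w]) (use kl in \<open>simp_all add: hatb\<close>)
    moreover have "offset ?b ?i = sum_list x" by (simp add: offb)
    ultimately have p: "pos (sum_list x) (relabel (offset ?b) w) = pos ?i w" by simp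
    have "CC_op (?E (bas w)) = split_op (sum_list x) (sum_list x + k) l (CC_op (bas w))"
      unfolding E linear_opD[OF linear_CC] CC_bas[OF w] split_op_def lin_ext_mon p
      by (rule sum.cong[OF refl], rule typed[THEN conjunct2]) auto
    moreover have "?E (bas w) \<in> spn (PW a)"
      unfolding E by (rule spn_sum) (unfold bas_spn, rule typed[THEN conjunct1], auto)
    ultimately show ?thesis by (rule conjI[rotated])
  qed
  have "CC_op (?E u) = split_op (sum_list x) (sum_list x + k) l (CC_op u)" if u: "u \<in> spn (PW ?b)" for u
  proof (rule linear_op_spn_eqI[OF u, of "\<lambda>u. CC_op (?E u)" "\<lambda>u. split_op (sum_list x) (sum_list x + k) l (CC_op u)"])
    show "linear_op (\<lambda>u. CC_op (?E u))" by (rule linear_op_comp[OF linear_CC linear_chain(2)])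
    show "linear_op (\<lambda>u. split_op (sum_list x) (sum_list x + k) l (CC_op u))" by (rule linear_op_comp[OF linear_split_op linear_CC])
  qed (rule word[THEN conjunct2])
  from this[OF proj_typed[OF b]] show "CC_op (?E (proj r (hat ?b) v)) = theta (bas [Layer x (Split k l) y]) (CC_op v)"
    using CC_proj[OF b v] by (simp add: theta_simps)
  have "?E (proj r (hat ?b) v) \<in> spn (PW a)"
    by (rule linear_op_spn[OF linear_chain(2) word[THEN conjunct1] proj_typed[OF b]])
  then show "?E (proj r (hat ?b) v) \<in> spn (PWs r)" by (rule spn_mono[OF PW_PWs[OF a(2)]])
qed

lemma dot_formula:
  assumes a: "a \<in> compositions r" and j: "1 \<le> j" "j \<le> length a" and v: "v \<in> spn (PWs r)"
  shows "CC_op (h_bar_op j (proj r (hat a) v)) =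
    theta (bas [Layer (take (j - 1) a) (Dot (a ! (j - 1))) (drop j a)]) (CC_op v)"
    and "h_bar_op j (proj r (hat a) v) \<in> spn (PWs r)"
proof -
  have h: "0 < hat a j" using a j by (auto simp: hat_def compositions_def)
  have "take (j - 1) a @ a ! (j - 1) # drop j a = a"
    using j id_take_nth_drop[of "j - 1" a] by simp
  then show "CC_op (h_bar_op j (proj r (hat a) v)) =
    theta (bas [Layer (take (j - 1) a) (Dot (a ! (j - 1))) (drop j a)]) (CC_op v)"
    using CC_dot(1)[OF proj_typed[OF a, of v] j(1) h] by (simp add: h_bar_op_rung theta_simps CC_proj[OF a v] offset_def)
  show "h_bar_op j (proj r (hat a) v) \<in> spn (PWs r)"
    unfolding h_bar_op_rung by (rule spn_mono[OF PW_PWs[OF a] CC_dot(2)[OF proj_typed[OF a] j(1) h]])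
qed

section \<open>Cosets of webs\<close>

definition cls :: "nat \<Rightarrow> web \<Rightarrow> web set" where
  "cls r x = WI r +>\<^bsub>free_superalgebra (web_gens r) gen_parity\<^esub> x"

lemma mem_cls: "z \<in> cls r x \<longleftrightarrow> (\<exists>i\<in>WI r. z = i + x)"
  by (auto simp: cls_def a_r_coset_def')

lemma cls_self: "x \<in> cls r x"
  using WI_closed(3) by (auto simp: mem_cls)

lemma cls_eqI:
  assumes "x - y \<in> WI r"
  shows "cls r x = cls r y"
proof (rule Set.set_eqI)
  fix z
  have "z \<in> cls r y" if "i \<in> WI r" "z = i + x" for i
    using that WI_closed(4)[OF that(1) assms] by (auto simp: mem_cls intro!: bexI[of _ "i + (x - y)"])
  moreover have "z \<in> cls r x" if "i \<in> WI r" "z = i + y" for i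
    using that WI_closed(4)[OF that(1) WI_closed(9)[OF assms]] by (auto simp: mem_cls intro!: bexI[of _ "i + - (x - y)"])
  ultimately show "z \<in> cls r x \<longleftrightarrow> z \<in> cls r y" by (auto simp: mem_cls)
qed

abbreviation web_words :: "nat \<Rightarrow> web set" where
  "web_words r \<equiv> {x. keys x \<subseteq> lists (web_gens r)}"

lemma web_algebra_simps:
  "carrier (web_algebra r) = cls r ` web_words r"
  "one (web_algebra r) = cls r 1"
  "grade (web_algebra r) p = cls r ` webs r p"
  "web_class r w = cls r (bas [w])"
  "x \<in> web_words r \<Longrightarrow> y \<in> web_words r \<Longrightarrow> cls r x \<otimes>\<^bsub>web_algebra r\<^esub> cls r y = cls r (x * y)"
  "x \<in> web_words r \<Longrightarrow> y \<in> web_words r \<Longrightarrow> add (web_algebra r) (cls r x) (cls r y) = cls r (x + y)"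
  "smult (web_algebra r) c (cls r x) = cls r (scl c x)"
proof -
  define A where "A = free_superalgebra (web_gens r) gen_parity"
  interpret A: ring A unfolding A_def by (rule ring_free_superalgebra)
  note carr = free_superalgebra_simps[of "web_gens r" gen_parity, folded A_def]
  have "ideal (WI r) A" unfolding A_def by (rule WI_closed(1))
  then interpret I: ideal "WI r" A .
  have W: "web_algebra r = super_quotient A (WI r)" by (simp add: web_algebra_def presented_def A_def WI_def)
  have c: "cls r x = WI r +>\<^bsub>A\<^esub> x" for x by (simp add: cls_def A_def)
  show "carrier (web_algebra r) = cls r ` web_words r"
    by (auto simp: W super_quotient_def FactRing_def A_RCOSETS_def' c carr)
  show "one (web_algebra r) = cls r 1" by (simp add: W super_quotient_def FactRing_def c carr)
  have "grade A p = webs r p" by (intro Set.set_eqI) (simp add: A_def free_superalgebra_def webs_iff)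
  then show "grade (web_algebra r) p = cls r ` webs r p" by (simp add: W super_quotient_def c)
  show "web_class r w = cls r (bas [w])" by (simp add: web_class_def cls_def WI_def)
  show "cls r x \<otimes>\<^bsub>web_algebra r\<^esub> cls r y = cls r (x * y)" if "x \<in> web_words r" "y \<in> web_words r"
    using I.rcoset_mult_add[of x y] that by (simp add: W super_quotient_def FactRing_def c carr)
  show "add (web_algebra r) (cls r x) (cls r y) = cls r (x + y)" if "x \<in> web_words r" "y \<in> web_words r"
    using I.a_rcos_sum[of x y] that by (simp add: W super_quotient_def FactRing_def c carr)
  \<comment> \<open>The scalar multiple in the quotient is a union over all representatives, and
    each of them contributes the same coset.\<close>
  have "cls r (scl c y) = cls r (scl c x)" if asm: "y \<in> cls r x" for y
  proof -
    obtain i where "i \<in> WI r" "y = i + x" using asm by (auto simp: mem_cls)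
    then have "scl c y - scl c x \<in> WI r" using WI_closed(8) by (simp add: scl_add)
    then show ?thesis by (rule cls_eqI)
  qed
  then have "(\<Union>y\<in>cls r x. cls r (scl c y)) = cls r (scl c x)"
    by (intro UN_constant_eq[OF cls_self] ballI)
  then show "smult (web_algebra r) c (cls r x) = cls r (scl c x)" by (simp add: W super_quotient_def c carr)
qed

section \<open>The isomorphism\<close>

definition opr :: "nat \<Rightarrow> web \<Rightarrow> tens \<Rightarrow> tens" where
  "opr r x v = CCi r (theta x (CC_op v))"

lemma linear_opr [simp]: "linear_op (opr r x)"
  unfolding opr_def[abs_def] by (rule linear_op_comp[OF linear_CCi linear_op_comp[OF linear_theta linear_CC]])

lemma opr_simps: "opr r (x + y) v = opr r x v + opr r y v" "opr r (x - y) v = opr r x v - opr r y v"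
  "opr r (scl c x) v = scl c (opr r x v)"
  by (simp_all add: opr_def theta_simps linear_opD[OF linear_CCi])

lemma opr_typed: "x \<in> web_words r \<Longrightarrow> v \<in> spn (PWs r) \<Longrightarrow> opr r x v \<in> spn (PWs r)"
  unfolding opr_def by (intro CCi_NWs theta_NWs CC_PWs) simp_all

lemma opr_one: "v \<in> spn (PWs r) \<Longrightarrow> opr r 1 v = v"
  by (simp add: opr_def CCi_CC)

lemma opr_mult: "y \<in> web_words r \<Longrightarrow> v \<in> spn (PWs r) \<Longrightarrow> opr r (x * y) v = opr r x (opr r y v)"
  using CC_CCi[OF theta_NWs[OF _ CC_PWs]] by (simp add: opr_def theta_mult)

lemma opr_WI: "x \<in> WI r \<Longrightarrow> v \<in> spn (PWs r) \<Longrightarrow> opr r x v = 0"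
  using theta_WI[OF _ CC_PWs] by (simp add: opr_def linear_opD[OF linear_CCi])

lemma opr_injective:
  assumes x: "x \<in> web_words r" and zero: "\<And>v. v \<in> spn (PWs r) \<Longrightarrow> opr r x v = 0"
  shows "x \<in> WI r"
proof (rule theta_injective)
  show "keys x \<subseteq> lists (web_gens r)" using x by simp
  fix v assume v: "v \<in> spn (NWs r)"
  have "opr r x (CCi r v) = 0" using CCi_NWs[OF v] by (rule zero)
  then have "CCi r (theta x v) = 0" by (simp add: opr_def CC_CCi[OF v])
  moreover have "theta x v \<in> spn (NWs r)" using theta_NWs x v by simp
  ultimately show "theta x v = 0" using CC_CCi[of "theta x v" r] by (simp add: linear_opD[OF linear_CC])
qed

lemma opr_eqI: "CC_op u = theta x (CC_op v) \<Longrightarrow> u \<in> spn (PWs r) \<Longrightarrow> opr r x v = u"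
  unfolding opr_def using CCi_CC[of u r] by simp

lemma opr_Idm: "a \<in> compositions r \<Longrightarrow> v \<in> spn (PWs r) \<Longrightarrow> opr r (bas [Idm a]) v = proj r (hat a) v"
  by (rule opr_eqI) (simp_all add: CC_proj theta_simps spn_mono[OF PW_PWs proj_typed])

lemma opr_good:
  assumes "x \<in> webs r p"
  shows "good r (PWs r) (PWs r) p (opr r x)"
  unfolding good_def
proof (intro conjI allI ballI impI)
  have x: "keys x \<subseteq> lists (web_gens r)" "x \<in> homogeneous gen_parity p" using assms by (simp_all add: webs_iff)
  show "opr r x v \<in> spn (PWs r)" if "v \<in> spn (PWs r)" for v using opr_typed that x by simp
  show "opr r x v \<in> homogeneous snd (p + p')" if "v \<in> spn (PWs r)" "v \<in> homogeneous snd p'" for p' v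
    unfolding opr_def using theta_homogeneous[OF x(2) CC_homogeneous[OF that(2)]] theta_NWs[OF x(1) CC_PWs[OF that(1)]]
    by (rule CCi_homogeneous)
  have "supercommutes r (p + 0) (PWs r) (\<lambda>v. theta x (CC_op v))"
    by (rule supercommutes_comp[OF supercommutes_theta[OF x] supercommutes_mono[OF supercommutes_CC PWs_Wl] CC_PWs linear_theta])
  then have "supercommutes r (0 + (p + 0)) (PWs r) (\<lambda>v. CCi r (theta x (CC_op v)))"
    by (rule supercommutes_comp[OF supercommutes_CCi _ theta_NWs[OF x(1) CC_PWs] linear_CCi])
  then show "supercommutes r p (PWs r) (opr r x)" by (simp add: opr_def[abs_def])
qed simp

lemma opr_full:
  assumes F: "good r (PWs r) (PWs r) p F" and r: "0 < r"
  shows "\<exists>x\<in>webs r p. \<forall>v\<in>spn (PWs r). opr r x v = F v"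
proof -
  let ?F = "\<lambda>v. CC_op (F (CCi r v))"
  have lin: "linear_op F" and sc: "supercommutes r p (PWs r) F" and typed: "\<And>v. v \<in> spn (PWs r) \<Longrightarrow> F v \<in> spn (PWs r)"
    and hom: "\<And>p' v. v \<in> spn (PWs r) \<Longrightarrow> v \<in> homogeneous snd p' \<Longrightarrow> F v \<in> homogeneous snd (p + p')"
    using F by (simp_all add: good_def)
  have "supercommutes r (p + 0) (NWs r) (\<lambda>v. F (CCi r v))"
    by (rule supercommutes_comp[OF sc supercommutes_CCi CCi_NWs lin])
  then have "supercommutes r (0 + (p + 0)) (NWs r) ?F"
    by (rule supercommutes_comp[OF supercommutes_mono[OF supercommutes_CC PWs_Wl] _ typed[OF CCi_NWs] linear_CC])
  then have sc': "supercommutes r p (NWs r) ?F" by simp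
  have "\<exists>x\<in>webs r p. \<forall>v\<in>spn (NWs r). theta x v = ?F v"
  proof (rule theta_full[OF _ sc' _ _ r])
    show "linear_op ?F" by (rule linear_op_comp[OF linear_CC linear_op_comp[OF lin linear_CCi]])
    show "?F v \<in> spn (NWs r)" if "v \<in> spn (NWs r)" for v by (rule CC_PWs[OF typed[OF CCi_NWs[OF that]]])
    show "?F v \<in> homogeneous snd (p + p')" if "v \<in> spn (NWs r)" "v \<in> homogeneous snd p'" for p' v
      by (rule CC_homogeneous[OF hom[OF CCi_NWs[OF that(1)] CCi_homogeneous[OF that(2,1)]]])
  qed
  then obtain x where x: "x \<in> webs r p" "\<And>v. v \<in> spn (NWs r) \<Longrightarrow> theta x v = ?F v" by blast
  have "opr r x v = F v" if "v \<in> spn (PWs r)" for v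
    using x(2)[OF CC_PWs[OF that]] CCi_CC[OF that] CCi_CC[OF typed[OF that]] by (simp add: opr_def)
  with x(1) show ?thesis by blast
qed

text \<open>Endomorphisms are by definition sums of an even and an odd map; on the side of webs the
  words are sorted by their number of dots modulo 2.\<close>

lemma web_words_decomp:
  assumes "x \<in> web_words r"
  obtains x0 x1 where "x0 \<in> webs r 0" "x1 \<in> webs r 1" "x = x0 + x1"
proof -
  let ?h = "\<lambda>p. lin_ext (\<lambda>w. if word_parity gen_parity w = p then bas w else 0) x"
  have w: "?h p \<in> webs r p" for p unfolding webs_def spn_def mem_Collect_eq
    by (rule keys_lin_ext) (use assms in auto)
  have bit: "p = 0 \<or> p = 1" for p :: bit by (cases p) simp_all
  have "x = ?h 0 + ?h 1"
    by (rule linear_op_eqI[of "\<lambda>x. x" "\<lambda>x. lin_ext (\<lambda>w. if word_parity gen_parity w = 0 then bas w else 0) x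
        + lin_ext (\<lambda>w. if word_parity gen_parity w = 1 then bas w else 0) x"])
      (use bit in \<open>auto simp: linear_op_add\<close>)
  with w[of 0] w[of 1] show thesis by (rule that)
qed

lemma web_words_closed:
  "x \<in> web_words r \<Longrightarrow> y \<in> web_words r \<Longrightarrow> x + y \<in> web_words r"
  "x \<in> web_words r \<Longrightarrow> y \<in> web_words r \<Longrightarrow> x - y \<in> web_words r"
  "x \<in> web_words r \<Longrightarrow> y \<in> web_words r \<Longrightarrow> x * y \<in> web_words r"
  "x \<in> web_words r \<Longrightarrow> scl c x \<in> web_words r"
  "1 \<in> web_words r"
  "x \<in> webs r p \<Longrightarrow> x \<in> web_words r"
  using web_gens_keys(1,2)[of x r y] web_gens_keys(3)[of x r c] keys_mult_lists[of x "web_gens r" y]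
  by (simp_all add: webs_iff keys_one_word zero_list_def)

text \<open>The choice of a representative is harmless, as the ideal acts by zero; see
  \<open>psi_cls\<close>.\<close>

definition psi :: "nat \<Rightarrow> web set \<Rightarrow> tens \<Rightarrow> tens" where
  "psi r X = restrict (opr r (SOME x. x \<in> X)) (spn (PWs r))"

lemma psi_cls: "psi r (cls r x) = restrict (opr r x) (spn (PWs r))"
proof -
  have "(SOME y. y \<in> cls r x) \<in> cls r x" using cls_self by (rule someI)
  then obtain i where "i \<in> WI r" "(SOME y. y \<in> cls r x) = i + x" by (auto simp: mem_cls)
  then show ?thesis unfolding psi_def by (intro restrict_ext) (simp add: opr_simps opr_WI)
qed

lemma psi_eqI:
  assumes "x \<in> web_words r" "y \<in> web_words r" "\<And>v. v \<in> spn (PWs r) \<Longrightarrow> opr r x v = opr r y v"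
  shows "cls r x = cls r y"
  by (rule cls_eqI, rule opr_injective[OF web_words_closed(2)[OF assms(1,2)]]) (simp add: opr_simps assms(3))

lemma restrict_eqD: "restrict f A = restrict g A \<Longrightarrow> v \<in> A \<Longrightarrow> f v = g v"
  by (metis restrict_apply')

lemma sergeev_hom_carrier:
  assumes S: "gen_closed r S" "gen_closed r S'"
  shows "f \<in> carrier (sergeev_hom r (spn S) (spn S')) \<longleftrightarrow>
    (\<exists>F G. good r S S' 0 F \<and> good r S S' 1 G \<and> f = restrict (\<lambda>v. F v + G v) (spn S))"
  (is "?L \<longleftrightarrow> ?R")
proof
  assume ?L
  then obtain f0 f1 where f: "f0 \<in> sergeev_hom_grade r (spn S) (spn S') 0" "f1 \<in> sergeev_hom_grade r (spn S) (spn S') 1"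
    "f = (\<lambda>v\<in>spn S. f0 v + f1 v)" by (auto simp: sergeev_hom_def)
  obtain F where F: "good r S S' 0 F" "f0 = restrict F (spn S)" using f(1) sergeev_hom_grade_iff[OF S] by blast
  obtain G where G: "good r S S' 1 G" "f1 = restrict G (spn S)" using f(2) sergeev_hom_grade_iff[OF S] by blast
  have "f = restrict (\<lambda>v. F v + G v) (spn S)" unfolding f(3) F(2) G(2) by (rule restrict_ext) simp
  with F(1) G(1) show ?R by blast
next
  assume ?R
  then obtain F G where FG: "good r S S' 0 F" "good r S S' 1 G" "f = restrict (\<lambda>v. F v + G v) (spn S)" by blast
  have h: "restrict F (spn S) \<in> sergeev_hom_grade r (spn S) (spn S') 0" "restrict G (spn S) \<in> sergeev_hom_grade r (spn S) (spn S') 1"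
    using FG(1,2) sergeev_hom_grade_iff[OF S] by blast+
  have "f = (\<lambda>v\<in>spn S. restrict F (spn S) v + restrict G (spn S) v)"
    unfolding FG(3) by (rule restrict_ext) simp
  then have "\<exists>f0 f1. f = (\<lambda>v\<in>spn S. f0 v + f1 v) \<and> f0 \<in> sergeev_hom_grade r (spn S) (spn S') 0 \<and> f1 \<in> sergeev_hom_grade r (spn S) (spn S') 1"
    using h by blast
  then show ?L by (simp only: sergeev_hom_def partial_object.select_convs mem_Collect_eq)
qed

lemma sergeev_hom_simps:
  "f \<otimes>\<^bsub>sergeev_hom r M N\<^esub> g = compose M f g" "one (sergeev_hom r M N) = (\<lambda>v\<in>M. v)"
  "add (sergeev_hom r M N) = (\<lambda>f g. \<lambda>v\<in>M. f v + g v)" "smult (sergeev_hom r M N) = (\<lambda>c f. \<lambda>v\<in>M. scl c (f v))"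
  "grade (sergeev_hom r M N) = sergeev_hom_grade r M N"
  by (simp_all add: sergeev_hom_def)

theorem psi_iso:
  assumes r: "0 < r"
  shows "superalgebra_iso (web_algebra r) (perm_end r) (psi r)"
proof -
  let ?W = "web_algebra r" and ?P = "spn (PWs r)"
  let ?E = "sergeev_hom r ?P ?P"
  note hc = sergeev_hom_carrier[OF gen_closed_PWs gen_closed_PWs, of _ r]
  have E: "perm_end r = ?E" by (simp add: perm_end_def perm_module_sum_spn[OF r])
  have mem: "psi r (cls r x) \<in> carrier ?E" if x: "x \<in> web_words r" for x
  proof -
    obtain x0 x1 where d: "x0 \<in> webs r 0" "x1 \<in> webs r 1" "x = x0 + x1" using web_words_decomp[OF x] .
    have "psi r (cls r x) = restrict (\<lambda>v. opr r x0 v + opr r x1 v) ?P"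
      unfolding psi_cls d(3) by (rule restrict_ext) (simp add: opr_simps)
    then show ?thesis unfolding hc using opr_good[OF d(1)] opr_good[OF d(2)] by blast
  qed
  have add: "psi r (X \<oplus>\<^bsub>?W\<^esub> Y) = psi r X \<oplus>\<^bsub>?E\<^esub> psi r Y" if asm: "X \<in> carrier ?W" "Y \<in> carrier ?W" for X Y
  proof -
    obtain x y where xy: "X = cls r x" "Y = cls r y" "x \<in> web_words r" "y \<in> web_words r"
      using asm by (auto simp: web_algebra_simps(1))
    show ?thesis unfolding xy(1,2) web_algebra_simps(6)[OF xy(3,4)] psi_cls sergeev_hom_simps
      by (rule restrict_ext) (simp add: opr_simps)
  qed
  have mult: "psi r (X \<otimes>\<^bsub>?W\<^esub> Y) = psi r X \<otimes>\<^bsub>?E\<^esub> psi r Y" if asm: "X \<in> carrier ?W" "Y \<in> carrier ?W" for X Y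
  proof -
    obtain x y where xy: "X = cls r x" "Y = cls r y" "x \<in> web_words r" "y \<in> web_words r"
      using asm by (auto simp: web_algebra_simps(1))
    show ?thesis unfolding xy(1,2) web_algebra_simps(5)[OF xy(3,4)] psi_cls sergeev_hom_simps compose_def
      by (rule restrict_ext) (use xy(4) opr_typed[of y r] in \<open>simp add: opr_mult\<close>)
  qed
  have smult: "psi r (c \<odot>\<^bsub>?W\<^esub> X) = c \<odot>\<^bsub>?E\<^esub> psi r X" if asm: "X \<in> carrier ?W" for X c
  proof -
    obtain x where x: "X = cls r x" using asm by (auto simp: web_algebra_simps(1))
    show ?thesis unfolding x web_algebra_simps(7) psi_cls sergeev_hom_simps
      by (rule restrict_ext) (simp add: opr_simps)
  qed
  have one: "psi r \<one>\<^bsub>?W\<^esub> = \<one>\<^bsub>?E\<^esub>"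
    unfolding web_algebra_simps(2) psi_cls sergeev_hom_simps by (rule restrict_ext) (simp add: opr_one)
  have inj: "inj_on (psi r) (carrier ?W)"
  proof (rule inj_onI)
    fix X Y assume "X \<in> carrier ?W" "Y \<in> carrier ?W" and eq: "psi r X = psi r Y"
    then obtain x y where xy: "X = cls r x" "Y = cls r y" "x \<in> web_words r" "y \<in> web_words r"
      by (auto simp: web_algebra_simps(1))
    have "opr r x v = opr r y v" if "v \<in> ?P" for v
      using eq that unfolding xy(1,2) psi_cls by (rule restrict_eqD)
    then show "X = Y" unfolding xy(1,2) by (rule psi_eqI[OF xy(3,4)])
  qed
  have surj: "f \<in> psi r ` carrier ?W" if asm: "f \<in> carrier ?E" for f
  proof -
    obtain F G where FG: "good r (PWs r) (PWs r) 0 F" "good r (PWs r) (PWs r) 1 G" "f = restrict (\<lambda>v. F v + G v) ?P"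
      using asm unfolding hc by blast
    obtain x where x: "x \<in> webs r 0" "\<And>v. v \<in> ?P \<Longrightarrow> opr r x v = F v" using opr_full[OF FG(1) r] by blast
    obtain y where y: "y \<in> webs r 1" "\<And>v. v \<in> ?P \<Longrightarrow> opr r y v = G v" using opr_full[OF FG(2) r] by blast
    have "f = psi r (cls r (x + y))"
      unfolding FG(3) psi_cls by (rule restrict_ext) (simp add: opr_simps x(2) y(2))
    moreover have "x + y \<in> web_words r" using web_words_closed(1)[OF web_words_closed(6)[OF x(1)] web_words_closed(6)[OF y(1)]] .
    ultimately show ?thesis unfolding web_algebra_simps(1) by blast
  qed
  have maps: "psi r X \<in> carrier ?E" if "X \<in> carrier ?W" for X
    using that mem by (auto simp: web_algebra_simps(1))
  have bij: "bij_betw (psi r) (carrier ?W) (carrier ?E)"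
    unfolding bij_betw_def using inj maps surj by blast
  have "psi r \<in> ring_hom ?W ?E" by (rule ring_hom_memI) (rule maps mult add one; assumption)+
  then have "psi r \<in> ring_iso ?W ?E" using bij by (simp add: ring_iso_def)
  moreover have "psi r ` grade ?W p \<subseteq> grade ?E p" for p
  proof -
    have "psi r (cls r x) \<in> sergeev_hom_grade r ?P ?P p" if "x \<in> webs r p" for x
      unfolding sergeev_hom_grade_iff[OF gen_closed_PWs gen_closed_PWs] psi_cls using opr_good[OF that] by blast
    then show ?thesis unfolding web_algebra_simps(3) sergeev_hom_simps by blast
  qed
  ultimately show ?thesis unfolding E superalgebra_iso_def superspace_iso_def using bij add smult by blast
qed

section \<open>Restriction to the summands\<close>

lemma good_restrict:
  assumes z: "z \<in> webs r p" and a: "a \<in> compositions r" and typed: "\<And>v. v \<in> spn (PW a) \<Longrightarrow> opr r z v \<in> spn (PW b)"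
  shows "good r (PW a) (PW b) p (opr r z)"
  using opr_good[OF z] typed spn_mono[OF PW_PWs[OF a]] supercommutes_mono[OF _ PW_PWs[OF a]]
  unfolding good_def by blast

text \<open>Extension by zero on the other summands turns a map between two summands into an
  endomorphism, to which \<open>opr_full\<close> applies.\<close>

lemma good_extend:
  assumes F: "good r (PW a) (PW b) p F" and a: "a \<in> compositions r" and b: "b \<in> compositions r"
  shows "good r (PWs r) (PWs r) p (\<lambda>v. F (proj r (hat a) v))"
  unfolding good_def
proof (intro conjI allI ballI impI)
  have lin: "linear_op F" and sc: "supercommutes r p (PW a) F" and typed: "\<And>v. v \<in> spn (PW a) \<Longrightarrow> F v \<in> spn (PW b)"
    and hom: "\<And>p' v. v \<in> spn (PW a) \<Longrightarrow> v \<in> homogeneous snd p' \<Longrightarrow> F v \<in> homogeneous snd (p + p')"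
    using F by (simp_all add: good_def)
  show "linear_op (\<lambda>v. F (proj r (hat a) v))" by (rule linear_op_comp[OF lin linear_proj])
  show "F (proj r (hat a) v) \<in> spn (PWs r)" for v by (rule spn_mono[OF PW_PWs[OF b] typed[OF proj_typed[OF a]]])
  show "F (proj r (hat a) v) \<in> homogeneous snd (p + p')" if "v \<in> homogeneous snd p'" for p' v
  proof (rule hom[OF proj_typed[OF a]])
    show "proj r (hat a) v \<in> homogeneous snd p'"
      using that unfolding homogeneous_spn by (rule linear_op_spn[OF linear_proj, rotated]) (simp add: proj_def)
  qed
  have "supercommutes r 0 (Wl r) (proj r (hat a))"
    by (rule supercommutesI) (auto simp: Wl_def SS_bas CC_bas' linear_opD[OF linear_proj] proj_def weight_words_hat[OF a] PW_swp PW_tog gen_act_linear lin_ext_scl)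
  then have "supercommutes r (p + 0) (PWs r) (\<lambda>v. F (proj r (hat a) v))"
    by (rule supercommutes_comp[OF sc supercommutes_mono[OF _ PWs_Wl] proj_typed[OF a] lin])
  then show "supercommutes r p (PWs r) (\<lambda>v. F (proj r (hat a) v))" by simp
qed

text \<open>Cutting off with the idempotents of \<open>b\<close> and \<open>a\<close> corresponds to
  projecting onto the two summands, so bijectivity follows from faithfulness and fullness on the
  whole sum.\<close>

theorem psi_corner:
  assumes r: "0 < r" and a: "a \<in> compositions r" and b: "b \<in> compositions r"
  shows "superspace_iso (corner (web_algebra r) (web_class r (Idm b)) (web_class r (Idm a)))
    (sergeev_hom r (perm_module r (hat a)) (perm_module r (hat b))) (\<lambda>x. restrict (psi r x) (perm_module r (hat a)))"
proof -
  let ?W = "web_algebra r" and ?A = "spn (PW a)" and ?B = "spn (PW b)" and ?P = "spn (PWs r)"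
  let ?C = "corner ?W (web_class r (Idm b)) (web_class r (Idm a))"
  let ?H = "sergeev_hom r ?A ?B"
  let ?z = "\<lambda>x. bas [Idm b] * x * bas [Idm a]"
  let ?phi = "\<lambda>X. restrict (psi r X) ?A"
  note hc = sergeev_hom_carrier[OF gen_closed_PW[OF a] gen_closed_PW[OF b]]
  have AP: "v \<in> ?P" if "v \<in> ?A" for v using that by (rule spn_mono[OF PW_PWs[OF a]])
  have Iw: "bas [Idm a] \<in> web_words r" "bas [Idm b] \<in> web_words r" using webs_Idm[OF a] webs_Idm[OF b] web_words_closed(6) by blast+
  have zw: "?z x \<in> web_words r" if "x \<in> web_words r" for x
    using web_words_closed(3)[OF web_words_closed(3)[OF Iw(2) that] Iw(1)] .
  have img: "(\<lambda>X. web_class r (Idm b) \<otimes>\<^bsub>?W\<^esub> X \<otimes>\<^bsub>?W\<^esub> web_class r (Idm a)) ` carrier ?W = (\<lambda>x. cls r (?z x)) ` web_words r"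
    unfolding web_algebra_simps(1,4) image_image
    by (rule image_cong[OF refl]) (simp only: web_algebra_simps(5) Iw web_words_closed(3))
  have carC: "carrier ?C = (\<lambda>x. cls r (?z x)) ` web_words r" by (simp add: corner_def img)
  have gradeC: "grade ?C p = (\<lambda>x. cls r (?z x)) ` web_words r \<inter> cls r ` webs r p" for p
    by (simp add: corner_def img web_algebra_simps(3))
  have opC: "add ?C = add ?W" "smult ?C = smult ?W" by (simp_all add: corner_def)
  have oz: "opr r (?z x) v = proj r (hat b) (opr r x (proj r (hat a) v))" if x: "x \<in> web_words r" and v: "v \<in> ?P" for x v
  proof -
    have pa: "proj r (hat a) v \<in> ?P" by (rule AP[OF proj_typed[OF a]])
    show ?thesis
      using opr_typed[OF x pa] pa v by (simp add: opr_mult[OF Iw(1)] opr_Idm[OF a] opr_mult[OF x] opr_Idm[OF b])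
  qed
  have phi: "?phi (cls r x) = restrict (opr r x) ?A" for x
    unfolding psi_cls by (rule restrict_ext) (simp add: AP)
  have typed: "opr r (?z x) v \<in> ?B" if "x \<in> web_words r" "v \<in> ?A" for x v
    using oz[OF that(1) AP[OF that(2)]] proj_typed[OF b] by simp
  have maps: "?phi (cls r (?z x)) \<in> carrier ?H" if x: "x \<in> web_words r" for x
  proof -
    obtain x0 x1 where d: "x0 \<in> webs r 0" "x1 \<in> webs r 1" "x = x0 + x1" using web_words_decomp[OF x] .
    have z: "?z x' \<in> webs r p" if "x' \<in> webs r p" for x' p
      using webs_mult[OF webs_mult[OF webs_Idm[OF b] that] webs_Idm[OF a]] by simp
    have "good r (PW a) (PW b) 0 (opr r (?z x0))"
      by (rule good_restrict[OF z[OF d(1)] a typed[OF web_words_closed(6)[OF d(1)]]])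
    moreover have "good r (PW a) (PW b) 1 (opr r (?z x1))"
      by (rule good_restrict[OF z[OF d(2)] a typed[OF web_words_closed(6)[OF d(2)]]])
    moreover have "?phi (cls r (?z x)) = restrict (\<lambda>v. opr r (?z x0) v + opr r (?z x1) v) ?A"
      unfolding phi by (rule restrict_ext) (simp add: d(3) distrib_left distrib_right opr_simps)
    ultimately show ?thesis unfolding hc by blast
  qed
  have inj: "inj_on ?phi (carrier ?C)"
  proof (rule inj_onI)
    fix X Y assume "X \<in> carrier ?C" "Y \<in> carrier ?C" and eq: "?phi X = ?phi Y"
    then obtain x y where xy: "X = cls r (?z x)" "Y = cls r (?z y)" "x \<in> web_words r" "y \<in> web_words r"
      unfolding carC by blast
    have eqA: "opr r (?z x) v = opr r (?z y) v" if "v \<in> ?A" for v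
      using eq that unfolding xy(1,2) phi by (rule restrict_eqD)
    have idem: "opr r (?z u) v = opr r (?z u) (proj r (hat a) v)" if "u \<in> web_words r" "v \<in> ?P" for u v
      using oz[OF that] oz[OF that(1) AP[OF proj_typed[OF a]], of v] by (simp add: proj_id[OF a proj_typed[OF a]])
    have "opr r (?z x) v = opr r (?z y) v" if "v \<in> ?P" for v
      using idem[OF xy(3) that] idem[OF xy(4) that] eqA[OF proj_typed[OF a], of v] by simp
    then show "X = Y" unfolding xy(1,2) by (rule psi_eqI[OF zw[OF xy(3)] zw[OF xy(4)]])
  qed
  have surj: "f \<in> ?phi ` carrier ?C" if asm: "f \<in> carrier ?H" for f
  proof -
    obtain F G where FG: "good r (PW a) (PW b) 0 F" "good r (PW a) (PW b) 1 G" "f = restrict (\<lambda>v. F v + G v) ?A"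
      using asm unfolding hc by blast
    obtain x where x: "x \<in> webs r 0" "\<And>v. v \<in> ?P \<Longrightarrow> opr r x v = F (proj r (hat a) v)"
      using opr_full[OF good_extend[OF FG(1) a b] r] by blast
    obtain y where y: "y \<in> webs r 1" "\<And>v. v \<in> ?P \<Longrightarrow> opr r y v = G (proj r (hat a) v)"
      using opr_full[OF good_extend[OF FG(2) a b] r] by blast
    have xy: "x + y \<in> web_words r" using web_words_closed(1)[OF web_words_closed(6)[OF x(1)] web_words_closed(6)[OF y(1)]] .
    have "opr r (?z (x + y)) v = F v + G v" if v: "v \<in> ?A" for v
    proof -
      have "F v + G v \<in> ?B" using FG(1,2) v by (simp add: good_def)
      then show ?thesis
        using oz[OF xy AP[OF v]] x(2)[OF AP[OF v]] y(2)[OF AP[OF v]] by (simp add: proj_id[OF a v] opr_simps proj_id[OF b])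
    qed
    then have "f = ?phi (cls r (?z (x + y)))" unfolding FG(3) phi by (intro restrict_ext) simp
    then show ?thesis unfolding carC using xy by blast
  qed
  have bij: "bij_betw ?phi (carrier ?C) (carrier ?H)"
    unfolding bij_betw_def
  proof (intro conjI inj subset_antisym subsetI)
    show "f \<in> carrier ?H" if "f \<in> ?phi ` carrier ?C" for f using that maps unfolding carC by blast
  qed (rule surj)
  have add: "?phi (X \<oplus>\<^bsub>?C\<^esub> Y) = ?phi X \<oplus>\<^bsub>?H\<^esub> ?phi Y" if asm: "X \<in> carrier ?C" "Y \<in> carrier ?C" for X Y
  proof -
    obtain x y where xy: "X = cls r (?z x)" "Y = cls r (?z y)" "x \<in> web_words r" "y \<in> web_words r"
      using asm unfolding carC by blast
    show ?thesis unfolding xy(1,2) opC web_algebra_simps(6)[OF zw[OF xy(3)] zw[OF xy(4)]] phi sergeev_hom_simps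
      by (rule restrict_ext) (simp add: opr_simps)
  qed
  have smult: "?phi (c \<odot>\<^bsub>?C\<^esub> X) = c \<odot>\<^bsub>?H\<^esub> ?phi X" if asm: "X \<in> carrier ?C" for X c
  proof -
    obtain x where x: "X = cls r (?z x)" using asm unfolding carC by blast
    show ?thesis unfolding x opC web_algebra_simps(7) phi sergeev_hom_simps
      by (rule restrict_ext) (simp add: opr_simps)
  qed
  have grade: "?phi ` grade ?C p \<subseteq> grade ?H p" for p
  proof
    fix f assume "f \<in> ?phi ` grade ?C p"
    then obtain X where X: "X \<in> grade ?C p" "f = ?phi X" by blast
    then obtain x y where xy: "X = cls r (?z x)" "x \<in> web_words r" "X = cls r y" "y \<in> webs r p"
      unfolding gradeC by blast
    \<comment> \<open>A homogeneous element of the corner has two representatives: one between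
      idempotents, which shows where it maps, and a homogeneous one, which shows its parity. They
      have the same action.\<close>
    have "psi r (cls r (?z x)) = psi r (cls r y)" using xy(1,3) by simp
    then have eq: "opr r (?z x) v = opr r y v" if "v \<in> ?P" for v
      unfolding psi_cls using that by (rule restrict_eqD)
    have "good r (PW a) (PW b) p (opr r y)"
      by (rule good_restrict[OF xy(4) a]) (use typed[OF xy(2)] eq AP in metis)
    then show "f \<in> grade ?H p"
      unfolding X(2) xy(3) phi sergeev_hom_simps sergeev_hom_grade_iff[OF gen_closed_PW[OF a] gen_closed_PW[OF b]] by blast
  qed
  show ?thesis unfolding perm_module_hat[OF a] perm_module_hat[OF b] superspace_iso_def using bij add smult grade by blast
qed

text \<open>Reduces each formula for a generator to an identity in offset labels.\<close>

lemma psi_web_class: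
  assumes "0 < r" "\<And>v. v \<in> spn (PWs r) \<Longrightarrow> CC_op (f v) = theta (bas [w]) (CC_op v) \<and> f v \<in> spn (PWs r)"
  shows "psi r (web_class r w) = on_sum r f"
  unfolding web_algebra_simps(4) psi_cls on_sum_def perm_module_sum_spn[OF assms(1)]
  using assms(2) by (intro restrict_ext opr_eqI) blast+

theorem theorem5p2:
  fixes r :: nat
  assumes "r \<ge> 1"
  shows "\<exists>\<psi> :: web set \<Rightarrow> tens \<Rightarrow> tens.
    superalgebra_iso (web_algebra r) (perm_end r) \<psi> \<and>
    \<comment> \<open>locally unital\<close>
    (\<forall>a\<in>compositions r. \<exists>\<mu>\<in>weights' r. \<psi> (web_class r (Idm a)) = on_sum r (proj r \<mu>)) \<and>
    \<comment> \<open>(1)\<close>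
    (\<forall>a\<in>compositions r. \<psi> (web_class r (Idm a)) = on_sum r (proj r (hat a))) \<and>
    \<comment> \<open>(2) and (3)\<close>
    (\<forall>a\<in>compositions r. \<forall>i. 1 \<le> i \<and> i \<le> length a - 1 \<longrightarrow>
       (let x = take (i - 1) a; k = a ! (i - 1); l = a ! i; y = drop (i + 1) a;
            b = x @ [k + l] @ y
        in \<psi> (web_class r (Layer x (Merge k l) y)) =
             on_sum r (op_prod (map (\<lambda>t. divided_power (e_op t) (hat a (t + 1))) (rev [i..<r]))
                       \<circ> proj r (hat a)) \<and>
           \<psi> (web_class r (Layer x (Split k l) y)) =
             on_sum r (op_prod (map (\<lambda>t. divided_power (f_op t) (hat a (t + 1))) [i..<r])
                       \<circ> proj r (hat b)))) \<and>
    \<comment> \<open>(4)\<close>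
    (\<forall>a\<in>compositions r. \<forall>j. 1 \<le> j \<and> j \<le> length a \<longrightarrow>
       \<psi> (web_class r (Layer (take (j - 1) a) (Dot (a ! (j - 1))) (drop j a))) =
         on_sum r (h_bar_op j \<circ> proj r (hat a))) \<and>
    \<comment> \<open>restriction to the summands\<close>
    (\<forall>a\<in>compositions r. \<forall>b\<in>compositions r.
       superspace_iso
         (corner (web_algebra r) (web_class r (Idm b)) (web_class r (Idm a)))
         (sergeev_hom r (perm_module r (hat a)) (perm_module r (hat b)))
         (\<lambda>x. restrict (\<psi> x) (perm_module r (hat a))))"
proof -
  have r: "0 < r" using assms by simp
  have Idm: "psi r (web_class r (Idm a)) = on_sum r (proj r (hat a))" if a: "a \<in> compositions r" for a
    by (rule psi_web_class[OF r]) (simp add: CC_proj[OF a] theta_simps spn_mono[OF PW_PWs[OF a] proj_typed[OF a]])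
  have split_at: "a = take (i - 1) a @ a ! (i - 1) # a ! i # drop (i + 1) a" if "1 \<le> i" "i \<le> length a - 1" for a :: "nat list" and i
    using that id_take_nth_drop[of "i - 1" a] Cons_nth_drop_Suc[of i a] by simp
  show ?thesis
  proof (intro exI[of _ "psi r"] conjI ballI allI impI, goal_cases)
    case 1
    show ?case by (rule psi_iso[OF r])
  next
    case (2 a)
    then show ?case using Idm[OF 2] by (intro bexI[of _ "hat a"]) (simp_all add: weights'_hat[OF r])
  next
    case (3 a)
    then show ?case by (rule Idm)
  next
    case (4 a i)
    then have i: "1 \<le> i" "i \<le> length a - 1" by simp_all
    let ?x = "take (i - 1) a"
    \<comment> \<open>The formulas were shown with \<open>length x + 1\<close> as the number of the
      left strand, which is the index \<open>i\<close> of the statement.\<close>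
    have len: "length ?x + 1 = i" using i by simp
    note merge = merge_formula[OF split_at[OF i] 4(1), unfolded len]
    note split = split_formula[OF split_at[OF i] 4(1), unfolded len]
    show ?case unfolding Let_def append_Cons append_Nil
      by (rule conjI; rule psi_web_class[OF r])
        (unfold o_apply, rule conjI, erule merge(1), erule merge(2), rule conjI, erule split(1), erule split(2))
  next
    case (5 a j)
    then have j: "1 \<le> j" "j \<le> length a" by simp_all
    show ?case
      by (rule psi_web_class[OF r]) (unfold o_apply, rule conjI, erule dot_formula(1)[OF 5(1) j], erule dot_formula(2)[OF 5(1) j])
  next
    case (6 a b)
    then show ?case by (rule psi_corner[OF r])
  qed
qed

end
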